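(* Let $p$ be a prime, let $R$ be an $F$-finite regular ring of characteristic $p$, let $I$ be a non-zero ideal of $R$ with a system of generators $\mathcal F=\{f_1,\dots,f_r\}$, and put $R_{\mathbf f}=R_{f_1\cdots f_r}$. Let $C(\mathbb Z_p^r,R_{\mathbf f})\,\boldsymbol{f^s}$ be the free rank-one $C(\mathbb Z_p^r,R_{\mathbf f})$-module generated by a formal symbol $\boldsymbol{f^s}=f_1^{s_1}\cdots f_r^{s_r}$, and let $H'_{\mathcal F}=H^r_{\langle f_i-t_i:1\le i\le r\rangle}R_{\mathbf f}[\mathbf t]$. (1) $C(\mathbb Z_p^r,R_{\mathbf f})\boldsymbol{f^s}$ and $H'_{\mathcal F}$ carry $C(\mathbb Z_p^r,D_{R_{\mathbf f}})$-module structures (those described in the context), and there is an isomorphism of $C(\mathbb Z_p^r,D_{R_{\mathbf f}})$-modules $\Theta_{\mathcal F}:C(\mathbb Z_p^r,R_{\mathbf f})\boldsymbol{f^s}\cong H'_{\mathcal F}$. (2) Suppose that all $f_i$ are non-zero divisors of $R$. Then $H_{\mathcal F}$ can be regarded as a $C(\mathbb Z_p^r,D_R)$-submodule of $H'_{\mathcal F}$ and, under the identification $\Theta_{\mathcal F}$, $N_{\mathcal F}$ is isomorphic to the $C(\mathbb Z_p^r,D_R)$-module $$\frac{\sum_{\alpha\in \mathrm{Fun}_r,\ \|\alpha\|=0}C(\mathbb Z_p^r,D_R)\cdot \mathtt{Bd}^{[\alpha]}\mathbf f^{[\alpha]}\boldsymbol{f^s}}{\sum_{\alpha\in \mathrm{Fun}_r,\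 \|\alpha\|=1}C(\mathbb Z_p^r,D_R)\cdot \mathtt{Bd}^{[\alpha]}\mathbf f^{[\alpha]}\boldsymbol{f^s}}.$$ (3) Suppose that all $f_i$ are non-zero divisors of $R$. Say that $F\in C(\mathbb Z_p,\mathbb F_p)$ satisfies a Bernstein-Sato functional equation for $I$ if $$\Sigma_{r,R}(F)\,\boldsymbol{f^s}=\sum_{\alpha\in\mathrm{Fun}_r,\ \|\alpha\|=1}P_\alpha\cdot \mathtt{Bd}^{[\alpha]}\mathbf f^{[\alpha]}\boldsymbol{f^s}$$ for some $P_\alpha\in C(\mathbb Z_p^r,D_R)$ (all but finitely many zero), where $\Sigma_{r,R}(F)\in C(\mathbb Z_p^r,\mathbb F_p)$ is the function $(x_1,\dots,x_r)\mapsto F(x_1+\cdots+x_r)$. Then $x\in\mathbb Z_p$ is a Bernstein-Sato root of $I$ if and only if $F(x)=0$ for every $F\in C(\mathbb Z_p,\mathbb F_p)$ satisfying a Bernstein-Sato functional equation for $I$.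
   Context: Notation: $\mathbb N=\{0,1,2,\dots\}$, $\mathbb N^+=\mathbb N\setminus\{0\}$. All rings $R$ are commutative with $1$. A ring $R$ of characteristic $p$ is $F$-finite if it is a finite module over $R^{p^e}=\{r^{p^e}:r\in R\}$ for every $e\in\mathbb N$. Put $D^e_R=\mathrm{End}_{R^{p^e}}(R)$ and $D_R=\bigcup_{e}D^e_R$ (the ring of $\mathbb F_p$-linear differential operators on $R$). For a multiplicative set $S$, an operator $\phi\in D^e_R$ acts on $S^{-1}R$ by $\phi(r/s)=\phi(s^{p^e-1}r)/s^{p^e}$; this gives a ring map $D_R\to D_{S^{-1}R}$, through which $D_R$ is viewed inside $D_{R_{\mathbf f}}$ when the $f_i$ are non-zero divisors. Bernstein-Sato roots: for an ideal $I$ let $D^e_R\cdot I^n$ be the ideal generated by all $\phi(g)$, $\phi\in D^e_R$, $g\in I^n$, and $\mathcal B^\bullet_I(p^e)=\{n\in\mathbb N: D^e_R\cdot I^n\supsetneq D^e_R\cdot I^{n+1}\}$. A $p$-adic integer $x$ is a Bernstein-Sato root of $I$ if it is the $p$-adic limit of a sequence $(\nu_e)_{e\in\mathbb N}$ with $\nu_e\in\mathcal B^\bullet_I(p^e)$. Continuous functions: for an $\mathbb F_p$-algebra $T$ (not necessarily commutative) with the discrete topology, $C(\mathbb Z_p^r,T)$ is the algebra of continuous maps $\mathbb Z_p^r\to T$ with pointwise operations. Every element is a finite sum of maps $G\cdot v$ with $G\in C(\mathbb Z_p^r,\mathbb F_p)$, $v\in T$ (constant map). For $x=\sum_i x^{[i]}p^i\in\mathbb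 Z_p$ with digits $x^{[i]}\in\{0,\dots,p-1\}$, $\langle x\rangle_e=\sum_{i<e}x^{[i]}p^i$. For $\mathbf k\in\mathbb N^r$, $\mathtt B_{\mathbf k}\in C(\mathbb Z_p^r,\mathbb F_p)$ is $(x_1,\dots,x_r)\mapsto\prod_i\binom{\langle x_i\rangle_e}{k_i}\bmod p$ for any $e$ with all $k_i<p^e$. Polynomial ring: $R[\mathbf t]=R[t_1,\dots,t_r]$, $\mathbf 1_r=(1,\dots,1)$. There is a ring homomorphism $\Delta_{r,R}:C(\mathbb Z_p^r,D_R)\to D_{R[\mathbf t]}$, $\Delta_{r,R}(P):u\mathbf t^{\mathbf a}\mapsto P(-\mathbf a-\mathbf 1_r)(u)\,\mathbf t^{\mathbf a}$ for $u\in R,\mathbf a\in\mathbb N^r$ (similarly for $R_{\mathbf f}$ in place of $R$). Its image lies in $V^0D_{R[\mathbf t]}$, where $V^iD_{R[\mathbf t]}=\{\varphi\in D_{R[\mathbf t]}:\varphi\cdot\langle\mathbf t\rangle^j\subseteq\langle\mathbf t\rangle^{j+i}\ \forall j\in\mathbb Z\}$, with $\langle\mathbf t\rangle=\langle t_1,\dots,t_r\rangle$ and $\langle \mathbf t\rangle^j=R[\mathbf t]$ for $j\le0$. Local cohomology: $H_{\mathcal F}=H^r_{\langle f_i-t_i:1\le i\le r\rangle}R[\mathbf t]$ is the quotient of $R[\mathbf t]_{\prod_i(f_i-t_i)}$ by the sum of the images of $R[\mathbf t]_{\prod_{j\ne i}(f_j-t_j)}$, $1\le i\le r$; $D_{R[\mathbf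 t]}$ acts on it through its action on localizations. Let $\delta=\left[\frac1{\prod_i(f_i-t_i)}\right]\in H_{\mathcal F}$ and $N_{\mathcal F}=V^0D_{R[\mathbf t]}\cdot\delta\,/\,V^1D_{R[\mathbf t]}\cdot\delta$. $H_{\mathcal F}$ and $N_{\mathcal F}$ are $C(\mathbb Z_p^r,D_R)$-modules via $\Delta_{r,R}$. $H'_{\mathcal F}$ is the same construction over $R_{\mathbf f}$, with class $\delta'=\left[\frac1{\prod_i(f_i-t_i)}\right]$; it is a $C(\mathbb Z_p^r,D_{R_{\mathbf f}})$-module via $\Delta_{r,R_{\mathbf f}}$. The natural map $H_{\mathcal F}\to H'_{\mathcal F}$ is induced by $R\to R_{\mathbf f}$. Action on $C(\mathbb Z_p^r,R_{\mathbf f})\boldsymbol{f^s}$: for $\phi\in D^e_{R_{\mathbf f}}$ and $u\in R_{\mathbf f}$ let $V_{\phi,u}\in C(\mathbb Z_p^r,R_{\mathbf f})$ be $(x_1,\dots,x_r)\mapsto \phi\big(u\prod_i f_i^{\langle x_i\rangle_e}\big)/\prod_i f_i^{\langle x_i\rangle_e}$ (independent of the choice of $e$). For $P=\sum_iG_i\phi_i$ and $U=\sum_jH_ju_j$ with $G_i,H_j\in C(\mathbb Z_p^r,\mathbb F_p)$, $\phi_i\in D_{R_{\mathbf f}}$, $u_j\in R_{\mathbf f}$, put $P\cdot U\boldsymbol{f^s}=\sum_{i,j}G_iH_jV_{\phi_i,u_j}\boldsymbol{f^s}$. The map $\Theta_{\mathcal F}$ is $U\boldsymbol{f^s}\mapsto\Delta_{r,R_{\mathbf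 f}}(U)(\delta')$. Index set: $\mathrm{Fun}_r$ is the set of functions $\alpha:\{1,\dots,r\}\times\mathbb N\to\{-p+1,\dots,p-1\}$ with finite support; $\|\alpha\|=\sum_{i,j}\alpha(i,j)p^j\in\mathbb Z$; $\mathtt{Bd}^{[\alpha]}=\mathtt B_{\alpha_-}$ where $\alpha_-\in\mathbb N^r$ has $i$-th entry $\sum_{j:\alpha(i,j)<0}-\alpha(i,j)p^j$; and $\mathbf f^{[\alpha]}=\prod_{i=1}^r f_i^{\sum_j\alpha(i,j)p^j}\in R_{\mathbf f}$. *)

theory Defs
  imports
    "HOL-Algebra.Algebra"
    "HOL-Number_Theory.Residues"
    "HOL-Library.Extended_Nat"
    "HOL-Analysis.Function_Topology"
    "HOL-Analysis.Abstract_Limits"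
begin

section \<open>Commutative algebra\<close>

definition char_ring :: "('a, 'm) ring_scheme \<Rightarrow> nat \<Rightarrow> bool" where
  "char_ring R p \<longleftrightarrow> (\<forall>n::nat. [n] \<cdot>\<^bsub>R\<^esub> \<one>\<^bsub>R\<^esub> = \<zero>\<^bsub>R\<^esub> \<longleftrightarrow> p dvd n)"

definition nonzero_divisor :: "('a, 'm) ring_scheme \<Rightarrow> 'a \<Rightarrow> bool" where
  "nonzero_divisor R a \<longleftrightarrow>
     a \<in> carrier R \<and> (\<forall>b\<in>carrier R. a \<otimes>\<^bsub>R\<^esub> b = \<zero>\<^bsub>R\<^esub> \<longrightarrow> b = \<zero>\<^bsub>R\<^esub>)"

definition F_finite :: "nat \<Rightarrow> ('a, 'm) ring_scheme \<Rightarrow> bool" where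
  "F_finite p R \<longleftrightarrow>
     (\<forall>e::nat. \<exists>B. finite B \<and> B \<subseteq> carrier R \<and>
        (\<forall>a\<in>carrier R. \<exists>c\<in>B \<rightarrow> carrier R.
            a = (\<Oplus>\<^bsub>R\<^esub>b\<in>B. (c b [^]\<^bsub>R\<^esub> (p ^ e)) \<otimes>\<^bsub>R\<^esub> b)))"

subsection \<open>Localization\<close>

text \<open>Zero divisors in \<open>S\<close>, and even \<open>0 \<in> S\<close>, are allowed; the localization may be the zero ring.\<close>

definition loc_rel :: "('a, 'm) ring_scheme \<Rightarrow> 'a set \<Rightarrow> (('a \<times> 'a) \<times> ('a \<times> 'a)) set" where
  "loc_rel R S =
     {((a, s), (b, t)). a \<in> carrier R \<and> b \<in> carrier R \<and> s \<in> S \<and> t \<in> S \<and>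
        (\<exists>u\<in>S. u \<otimes>\<^bsub>R\<^esub> (t \<otimes>\<^bsub>R\<^esub> a) = u \<otimes>\<^bsub>R\<^esub> (s \<otimes>\<^bsub>R\<^esub> b))}"

definition loc_frac :: "('a, 'm) ring_scheme \<Rightarrow> 'a set \<Rightarrow> 'a \<Rightarrow> 'a \<Rightarrow> ('a \<times> 'a) set" where
  "loc_frac R S a s = loc_rel R S `` {(a, s)}"

text \<open>Operations on equivalence classes are defined as unions over representatives, as in
  \<^theory>\<open>HOL.Equiv_Relations\<close>; the family is constant in every use below.\<close>

definition Loc :: "('a, 'm) ring_scheme \<Rightarrow> 'a set \<Rightarrow> ('a \<times> 'a) set ring" where
  "Loc R S =
     \<lparr> carrier = (carrier R \<times> S) // loc_rel R S,
       monoid.mult = (\<lambda>C D. \<Union>(a, s)\<in>C. \<Union>(b, t)\<in>D. loc_frac R S (a \<otimes>\<^bsub>R\<^esub> b) (s \<otimes>\<^bsub>R\<^esub> t)),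
       monoid.one = loc_frac R S \<one>\<^bsub>R\<^esub> \<one>\<^bsub>R\<^esub>,
       ring.zero = loc_frac R S \<zero>\<^bsub>R\<^esub> \<one>\<^bsub>R\<^esub>,
       ring.add = (\<lambda>C D. \<Union>(a, s)\<in>C. \<Union>(b, t)\<in>D.
                loc_frac R S ((t \<otimes>\<^bsub>R\<^esub> a) \<oplus>\<^bsub>R\<^esub> (s \<otimes>\<^bsub>R\<^esub> b)) (s \<otimes>\<^bsub>R\<^esub> t)) \<rparr>"

definition loc_incl :: "('a, 'm) ring_scheme \<Rightarrow> 'a set \<Rightarrow> 'a \<Rightarrow> ('a \<times> 'a) set" where
  "loc_incl R S a = loc_frac R S a \<one>\<^bsub>R\<^esub>"

text \<open>The map \<open>S\<^sup>-\<^sup>1R \<rightarrow> T\<^sup>-\<^sup>1B\<close> induced by a homomorphism \<open>h : R \<rightarrow> B\<close> with \<open>h ` S \<subseteq> T\<close>.\<close>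

definition loc_map ::
  "('b, 'n) ring_scheme \<Rightarrow> 'b set \<Rightarrow> ('a \<Rightarrow> 'b) \<Rightarrow> ('a \<times> 'a) set \<Rightarrow> ('b \<times> 'b) set" where
  "loc_map B T h C = (\<Union>(a, s)\<in>C. loc_frac B T (h a) (h s))"

definition powers :: "('a, 'm) ring_scheme \<Rightarrow> 'a \<Rightarrow> 'a set" where
  "powers R g = range (\<lambda>n::nat. g [^]\<^bsub>R\<^esub> n)"

subsection \<open>Regular rings\<close>

definition krull_dim :: "('a, 'm) ring_scheme \<Rightarrow> enat" where
  "krull_dim R = Sup {enat n |n. \<exists>P. (\<forall>i\<le>n. primeideal (P i) R) \<and> (\<forall>i<n. P i \<subset> P (Suc i))}"

definition regular_local_ring :: "('a, 'm) ring_scheme \<Rightarrow> bool" where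
  "regular_local_ring R \<longleftrightarrow>
     cring R \<and> noetherian_ring R \<and>
     (\<exists>M. {J. maximalideal J R} = {M} \<and>
          (\<exists>B\<subseteq>carrier R. finite B \<and> M = Idl\<^bsub>R\<^esub> B \<and> enat (card B) = krull_dim R))"

definition regular_ring :: "('a, 'm) ring_scheme \<Rightarrow> bool" where
  "regular_ring R \<longleftrightarrow>
     cring R \<and> noetherian_ring R \<and>
     (\<forall>P. primeideal P R \<longrightarrow> regular_local_ring (Loc R (carrier R - P)))"

subsection \<open>Polynomials in \<open>t\<^sub>1, \<dots>, t\<^sub>r\<close>\<close>

text \<open>Underlying set, constants, variables and addition are those of
  \<^theory>\<open>HOL-Algebra.Indexed_Polynomials\<close>, where the monomial \<open>t\<^sup>a\<close> is the multiset
  containing \<open>i\<close> with multiplicity \<open>a\<^sub>i\<close>; that theory does not define the product.\<close>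

definition MPoly :: "('a, 'm) ring_scheme \<Rightarrow> nat \<Rightarrow> (nat multiset \<Rightarrow> 'a) ring" where
  "MPoly R r =
     \<lparr> carrier = ring.indexed_pset R {1..r} (carrier R),
       monoid.mult = (\<lambda>g h m. \<Oplus>\<^bsub>R\<^esub>a\<in>{a. a \<subseteq># m}. g a \<otimes>\<^bsub>R\<^esub> h (m - a)),
       monoid.one = ring.indexed_const R \<one>\<^bsub>R\<^esub>,
       ring.zero = ring.indexed_const R \<zero>\<^bsub>R\<^esub>,
       ring.add = ring.indexed_padd R \<rparr>"

definition mpoly_map :: "('a \<Rightarrow> 'b) \<Rightarrow> (nat multiset \<Rightarrow> 'a) \<Rightarrow> (nat multiset \<Rightarrow> 'b)" where
  "mpoly_map h g = (\<lambda>m. h (g m))"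

section \<open>Left modules over noncommutative rings\<close>

text \<open>We reuse the record type of \<^theory>\<open>HOL-Algebra.Module\<close>, whose locale \<open>module\<close> requires
  a commutative ring of scalars. The multiplicative fields of a module record are irrelevant.\<close>

locale left_module = T?: ring T + M?: abelian_group M
  for T :: "('t, 'm) ring_scheme" (structure) and M :: "('t, 'x, 'n) module_scheme" (structure) +
  assumes smult_closed:
      "\<lbrakk>a \<in> carrier T; x \<in> carrier M\<rbrakk> \<Longrightarrow> a \<odot>\<^bsub>M\<^esub> x \<in> carrier M"
    and smult_l_distr:
      "\<lbrakk>a \<in> carrier T; b \<in> carrier T; x \<in> carrier M\<rbrakk> \<Longrightarrow>
        (a \<oplus>\<^bsub>T\<^esub> b) \<odot>\<^bsub>M\<^esub> x = a \<odot>\<^bsub>M\<^esub> x \<oplus>\<^bsub>M\<^esub> b \<odot>\<^bsub>M\<^esub> x"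
    and smult_r_distr:
      "\<lbrakk>a \<in> carrier T; x \<in> carrier M; y \<in> carrier M\<rbrakk> \<Longrightarrow>
        a \<odot>\<^bsub>M\<^esub> (x \<oplus>\<^bsub>M\<^esub> y) = a \<odot>\<^bsub>M\<^esub> x \<oplus>\<^bsub>M\<^esub> a \<odot>\<^bsub>M\<^esub> y"
    and smult_assoc:
      "\<lbrakk>a \<in> carrier T; b \<in> carrier T; x \<in> carrier M\<rbrakk> \<Longrightarrow>
        (a \<otimes>\<^bsub>T\<^esub> b) \<odot>\<^bsub>M\<^esub> x = a \<odot>\<^bsub>M\<^esub> (b \<odot>\<^bsub>M\<^esub> x)"
    and smult_one: "x \<in> carrier M \<Longrightarrow> \<one>\<^bsub>T\<^esub> \<odot>\<^bsub>M\<^esub> x = x"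

definition left_module_hom ::
  "('t, 'm) ring_scheme \<Rightarrow> ('t, 'x, 'n) module_scheme \<Rightarrow> ('t, 'y, 'k) module_scheme \<Rightarrow>
    ('x \<Rightarrow> 'y) \<Rightarrow> bool" where
  "left_module_hom T M N h \<longleftrightarrow>
     left_module T M \<and> left_module T N \<and> h \<in> carrier M \<rightarrow> carrier N \<and>
     (\<forall>x\<in>carrier M. \<forall>y\<in>carrier M. h (x \<oplus>\<^bsub>M\<^esub> y) = h x \<oplus>\<^bsub>N\<^esub> h y) \<and>
     (\<forall>a\<in>carrier T. \<forall>x\<in>carrier M. h (a \<odot>\<^bsub>M\<^esub> x) = a \<odot>\<^bsub>N\<^esub> h x)"

definition left_module_iso ::
  "('t, 'm) ring_scheme \<Rightarrow> ('t, 'x, 'n) module_scheme \<Rightarrow> ('t, 'y, 'k) module_scheme \<Rightarrow>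
    ('x \<Rightarrow> 'y) \<Rightarrow> bool" where
  "left_module_iso T M N h \<longleftrightarrow>
     left_module_hom T M N h \<and> bij_betw h (carrier M) (carrier N)"

definition restrict_scalars ::
  "('s \<Rightarrow> 't) \<Rightarrow> ('t, 'x, 'n) module_scheme \<Rightarrow> ('s, 'x) module" where
  "restrict_scalars \<sigma> M =
     \<lparr> carrier = carrier M, monoid.mult = monoid.mult M, monoid.one = \<one>\<^bsub>M\<^esub>, ring.zero = \<zero>\<^bsub>M\<^esub>, ring.add = ring.add M,
       smult = (\<lambda>a x. \<sigma> a \<odot>\<^bsub>M\<^esub> x) \<rparr>"

definition quot_module ::
  "('t, 'x, 'n) module_scheme \<Rightarrow> 'x set \<Rightarrow> ('t, 'x set) module" where
  "quot_module M K =
     \<lparr> carrier = a_rcosets\<^bsub>M\<^esub> K, monoid.mult = undefined, monoid.one = undefined,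
       ring.zero = K, ring.add = set_add M,
       smult = (\<lambda>a C. \<Union>x\<in>C. K +>\<^bsub>M\<^esub> (a \<odot>\<^bsub>M\<^esub> x)) \<rparr>"

definition cyclic_sum ::
  "('t, 'm) ring_scheme \<Rightarrow> ('t, 'x, 'n) module_scheme \<Rightarrow> ('j \<Rightarrow> 'x) \<Rightarrow> 'j set \<Rightarrow> 'x set" where
  "cyclic_sum T M v J =
     {(\<Oplus>\<^bsub>M\<^esub>j\<in>A. a j \<odot>\<^bsub>M\<^esub> v j) |A a. finite A \<and> A \<subseteq> J \<and> a \<in> A \<rightarrow> carrier T}"

section \<open>The \<open>p\<close>-adic integers and continuous functions\<close>

text \<open>\<open>Zp p\<close> is the inverse limit of the rings \<open>\<int>/p\<^sup>e\<close>, the component of \<open>x\<close> in \<open>\<int>/p\<^sup>e\<close> being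
  given by its representative \<open>x e \<in> {0..<p\<^sup>e}\<close>. In terms of digits, \<open>x e\<close> is the truncation
  \<open>\<langle>x\<rangle>\<^sub>e = \<Sum>i<e. x\<^sup>[\<^sup>i\<^sup>] p\<^sup>i\<close>.\<close>

definition Zp :: "nat \<Rightarrow> (nat \<Rightarrow> int) ring" where
  "Zp p =
     \<lparr> carrier = {x. \<forall>e. x e \<in> {0..<int p ^ e} \<and> x (Suc e) mod int p ^ e = x e},
       monoid.mult = (\<lambda>x y e. (x e * y e) mod int p ^ e),
       monoid.one = (\<lambda>e. 1 mod int p ^ e),
       ring.zero = (\<lambda>e. 0),
       ring.add = (\<lambda>x y e. (x e + y e) mod int p ^ e) \<rparr>"

definition Zp_of_int :: "nat \<Rightarrow> int \<Rightarrow> (nat \<Rightarrow> int)" where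
  "Zp_of_int p k = (\<lambda>e. k mod int p ^ e)"

definition trunc :: "(nat \<Rightarrow> int) \<Rightarrow> nat \<Rightarrow> nat" where
  "trunc x e = nat (x e)"

definition Zp_topology :: "nat \<Rightarrow> (nat \<Rightarrow> int) topology" where
  "Zp_topology p =
     subtopology (product_topology (\<lambda>e. discrete_topology {0..<int p ^ e}) UNIV) (carrier (Zp p))"

definition Zp_space :: "nat \<Rightarrow> nat \<Rightarrow> (nat \<Rightarrow> nat \<Rightarrow> int) topology" where
  "Zp_space p r = product_topology (\<lambda>_. Zp_topology p) {1..r}"

definition Cfun :: "'x topology \<Rightarrow> ('t, 'm) ring_scheme \<Rightarrow> ('x \<Rightarrow> 't) ring" where
  "Cfun Y T =
     \<lparr> carrier = {G \<in> extensional (topspace Y).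
                    continuous_map Y (discrete_topology (carrier T)) G},
       monoid.mult = (\<lambda>G H. \<lambda>x\<in>topspace Y. G x \<otimes>\<^bsub>T\<^esub> H x),
       monoid.one = (\<lambda>x\<in>topspace Y. \<one>\<^bsub>T\<^esub>),
       ring.zero = (\<lambda>x\<in>topspace Y. \<zero>\<^bsub>T\<^esub>),
       ring.add = (\<lambda>G H. \<lambda>x\<in>topspace Y. G x \<oplus>\<^bsub>T\<^esub> H x) \<rparr>"

abbreviation Fp :: "nat \<Rightarrow> int ring" where
  "Fp p \<equiv> residue_ring (int p)"

definition Fp_scale ::
  "'x topology \<Rightarrow> ('t, 'm) ring_scheme \<Rightarrow> ('x \<Rightarrow> int) \<Rightarrow> ('x \<Rightarrow> 't) \<Rightarrow> ('x \<Rightarrow> 't)" where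
  "Fp_scale Y T G W = (\<lambda>x\<in>topspace Y. [G x] \<cdot>\<^bsub>T\<^esub> W x)"

definition Cfun_decomp ::
  "nat \<Rightarrow> 'x topology \<Rightarrow> ('t, 'm) ring_scheme \<Rightarrow> ('x \<Rightarrow> 't) \<Rightarrow>
    nat \<Rightarrow> (nat \<Rightarrow> 'x \<Rightarrow> int) \<Rightarrow> (nat \<Rightarrow> 't) \<Rightarrow> bool" where
  "Cfun_decomp p Y T P n G v \<longleftrightarrow>
     (\<forall>i<n. G i \<in> carrier (Cfun Y (Fp p)) \<and> v i \<in> carrier T) \<and>
     P = (\<Oplus>\<^bsub>Cfun Y T\<^esub>i\<in>{..<n}. Fp_scale Y T (G i) (\<lambda>x\<in>topspace Y. v i))"

definition Bfun :: "nat \<Rightarrow> nat \<Rightarrow> (nat \<Rightarrow> nat) \<Rightarrow> ((nat \<Rightarrow> nat \<Rightarrow> int) \<Rightarrow> int)" where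
  "Bfun p r k =
     (let e = (LEAST e. \<forall>i\<in>{1..r}. k i < p ^ e)
      in (\<lambda>x\<in>topspace (Zp_space p r).
           int (\<Prod>i\<in>{1..r}. trunc (x i) e choose k i) mod int p))"

section \<open>Differential operators\<close>

definition DiffOp_level :: "nat \<Rightarrow> ('a, 'm) ring_scheme \<Rightarrow> nat \<Rightarrow> ('a \<Rightarrow> 'a) set" where
  "DiffOp_level p R e =
     {\<phi> \<in> carrier R \<rightarrow>\<^sub>E carrier R.
        (\<forall>a\<in>carrier R. \<forall>b\<in>carrier R. \<phi> (a \<oplus>\<^bsub>R\<^esub> b) = \<phi> a \<oplus>\<^bsub>R\<^esub> \<phi> b) \<and>
        (\<forall>c\<in>carrier R. \<forall>a\<in>carrier R.
            \<phi> ((c [^]\<^bsub>R\<^esub> (p ^ e)) \<otimes>\<^bsub>R\<^esub> a) = (c [^]\<^bsub>R\<^esub> (p ^ e)) \<otimes>\<^bsub>R\<^esub> \<phi> a)}"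

definition DiffOp :: "nat \<Rightarrow> ('a, 'm) ring_scheme \<Rightarrow> ('a \<Rightarrow> 'a) ring" where
  "DiffOp p R =
     \<lparr> carrier = (\<Union>e. DiffOp_level p R e),
       monoid.mult = compose (carrier R),
       monoid.one = (\<lambda>a\<in>carrier R. a),
       ring.zero = (\<lambda>a\<in>carrier R. \<zero>\<^bsub>R\<^esub>),
       ring.add = (\<lambda>\<phi> \<psi>. \<lambda>a\<in>carrier R. \<phi> a \<oplus>\<^bsub>R\<^esub> \<psi> a) \<rparr>"

text \<open>Several constructions use some \<open>e\<close> with \<open>\<phi> \<in> D\<^sup>e\<close> but do not depend on it; they are
  evaluated at the least such \<open>e\<close>.\<close>

definition level :: "nat \<Rightarrow> ('a, 'm) ring_scheme \<Rightarrow> ('a \<Rightarrow> 'a) \<Rightarrow> nat" where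
  "level p R \<phi> = (LEAST e. \<phi> \<in> DiffOp_level p R e)"

text \<open>The action of \<open>\<phi>\<close> on \<open>S\<^sup>-\<^sup>1R\<close>, that is, its image under \<open>D\<^sub>R \<rightarrow> D\<^bsub>S\<^sup>-\<^sup>1R\<^esub>\<close>.\<close>

definition DiffOp_loc ::
  "nat \<Rightarrow> ('a, 'm) ring_scheme \<Rightarrow> 'a set \<Rightarrow> ('a \<Rightarrow> 'a) \<Rightarrow> (('a \<times> 'a) set \<Rightarrow> ('a \<times> 'a) set)" where
  "DiffOp_loc p R S \<phi> =
     (let q = p ^ level p R \<phi>
      in (\<lambda>C\<in>carrier (Loc R S).
           \<Union>(a, s)\<in>C. loc_frac R S (\<phi> ((s [^]\<^bsub>R\<^esub> (q - 1)) \<otimes>\<^bsub>R\<^esub> a)) (s [^]\<^bsub>R\<^esub> q)))"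

definition Loc_module ::
  "nat \<Rightarrow> ('a, 'm) ring_scheme \<Rightarrow> 'a set \<Rightarrow> ('a \<Rightarrow> 'a, ('a \<times> 'a) set) module" where
  "Loc_module p R S =
     \<lparr> carrier = carrier (Loc R S), monoid.mult = monoid.mult (Loc R S), monoid.one = \<one>\<^bsub>Loc R S\<^esub>,
       ring.zero = \<zero>\<^bsub>Loc R S\<^esub>, ring.add = ring.add (Loc R S), smult = DiffOp_loc p R S \<rparr>"

abbreviation CD ::
  "nat \<Rightarrow> nat \<Rightarrow> ('a, 'm) ring_scheme \<Rightarrow> ((nat \<Rightarrow> nat \<Rightarrow> int) \<Rightarrow> 'a \<Rightarrow> 'a) ring" where
  "CD p r R \<equiv> Cfun (Zp_space p r) (DiffOp p R)"

subsection \<open>Bernstein-Sato roots\<close>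

definition DiffOp_ideal :: "nat \<Rightarrow> ('a, 'm) ring_scheme \<Rightarrow> nat \<Rightarrow> 'a set \<Rightarrow> 'a set" where
  "DiffOp_ideal p R e J = Idl\<^bsub>R\<^esub> (\<Union>\<phi>\<in>DiffOp_level p R e. \<phi> ` J)"

definition BS_set :: "nat \<Rightarrow> ('a, 'm) ring_scheme \<Rightarrow> 'a set \<Rightarrow> nat \<Rightarrow> nat set" where
  "BS_set p R I e =
     {n. DiffOp_ideal p R e (I [^]\<^bsub>ideals_set R\<^esub> Suc n) \<subset> DiffOp_ideal p R e (I [^]\<^bsub>ideals_set R\<^esub> n)}"

definition BS_root :: "nat \<Rightarrow> ('a, 'm) ring_scheme \<Rightarrow> 'a set \<Rightarrow> (nat \<Rightarrow> int) \<Rightarrow> bool" where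
  "BS_root p R I x \<longleftrightarrow>
     x \<in> carrier (Zp p) \<and>
     (\<exists>\<nu>. (\<forall>e. \<nu> e \<in> BS_set p R I e) \<and>
          limitin (Zp_topology p) (\<lambda>e. Zp_of_int p (int (\<nu> e))) x sequentially)"

section \<open>Local cohomology\<close>

definition Delta ::
  "nat \<Rightarrow> nat \<Rightarrow> ('a, 'm) ring_scheme \<Rightarrow> ((nat \<Rightarrow> nat \<Rightarrow> int) \<Rightarrow> 'a \<Rightarrow> 'a) \<Rightarrow>
    ((nat multiset \<Rightarrow> 'a) \<Rightarrow> (nat multiset \<Rightarrow> 'a))" where
  "Delta p r R P =
     (\<lambda>g\<in>carrier (MPoly R r). \<lambda>m. P (\<lambda>i\<in>{1..r}. Zp_of_int p (- int (count m i) - 1)) (g m))"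

definition t_power :: "('a, 'm) ring_scheme \<Rightarrow> nat \<Rightarrow> int \<Rightarrow> (nat multiset \<Rightarrow> 'a) set" where
  "t_power R r j =
     (Idl\<^bsub>MPoly R r\<^esub> (ring.indexed_var R ` {1..r})) [^]\<^bsub>ideals_set (MPoly R r)\<^esub> nat j"

definition V_filt ::
  "nat \<Rightarrow> nat \<Rightarrow> ('a, 'm) ring_scheme \<Rightarrow> int \<Rightarrow>
    ((nat multiset \<Rightarrow> 'a) \<Rightarrow> (nat multiset \<Rightarrow> 'a)) set" where
  "V_filt p r R i =
     {\<phi> \<in> carrier (DiffOp p (MPoly R r)). \<forall>j. \<phi> ` t_power R r j \<subseteq> t_power R r (j + i)}"

definition f_minus_t ::
  "('a, 'm) ring_scheme \<Rightarrow> nat \<Rightarrow> (nat \<Rightarrow> 'a) \<Rightarrow> nat \<Rightarrow> (nat multiset \<Rightarrow> 'a)" where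
  "f_minus_t R r f i = ring.indexed_const R (f i) \<ominus>\<^bsub>MPoly R r\<^esub> ring.indexed_var R i"

definition prod_f_minus_t ::
  "('a, 'm) ring_scheme \<Rightarrow> nat \<Rightarrow> (nat \<Rightarrow> 'a) \<Rightarrow> nat set \<Rightarrow> (nat multiset \<Rightarrow> 'a)" where
  "prod_f_minus_t R r f J = (\<Otimes>\<^bsub>MPoly R r\<^esub>i\<in>J. f_minus_t R r f i)"

definition cech_set :: "('a, 'm) ring_scheme \<Rightarrow> nat \<Rightarrow> (nat \<Rightarrow> 'a) \<Rightarrow> (nat multiset \<Rightarrow> 'a) set" where
  "cech_set R r f = powers (MPoly R r) (prod_f_minus_t R r f {1..r})"

definition cech_top ::
  "nat \<Rightarrow> nat \<Rightarrow> ('a, 'm) ring_scheme \<Rightarrow> (nat \<Rightarrow> 'a) \<Rightarrow>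
    ((nat multiset \<Rightarrow> 'a) \<Rightarrow> (nat multiset \<Rightarrow> 'a),
     ((nat multiset \<Rightarrow> 'a) \<times> (nat multiset \<Rightarrow> 'a)) set) module" where
  "cech_top p r R f = Loc_module p (MPoly R r) (cech_set R r f)"

text \<open>The image of \<open>R[t]\<^sub>h\<close>, \<open>h = \<Prod>\<^bsub>j\<noteq>i\<^esub> (f\<^sub>j - t\<^sub>j)\<close>: the elements \<open>a/h\<^sup>n\<close>, where \<open>h\<close> is a unit of the
  larger localization.\<close>

definition cech_image ::
  "('a, 'm) ring_scheme \<Rightarrow> nat \<Rightarrow> (nat \<Rightarrow> 'a) \<Rightarrow> nat \<Rightarrow>
    ((nat multiset \<Rightarrow> 'a) \<times> (nat multiset \<Rightarrow> 'a)) set set" where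
  "cech_image R r f i =
     (let A = MPoly R r; S = cech_set R r f; h = prod_f_minus_t R r f ({1..r} - {i})
      in {loc_incl A S a \<otimes>\<^bsub>Loc A S\<^esub> inv\<^bsub>Loc A S\<^esub> (loc_incl A S (h [^]\<^bsub>A\<^esub> n)) |a (n::nat).
            a \<in> carrier A})"

definition cech_bound ::
  "('a, 'm) ring_scheme \<Rightarrow> nat \<Rightarrow> (nat \<Rightarrow> 'a) \<Rightarrow>
    ((nat multiset \<Rightarrow> 'a) \<times> (nat multiset \<Rightarrow> 'a)) set set" where
  "cech_bound R r f =
     {(\<Oplus>\<^bsub>Loc (MPoly R r) (cech_set R r f)\<^esub>i\<in>{1..r}. y i) |y. \<forall>i\<in>{1..r}. y i \<in> cech_image R r f i}"

text \<open>The \<open>r\<close>-th local cohomology, first as a module over \<open>D\<^bsub>R[t]\<^esub>\<close>, then over \<open>C(\<int>\<^sub>p\<^sup>r, D\<^sub>R)\<close>.\<close>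

definition loc_coh ::
  "nat \<Rightarrow> nat \<Rightarrow> ('a, 'm) ring_scheme \<Rightarrow> (nat \<Rightarrow> 'a) \<Rightarrow>
    ((nat multiset \<Rightarrow> 'a) \<Rightarrow> (nat multiset \<Rightarrow> 'a),
     ((nat multiset \<Rightarrow> 'a) \<times> (nat multiset \<Rightarrow> 'a)) set set) module" where
  "loc_coh p r R f = quot_module (cech_top p r R f) (cech_bound R r f)"

definition H_mod ::
  "nat \<Rightarrow> nat \<Rightarrow> ('a, 'm) ring_scheme \<Rightarrow> (nat \<Rightarrow> 'a) \<Rightarrow>
    ((nat \<Rightarrow> nat \<Rightarrow> int) \<Rightarrow> 'a \<Rightarrow> 'a,
     ((nat multiset \<Rightarrow> 'a) \<times> (nat multiset \<Rightarrow> 'a)) set set) module" where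
  "H_mod p r R f = restrict_scalars (Delta p r R) (loc_coh p r R f)"

definition delta ::
  "nat \<Rightarrow> nat \<Rightarrow> ('a, 'm) ring_scheme \<Rightarrow> (nat \<Rightarrow> 'a) \<Rightarrow>
    ((nat multiset \<Rightarrow> 'a) \<times> (nat multiset \<Rightarrow> 'a)) set set" where
  "delta p r R f =
     cech_bound R r f +>\<^bsub>cech_top p r R f\<^esub>
       loc_frac (MPoly R r) (cech_set R r f) \<one>\<^bsub>MPoly R r\<^esub> (prod_f_minus_t R r f {1..r})"

definition V_delta ::
  "nat \<Rightarrow> nat \<Rightarrow> ('a, 'm) ring_scheme \<Rightarrow> (nat \<Rightarrow> 'a) \<Rightarrow> int \<Rightarrow>
    ((nat multiset \<Rightarrow> 'a) \<times> (nat multiset \<Rightarrow> 'a)) set set set" where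
  "V_delta p r R f i = (\<lambda>\<phi>. \<phi> \<odot>\<^bsub>loc_coh p r R f\<^esub> delta p r R f) ` V_filt p r R i"

definition V0_mod ::
  "nat \<Rightarrow> nat \<Rightarrow> ('a, 'm) ring_scheme \<Rightarrow> (nat \<Rightarrow> 'a) \<Rightarrow>
    ((nat \<Rightarrow> nat \<Rightarrow> int) \<Rightarrow> 'a \<Rightarrow> 'a,
     ((nat multiset \<Rightarrow> 'a) \<times> (nat multiset \<Rightarrow> 'a)) set set) module" where
  "V0_mod p r R f = (H_mod p r R f)\<lparr>carrier := V_delta p r R f 0\<rparr>"

definition N_mod ::
  "nat \<Rightarrow> nat \<Rightarrow> ('a, 'm) ring_scheme \<Rightarrow> (nat \<Rightarrow> 'a) \<Rightarrow>
    ((nat \<Rightarrow> nat \<Rightarrow> int) \<Rightarrow> 'a \<Rightarrow> 'a,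
     ((nat multiset \<Rightarrow> 'a) \<times> (nat multiset \<Rightarrow> 'a)) set set set) module" where
  "N_mod p r R f = quot_module (V0_mod p r R f) (V_delta p r R f 1)"

section \<open>The module \<open>C(\<int>\<^sub>p\<^sup>r, B) f\<^sup>s\<close>\<close>

text \<open>Here \<open>B\<close> is a ring in which all \<open>f\<^sub>i\<close> are units. The element \<open>U f\<^sup>s\<close> is encoded by its
  coefficient \<open>U\<close>, so that the symbol \<open>f\<^sup>s\<close> itself is the constant function \<open>1\<close>.\<close>

definition Vfun ::
  "nat \<Rightarrow> nat \<Rightarrow> ('b, 'm) ring_scheme \<Rightarrow> (nat \<Rightarrow> 'b) \<Rightarrow> ('b \<Rightarrow> 'b) \<Rightarrow> 'b \<Rightarrow>
    ((nat \<Rightarrow> nat \<Rightarrow> int) \<Rightarrow> 'b)" where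
  "Vfun p r B f \<phi> u =
     (\<lambda>x\<in>topspace (Zp_space p r).
        let fx = (\<Otimes>\<^bsub>B\<^esub>i\<in>{1..r}. f i [^]\<^bsub>B\<^esub> trunc (x i) (level p B \<phi>))
        in \<phi> (u \<otimes>\<^bsub>B\<^esub> fx) \<otimes>\<^bsub>B\<^esub> inv\<^bsub>B\<^esub> fx)"

text \<open>The \<open>THE\<close> is proper because the sum does not depend on the decompositions chosen.\<close>

definition fs_smult ::
  "nat \<Rightarrow> nat \<Rightarrow> ('b, 'm) ring_scheme \<Rightarrow> (nat \<Rightarrow> 'b) \<Rightarrow>
    ((nat \<Rightarrow> nat \<Rightarrow> int) \<Rightarrow> 'b \<Rightarrow> 'b) \<Rightarrow> ((nat \<Rightarrow> nat \<Rightarrow> int) \<Rightarrow> 'b) \<Rightarrow> ((nat \<Rightarrow> nat \<Rightarrow> int) \<Rightarrow> 'b)" where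
  "fs_smult p r B f P U =
     (let Y = Zp_space p r
      in THE W. \<exists>n G \<phi> m H u.
           Cfun_decomp p Y (DiffOp p B) P n G \<phi> \<and> Cfun_decomp p Y B U m H u \<and>
           W = (\<Oplus>\<^bsub>Cfun Y B\<^esub>i\<in>{..<n}. \<Oplus>\<^bsub>Cfun Y B\<^esub>j\<in>{..<m}.
                  Fp_scale Y B (G i) (Fp_scale Y B (H j) (Vfun p r B f (\<phi> i) (u j)))))"

definition fs_mod ::
  "nat \<Rightarrow> nat \<Rightarrow> ('b, 'm) ring_scheme \<Rightarrow> (nat \<Rightarrow> 'b) \<Rightarrow>
    ((nat \<Rightarrow> nat \<Rightarrow> int) \<Rightarrow> 'b \<Rightarrow> 'b, (nat \<Rightarrow> nat \<Rightarrow> int) \<Rightarrow> 'b) module" where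
  "fs_mod p r B f =
     (let C = Cfun (Zp_space p r) B
      in \<lparr> carrier = carrier C, monoid.mult = monoid.mult C, monoid.one = \<one>\<^bsub>C\<^esub>, ring.zero = \<zero>\<^bsub>C\<^esub>, ring.add = ring.add C,
           smult = fs_smult p r B f \<rparr>)"

text \<open>\<open>U f\<^sup>s\<close> is sent to \<open>\<Delta>(U)(\<delta>)\<close>, where \<open>U\<close> acts through multiplication by its values.\<close>

definition Theta ::
  "nat \<Rightarrow> nat \<Rightarrow> ('b, 'm) ring_scheme \<Rightarrow> (nat \<Rightarrow> 'b) \<Rightarrow> ((nat \<Rightarrow> nat \<Rightarrow> int) \<Rightarrow> 'b) \<Rightarrow>
    ((nat multiset \<Rightarrow> 'b) \<times> (nat multiset \<Rightarrow> 'b)) set set" where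
  "Theta p r B f U =
     Delta p r B (\<lambda>x\<in>topspace (Zp_space p r). \<lambda>b\<in>carrier B. U x \<otimes>\<^bsub>B\<^esub> b)
       \<odot>\<^bsub>loc_coh p r B f\<^esub> delta p r B f"

section \<open>Passage from \<open>R\<close> to \<open>R\<^sub>f\<close>\<close>

definition f_powers :: "('a, 'm) ring_scheme \<Rightarrow> nat \<Rightarrow> (nat \<Rightarrow> 'a) \<Rightarrow> 'a set" where
  "f_powers R r f = powers R (\<Otimes>\<^bsub>R\<^esub>i\<in>{1..r}. f i)"

abbreviation Rf :: "('a, 'm) ring_scheme \<Rightarrow> nat \<Rightarrow> (nat \<Rightarrow> 'a) \<Rightarrow> ('a \<times> 'a) set ring" where
  "Rf R r f \<equiv> Loc R (f_powers R r f)"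

abbreviation Rf_incl :: "('a, 'm) ring_scheme \<Rightarrow> nat \<Rightarrow> (nat \<Rightarrow> 'a) \<Rightarrow> 'a \<Rightarrow> ('a \<times> 'a) set" where
  "Rf_incl R r f \<equiv> loc_incl R (f_powers R r f)"

definition CD_incl ::
  "nat \<Rightarrow> nat \<Rightarrow> ('a, 'm) ring_scheme \<Rightarrow> (nat \<Rightarrow> 'a) \<Rightarrow>
    ((nat \<Rightarrow> nat \<Rightarrow> int) \<Rightarrow> 'a \<Rightarrow> 'a) \<Rightarrow>
    ((nat \<Rightarrow> nat \<Rightarrow> int) \<Rightarrow> ('a \<times> 'a) set \<Rightarrow> ('a \<times> 'a) set)" where
  "CD_incl p r R f P = (\<lambda>x\<in>topspace (Zp_space p r). DiffOp_loc p R (f_powers R r f) (P x))"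

abbreviation fs_Rf ::
  "nat \<Rightarrow> nat \<Rightarrow> ('a, 'm) ring_scheme \<Rightarrow> (nat \<Rightarrow> 'a) \<Rightarrow>
    ((nat \<Rightarrow> nat \<Rightarrow> int) \<Rightarrow> ('a \<times> 'a) set \<Rightarrow> ('a \<times> 'a) set,
     (nat \<Rightarrow> nat \<Rightarrow> int) \<Rightarrow> ('a \<times> 'a) set) module" where
  "fs_Rf p r R f \<equiv> fs_mod p r (Rf R r f) (\<lambda>i. Rf_incl R r f (f i))"

abbreviation H_Rf ::
  "nat \<Rightarrow> nat \<Rightarrow> ('a, 'm) ring_scheme \<Rightarrow> (nat \<Rightarrow> 'a) \<Rightarrow>
    ((nat \<Rightarrow> nat \<Rightarrow> int) \<Rightarrow> ('a \<times> 'a) set \<Rightarrow> ('a \<times> 'a) set,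
     ((nat multiset \<Rightarrow> ('a \<times> 'a) set) \<times> (nat multiset \<Rightarrow> ('a \<times> 'a) set)) set set) module" where
  "H_Rf p r R f \<equiv> H_mod p r (Rf R r f) (\<lambda>i. Rf_incl R r f (f i))"

abbreviation Theta_Rf ::
  "nat \<Rightarrow> nat \<Rightarrow> ('a, 'm) ring_scheme \<Rightarrow> (nat \<Rightarrow> 'a) \<Rightarrow>
    ((nat \<Rightarrow> nat \<Rightarrow> int) \<Rightarrow> ('a \<times> 'a) set) \<Rightarrow>
    ((nat multiset \<Rightarrow> ('a \<times> 'a) set) \<times> (nat multiset \<Rightarrow> ('a \<times> 'a) set)) set set" where
  "Theta_Rf p r R f \<equiv> Theta p r (Rf R r f) (\<lambda>i. Rf_incl R r f (f i))"

definition H_incl ::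
  "nat \<Rightarrow> nat \<Rightarrow> ('a, 'm) ring_scheme \<Rightarrow> (nat \<Rightarrow> 'a) \<Rightarrow>
    ((nat multiset \<Rightarrow> 'a) \<times> (nat multiset \<Rightarrow> 'a)) set set \<Rightarrow>
    ((nat multiset \<Rightarrow> ('a \<times> 'a) set) \<times> (nat multiset \<Rightarrow> ('a \<times> 'a) set)) set set" where
  "H_incl p r R f Z =
     (let B = Rf R r f; f' = (\<lambda>i. Rf_incl R r f (f i))
      in \<Union>C\<in>Z. cech_bound B r f' +>\<^bsub>cech_top p r B f'\<^esub>
             loc_map (MPoly B r) (cech_set B r f') (mpoly_map (Rf_incl R r f)) C)"

section \<open>Bernstein-Sato functional equations\<close>

definition Fun_set :: "nat \<Rightarrow> nat \<Rightarrow> (nat \<Rightarrow> nat \<Rightarrow> int) set" where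
  "Fun_set p r =
     {\<alpha>. (\<forall>i j. \<alpha> i j \<in> {- int p + 1..int p - 1}) \<and> (\<forall>i j. i \<notin> {1..r} \<longrightarrow> \<alpha> i j = 0) \<and>
         finite {(i, j). \<alpha> i j \<noteq> 0}}"

definition Fun_exp :: "nat \<Rightarrow> (nat \<Rightarrow> nat \<Rightarrow> int) \<Rightarrow> nat \<Rightarrow> int" where
  "Fun_exp p \<alpha> i = (\<Sum>j | \<alpha> i j \<noteq> 0. \<alpha> i j * int p ^ j)"

definition Fun_norm :: "nat \<Rightarrow> nat \<Rightarrow> (nat \<Rightarrow> nat \<Rightarrow> int) \<Rightarrow> int" where
  "Fun_norm p r \<alpha> = (\<Sum>i\<in>{1..r}. Fun_exp p \<alpha> i)"

definition Fun_neg :: "nat \<Rightarrow> (nat \<Rightarrow> nat \<Rightarrow> int) \<Rightarrow> nat \<Rightarrow> nat" where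
  "Fun_neg p \<alpha> i = (\<Sum>j | \<alpha> i j < 0. nat (- \<alpha> i j) * p ^ j)"

text \<open>The element \<open>Bd\<^sup>[\<^sup>\<alpha>\<^sup>] f\<^sup>[\<^sup>\<alpha>\<^sup>] f\<^sup>s\<close>; the exponents in \<open>f\<^sup>[\<^sup>\<alpha>\<^sup>]\<close> are integers.\<close>

definition Bd_fs ::
  "nat \<Rightarrow> nat \<Rightarrow> ('a, 'm) ring_scheme \<Rightarrow> (nat \<Rightarrow> 'a) \<Rightarrow> (nat \<Rightarrow> nat \<Rightarrow> int) \<Rightarrow>
    ((nat \<Rightarrow> nat \<Rightarrow> int) \<Rightarrow> ('a \<times> 'a) set)" where
  "Bd_fs p r R f \<alpha> =
     (let Y = Zp_space p r; B = Rf R r f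
      in Fp_scale Y B (Bfun p r (Fun_neg p \<alpha>))
           (\<lambda>x\<in>topspace Y. \<Otimes>\<^bsub>B\<^esub>i\<in>{1..r}. Rf_incl R r f (f i) [^]\<^bsub>B\<^esub> Fun_exp p \<alpha> i))"

abbreviation fs_over_R ::
  "nat \<Rightarrow> nat \<Rightarrow> ('a, 'm) ring_scheme \<Rightarrow> (nat \<Rightarrow> 'a) \<Rightarrow>
    ((nat \<Rightarrow> nat \<Rightarrow> int) \<Rightarrow> 'a \<Rightarrow> 'a, (nat \<Rightarrow> nat \<Rightarrow> int) \<Rightarrow> ('a \<times> 'a) set) module" where
  "fs_over_R p r R f \<equiv> restrict_scalars (CD_incl p r R f) (fs_Rf p r R f)"

definition Bd_sum ::
  "nat \<Rightarrow> nat \<Rightarrow> ('a, 'm) ring_scheme \<Rightarrow> (nat \<Rightarrow> 'a) \<Rightarrow> int \<Rightarrow>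
    ((nat \<Rightarrow> nat \<Rightarrow> int) \<Rightarrow> ('a \<times> 'a) set) set" where
  "Bd_sum p r R f k =
     cyclic_sum (CD p r R) (fs_over_R p r R f) (Bd_fs p r R f)
       {\<alpha> \<in> Fun_set p r. Fun_norm p r \<alpha> = k}"

definition Bd_mod ::
  "nat \<Rightarrow> nat \<Rightarrow> ('a, 'm) ring_scheme \<Rightarrow> (nat \<Rightarrow> 'a) \<Rightarrow>
    ((nat \<Rightarrow> nat \<Rightarrow> int) \<Rightarrow> 'a \<Rightarrow> 'a, (nat \<Rightarrow> nat \<Rightarrow> int) \<Rightarrow> ('a \<times> 'a) set) module" where
  "Bd_mod p r R f = (fs_over_R p r R f)\<lparr>carrier := Bd_sum p r R f 0\<rparr>"

definition Sigma_fun ::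
  "nat \<Rightarrow> nat \<Rightarrow> ((nat \<Rightarrow> int) \<Rightarrow> int) \<Rightarrow> ((nat \<Rightarrow> nat \<Rightarrow> int) \<Rightarrow> int)" where
  "Sigma_fun p r F = (\<lambda>x\<in>topspace (Zp_space p r). F (\<Oplus>\<^bsub>Zp p\<^esub>i\<in>{1..r}. x i))"

definition BS_functional_eq ::
  "nat \<Rightarrow> nat \<Rightarrow> ('a, 'm) ring_scheme \<Rightarrow> (nat \<Rightarrow> 'a) \<Rightarrow> ((nat \<Rightarrow> int) \<Rightarrow> int) \<Rightarrow> bool" where
  "BS_functional_eq p r R f F \<longleftrightarrow>
     (let Y = Zp_space p r; B = Rf R r f; M = fs_over_R p r R f;
          J = {\<alpha> \<in> Fun_set p r. Fun_norm p r \<alpha> = 1}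
      in \<exists>P \<in> J \<rightarrow> carrier (CD p r R).
           finite {\<alpha>\<in>J. P \<alpha> \<noteq> \<zero>\<^bsub>CD p r R\<^esub>} \<and>
           Fp_scale Y B (Sigma_fun p r F) \<one>\<^bsub>Cfun Y B\<^esub> =
             (\<Oplus>\<^bsub>M\<^esub>\<alpha>\<in>{\<alpha>\<in>J. P \<alpha> \<noteq> \<zero>\<^bsub>CD p r R\<^esub>}. P \<alpha> \<odot>\<^bsub>M\<^esub> Bd_fs p r R f \<alpha>))"

end

(* Everything is read off the expansion of a local cohomology class as a power series in t. For
   z = a / prod_i (f_i - t_i)^q with q = p^e, the coefficient of t^N multiplied by f^(N+1) becomes
   constant once N is large and N = -1 - x modulo q. Its eventual value Lam z (x) is a locally
   constant function of x; the kernel of Lam is the Cech boundary, Lam intertwines Delta(P) with P,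
   and Lam delta = 1. So Lam embeds H into C(Z_p^r, R_f) f^s and inverts Theta over R_f.
   Under Lam the submodule V^k delta becomes the set S^k of those U for which, for some e, U is
   constant modulo p^e and U(x) f^<x>_e lies in D^e I^(|<x>_e| + k) for every x. Lucas's theorem
   shows that the elements Bd^[alpha] f^[alpha] f^s with |alpha| = k generate S^k as well. Finally
   Sigma(F) f^s lies in S^1 iff F vanishes on every residue class, modulo some p^e, in which some n
   satisfies D^e I^n <> D^e I^(n+1), and this is the definition of a Bernstein-Sato root. *)

theory Submission
 imports Defs
begin

text \<open>Over a ring B in which the f_i are units the series 1/(f_i - t_i) exist, and Frobenius
  turns prod_i (f_i - t_i)^q into prod_i (f_i^q - t_i^q), whose inverse is a series in the t_i^q. So
  the coefficient of t^N in z involves only the monomials of a with exponent congruent to N modulo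
  q; this is the origin of the residue classes. The residue -1 - x is the one at which
  \<open>Delta\<close> evaluates P, and the factor f^(N+1) normalizes the expansion of delta to 1.
  In finite terms: modulo the f_i^q - t_i^q the polynomials are free over R on the t^b with all b_i
  < q, and the value at x is the coefficient of a at b = q - 1 - x, divided by f^x, with x truncated
  modulo q.

  Two obstacles shape the proof. Fractions have many representatives and operators many levels, so a
  construction independent of e is computed at one large e. Module structures on quotients are not
  checked on cosets but pulled back along injections into C(Z_p^r, B) f^s. One setting, R embedded
  in B, serves for R in R_f and for the identity of R_f; comparing the two relates H, H' and
  Theta.\<close>

abbreviation "rep \<equiv> replicate_mset"
abbreviation "car \<equiv> carrier"
abbreviation "DL \<equiv> DiffOp_level"

section \<open>The \<open>p\<close>-adic integers and locally constant functions\<close>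

text \<open>A compactness argument: finitely many fibres of the maps \<pi> on which G is constant
  cover Y, and by monotonicity the largest of their levels works everywhere. The level maps are kept
  abstract because the criterion is applied to Z_p and again to Z_p^r.\<close>

lemma continuous_map_discrete_uniform: fixes \<pi> :: "nat => 'x => 'k" assumes cpt: "compact_space Y"
  and op: "!!e x. x : topspace Y ==> openin Y {y : topspace Y. \<pi> e y = \<pi> e x}"
  and nb: "!!U x. openin Y U ==> x : U ==> \<exists>e. {y : topspace Y. \<pi> e y = \<pi> e x} <= U"
  and mono: "!!e E x y. e <= E ==> x : topspace Y ==> y : topspace Y ==> \<pi> E x = \<pi> E y ==> \<pi> e x = \<pi> e y"
 shows "continuous_map Y (discrete_topology D) G \<longleftrightarrow>
  G : topspace Y \<rightarrow> D \<and> (\<exists>e. \<forall>x\<in>topspace Y. \<forall>y\<in>topspace Y. \<pi> e x = \<pi> e y \<longrightarrow> G x = G y)"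
proof
 assume c: "continuous_map Y (discrete_topology D) G"
 hence G: "G : topspace Y \<rightarrow> D" by (auto simp: continuous_map_def)
 have "\<exists>e. {y : topspace Y. \<pi> e y = \<pi> e x} <= {y : topspace Y. G y = G x}" if "x : topspace Y" for x
 proof (rule nb)
  have "openin (discrete_topology D) {G x}" using G that by auto
  hence "openin Y {y : topspace Y. G y : {G x}}" using c unfolding continuous_map_def by blast
  thus "openin Y {y : topspace Y. G y = G x}" by simp
  show "x : {y : topspace Y. G y = G x}" using that by simp
 qed
 then obtain ee where ee: "!!x. x : topspace Y ==>
   {y : topspace Y. \<pi> (ee x) y = \<pi> (ee x) x} <= {y : topspace Y. G y = G x}" by metis
 define V where "V x = {y : topspace Y. \<pi> (ee x) y = \<pi> (ee x) x}" for x
 have "\<exists>F. finite F \<and> F <= V ` topspace Y \<and> topspace Y <= \<Union>F" proof (rule compactinD)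
  show "compactin Y (topspace Y)" using cpt by (simp add: compact_space_def)
  show "!!U. U : V ` topspace Y ==> openin Y U" using op by (auto simp: V_def)
  show "topspace Y <= \<Union>(V ` topspace Y)" by (auto simp: V_def)
 qed
 then obtain F where F: "finite F" "F <= V ` topspace Y" "topspace Y <= \<Union>F" by blast
 obtain Xs where "Xs <= topspace Y" "finite Xs" "F = V ` Xs" using finite_subset_image[OF F(1,2)] by blast
 with F(3) have Xs: "finite Xs" "Xs <= topspace Y" "topspace Y <= \<Union>(V ` Xs)" by simp_all
 define e where "e = Max (insert 0 (ee ` Xs))"
 have "G x = G y" if x: "x : topspace Y" and y: "y : topspace Y" and xy: "\<pi> e x = \<pi> e y" for x y proof -
  obtain z where z: "z : Xs" "x : V z" using Xs x by blast
  have "ee z <= e" using Xs z by (auto simp: e_def)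
  hence "\<pi> (ee z) x = \<pi> (ee z) y" using mono x y xy by blast
  hence "y : V z" using z y by (auto simp: V_def)
  moreover have "V z <= {y : topspace Y. G y = G z}" using ee[of z] z(1) Xs(2) by (auto simp: V_def)
  ultimately have "G y = G z" "G x = G z" using z(2) by blast+ thus ?thesis by simp
 qed
 thus "G : topspace Y \<rightarrow> D \<and> (\<exists>e. \<forall>x\<in>topspace Y. \<forall>y\<in>topspace Y. \<pi> e x = \<pi> e y \<longrightarrow> G x = G y)"
  using G by blast
next
 assume r: "G : topspace Y \<rightarrow> D \<and> (\<exists>e. \<forall>x\<in>topspace Y. \<forall>y\<in>topspace Y. \<pi> e x = \<pi> e y \<longrightarrow> G x = G y)"
 then obtain e where e: "!!x y. x : topspace Y ==> y : topspace Y ==> \<pi> e x = \<pi> e y ==> G x = G y"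
  by blast
 have "openin Y {x : topspace Y. G x : U}" for U proof (subst openin_subopen, intro ballI)
  fix x assume x: "x : {x : topspace Y. G x : U}"
  have "G y : U" if "y : topspace Y" "\<pi> e y = \<pi> e x" for y using e[OF that(1) _ that(2)] x by simp
  thus "\<exists>T. openin Y T \<and> x : T \<and> T <= {x : topspace Y. G x : U}"
   using op[of x e] x by (intro exI[of _ "{y : topspace Y. \<pi> e y = \<pi> e x}"]) blast
 qed
 thus "continuous_map Y (discrete_topology D) G" using r unfolding continuous_map_def by auto
qed

lemma Zp_carrier: "x : car (Zp p) \<longleftrightarrow> (\<forall>e. 0 <= x e \<and> x e < int p ^ e \<and> x (Suc e) mod int p ^ e = x e)"
 by (auto simp: Zp_def)

lemma Zp_mod: assumes x: "x : car (Zp p)" and "e <= E" shows "x E mod int p ^ e = x e" using \<open>e <= E\<close>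
proof (induction E rule: dec_induct)
 case base
 show ?case using x by (simp add: Zp_carrier)
next
 case (step E)
 have "x (Suc E) mod int p ^ e = (x (Suc E) mod int p ^ E) mod int p ^ e" using step.hyps by (simp add: mod_mod_cancel le_imp_power_dvd)
 thus ?case using x step.IH by (simp add: Zp_carrier)
qed

lemma Zp_eq_mono: assumes "x : car (Zp p)" "y : car (Zp p)" "e <= E" "x E = y E" shows "x e = y e"
 using Zp_mod[OF assms(1,3)] Zp_mod[OF assms(2,3)] assms(4) by simp

lemma Zp_of_int_carrier: assumes "p > 0" shows "Zp_of_int p k : car (Zp p)"
 using assms by (auto simp: Zp_carrier Zp_of_int_def mod_mod_cancel)

lemma int_trunc: "x : car (Zp p) ==> int (trunc x e) = x e" by (simp add: trunc_def Zp_carrier)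

lemma trunc_less: "x : car (Zp p) ==> trunc x e < p ^ e"
 using int_trunc[of x p e] Zp_carrier[of x p] by (metis of_nat_less_iff of_nat_power)

lemma trunc_mod: assumes "x : car (Zp p)" "e <= E" shows "trunc x E mod p ^ e = trunc x e" proof -
 have "int (trunc x E mod p ^ e) = int (trunc x e)" using Zp_mod[OF assms] int_trunc[OF assms(1)] by (simp add: zmod_int) thus ?thesis by simp
qed

lemma trunc_eq_iff:
 "x : car (Zp p) ==> y : car (Zp p) ==> trunc x e = trunc y e \<longleftrightarrow> x e = y e"
 using int_trunc[of x p e] int_trunc[of y p e] by (simp add: of_nat_eq_iff[where 'a=int, symmetric] del: of_nat_eq_iff)

lemma trunc_Zp_of_int: "trunc (Zp_of_int p (int n)) e = n mod p ^ e" proof -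
 have "int (n mod p ^ e) = int n mod int p ^ e" by (simp add: zmod_int) thus ?thesis unfolding trunc_def Zp_of_int_def by (metis nat_int)
qed

lemma topspace_Zp_topology: "topspace (Zp_topology p) = car (Zp p)" by (auto simp: Zp_topology_def Zp_carrier)

lemma topspace_Zp_space: "topspace (Zp_space p r) = ({1..r} \<rightarrow>\<^sub>E car (Zp p))" by (simp add: Zp_space_def topspace_Zp_topology)

lemma openin_Zp_ball: assumes "x : car (Zp p)" shows "openin (Zp_topology p) {y : car (Zp p). y e = x e}" proof -
 let ?P = "product_topology (%e. discrete_topology {0..<int p ^ e}) UNIV"
 have "continuous_map ?P (discrete_topology {0..<int p ^ e}) (%x. x e)" by (rule continuous_map_product_projection) simp
 moreover have "openin (discrete_topology {0..<int p ^ e}) {x e}" using assms by (simp add: Zp_carrier)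
 ultimately have "openin ?P {y : topspace ?P. y e : {x e}}" unfolding continuous_map_def by blast
 hence "openin (Zp_topology p) (car (Zp p) \<inter> {y : topspace ?P. y e : {x e}})"
  unfolding Zp_topology_def by (rule openin_subtopology_Int2)
 moreover have "car (Zp p) \<inter> {y : topspace ?P. y e : {x e}} = {y : car (Zp p). y e = x e}" by (auto simp: Zp_carrier)
 ultimately show ?thesis by simp
qed

text \<open>A basic open set of the product constrains finitely many coordinates only, and the
  component at the largest of them determines all of these.\<close>

lemma Zp_ball_subset: assumes "openin (Zp_topology p) U" and x: "x : U" shows "\<exists>e. {y : car (Zp p). y e = x e} <= U"
proof -
 let ?P = "product_topology (%e. discrete_topology {0..<int p ^ e}) UNIV"
 obtain T where T: "openin ?P T" "U = T \<inter> car (Zp p)" using assms(1) unfolding Zp_topology_def openin_subtopology by blast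
 hence "\<exists>V. finite {i : UNIV. V i ~= topspace (discrete_topology {0..<int p ^ i})} \<and>
   (\<forall>i \<in> UNIV. openin (discrete_topology {0..<int p ^ i}) (V i)) \<and> x : Pi\<^sub>E UNIV V \<and> Pi\<^sub>E UNIV V <= T"
  using x unfolding openin_product_topology_alt by blast
 then obtain V where V: "finite {i. V i ~= {0..<int p ^ i}}" "x : Pi\<^sub>E UNIV V" "Pi\<^sub>E UNIV V <= T" by auto
 define e where "e = Max (insert 0 {i. V i ~= {0..<int p ^ i}})"
 have "y : U" if y: "y : car (Zp p)" "y e = x e" for y proof -
  have xc: "x : car (Zp p)" using T x by blast
  have "y i : V i" for i proof (cases "V i = {0..<int p ^ i}")
   case True thus ?thesis using y by (simp add: Zp_carrier)
  next
   case False
   hence "i <= e" using V(1) by (auto simp: e_def)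
   hence "y i = x i" using Zp_eq_mono[OF y(1) xc _ y(2)] by blast thus ?thesis using V(2) by auto
  qed
  thus ?thesis using V(3) T y by auto
 qed
 thus ?thesis by blast
qed

text \<open>Z_p is closed in a product of finite discrete spaces: each compatibility condition ties
  together two coordinates and is a finite union of closed boxes.\<close>

lemma compact_space_Zp: assumes "p > 0" shows "compact_space (Zp_topology p)" proof -
 let ?P = "product_topology (%e. discrete_topology {0..<int p ^ e}) UNIV"
 have proj: "continuous_map ?P (discrete_topology {0..<int p ^ e}) (%x. x e)" for e by (rule continuous_map_product_projection) simp
 have cl: "closedin ?P {x : topspace ?P. x e : A}" if "A <= {0..<int p ^ e}" for e A
  by (rule closedin_continuous_map_preimage[OF proj]) (use that in auto)
 have eq: "{x : topspace ?P. x (Suc e) mod int p ^ e = x e} = (\<Union>v\<in>{0..<int p ^ e}. {x : topspace ?P. x e : {v}} \<inter>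
    {x : topspace ?P. x (Suc e) : {w : {0..<int p ^ Suc e}. w mod int p ^ e = v}})" for e
  by (auto simp: PiE_iff) (metis power_Suc mult.commute)
 have cl2: "closedin ?P {x : topspace ?P. x (Suc e) mod int p ^ e = x e}" for e unfolding eq
  by (intro closedin_Union finite_imageI; (clarify, intro closedin_Int cl)?) auto
 have "car (Zp p) = (\<Inter>e. {x : topspace ?P. x (Suc e) mod int p ^ e = x e})" by (auto simp: Zp_carrier PiE_iff)
 hence "closedin ?P (car (Zp p))" using cl2 by (simp only:) (intro closedin_Inter; auto)
 moreover have "compact_space ?P" by (simp add: compact_space_product_topology compact_space_discrete_topology)
 ultimately have "compactin ?P (car (Zp p))" using closedin_compact_space by blast thus ?thesis
  unfolding Zp_topology_def by (rule compact_space_subtopology)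
qed

lemma Cfun_Zp_iff: assumes "p > 0" shows "G : car (Cfun (Zp_topology p) T) \<longleftrightarrow>
  G : car (Zp p) \<rightarrow>\<^sub>E car T \<and>
  (\<exists>e. \<forall>x\<in>car (Zp p). \<forall>y\<in>car (Zp p). x e = y e \<longrightarrow> G x = G y)" proof -
 have "continuous_map (Zp_topology p) (discrete_topology (car T)) G \<longleftrightarrow>
  G : topspace (Zp_topology p) \<rightarrow> car T \<and>
  (\<exists>e. \<forall>x\<in>topspace (Zp_topology p). \<forall>y\<in>topspace (Zp_topology p). x e = y e \<longrightarrow> G x = G y)"
 proof (rule continuous_map_discrete_uniform[where \<pi> = "%e x. x e"])
  show "compact_space (Zp_topology p)" using assms by (rule compact_space_Zp)
 next
  fix e E :: nat and x y :: "nat => int"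
  assume "e <= E" "x : topspace (Zp_topology p)" "y : topspace (Zp_topology p)" "x E = y E"
  thus "x e = y e" using Zp_eq_mono[of x p y e E] by (simp add: topspace_Zp_topology)
 qed (simp_all add: topspace_Zp_topology openin_Zp_ball Zp_ball_subset)
 thus ?thesis by (auto simp: Cfun_def topspace_Zp_topology PiE_def)
qed

section \<open>Locally constant functions on Z_p^r\<close>

definition cong_pts :: "nat => nat => (nat => nat => int) => (nat => nat => int) => bool" where
 "cong_pts r e x y \<longleftrightarrow> (\<forall>i\<in>{1..r}. x i e = y i e)"

lemma cong_pts_refl [simp]: "cong_pts r e x x" by (simp add: cong_pts_def)

abbreviation Ypts :: "nat => nat => (nat => nat => int) set" where
 "Ypts p r \<equiv> topspace (Zp_space p r)"

lemma Ypts_D: "x : Ypts p r ==> i : {1..r} ==> x i : car (Zp p)" by (auto simp: topspace_Zp_space)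

lemma cong_pts_mono: assumes "x : Ypts p r" "y : Ypts p r" "e <= E" "cong_pts r E x y" shows "cong_pts r e x y"
 using assms Zp_eq_mono[OF Ypts_D Ypts_D] unfolding cong_pts_def by metis

definition loc_const :: "nat => nat => nat => ((nat => nat => int) => 't) => bool" where
 "loc_const p r e G \<longleftrightarrow> (\<forall>x\<in>Ypts p r. \<forall>y\<in>Ypts p r. cong_pts r e x y \<longrightarrow> G x = G y)"

lemma loc_constD: "loc_const p r e G ==> x : Ypts p r ==> y : Ypts p r ==> cong_pts r e x y ==> G x = G y"
 unfolding loc_const_def by blast

lemma loc_const_mono: "loc_const p r e G ==> e <= E ==> loc_const p r E G"
 unfolding loc_const_def by (intro ballI impI, drule (1) bspec, drule (1) bspec, drule mp) (rule cong_pts_mono)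

text \<open>The levels are the tuples of components at a common e. There are finitely many
  coordinates, so the maximum of the levels needed in each of them serves all.\<close>

lemma Cfun_iff: assumes "p > 0" shows "G : car (Cfun (Zp_space p r) T) \<longleftrightarrow>
  G : Ypts p r \<rightarrow>\<^sub>E car T \<and> (\<exists>e. loc_const p r e G)" proof -
 define Y where "Y = Zp_space p r"
 have top: "topspace Y = ({1..r} \<rightarrow>\<^sub>E car (Zp p))" by (simp add: Y_def topspace_Zp_space)
 define tr :: "nat => (nat => nat => int) => nat => int"
  where "tr e x = restrict (%i. x i e) {1..r}" for e x
 have tr: "tr e x = tr e y \<longleftrightarrow> cong_pts r e x y" for e x y
  unfolding tr_def cong_pts_def by (auto simp: fun_eq_iff restrict_def split: if_splits)
 have "continuous_map Y (discrete_topology (car T)) G \<longleftrightarrow> G : topspace Y \<rightarrow> car T \<and>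
  (\<exists>e. \<forall>x\<in>topspace Y. \<forall>y\<in>topspace Y. tr e x = tr e y \<longrightarrow> G x = G y)"
 proof (rule continuous_map_discrete_uniform)
  show "compact_space Y" by (simp add: Y_def Zp_space_def compact_space_product_topology compact_space_Zp assms)
 next
  fix e x assume x: "x : topspace Y"
  have "{y : topspace Y. tr e y = tr e x} = (\<Pi>\<^sub>E i\<in>{1..r}. {z : car (Zp p). z e = x i e})"
   unfolding tr top cong_pts_def by (auto simp: PiE_iff extensional_def)
  also have "openin Y ..." unfolding Y_def Zp_space_def by (subst openin_PiE) (use x openin_Zp_ball in \<open>auto simp: top PiE_iff\<close>)
  finally show "openin Y {y : topspace Y. tr e y = tr e x}" .
 next
  fix U x assume U: "openin Y U" and x: "x : U"
  hence "\<exists>V. finite {i : {1..r}. V i ~= topspace (Zp_topology p)} \<and>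
    (\<forall>i \<in> {1..r}. openin (Zp_topology p) (V i)) \<and> x : Pi\<^sub>E {1..r} V \<and> Pi\<^sub>E {1..r} V <= U"
   unfolding Y_def Zp_space_def openin_product_topology_alt by blast
  then obtain V where V: "!!i. i : {1..r} ==> openin (Zp_topology p) (V i)"
   "x : Pi\<^sub>E {1..r} V" "Pi\<^sub>E {1..r} V <= U" by blast
  have "\<exists>e. \<forall>i\<in>{1..r}. {y : car (Zp p). y (e i) = x i (e i)} <= V i"
   using Zp_ball_subset[OF V(1)] V(2) by (intro bchoice) (auto simp: PiE_iff)
  then obtain ee where ee: "!!i. i : {1..r} ==> {y : car (Zp p). y (ee i) = x i (ee i)} <= V i" by blast
  define e where "e = Max (insert 0 (ee ` {1..r}))"
  have xt: "x : topspace Y" using U x openin_subset by blast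
  have "y : U" if y: "y : topspace Y" "tr e y = tr e x" for y proof -
   have "y i : V i" if i: "i : {1..r}" for i proof -
    have "ee i <= e" using i by (auto simp: e_def)
    moreover have "y i : car (Zp p)" "x i : car (Zp p)" "y i e = x i e" using y i xt unfolding tr by (auto simp: top cong_pts_def)
    ultimately have "y i (ee i) = x i (ee i)" using Zp_eq_mono[of "y i" p "x i" "ee i" e] by blast
    thus ?thesis using ee[OF i] \<open>y i : car (Zp p)\<close> by blast
   qed
   hence "y : Pi\<^sub>E {1..r} V" using y by (auto simp: top PiE_iff) thus ?thesis using V by blast
  qed
  thus "\<exists>e. {y : topspace Y. tr e y = tr e x} <= U" by blast
 next
  show "!!e E x y. e <= E ==> x : topspace Y ==> y : topspace Y ==> tr E x = tr E y ==> tr e x = tr e y"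
   unfolding tr Y_def by (rule cong_pts_mono)
 qed
 thus ?thesis unfolding tr by (auto simp: Cfun_def Y_def loc_const_def PiE_def)
qed

text \<open>At a level e the function factors through the tuples of residues modulo p^e, of which
  there are finitely many.\<close>

lemma Cfun_finite_range: assumes p: "p > 0" and G: "G : car (Cfun (Zp_space p r) T)" shows "finite (G ` Ypts p r)" proof -
 obtain e where e: "loc_const p r e G" and GT: "G : Ypts p r \<rightarrow>\<^sub>E car T"  using G unfolding Cfun_iff[OF p] by auto
 let ?t = "%x. \<lambda>i\<in>{1..r}. x i e"
 have "?t ` Ypts p r <= ({1..r} \<rightarrow>\<^sub>E {0..<int p ^ e})" by (auto simp: topspace_Zp_space PiE_iff Zp_carrier)
 hence "finite (?t ` Ypts p r)" by (rule finite_subset) (intro finite_PiE; simp)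
 note fint = this
 have "\<exists>h. \<forall>x\<in>Ypts p r. G x = h (?t x)" proof -
  have "G x = G (SOME y. y : Ypts p r \<and> ?t y = ?t x)" if x: "x : Ypts p r" for x proof -
   define z where "z = (SOME y. y : Ypts p r \<and> ?t y = ?t x)"
   have "\<exists>y. y : Ypts p r \<and> ?t y = ?t x" using x by blast
   from someI_ex[OF this] have z: "z : Ypts p r" "?t z = ?t x" unfolding z_def by blast+
   have "cong_pts r e x z" unfolding cong_pts_def proof
    fix i assume "i : {1..r}"
    thus "x i e = z i e" using fun_cong[OF z(2), of i] by simp
   qed
   thus ?thesis using loc_constD[OF e x z(1)] unfolding z_def by blast
  qed
  thus ?thesis by (intro exI[of _ "%t. G (SOME y. y : Ypts p r \<and> ?t y = t)"]) blast
 qed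
 then obtain h where "!!x. x : Ypts p r ==> G x = h (?t x)" by blast
 hence "G ` Ypts p r <= h ` (?t ` Ypts p r)" by auto thus ?thesis using fint by (rule finite_subset[OF _ finite_imageI])
qed

text \<open>The finite range bounds any numerical invariant of the values, such as
  \<open>level\<close> for operators; hence one e serves both as period and as bound.\<close>

lemma Cfun_bounded_level: fixes lev :: "'t => nat" assumes p: "p > 0" and G: "G : car (Cfun (Zp_space p r) T)"
 shows "\<exists>e. loc_const p r e G \<and> (\<forall>x\<in>Ypts p r. lev (G x) <= e)" proof -
 obtain e where e: "loc_const p r e G" using G unfolding Cfun_iff[OF p] by auto
 have "finite (G ` Ypts p r)" by (rule Cfun_finite_range[OF p G])
 hence fin: "finite (lev ` (G ` Ypts p r))" by blast
 define E where "E = max e (Max (insert 0 (lev ` (G ` Ypts p r))))"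
 have "lev (G x) <= E" if "x : Ypts p r" for x proof -
  have "lev (G x) : lev ` (G ` Ypts p r)" using that by blast
  hence "lev (G x) <= Max (insert 0 (lev ` (G ` Ypts p r)))" using fin by simp thus ?thesis by (simp add: E_def)
 qed
 moreover have "loc_const p r E G" using e by (rule loc_const_mono) (simp add: E_def)
 ultimately show ?thesis by blast
qed

section \<open>Left modules\<close>

context left_module begin

lemma smult_zero_left [simp]: "x : car M ==> \<zero>\<^bsub>T\<^esub> \<odot>\<^bsub>M\<^esub> x = \<zero>\<^bsub>M\<^esub>"
 using smult_l_distr[of "\<zero>\<^bsub>T\<^esub>" "\<zero>\<^bsub>T\<^esub>" x] smult_closed[of "\<zero>\<^bsub>T\<^esub>" x]
 by (simp add: M.add.l_cancel_one')

lemma smult_zero_right [simp]: "a : car T ==> a \<odot>\<^bsub>M\<^esub> \<zero>\<^bsub>M\<^esub> = \<zero>\<^bsub>M\<^esub>"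
 using smult_r_distr[of a "\<zero>\<^bsub>M\<^esub>" "\<zero>\<^bsub>M\<^esub>"] smult_closed[of a "\<zero>\<^bsub>M\<^esub>"]
 by (simp add: M.add.l_cancel_one')

lemma smult_minus_one: 
 assumes x: "x : car M" shows "(\<ominus>\<^bsub>T\<^esub> \<one>\<^bsub>T\<^esub>) \<odot>\<^bsub>M\<^esub> x = \<ominus>\<^bsub>M\<^esub> x"
proof -
 have "(\<ominus>\<^bsub>T\<^esub> \<one>\<^bsub>T\<^esub>) \<odot>\<^bsub>M\<^esub> x \<oplus>\<^bsub>M\<^esub> x = (\<ominus>\<^bsub>T\<^esub> \<one>\<^bsub>T\<^esub> \<oplus>\<^bsub>T\<^esub> \<one>\<^bsub>T\<^esub>) \<odot>\<^bsub>M\<^esub> x"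
  using x by (subst smult_l_distr) (simp_all add: smult_one)
 also have "... = \<zero>\<^bsub>M\<^esub>" using x by (simp add: T.l_neg)
 finally show ?thesis using x by (metis M.minus_equality smult_closed T.a_inv_closed T.one_closed)
qed

text \<open>Closure under negation comes from the scalar -1.\<close>

lemma submoduleI_left: assumes "H <= car M" "\<zero>\<^bsub>M\<^esub> : H"
  and "!!x y. x : H ==> y : H ==> x \<oplus>\<^bsub>M\<^esub> y : H"
  and sm: "!!a x. a : car T ==> x : H ==> a \<odot>\<^bsub>M\<^esub> x : H"
 shows "submodule H T M" proof (intro submodule.intro subgroup.intro submodule_axioms.intro)
 fix x assume x: "x : H"
 hence "(\<ominus>\<^bsub>T\<^esub> \<one>\<^bsub>T\<^esub>) \<odot>\<^bsub>M\<^esub> x : H" by (intro sm) simp_all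
 moreover have "x : car M" using x assms(1) by blast
 ultimately show "inv\<^bsub>add_monoid M\<^esub> x : H" by (simp add: smult_minus_one flip: a_inv_def)
qed (use assms in auto)

end

text \<open>Injectivity of h lets each axiom be checked after applying h, where N supplies it.
  Inverses in M have no formula of their own, so the scalar -1 of T produces them.\<close>

lemma left_module_transfer: assumes N: "left_module T N" and h: "h : car M \<rightarrow> car N" and inj: "inj_on h (car M)"
  and z: "\<zero>\<^bsub>M\<^esub> : car M" "h \<zero>\<^bsub>M\<^esub> = \<zero>\<^bsub>N\<^esub>"
  and add: "!!x y. x : car M ==> y : car M ==> x \<oplus>\<^bsub>M\<^esub> y : car M"
   "!!x y. x : car M ==> y : car M ==> h (x \<oplus>\<^bsub>M\<^esub> y) = h x \<oplus>\<^bsub>N\<^esub> h y"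
  and sm: "!!a x. a : car T ==> x : car M ==> a \<odot>\<^bsub>M\<^esub> x : car M"
   "!!a x. a : car T ==> x : car M ==> h (a \<odot>\<^bsub>M\<^esub> x) = a \<odot>\<^bsub>N\<^esub> h x"
 shows "left_module T M" proof -
 interpret N: left_module T N by (rule N)
 have hc: "!!x. x : car M ==> h x : car N" using h by blast
 note injD = inj_onD[OF inj]
 have "abelian_group M" proof (rule abelian_groupI)
  fix x y w assume c: "x : car M" "y : car M" "w : car M"
  show "(x \<oplus>\<^bsub>M\<^esub> y) \<oplus>\<^bsub>M\<^esub> w = x \<oplus>\<^bsub>M\<^esub> (y \<oplus>\<^bsub>M\<^esub> w)"
   by (rule injD) (use c in \<open>auto simp: add hc N.a_assoc\<close>)
 next
  fix x y assume c: "x : car M" "y : car M"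
  show "x \<oplus>\<^bsub>M\<^esub> y = y \<oplus>\<^bsub>M\<^esub> x" by (rule injD) (use c in \<open>auto simp: add hc N.a_comm\<close>)
 next
  fix x assume c: "x : car M"
  show "\<zero>\<^bsub>M\<^esub> \<oplus>\<^bsub>M\<^esub> x = x" by (rule injD) (use c in \<open>auto simp: add z hc\<close>)
  let ?y = "(\<ominus>\<^bsub>T\<^esub> \<one>\<^bsub>T\<^esub>) \<odot>\<^bsub>M\<^esub> x"
  have y: "?y : car M" using c by (intro sm) simp_all
  moreover have "?y \<oplus>\<^bsub>M\<^esub> x = \<zero>\<^bsub>M\<^esub>"
   by (rule injD) (use c y in \<open>simp_all add: add z hc sm N.smult_minus_one N.l_neg\<close>)
  ultimately show "\<exists>y\<in>car M. y \<oplus>\<^bsub>M\<^esub> x = \<zero>\<^bsub>M\<^esub>" by blast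
 qed (use add z in auto)
 thus ?thesis proof (intro left_module.intro left_module_axioms.intro N.ring_axioms)
  fix a b x assume c: "a : car T" "b : car T" "x : car M"
  show "(a \<oplus>\<^bsub>T\<^esub> b) \<odot>\<^bsub>M\<^esub> x = a \<odot>\<^bsub>M\<^esub> x \<oplus>\<^bsub>M\<^esub> b \<odot>\<^bsub>M\<^esub> x"
   by (rule injD) (use c in \<open>simp_all add: add sm hc N.smult_l_distr\<close>)
  show "(a \<otimes>\<^bsub>T\<^esub> b) \<odot>\<^bsub>M\<^esub> x = a \<odot>\<^bsub>M\<^esub> (b \<odot>\<^bsub>M\<^esub> x)"
   by (rule injD) (use c in \<open>simp_all add: add sm hc N.smult_assoc\<close>)
 next
  fix a x y assume c: "a : car T" "x : car M" "y : car M"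
  show "a \<odot>\<^bsub>M\<^esub> (x \<oplus>\<^bsub>M\<^esub> y) = a \<odot>\<^bsub>M\<^esub> x \<oplus>\<^bsub>M\<^esub> a \<odot>\<^bsub>M\<^esub> y"
   by (rule injD) (use c in \<open>simp_all add: add sm hc N.smult_r_distr\<close>)
 next
  fix x assume c: "x : car M"
  show "\<one>\<^bsub>T\<^esub> \<odot>\<^bsub>M\<^esub> x = x" by (rule injD) (use c in \<open>simp_all add: sm hc N.smult_one\<close>)
 qed (use sm in auto)
qed

lemma left_module_submodule: assumes "left_module T N" "submodule H T N" shows "left_module T (N\<lparr>carrier := H\<rparr>)"
proof (rule left_module_transfer[OF assms(1), where h = "%x. x"])
 interpret submodule H T N by (rule assms(2))
 show "\<zero>\<^bsub>N\<lparr>carrier := H\<rparr>\<^esub> : car (N\<lparr>carrier := H\<rparr>)" using one_closed by simp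
 show "!!x y. x : car (N\<lparr>carrier := H\<rparr>) ==> y : car (N\<lparr>carrier := H\<rparr>) ==>
  x \<oplus>\<^bsub>N\<lparr>carrier := H\<rparr>\<^esub> y : car (N\<lparr>carrier := H\<rparr>)" using m_closed by simp
 show "!!a x. a : car T ==> x : car (N\<lparr>carrier := H\<rparr>) ==>
  a \<odot>\<^bsub>N\<lparr>carrier := H\<rparr>\<^esub> x : car (N\<lparr>carrier := H\<rparr>)" using smult_closed by simp
 show "(%x. x) : car (N\<lparr>carrier := H\<rparr>) \<rightarrow> car N" using subset by auto
qed auto

lemma left_module_restrict_scalars: assumes M: "left_module T M" and h: "h : ring_hom S T" and S: "ring S"
 shows "left_module S (restrict_scalars h M)" proof -
 interpret M: left_module T M by (rule M)
 have ag: "abelian_group (restrict_scalars h M)" by (rule abelian_groupI) (auto simp: restrict_scalars_def M.a_ac intro: M.M.a_inv_closed M.M.l_neg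
    intro!: bexI[of _ "\<ominus>\<^bsub>M\<^esub> _"])
 show ?thesis proof (intro left_module.intro left_module_axioms.intro S ag)
 qed (use h in \<open>auto simp: restrict_scalars_def ring_hom_add ring_hom_mult ring_hom_one ring_hom_closed
    intro: M.smult_closed M.smult_l_distr M.smult_r_distr M.smult_assoc M.smult_one\<close>)
qed

lemma left_module_iso_inverse: assumes h: "left_module_iso T M N h"
  and g: "!!y. y : car N ==> g y : car M" "!!y. y : car N ==> h (g y) = y"
 shows "left_module_iso T N M g" proof -
 have M: "left_module T M" and N: "left_module T N" and hc: "h : car M \<rightarrow> car N"
  and ha: "!!x y. x : car M ==> y : car M ==> h (x \<oplus>\<^bsub>M\<^esub> y) = h x \<oplus>\<^bsub>N\<^esub> h y"
  and hs: "!!a x. a : car T ==> x : car M ==> h (a \<odot>\<^bsub>M\<^esub> x) = a \<odot>\<^bsub>N\<^esub> h x"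
  and inj: "inj_on h (car M)" using h by (auto simp: left_module_iso_def left_module_hom_def bij_betw_def)
 interpret M: left_module T M by (rule M)
 interpret N: left_module T N by (rule N)
 note injD = inj_onD[OF inj]
 have gh: "g (h x) = x" if "x : car M" for x by (rule injD) (use that g hc in auto)
 show ?thesis unfolding left_module_iso_def left_module_hom_def proof (intro conjI M N ballI)
  show "g : car N \<rightarrow> car M" using g by blast
  show "bij_betw g (car N) (car M)" by (rule bij_betwI[where g = h]) (use g hc gh in auto)
 next
  fix x y assume "x : car N" "y : car N"
  thus "g (x \<oplus>\<^bsub>N\<^esub> y) = g x \<oplus>\<^bsub>M\<^esub> g y" by (intro injD) (simp_all add: g ha)
 next
  fix a x assume "a : car T" "x : car N"
  thus "g (a \<odot>\<^bsub>N\<^esub> x) = a \<odot>\<^bsub>M\<^esub> g x" by (intro injD) (simp_all add: g hs N.smult_closed M.smult_closed)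
 qed
qed

subsection \<open>Quotients by kernels\<close>

text \<open>M is an additive group with a scalar operation for which no module axioms are assumed.
  The quotient receives them from N, into which L embeds it.\<close>

locale kernel_quotient = M?: abelian_group M + N?: abelian_group N
 for M :: "('t, 'x, 'n) module_scheme" (structure) and N :: "('t, 'y, 'k) module_scheme" + fixes L :: "'x => 'y" and K :: "'x set"
 assumes L_closed: "x : car M ==> L x : car N"
  and L_add: "x : car M ==> y : car M ==> L (x \<oplus>\<^bsub>M\<^esub> y) = L x \<oplus>\<^bsub>N\<^esub> L y"
  and K_eq: "K = {x : car M. L x = \<zero>\<^bsub>N\<^esub>}"
begin

lemma L_zero: "L \<zero>\<^bsub>M\<^esub> = \<zero>\<^bsub>N\<^esub>"
 using L_add[of "\<zero>\<^bsub>M\<^esub>" "\<zero>\<^bsub>M\<^esub>"] L_closed[of "\<zero>\<^bsub>M\<^esub>"] by (simp add: N.add.l_cancel_one')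

lemma L_minus: "x : car M ==> L (\<ominus>\<^bsub>M\<^esub> x) = \<ominus>\<^bsub>N\<^esub> L x"
 using L_add[of "\<ominus>\<^bsub>M\<^esub> x" x] L_closed[of x] L_closed[of "\<ominus>\<^bsub>M\<^esub> x"] 
 by (simp add: M.l_neg L_zero N.minus_equality)

lemma coset_eq:  assumes x: "x : car M" shows "K +>\<^bsub>M\<^esub> x = {y : car M. L y = L x}" proof (intro equalityI subsetI)
 fix y assume "y : K +>\<^bsub>M\<^esub> x"
 thus "y : {y : car M. L y = L x}" using x by (auto simp: a_r_coset_def' K_eq L_add L_closed)
next
 fix y assume y: "y : {y : car M. L y = L x}"
 have "y \<oplus>\<^bsub>M\<^esub> \<ominus>\<^bsub>M\<^esub> x : K" "y = (y \<oplus>\<^bsub>M\<^esub> \<ominus>\<^bsub>M\<^esub> x) \<oplus>\<^bsub>M\<^esub> x"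
  using x y by (simp_all add: K_eq L_add L_minus L_closed N.r_neg M.a_assoc M.l_neg)
 thus "y : K +>\<^bsub>M\<^esub> x" unfolding a_r_coset_def' by blast
qed

lemma coset_eq_iff:
 assumes "x : car M" "y : car M" shows "K +>\<^bsub>M\<^esub> x = K +>\<^bsub>M\<^esub> y \<longleftrightarrow> L x = L y"
 using assms by (auto simp: coset_eq)

lemma coset_add: assumes x: "x : car M" and y: "y : car M"
 shows "(K +>\<^bsub>M\<^esub> x) <+>\<^bsub>M\<^esub> (K +>\<^bsub>M\<^esub> y) = K +>\<^bsub>M\<^esub> (x \<oplus>\<^bsub>M\<^esub> y)" proof -
 have "z : (K +>\<^bsub>M\<^esub> x) <+>\<^bsub>M\<^esub> (K +>\<^bsub>M\<^esub> y)" if z: "z : K +>\<^bsub>M\<^esub> (x \<oplus>\<^bsub>M\<^esub> y)" for z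
 proof -
  have zc: "z : car M" "L z = L x \<oplus>\<^bsub>N\<^esub> L y" using z x y by (auto simp: coset_eq L_add)
  let ?w = "\<ominus>\<^bsub>M\<^esub> x \<oplus>\<^bsub>M\<^esub> z"
  have "L ?w = \<ominus>\<^bsub>N\<^esub> L x \<oplus>\<^bsub>N\<^esub> (L x \<oplus>\<^bsub>N\<^esub> L y)" using zc x by (simp add: L_add L_minus)
  also have "... = L y" using x y by (simp add: L_closed N.r_neg1)
  finally have "?w : K +>\<^bsub>M\<^esub> y" using x y zc by (simp add: coset_eq)
  moreover have "x : K +>\<^bsub>M\<^esub> x" using x by (simp add: coset_eq)
  moreover have "z = x \<oplus>\<^bsub>M\<^esub> ?w" using x zc by (simp add: M.r_neg2)
  ultimately show ?thesis unfolding set_add_def' by blast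
 qed
 moreover have "(K +>\<^bsub>M\<^esub> x) <+>\<^bsub>M\<^esub> (K +>\<^bsub>M\<^esub> y) <= K +>\<^bsub>M\<^esub> (x \<oplus>\<^bsub>M\<^esub> y)"
  using x y unfolding set_add_def' by (auto simp: coset_eq L_add)
 ultimately show ?thesis by blast
qed

lemma carrier_quot: "C : car (quot_module M K) \<longleftrightarrow> (\<exists>x\<in>car M. C = K +>\<^bsub>M\<^esub> x)"
 by (auto simp: quot_module_def A_RCOSETS_def')

text \<open>The coset of x is exactly the fibre of L through x, so the image of a coset is a
  singleton and \<open>the_elem\<close> extracts its element.\<close>

definition quot_map :: "'x set => 'y" where "quot_map C = the_elem (L ` C)"

lemma quot_map_coset: assumes "x : car M" shows "quot_map (K +>\<^bsub>M\<^esub> x) = L x" proof -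
 have "L ` (K +>\<^bsub>M\<^esub> x) = {L x}" using assms by (auto simp: coset_eq) thus ?thesis by (simp add: quot_map_def)
qed

lemma inj_quot_map: "inj_on quot_map (car (quot_module M K))" by (rule inj_onI) (clarsimp simp: carrier_quot quot_map_coset coset_eq_iff)

lemma image_quot_map: "quot_map ` car (quot_module M K) = L ` car M" proof
 show "quot_map ` car (quot_module M K) <= L ` car M" by (auto simp: carrier_quot quot_map_coset)
 show "L ` car M <= quot_map ` car (quot_module M K)" proof clarify
  fix x assume "x : car M"
  thus "L x : quot_map ` car (quot_module M K)"
   by (intro image_eqI[where x = "K +>\<^bsub>M\<^esub> x"]) (auto simp: quot_map_coset carrier_quot)
 qed
qed

lemma zero_coset: "K = K +>\<^bsub>M\<^esub> \<zero>\<^bsub>M\<^esub>" unfolding coset_eq[OF M.zero_closed] L_zero by (rule K_eq)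

text \<open>Scalar multiplication in \<open>quot_module\<close> is a union over representatives; it
  collapses to a single coset as soon as the value of L at the scalar multiple depends on L y
  only.\<close>

lemma smult_coset: assumes x: "x : car M"
  and c: "!!y. y : car M ==> L y = L x ==> a \<odot>\<^bsub>M\<^esub> y : car M \<and> L (a \<odot>\<^bsub>M\<^esub> y) = v"
 shows "a \<odot>\<^bsub>quot_module M K\<^esub> (K +>\<^bsub>M\<^esub> x) = K +>\<^bsub>M\<^esub> (a \<odot>\<^bsub>M\<^esub> x)" proof -
 have "K +>\<^bsub>M\<^esub> (a \<odot>\<^bsub>M\<^esub> y) = K +>\<^bsub>M\<^esub> (a \<odot>\<^bsub>M\<^esub> x)" if "y : K +>\<^bsub>M\<^esub> x" for y
  using that c[of y] c[of x] x by (auto simp: coset_eq)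
 hence "(\<Union>y\<in>K +>\<^bsub>M\<^esub> x. K +>\<^bsub>M\<^esub> (a \<odot>\<^bsub>M\<^esub> y)) = (\<Union>y\<in>K +>\<^bsub>M\<^esub> x. K +>\<^bsub>M\<^esub> (a \<odot>\<^bsub>M\<^esub> x))"
  by (rule SUP_cong[OF refl])
 moreover have "K +>\<^bsub>M\<^esub> x ~= {}" using x by (auto simp: coset_eq)
 ultimately show ?thesis by (simp add: quot_module_def)
qed

lemma quot_map_hom: assumes N: "left_module T N"
  and sm: "!!a x. a : car T ==> x : car M ==> a \<odot>\<^bsub>M\<^esub> x : car M"
   "!!a x. a : car T ==> x : car M ==> L (a \<odot>\<^bsub>M\<^esub> x) = a \<odot>\<^bsub>N\<^esub> L x"
 shows "left_module_hom T (quot_module M K) N quot_map" proof -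
 let ?Q = "quot_module M K"
 have s: "a \<odot>\<^bsub>?Q\<^esub> (K +>\<^bsub>M\<^esub> x) = K +>\<^bsub>M\<^esub> (a \<odot>\<^bsub>M\<^esub> x)" if "a : car T" "x : car M" for a x
  by (rule smult_coset[where v = "a \<odot>\<^bsub>N\<^esub> L x"]) (use that sm in auto)
 have add: "C \<oplus>\<^bsub>?Q\<^esub> D = C <+>\<^bsub>M\<^esub> D" for C D by (simp add: quot_module_def)
 have z: "\<zero>\<^bsub>?Q\<^esub> = K +>\<^bsub>M\<^esub> \<zero>\<^bsub>M\<^esub>" using zero_coset by (simp add: quot_module_def)
 have c: "quot_map : car ?Q \<rightarrow> car N" by (auto simp: carrier_quot quot_map_coset L_closed)
 have a: "quot_map (x \<oplus>\<^bsub>?Q\<^esub> y) = quot_map x \<oplus>\<^bsub>N\<^esub> quot_map y" "x \<oplus>\<^bsub>?Q\<^esub> y : car ?Q"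
  if "x : car ?Q" "y : car ?Q" for x y using that by (auto simp: carrier_quot quot_map_coset add coset_add L_add)
 have sq: "quot_map (b \<odot>\<^bsub>?Q\<^esub> x) = b \<odot>\<^bsub>N\<^esub> quot_map x" "b \<odot>\<^bsub>?Q\<^esub> x : car ?Q"
  if "b : car T" "x : car ?Q" for b x using that by (auto simp: carrier_quot quot_map_coset s sm)
 have "left_module T ?Q" by (rule left_module_transfer[OF N c inj_quot_map]) (auto simp: a sq, auto simp: z carrier_quot quot_map_coset L_zero)
 thus ?thesis unfolding left_module_hom_def using N c a sq by blast
qed

end

text \<open>The ordinary quotient by a submodule. It is meant for the target S^0 / S^1, for which no
  embedding into a known module is at hand.\<close>

lemma quot_module_left_module: assumes N: "left_module T N" and K: "submodule K T N"
 shows "left_module_hom T N (quot_module N K) (%x. K +>\<^bsub>N\<^esub> x)"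
  and "!!x. x : car N ==> K +>\<^bsub>N\<^esub> x = \<zero>\<^bsub>quot_module N K\<^esub> \<longleftrightarrow> x : K"
proof -
 interpret N: left_module T N by (rule N)
 interpret K: submodule K T N by (rule K)
 interpret S: abelian_subgroup K N by (rule abelian_subgroupI3) (simp_all add: additive_subgroup.intro K.is_subgroup N.abelian_group_axioms)
 let ?Q = "quot_module N K"
 have cq: "C : car ?Q \<longleftrightarrow> (\<exists>x\<in>car N. C = K +>\<^bsub>N\<^esub> x)" for C
  by (auto simp: quot_module_def A_RCOSETS_def')
 have add: "(K +>\<^bsub>N\<^esub> x) \<oplus>\<^bsub>?Q\<^esub> (K +>\<^bsub>N\<^esub> y) = K +>\<^bsub>N\<^esub> (x \<oplus>\<^bsub>N\<^esub> y)" 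
  if "x : car N" "y : car N" for x y using that S.a_rcos_sum by (simp add: quot_module_def)
 have Kc: "!!k. k : K ==> k : car N" by (rule S.a_Hcarr)
 have eqI: "K +>\<^bsub>N\<^esub> (k \<oplus>\<^bsub>N\<^esub> x) = K +>\<^bsub>N\<^esub> x" if "k : K" "x : car N" for k x
  using N.a_coset_add_assoc[of K k x] N.a_coset_join2[of k K] that Kc S.a_subgroup S.a_subset by simp
 have sm: "a \<odot>\<^bsub>?Q\<^esub> (K +>\<^bsub>N\<^esub> x) = K +>\<^bsub>N\<^esub> (a \<odot>\<^bsub>N\<^esub> x)" if "a : car T" "x : car N" for a x
 proof -
  have "K +>\<^bsub>N\<^esub> (a \<odot>\<^bsub>N\<^esub> y) = K +>\<^bsub>N\<^esub> (a \<odot>\<^bsub>N\<^esub> x)" if "y : K +>\<^bsub>N\<^esub> x" for y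
  proof -
   have "y : (\<Union>h\<in>K. {h \<oplus>\<^bsub>N\<^esub> x})" using that by (simp only: a_r_coset_def')
   then obtain k where k: "k : K" "y = k \<oplus>\<^bsub>N\<^esub> x" by (elim UN_E singletonE)
   have ay: "a \<odot>\<^bsub>N\<^esub> y = a \<odot>\<^bsub>N\<^esub> k \<oplus>\<^bsub>N\<^esub> a \<odot>\<^bsub>N\<^esub> x"
    unfolding k(2) using \<open>a : car T\<close> \<open>x : car N\<close> Kc[OF k(1)] by (intro N.smult_r_distr)
   show ?thesis unfolding ay
    by (rule eqI[OF K.smult_closed[OF \<open>a : car T\<close> k(1)] N.smult_closed[OF \<open>a : car T\<close> \<open>x : car N\<close>]])
  qed
  hence "(\<Union>y\<in>K +>\<^bsub>N\<^esub> x. K +>\<^bsub>N\<^esub> (a \<odot>\<^bsub>N\<^esub> y)) = (\<Union>y\<in>K +>\<^bsub>N\<^esub> x. K +>\<^bsub>N\<^esub> (a \<odot>\<^bsub>N\<^esub> x))"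
   by (rule SUP_cong[OF refl])
  moreover have "K +>\<^bsub>N\<^esub> x ~= {}" using S.a_rcos_self[OF \<open>x : car N\<close>] by blast
  ultimately show ?thesis by (simp add: quot_module_def)
 qed
 have z: "\<zero>\<^bsub>?Q\<^esub> = K +>\<^bsub>N\<^esub> \<zero>\<^bsub>N\<^esub>" using N.a_coset_add_zero S.a_subset by (simp add: quot_module_def)
 have "abelian_group ?Q" proof (rule abelian_groupI)
  fix C assume "C : car ?Q"
  then obtain x where x: "x : car N" "C = K +>\<^bsub>N\<^esub> x" by (auto simp: cq)
  have "(K +>\<^bsub>N\<^esub> (\<ominus>\<^bsub>N\<^esub> x)) \<oplus>\<^bsub>?Q\<^esub> C = \<zero>\<^bsub>?Q\<^esub>"
   using x by (simp add: add N.M.l_neg z)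
  moreover have "(K +>\<^bsub>N\<^esub> (\<ominus>\<^bsub>N\<^esub> x)) : car ?Q" using x by (auto simp: cq)
  ultimately show "\<exists>y\<in>car ?Q. y \<oplus>\<^bsub>?Q\<^esub> C = \<zero>\<^bsub>?Q\<^esub>" by blast
 qed (auto simp: cq add z N.M.a_ac)
 hence Q: "left_module T ?Q" by (intro left_module.intro left_module_axioms.intro N.ring_axioms)
   (auto simp: cq add sm N.smult_closed N.smult_l_distr N.smult_r_distr N.smult_assoc N.smult_one)
 show "left_module_hom T N ?Q (%x. K +>\<^bsub>N\<^esub> x)" unfolding left_module_hom_def using N Q by (auto simp: cq add sm)
 show "K +>\<^bsub>N\<^esub> x = \<zero>\<^bsub>?Q\<^esub> \<longleftrightarrow> x : K" if "x : car N" for x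
  using that N.a_coset_join1[of K x] N.a_coset_join2[of x K] S.a_subgroup by (auto simp: quot_module_def)
qed

section \<open>Rings of locally constant functions\<close>

abbreviation CF :: "nat => nat => ('t, 'm) ring_scheme => ((nat => nat => int) => 't) ring" where
 "CF p r T \<equiv> Cfun (Zp_space p r) T"

lemma Cfun_ops:
 "G \<otimes>\<^bsub>Cfun Y T\<^esub> H = (\<lambda>x\<in>topspace Y. G x \<otimes>\<^bsub>T\<^esub> H x)"
 "G \<oplus>\<^bsub>Cfun Y T\<^esub> H = (\<lambda>x\<in>topspace Y. G x \<oplus>\<^bsub>T\<^esub> H x)"
 "\<one>\<^bsub>Cfun Y T\<^esub> = (\<lambda>x\<in>topspace Y. \<one>\<^bsub>T\<^esub>)"
 "\<zero>\<^bsub>Cfun Y T\<^esub> = (\<lambda>x\<in>topspace Y. \<zero>\<^bsub>T\<^esub>)" by (simp_all add: Cfun_def)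

lemma CF_I: assumes "p > 0" "G : Ypts p r \<rightarrow>\<^sub>E car T" "loc_const p r e G" shows "G : car (CF p r T)"
 using assms Cfun_iff[of p G r T] by blast

lemma Cfun_val: "G : car (Cfun Y T) ==> x : topspace Y ==> G x : car T"
 by (auto simp: Cfun_def continuous_map_def)

lemma Cfun_ext: assumes "G : car (Cfun Y T)" "H : car (Cfun Y T)" "!!x. x : topspace Y ==> G x = H x"
 shows "G = H" by (rule extensionalityI[of _ "topspace Y"]) (use assms in \<open>auto simp: Cfun_def\<close>)

lemma CF_loc_const: "p > 0 ==> G : car (CF p r T) ==> \<exists>e. loc_const p r e G"
 using Cfun_iff[of p G r T] by blast

lemma loc_constI:
 assumes "!!x y. x : Ypts p r ==> y : Ypts p r ==> cong_pts r e x y ==> G x = G y"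
 shows "loc_const p r e G" unfolding loc_const_def using assms by blast

text \<open>The maximum of the levels of G and H is a level of any function computed pointwise from
  both.\<close>

lemma CF_lift2: assumes p: "p > 0" and G: "G : car (CF p r S)" and H: "H : car (CF p r T)"
  and h: "!!a b. a : car S ==> b : car T ==> h a b : car Q"
 shows "(\<lambda>x\<in>Ypts p r. h (G x) (H x)) : car (CF p r Q)" proof -
 obtain e where e: "loc_const p r e G" using CF_loc_const[OF p G] by blast
 obtain d where d: "loc_const p r d H" using CF_loc_const[OF p H] by blast
 show ?thesis proof (rule CF_I[OF p, of _ _ _ "max e d"])
  show "(\<lambda>x\<in>Ypts p r. h (G x) (H x)) : Ypts p r \<rightarrow>\<^sub>E car Q" using h Cfun_val[OF G] Cfun_val[OF H] by auto
  show "loc_const p r (max e d) (\<lambda>x\<in>Ypts p r. h (G x) (H x))" proof (rule loc_constI)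
   fix x y assume x: "x : Ypts p r" and y: "y : Ypts p r" and c: "cong_pts r (max e d) x y"
   have "G x = G y" using loc_constD[OF loc_const_mono[OF e] x y c] by simp
   moreover have "H x = H y" using loc_constD[OF loc_const_mono[OF d] x y c] by simp
   ultimately show "(\<lambda>x\<in>Ypts p r. h (G x) (H x)) x = (\<lambda>x\<in>Ypts p r. h (G x) (H x)) y" using x y by simp
  qed
 qed
qed

lemma CF_const: "p > 0 ==> v : car T ==> (\<lambda>x\<in>Ypts p r. v) : car (CF p r T)"
 by (rule CF_I[of _ _ _ _ 0]) (auto intro!: loc_constI)

lemma ring_CF: assumes T: "ring T" and p: "p > 0" shows "ring (CF p r T)" proof -
 interpret T: ring T by (rule T)
 let ?C = "CF p r T"
 have cl: "!!G H. G : car ?C ==> H : car ?C ==> G \<oplus>\<^bsub>?C\<^esub> H : car ?C"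
  "!!G H. G : car ?C ==> H : car ?C ==> G \<otimes>\<^bsub>?C\<^esub> H : car ?C"
  "\<zero>\<^bsub>?C\<^esub> : car ?C" "\<one>\<^bsub>?C\<^esub> : car ?C" unfolding Cfun_ops
  by (rule CF_lift2[OF p], assumption, assumption, simp)+ (rule CF_const[OF p], simp)+
 have neg: "(\<lambda>x\<in>Ypts p r. \<ominus>\<^bsub>T\<^esub> G x) : car ?C" if "G : car ?C" for G
  using CF_lift2[OF p that that, of "%a b. \<ominus>\<^bsub>T\<^esub> a" T] by simp
 note v = Cfun_val[where Y = "Zp_space p r" and T = T]
 show ?thesis proof (rule ringI)
  show "abelian_group ?C" proof (rule abelian_groupI)
   fix G assume G: "G : car ?C"
   have "(\<lambda>x\<in>Ypts p r. \<ominus>\<^bsub>T\<^esub> G x) \<oplus>\<^bsub>?C\<^esub> G = \<zero>\<^bsub>?C\<^esub>"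
    by (rule Cfun_ext[OF cl(1)[OF neg[OF G] G] cl(3)]) (simp add: Cfun_ops T.l_neg v[OF G])
   thus "\<exists>H\<in>car ?C. H \<oplus>\<^bsub>?C\<^esub> G = \<zero>\<^bsub>?C\<^esub>" using neg[OF G] by blast
   show "\<zero>\<^bsub>?C\<^esub> \<oplus>\<^bsub>?C\<^esub> G = G"
    by (rule Cfun_ext[where Y = "Zp_space p r" and T = T]) (simp_all add: cl G, simp_all add: Cfun_ops v G )
  next
   fix G H assume c: "G : car ?C" "H : car ?C"
   show "G \<oplus>\<^bsub>?C\<^esub> H = H \<oplus>\<^bsub>?C\<^esub> G"
    by (rule Cfun_ext[where Y = "Zp_space p r" and T = T]) (simp_all add: cl c, simp_all add: Cfun_ops v c T.a_comm)
  next
   fix F G H assume c: "F : car ?C" "G : car ?C" "H : car ?C"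
   show "F \<oplus>\<^bsub>?C\<^esub> G \<oplus>\<^bsub>?C\<^esub> H = F \<oplus>\<^bsub>?C\<^esub> (G \<oplus>\<^bsub>?C\<^esub> H)"
    by (rule Cfun_ext[where Y = "Zp_space p r" and T = T]) (simp_all add: cl c, simp_all add: Cfun_ops v c T.a_assoc)
  qed (use cl in auto)
  show "Group.monoid ?C" proof (rule monoidI)
   fix F G H assume c: "F : car ?C" "G : car ?C" "H : car ?C"
   show "F \<otimes>\<^bsub>?C\<^esub> G \<otimes>\<^bsub>?C\<^esub> H = F \<otimes>\<^bsub>?C\<^esub> (G \<otimes>\<^bsub>?C\<^esub> H)"
    by (rule Cfun_ext[where Y = "Zp_space p r" and T = T]) (simp_all add: cl c, simp_all add: Cfun_ops v c T.m_assoc)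
  next
   fix G assume G: "G : car ?C"
   show "\<one>\<^bsub>?C\<^esub> \<otimes>\<^bsub>?C\<^esub> G = G" by (rule Cfun_ext[where Y = "Zp_space p r" and T = T]) (simp_all add: cl G, simp_all add: Cfun_ops v G )
   show "G \<otimes>\<^bsub>?C\<^esub> \<one>\<^bsub>?C\<^esub> = G" by (rule Cfun_ext[where Y = "Zp_space p r" and T = T]) (simp_all add: cl G, simp_all add: Cfun_ops v G )
  qed (use cl in auto)
 next
  fix F G H assume c: "F : car ?C" "G : car ?C" "H : car ?C"
  show "(F \<oplus>\<^bsub>?C\<^esub> G) \<otimes>\<^bsub>?C\<^esub> H = F \<otimes>\<^bsub>?C\<^esub> H \<oplus>\<^bsub>?C\<^esub> G \<otimes>\<^bsub>?C\<^esub> H"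
   by (rule Cfun_ext[where Y = "Zp_space p r" and T = T]) (simp_all add: cl c, simp_all add: Cfun_ops v c T.l_distr)
  show "H \<otimes>\<^bsub>?C\<^esub> (F \<oplus>\<^bsub>?C\<^esub> G) = H \<otimes>\<^bsub>?C\<^esub> F \<oplus>\<^bsub>?C\<^esub> H \<otimes>\<^bsub>?C\<^esub> G"
   by (rule Cfun_ext[where Y = "Zp_space p r" and T = T]) (simp_all add: cl c, simp_all add: Cfun_ops v c T.r_distr)
 qed
qed

lemma CF_finsum: assumes T: "ring T" and p: "p > 0" and F: "F : A \<rightarrow> car (CF p r T)" and x: "x : Ypts p r"
 shows "(\<Oplus>\<^bsub>CF p r T\<^esub>i\<in>A. F i) x = (\<Oplus>\<^bsub>T\<^esub>i\<in>A. F i x)" proof -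
 interpret T: ring T by (rule T)
 interpret C: ring "CF p r T" by (rule ring_CF[OF T p])
 show ?thesis using F proof (induction A rule: infinite_finite_induct)
  case (insert a A)
  hence "(%i. F i x) : A \<rightarrow> car T" "F a x : car T" using Cfun_val[OF _ x] by (auto simp: Pi_iff)
  with insert show ?case by (subst C.finsum_insert, simp_all add: Pi_iff) (use x in \<open>simp add: Cfun_ops\<close>)
 qed (use x in \<open>simp_all add: Cfun_ops\<close>)
qed

lemma Fp_scale_CF: assumes T: "ring T" and p: "p > 0" and G: "G : car (CF p r (Fp p))" and W: "W : car (CF p r T)"
 shows "Fp_scale (Zp_space p r) T G W : car (CF p r T)" proof -
 interpret T: ring T by (rule T)
 show ?thesis unfolding Fp_scale_def by (rule CF_lift2[OF p G W, where h = "%k w. [k] \<cdot>\<^bsub>T\<^esub> w"]) simp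
qed

lemma Fp_carrier: "p > 1 ==> car (Fp p) = {0..int p - 1}" by (auto simp: residue_ring_def)

text \<open>The indicator functions of the finitely many fibres of P, together with the values of P,
  form a decomposition. This existence makes the description by decompositions in
  \<open>fs_smult\<close> non-vacuous.\<close>

lemma Cfun_decomp_exists: assumes T: "ring T" and p: "p > 1" and P: "P : car (CF p r T)"
 shows "\<exists>n G v. Cfun_decomp p (Zp_space p r) T P n G v" proof -
 interpret T: ring T by (rule T)
 have p0: "p > 0" using p by simp
 obtain e where e: "loc_const p r e P" using CF_loc_const[OF p0 P] by blast
 define Vs where "Vs = P ` Ypts p r"
 have "finite Vs" unfolding Vs_def by (rule Cfun_finite_range[OF p0 P])
 then obtain n v where v: "bij_betw v {..<n::nat} Vs" using ex_bij_betw_nat_finite[of Vs] by (auto simp: atLeast0LessThan)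
 have vc: "v i : car T" if "i < n" for i using bij_betw_apply[OF v, of i] that Cfun_val[OF P] by (auto simp: Vs_def)
 define G :: "nat => (nat => nat => int) => int"
  where "G i = (\<lambda>x\<in>Ypts p r. if P x = v i then 1 else 0)" for i
 have G: "G i : car (CF p r (Fp p))" for i proof (rule CF_I[OF p0, of _ _ _ e])
  show "G i : Ypts p r \<rightarrow>\<^sub>E car (Fp p)" using p by (auto simp: G_def Fp_carrier)
  show "loc_const p r e (G i)" proof (rule loc_constI)
   fix x y assume x: "x : Ypts p r" and y: "y : Ypts p r" and "cong_pts r e x y"
   hence "P x = P y" by (rule loc_constD[OF e])
   thus "G i x = G i y" using x y by (simp add: G_def)
  qed
 qed
 let ?F = "%i. Fp_scale (Zp_space p r) T (G i) (\<lambda>x\<in>Ypts p r. v i)"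
 interpret C: ring "CF p r T" by (rule ring_CF[OF T p0])
 have F: "?F : {..<n} \<rightarrow> car (CF p r T)" by (auto intro!: Fp_scale_CF[OF T p0 G] CF_const[OF p0] vc)
 have "P = (\<Oplus>\<^bsub>CF p r T\<^esub>i\<in>{..<n}. ?F i)" proof (rule Cfun_ext[OF P])
  show "(\<Oplus>\<^bsub>CF p r T\<^esub>i\<in>{..<n}. ?F i) : car (CF p r T)" using F by simp
  fix x assume x: "x : Ypts p r"
  hence "P x : Vs" by (simp add: Vs_def)
  then obtain k where k: "k < n" "v k = P x" using v by (auto simp: bij_betw_def)
  have "(\<Oplus>\<^bsub>CF p r T\<^esub>i\<in>{..<n}. ?F i) x = (\<Oplus>\<^bsub>T\<^esub>i\<in>{..<n}. ?F i x)" by (rule CF_finsum[OF T p0 F x])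
  also have "... = (\<Oplus>\<^bsub>T\<^esub>i\<in>{..<n}. if k = i then v i else \<zero>\<^bsub>T\<^esub>)"
  proof (rule T.finsum_cong'[OF refl])
   fix i assume i: "i : {..<n}"
   have "P x = v i \<longleftrightarrow> k = i" using v i k by (auto simp: bij_betw_def inj_on_def)
   thus "?F i x = (if k = i then v i else \<zero>\<^bsub>T\<^esub>)" using x i vc by (simp add: Fp_scale_def G_def add_pow_int_ge)
  qed (use vc in auto)
  also have "... = v k" using k vc by (intro T.finsum_singleton) auto
  finally show "P x = (\<Oplus>\<^bsub>CF p r T\<^esub>i\<in>{..<n}. ?F i) x" using k by simp
 qed
 hence "Cfun_decomp p (Zp_space p r) T P n G v" unfolding Cfun_decomp_def using G vc by blast thus ?thesis by blast
qed

section \<open>Differential operators\<close>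

lemma DLD: assumes "phi : DL p R e" shows "phi : car R \<rightarrow>\<^sub>E car R"
  and "!!a. a : car R ==> phi a : car R"
  and "!!a b. a : car R ==> b : car R ==> phi (a \<oplus>\<^bsub>R\<^esub> b) = phi a \<oplus>\<^bsub>R\<^esub> phi b"
  and "!!c a. c : car R ==> a : car R ==>
   phi ((c [^]\<^bsub>R\<^esub> (p ^ e)) \<otimes>\<^bsub>R\<^esub> a) = (c [^]\<^bsub>R\<^esub> (p ^ e)) \<otimes>\<^bsub>R\<^esub> phi a"
 using assms by (auto simp: DiffOp_level_def)

lemma DLI: assumes "phi : car R \<rightarrow>\<^sub>E car R"
  and "!!a b. a : car R ==> b : car R ==> phi (a \<oplus>\<^bsub>R\<^esub> b) = phi a \<oplus>\<^bsub>R\<^esub> phi b"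
  and "!!c a. c : car R ==> a : car R ==>
   phi ((c [^]\<^bsub>R\<^esub> (p ^ e)) \<otimes>\<^bsub>R\<^esub> a) = (c [^]\<^bsub>R\<^esub> (p ^ e)) \<otimes>\<^bsub>R\<^esub> phi a"
 shows "phi : DL p R e" using assms by (auto simp: DiffOp_level_def)

lemma DiffOp_ops:
 "phi \<otimes>\<^bsub>DiffOp p R\<^esub> psi = compose (car R) phi psi"
 "phi \<oplus>\<^bsub>DiffOp p R\<^esub> psi = (\<lambda>a\<in>car R. phi a \<oplus>\<^bsub>R\<^esub> psi a)"
 "\<one>\<^bsub>DiffOp p R\<^esub> = (\<lambda>a\<in>car R. a)"
 "\<zero>\<^bsub>DiffOp p R\<^esub> = (\<lambda>a\<in>car R. \<zero>\<^bsub>R\<^esub>)" by (simp_all add: DiffOp_def)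

lemma DiffOp_carrier: "phi : car (DiffOp p R) \<longleftrightarrow> (\<exists>e. phi : DL p R e)"
 by (auto simp: DiffOp_def)

lemma level_least: "phi : DL p R e ==> phi : DL p R (level p R phi) \<and> level p R phi <= e"
 unfolding level_def by (meson LeastI Least_le)

lemma DiffOp_ext:
 assumes "phi : DL p R e" "psi : DL p R d" "!!a. a : car R ==> phi a = psi a"
 shows "phi = psi" by (rule extensionalityI[of _ "car R"])
  (use DLD(1)[OF assms(1)] DLD(1)[OF assms(2)] assms(3) in \<open>auto simp: PiE_def\<close>)

context cring begin

lemma DiffOp_level_mono: assumes phi: "phi : DL p R e" and "e <= d" shows "phi : DL p R d"
proof (rule DLI)
 fix c a assume c: "c : car R" "a : car R"
 have "c [^] (p ^ d) = (c [^] (p ^ (d - e))) [^] (p ^ e)" using c \<open>e <= d\<close> by (simp add: nat_pow_pow flip: power_add)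
 thus "phi (c [^] (p ^ d) \<otimes> a) = c [^] (p ^ d) \<otimes> phi a" using c by (simp add: DLD(4)[OF phi])
qed (use DLD[OF phi] in auto)

lemma DiffOp_level_level: "phi : car (DiffOp p R) ==> level p R phi <= e ==> phi : DL p R e"
 using level_least DiffOp_carrier DiffOp_level_mono by metis

lemma DiffOp_level_add: assumes phi: "phi : DL p R e" and psi: "psi : DL p R e"
 shows "(\<lambda>a\<in>car R. phi a \<oplus> psi a) : DL p R e"
 by (rule DLI) (auto simp: DLD[OF phi] DLD[OF psi] a_ac r_distr)

lemma DiffOp_level_compose: assumes phi: "phi : DL p R e" and psi: "psi : DL p R e"
 shows "compose (car R) phi psi : DL p R e"
 by (rule DLI) (auto simp: DLD[OF phi] DLD[OF psi] compose_def)

lemma DiffOp_level_zero: "(\<lambda>a\<in>car R. \<zero>) : DL p R e" by (rule DLI) auto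

lemma DiffOp_level_one: "(\<lambda>a\<in>car R. a) : DL p R e" by (rule DLI) auto

lemma DiffOp_level_minus: assumes phi: "phi : DL p R e"
 shows "(\<lambda>a\<in>car R. \<ominus> phi a) : DL p R e"
 by (rule DLI) (auto simp: DLD[OF phi] minus_add r_minus)

lemma DiffOp_zero: assumes phi: "phi : DL p R e" shows "phi \<zero> = \<zero>"
 using DLD(3)[OF phi, of \<zero> \<zero>] DLD(2)[OF phi, of \<zero>] by (simp add: add.l_cancel_one')

lemma DiffOp_finsum: assumes phi: "phi : DL p R e" and "v : A \<rightarrow> car R"
 shows "phi (\<Oplus>i\<in>A. v i) = (\<Oplus>i\<in>A. phi (v i))" using assms(2) proof (induction A rule: infinite_finite_induct)
 case (insert x A)
 hence "v : A \<rightarrow> car R" "v x : car R" "(%i. phi (v i)) : A \<rightarrow> car R"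
  using DLD(2)[OF phi] by auto
 thus ?case using insert DLD[OF phi] by simp
qed (simp_all add: DiffOp_zero[OF phi])

lemma DiffOp_common: assumes "phi : car (DiffOp p R)" "psi : car (DiffOp p R)"
 shows "\<exists>e. phi : DL p R e \<and> psi : DL p R e"
 using assms unfolding DiffOp_carrier by (meson DiffOp_level_mono max.cobounded1 max.cobounded2)

lemma ring_DiffOp: "ring (DiffOp p R)" proof -
 let ?D = "DiffOp p R"
 note ca = DiffOp_carrier[of _ p R]
 have cl: "phi \<oplus>\<^bsub>?D\<^esub> psi : car ?D" "phi \<otimes>\<^bsub>?D\<^esub> psi : car ?D"
  if "phi : car ?D" "psi : car ?D" for phi psi using DiffOp_common[OF that] DiffOp_level_add DiffOp_level_compose
  unfolding ca DiffOp_ops by blast+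
 have cl0: "\<zero>\<^bsub>?D\<^esub> : car ?D" "\<one>\<^bsub>?D\<^esub> : car ?D"
  unfolding ca DiffOp_ops using DiffOp_level_zero DiffOp_level_one by blast+
 have ext: "phi = psi" if c: "phi : car ?D" "psi : car ?D" and eq: "!!a. a : car R ==> phi a = psi a" for phi psi
 proof -
  obtain e d where "phi : DL p R e" "psi : DL p R d" using c unfolding ca by blast
  thus ?thesis using eq by (rule DiffOp_ext)
 qed
 have v: "phi a : car R" if "phi : car ?D" "a : car R" for phi a proof -
  obtain e where "phi : DL p R e" using \<open>phi : car ?D\<close> unfolding ca by blast
  thus ?thesis using \<open>a : car R\<close> by (rule DLD(2))
 qed
 have ad: "phi (a \<oplus> b) = phi a \<oplus> phi b" if "phi : car ?D" "a : car R" "b : car R" for phi a b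
 proof -
  obtain e where "phi : DL p R e" using \<open>phi : car ?D\<close> unfolding ca by blast
  thus ?thesis using \<open>a : car R\<close> \<open>b : car R\<close> by (rule DLD(3))
 qed
 show ?thesis proof (rule ringI)
  show "abelian_group ?D" proof (rule abelian_groupI)
   fix phi assume f: "phi : car ?D"
   have n: "(\<lambda>a\<in>car R. \<ominus> phi a) : car ?D" using f DiffOp_level_minus unfolding ca by blast
   have "(\<lambda>a\<in>car R. \<ominus> phi a) \<oplus>\<^bsub>?D\<^esub> phi = \<zero>\<^bsub>?D\<^esub>"
    by (rule ext) (simp_all add: cl cl0 n f, simp_all add: DiffOp_ops v n f l_neg)
   thus "\<exists>psi\<in>car ?D. psi \<oplus>\<^bsub>?D\<^esub> phi = \<zero>\<^bsub>?D\<^esub>" using n by blast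
   show "\<zero>\<^bsub>?D\<^esub> \<oplus>\<^bsub>?D\<^esub> phi = phi" by (rule ext) (simp_all add: cl cl0 f, simp_all add: DiffOp_ops v f )
  next
   fix phi psi assume c: "phi : car ?D" "psi : car ?D"
   show "phi \<oplus>\<^bsub>?D\<^esub> psi = psi \<oplus>\<^bsub>?D\<^esub> phi"
    by (rule ext) (simp_all add: cl cl0 c, simp_all add: DiffOp_ops v c a_comm)
  next
   fix phi psi \<chi> assume c: "phi : car ?D" "psi : car ?D" "\<chi> : car ?D"
   show "phi \<oplus>\<^bsub>?D\<^esub> psi \<oplus>\<^bsub>?D\<^esub> \<chi> = phi \<oplus>\<^bsub>?D\<^esub> (psi \<oplus>\<^bsub>?D\<^esub> \<chi>)"
    by (rule ext) (simp_all add: cl cl0 c, simp_all add: DiffOp_ops v c a_assoc)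
  qed (use cl cl0 in auto)
  show "Group.monoid ?D" proof (rule monoidI)
   fix phi psi \<chi> assume c: "phi : car ?D" "psi : car ?D" "\<chi> : car ?D"
   show "phi \<otimes>\<^bsub>?D\<^esub> psi \<otimes>\<^bsub>?D\<^esub> \<chi> = phi \<otimes>\<^bsub>?D\<^esub> (psi \<otimes>\<^bsub>?D\<^esub> \<chi>)"
    by (rule ext) (simp_all add: cl cl0 c, simp_all add: DiffOp_ops v c compose_def)
  next
   fix phi assume f: "phi : car ?D"
   show "\<one>\<^bsub>?D\<^esub> \<otimes>\<^bsub>?D\<^esub> phi = phi"
    by (rule ext) (simp_all add: cl cl0 f, simp add: DiffOp_ops v f compose_def)
   show "phi \<otimes>\<^bsub>?D\<^esub> \<one>\<^bsub>?D\<^esub> = phi"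
    by (rule ext) (simp_all add: cl cl0 f, simp add: DiffOp_ops v f compose_def)
  qed (use cl cl0 in auto)
 next
  fix phi psi \<chi> assume c: "phi : car ?D" "psi : car ?D" "\<chi> : car ?D"
  show "(phi \<oplus>\<^bsub>?D\<^esub> psi) \<otimes>\<^bsub>?D\<^esub> \<chi> = phi \<otimes>\<^bsub>?D\<^esub> \<chi> \<oplus>\<^bsub>?D\<^esub> psi \<otimes>\<^bsub>?D\<^esub> \<chi>"
   by (rule ext) (simp_all add: cl cl0 c, simp_all add: DiffOp_ops v c compose_def)
  show "\<chi> \<otimes>\<^bsub>?D\<^esub> (phi \<oplus>\<^bsub>?D\<^esub> psi) = \<chi> \<otimes>\<^bsub>?D\<^esub> phi \<oplus>\<^bsub>?D\<^esub> \<chi> \<otimes>\<^bsub>?D\<^esub> psi"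
   by (rule ext) (simp_all add: cl cl0 c, simp_all add: DiffOp_ops v c compose_def ad)
 qed
qed

end

section \<open>Localization\<close>

lemma (in comm_monoid) inv_mult_Units: assumes "x : Units G" "y : Units G" shows "inv (x \<otimes> y) = inv x \<otimes> inv y"
proof (rule comm_inv_char)
 have "x \<otimes> y \<otimes> (inv x \<otimes> inv y) = (x \<otimes> inv x) \<otimes> (y \<otimes> inv y)"
  using assms by (simp only: m_ac m_closed Units_inv_closed Units_closed)
 thus "x \<otimes> y \<otimes> (inv x \<otimes> inv y) = \<one>" using assms by simp
qed (use assms in auto)

text \<open>Read with q = Suc k: (s^q)^q splits off the q-th power of s^(q-1). For q = p^e an
  operator of level e lets this factor pass, and it cancels in fractions.\<close>

lemma (in comm_monoid) pow_Suc_Suc: assumes s: "s : car G" shows "(s [^] Suc k) [^] Suc k = (s [^] k) [^] Suc k \<otimes> s [^] Suc k" proof -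
 have "(s [^] Suc k) [^] Suc k = (s [^] k \<otimes> s) [^] Suc k" by simp
 also have "... = (s [^] k) [^] Suc k \<otimes> s [^] Suc k" by (rule nat_pow_distrib) (use s in auto)
 finally show ?thesis .
qed

locale mult_set = cring R for R :: "('a, 'm) ring_scheme" (structure) and S :: "'a set" +
 assumes S_sub: "S <= car R" and S_one: "\<one> : S"
  and S_mult: "s : S ==> t : S ==> s \<otimes> t : S"
begin

abbreviation frac where "frac \<equiv> loc_frac R S"

lemma S_car [simp]: "s : S ==> s : car R" using S_sub by blast

lemma S_pow: "s : S ==> s [^] (n::nat) : S" by (induction n) (simp_all add: S_one S_mult)

lemma loc_rel_iff: "((a, s), (b, t)) : loc_rel R S \<longleftrightarrow> a : car R \<and> b : car R \<and> s : S \<and> t : S \<and>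
 (\<exists>u\<in>S. u \<otimes> (t \<otimes> a) = u \<otimes> (s \<otimes> b))" by (simp add: loc_rel_def)

lemma equiv_loc_rel: "equiv (car R \<times> S) (loc_rel R S)" proof (rule equivI)
 show "loc_rel R S <= (car R \<times> S) \<times> (car R \<times> S)" by (auto simp: loc_rel_def)
 show "refl_on (car R \<times> S) (loc_rel R S)" using S_one by (auto simp: refl_on_def loc_rel_def)
 show "sym (loc_rel R S)" unfolding sym_def by (auto simp: loc_rel_iff) metis
 show "trans (loc_rel R S)" proof (rule transI, clarify)
  fix a s b t c w
  assume "((a, s), (b, t)) : loc_rel R S" "((b, t), (c, w)) : loc_rel R S"
  then obtain u v where c: "a : car R" "b : car R" "c : car R" "s : S" "t : S" "w : S"
   "u : S" "v : S" and e: "u \<otimes> (t \<otimes> a) = u \<otimes> (s \<otimes> b)" "v \<otimes> (w \<otimes> b) = v \<otimes> (t \<otimes> c)"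
   by (auto simp: loc_rel_iff)
  have "(u \<otimes> v \<otimes> t) \<otimes> (w \<otimes> a) = (v \<otimes> w) \<otimes> (u \<otimes> (t \<otimes> a))" using c by (simp add: m_ac)
  also have "... = (u \<otimes> s) \<otimes> (v \<otimes> (w \<otimes> b))" unfolding e(1) using c by (simp add: m_ac)
  also have "... = (u \<otimes> v \<otimes> t) \<otimes> (s \<otimes> c)" unfolding e(2) using c by (simp add: m_ac)
  finally show "((a, s), (c, w)) : loc_rel R S" using c S_mult by (auto simp: loc_rel_iff intro!: bexI[of _ "u \<otimes> v \<otimes> t"])
 qed
qed

lemma frac_eq_iff: assumes "a : car R" "s : S" "b : car R" "t : S"
 shows "frac a s = frac b t \<longleftrightarrow> (\<exists>u\<in>S. u \<otimes> (t \<otimes> a) = u \<otimes> (s \<otimes> b))"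
 unfolding loc_frac_def using eq_equiv_class_iff[OF equiv_loc_rel, of "(a, s)" "(b, t)"] assms by (simp add: loc_rel_iff)

lemma frac_eqI: assumes "a : car R" "s : S" "b : car R" "t : S" "t \<otimes> a = s \<otimes> b"
 shows "frac a s = frac b t" using frac_eq_iff[OF assms(1-4)] assms(5) S_one by auto

lemma frac_eqI2:
 assumes "a : car R" "s : S" "b : car R" "t : S" "u : S" "u \<otimes> (t \<otimes> a) = u \<otimes> (s \<otimes> b)"
 shows "frac a s = frac b t" using frac_eq_iff[OF assms(1-4)] assms(5,6) by blast

lemma frac_expand: assumes "a : car R" "s : S" "t : S" shows "frac (t \<otimes> a) (t \<otimes> s) = frac a s"
 by (rule frac_eqI) (use assms S_mult in \<open>simp_all add: m_ac\<close>)

lemma mem_frac: "(b, t) : frac a s \<longleftrightarrow> ((a, s), (b, t)) : loc_rel R S" by (simp add: loc_frac_def)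

lemma carrier_Loc: "C : car (Loc R S) \<longleftrightarrow> (\<exists>a\<in>car R. \<exists>s\<in>S. C = frac a s)"
 by (auto simp: Loc_def quotient_def loc_frac_def)

lemma frac_closed [simp]: "a : car R ==> s : S ==> frac a s : car (Loc R S)"
 by (auto simp: carrier_Loc)

text \<open>All operations on fractions are unions over representatives; this reduces them to the
  value at one representative once F is seen to respect the relation.\<close>

lemma UN_frac: assumes a: "a : car R" and s: "s : S"
  and F: "!!b t u. b : car R ==> t : S ==> u : S ==> u \<otimes> (t \<otimes> a) = u \<otimes> (s \<otimes> b) ==> F b t = F a s"
 shows "(\<Union>(b, t)\<in>frac a s. F b t) = F a s" proof (rule UN_constant_eq)
 show "(a, s) : frac a s" using a s S_one by (auto simp: mem_frac loc_rel_iff)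
 show "\<forall>y\<in>frac a s. (case y of (b, t) => F b t) = F a s" proof (intro ballI)
  fix y assume y: "y : frac a s"
  obtain b t where bt: "y = (b, t)" by (cases y)
  then obtain u where "b : car R" "t : S" "u : S" "u \<otimes> (t \<otimes> a) = u \<otimes> (s \<otimes> b)"
   using y by (auto simp: mem_frac loc_rel_iff)
  hence "F b t = F a s" by (rule F)
  thus "(case y of (b, t) => F b t) = F a s" unfolding bt by simp
 qed
qed

lemma frac_mult: assumes c: "a : car R" "s : S" "b : car R" "t : S"
 shows "frac a s \<otimes>\<^bsub>Loc R S\<^esub> frac b t = frac (a \<otimes> b) (s \<otimes> t)" proof -
 have 1: "(\<Union>(b', t')\<in>frac b t. frac (a' \<otimes> b') (s' \<otimes> t')) = frac (a' \<otimes> b) (s' \<otimes> t)"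
  if a': "a' : car R" "s' : S" for a' s' proof (rule UN_frac[OF c(3,4)])
  fix b' t' u assume d: "b' : car R" "t' : S" "u : S" and e: "u \<otimes> (t' \<otimes> b) = u \<otimes> (t \<otimes> b')"
  have "u \<otimes> ((s' \<otimes> t) \<otimes> (a' \<otimes> b')) = s' \<otimes> a' \<otimes> (u \<otimes> (t \<otimes> b'))" using a' c d by (simp add: m_ac)
  also have "... = u \<otimes> ((s' \<otimes> t') \<otimes> (a' \<otimes> b))" unfolding e[symmetric] using a' c d by (simp add: m_ac)
  finally show "frac (a' \<otimes> b') (s' \<otimes> t') = frac (a' \<otimes> b) (s' \<otimes> t)"
   by (intro frac_eqI2[OF _ _ _ _ d(3)]) (use a' c d S_mult in simp_all)
 qed
 have "(\<Union>(a', s')\<in>frac a s. \<Union>(b', t')\<in>frac b t. frac (a' \<otimes> b') (s' \<otimes> t')) =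
  (\<Union>(b', t')\<in>frac b t. frac (a \<otimes> b') (s \<otimes> t'))" proof (rule UN_frac[OF c(1,2)])
  fix a' s' u assume d: "a' : car R" "s' : S" "u : S" and e: "u \<otimes> (s' \<otimes> a) = u \<otimes> (s \<otimes> a')"
  have "u \<otimes> ((s \<otimes> t) \<otimes> (a' \<otimes> b)) = t \<otimes> b \<otimes> (u \<otimes> (s \<otimes> a'))" using c d by (simp add: m_ac)
  also have "... = u \<otimes> ((s' \<otimes> t) \<otimes> (a \<otimes> b))" unfolding e[symmetric] using c d by (simp add: m_ac)
  finally have "frac (a' \<otimes> b) (s' \<otimes> t) = frac (a \<otimes> b) (s \<otimes> t)"
   by (intro frac_eqI2[OF _ _ _ _ d(3)]) (use c d S_mult in simp_all)
  thus "(\<Union>(b', t')\<in>frac b t. frac (a' \<otimes> b') (s' \<otimes> t')) = (\<Union>(b', t')\<in>frac b t. frac (a \<otimes> b') (s \<otimes> t'))"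
   using 1 c d by simp
 qed
 thus ?thesis using 1[OF c(1,2)] by (simp add: Loc_def)
qed

lemma frac_add: assumes c: "a : car R" "s : S" "b : car R" "t : S"
 shows "frac a s \<oplus>\<^bsub>Loc R S\<^esub> frac b t = frac ((t \<otimes> a) \<oplus> (s \<otimes> b)) (s \<otimes> t)" proof -
 have 1: "(\<Union>(b', t')\<in>frac b t. frac ((t' \<otimes> a') \<oplus> (s' \<otimes> b')) (s' \<otimes> t')) = frac ((t \<otimes> a') \<oplus> (s' \<otimes> b)) (s' \<otimes> t)"
  if a': "a' : car R" "s' : S" for a' s' proof (rule UN_frac[OF c(3,4)])
  fix b' t' u assume d: "b' : car R" "t' : S" "u : S" and e: "u \<otimes> (t' \<otimes> b) = u \<otimes> (t \<otimes> b')"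
  have "u \<otimes> ((s' \<otimes> t) \<otimes> ((t' \<otimes> a') \<oplus> (s' \<otimes> b'))) = u \<otimes> s' \<otimes> t \<otimes> t' \<otimes> a' \<oplus> s' \<otimes> s' \<otimes> (u \<otimes> (t \<otimes> b'))"
   using a' c d by (simp add: m_ac r_distr)
  also have "... = u \<otimes> ((s' \<otimes> t') \<otimes> ((t \<otimes> a') \<oplus> (s' \<otimes> b)))" unfolding e[symmetric]
   using a' c d by (simp add: m_ac r_distr)
  finally show "frac ((t' \<otimes> a') \<oplus> (s' \<otimes> b')) (s' \<otimes> t') = frac ((t \<otimes> a') \<oplus> (s' \<otimes> b)) (s' \<otimes> t)"
   by (intro frac_eqI2[OF _ _ _ _ d(3)]) (use a' c d S_mult in simp_all)
 qed
 have "(\<Union>(a', s')\<in>frac a s. \<Union>(b', t')\<in>frac b t. frac ((t' \<otimes> a') \<oplus> (s' \<otimes> b')) (s' \<otimes> t')) =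
  (\<Union>(b', t')\<in>frac b t. frac ((t' \<otimes> a) \<oplus> (s \<otimes> b')) (s \<otimes> t'))" proof (rule UN_frac[OF c(1,2)])
  fix a' s' u assume d: "a' : car R" "s' : S" "u : S" and e: "u \<otimes> (s' \<otimes> a) = u \<otimes> (s \<otimes> a')"
  have "u \<otimes> ((s \<otimes> t) \<otimes> ((t \<otimes> a') \<oplus> (s' \<otimes> b))) = t \<otimes> t \<otimes> (u \<otimes> (s \<otimes> a')) \<oplus> u \<otimes> s \<otimes> s' \<otimes> t \<otimes> b"
   using c d by (simp add: m_ac r_distr)
  also have "... = u \<otimes> ((s' \<otimes> t) \<otimes> ((t \<otimes> a) \<oplus> (s \<otimes> b)))" unfolding e[symmetric]
   using c d by (simp add: m_ac r_distr)
  finally have "frac ((t \<otimes> a') \<oplus> (s' \<otimes> b)) (s' \<otimes> t) = frac ((t \<otimes> a) \<oplus> (s \<otimes> b)) (s \<otimes> t)"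
   by (intro frac_eqI2[OF _ _ _ _ d(3)]) (use c d S_mult in simp_all)
  thus "(\<Union>(b', t')\<in>frac b t. frac ((t' \<otimes> a') \<oplus> (s' \<otimes> b')) (s' \<otimes> t')) =
    (\<Union>(b', t')\<in>frac b t. frac ((t' \<otimes> a) \<oplus> (s \<otimes> b')) (s \<otimes> t'))" using 1 c d by simp
 qed
 thus ?thesis using 1[OF c(1,2)] by (simp add: Loc_def)
qed

lemma frac_add_same: assumes c: "a : car R" "s : S" "b : car R"
 shows "frac a s \<oplus>\<^bsub>Loc R S\<^esub> frac b s = frac (a \<oplus> b) s" unfolding frac_add[OF c(1,2,3,2)]
 by (rule frac_eqI) (use c S_mult in \<open>simp_all add: r_distr m_ac\<close>)

lemma Loc_one: "\<one>\<^bsub>Loc R S\<^esub> = frac \<one> \<one>" and Loc_zero: "\<zero>\<^bsub>Loc R S\<^esub> = frac \<zero> \<one>"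
 by (simp_all add: Loc_def)

lemma frac_zero: "s : S ==> frac \<zero> s = \<zero>\<^bsub>Loc R S\<^esub>"
 unfolding Loc_zero by (rule frac_eqI) (simp_all add: S_one)

lemma Loc_common_denom2: assumes "z : car (Loc R S)" "w : car (Loc R S)"
 obtains a b s where "a : car R" "b : car R" "s : S" "z = frac a s" "w = frac b s" proof -
 obtain a s b t where c: "a : car R" "s : S" "z = frac a s" "b : car R" "t : S" "w = frac b t"
  using assms by (auto simp: carrier_Loc)
 have "z = frac (t \<otimes> a) (t \<otimes> s)" using c by (simp add: frac_expand)
 moreover have "w = frac (s \<otimes> b) (t \<otimes> s)" using c by (simp add: m_comm[of t s] frac_expand)
 ultimately show ?thesis using that[of "t \<otimes> a" "s \<otimes> b" "t \<otimes> s"] c S_mult by simp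
qed

lemma cring_Loc: "cring (Loc R S)" proof (rule cringI)
 note S_one [simp] S_mult [simp]
 show "abelian_group (Loc R S)" proof (rule abelian_groupI)
  fix x y z assume "x : car (Loc R S)" "y : car (Loc R S)" "z : car (Loc R S)"
  then obtain a s b t c w where e: "a : car R" "s : S" "x = frac a s" "b : car R" "t : S" "y = frac b t"
   "c : car R" "w : S" "z = frac c w" by (auto simp: carrier_Loc)
  show "x \<oplus>\<^bsub>Loc R S\<^esub> y \<oplus>\<^bsub>Loc R S\<^esub> z = x \<oplus>\<^bsub>Loc R S\<^esub> (y \<oplus>\<^bsub>Loc R S\<^esub> z)"
   using e by (simp add: frac_add r_distr m_ac a_ac)
 next
  fix x y assume "x : car (Loc R S)" "y : car (Loc R S)"
  then obtain a s b t where e: "a : car R" "s : S" "x = frac a s" "b : car R" "t : S" "y = frac b t"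
   by (auto simp: carrier_Loc)
  show "x \<oplus>\<^bsub>Loc R S\<^esub> y : car (Loc R S)" using e by (simp add: frac_add)
  show "x \<oplus>\<^bsub>Loc R S\<^esub> y = y \<oplus>\<^bsub>Loc R S\<^esub> x" using e by (simp add: frac_add m_comm[of t s] a_comm)
 next
  fix x assume "x : car (Loc R S)"
  then obtain a s where e: "a : car R" "s : S" "x = frac a s" by (auto simp: carrier_Loc)
  show "\<zero>\<^bsub>Loc R S\<^esub> \<oplus>\<^bsub>Loc R S\<^esub> x = x" using e by (simp add: Loc_zero frac_add)
  have "frac (\<ominus> a) s \<oplus>\<^bsub>Loc R S\<^esub> x = \<zero>\<^bsub>Loc R S\<^esub>" using e by (simp add: frac_add_same l_neg frac_zero)
  thus "\<exists>y\<in>car (Loc R S). y \<oplus>\<^bsub>Loc R S\<^esub> x = \<zero>\<^bsub>Loc R S\<^esub>" using e by (intro bexI) auto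
 qed (simp add: Loc_zero)
 show "comm_monoid (Loc R S)" proof (rule comm_monoidI)
  fix x y z assume "x : car (Loc R S)" "y : car (Loc R S)" "z : car (Loc R S)"
  then obtain a s b t c w where e: "a : car R" "s : S" "x = frac a s" "b : car R" "t : S" "y = frac b t"
   "c : car R" "w : S" "z = frac c w" by (auto simp: carrier_Loc)
  show "x \<otimes>\<^bsub>Loc R S\<^esub> y \<otimes>\<^bsub>Loc R S\<^esub> z = x \<otimes>\<^bsub>Loc R S\<^esub> (y \<otimes>\<^bsub>Loc R S\<^esub> z)"
   using e by (simp add: frac_mult m_ac)
 next
  fix x y assume "x : car (Loc R S)" "y : car (Loc R S)"
  then obtain a s b t where e: "a : car R" "s : S" "x = frac a s" "b : car R" "t : S" "y = frac b t"
   by (auto simp: carrier_Loc)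
  show "x \<otimes>\<^bsub>Loc R S\<^esub> y : car (Loc R S)" using e by (simp add: frac_mult)
  show "x \<otimes>\<^bsub>Loc R S\<^esub> y = y \<otimes>\<^bsub>Loc R S\<^esub> x" using e by (simp add: frac_mult m_comm)
 next
  fix x assume "x : car (Loc R S)"
  then obtain a s where e: "a : car R" "s : S" "x = frac a s" by (auto simp: carrier_Loc)
  show "\<one>\<^bsub>Loc R S\<^esub> \<otimes>\<^bsub>Loc R S\<^esub> x = x" using e by (simp add: Loc_one frac_mult)
 qed (simp add: Loc_one)
 fix x y z assume xy: "x : car (Loc R S)" "y : car (Loc R S)" and "z : car (Loc R S)"
 then obtain c w where c: "c : car R" "w : S" "z = frac c w" by (auto simp: carrier_Loc)
 obtain a b s where e: "a : car R" "b : car R" "s : S" "x = frac a s" "y = frac b s" by (rule Loc_common_denom2[OF xy])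
 show "(x \<oplus>\<^bsub>Loc R S\<^esub> y) \<otimes>\<^bsub>Loc R S\<^esub> z = x \<otimes>\<^bsub>Loc R S\<^esub> z \<oplus>\<^bsub>Loc R S\<^esub> y \<otimes>\<^bsub>Loc R S\<^esub> z"
  using c e by (simp add: frac_add_same frac_mult l_distr)
qed

lemma loc_incl_hom: "loc_incl R S : ring_hom R (Loc R S)" by (rule ring_hom_memI) (auto simp: loc_incl_def frac_mult frac_add_same S_one Loc_one)

lemma loc_incl_inverse:  assumes "s : S"
 shows "loc_incl R S s : Units (Loc R S)" "inv\<^bsub>Loc R S\<^esub> (loc_incl R S s) = frac \<one> s" proof -
 interpret L: cring "Loc R S" by (rule cring_Loc)
 have 1: "loc_incl R S s \<otimes>\<^bsub>Loc R S\<^esub> frac \<one> s = \<one>\<^bsub>Loc R S\<^esub>"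
  using assms by (simp add: loc_incl_def frac_mult S_one Loc_one) (rule frac_eqI; simp add: S_one)
 have c: "loc_incl R S s : car (Loc R S)" "frac \<one> s : car (Loc R S)" using assms S_one by (auto simp: loc_incl_def)
 hence 2: "frac \<one> s \<otimes>\<^bsub>Loc R S\<^esub> loc_incl R S s = \<one>\<^bsub>Loc R S\<^esub>" using 1 L.m_comm by simp
 show "loc_incl R S s : Units (Loc R S)" unfolding Units_def using 1 2 c by blast
 show "inv\<^bsub>Loc R S\<^esub> (loc_incl R S s) = frac \<one> s" by (rule L.comm_inv_char[OF c 1])
qed

lemma loc_incl_eq_iff:  assumes "a : car R" "b : car R"
 shows "loc_incl R S a = loc_incl R S b \<longleftrightarrow> (\<exists>u\<in>S. u \<otimes> a = u \<otimes> b)"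
 using assms S_one by (simp add: loc_incl_def frac_eq_iff)

lemma frac_pow: "a : car R ==> s : S ==> frac a s [^]\<^bsub>Loc R S\<^esub> (n::nat) = frac (a [^] n) (s [^] n)"
 by (induction n) (simp_all add: Loc_one frac_mult S_pow)

lemma loc_map_frac: assumes T: "mult_set B T" and h: "h : ring_hom R B" and hS: "!!s. s : S ==> h s : T"
  and a: "a : car R" "s : S" shows "loc_map B T h (frac a s) = loc_frac B T (h a) (h s)" unfolding loc_map_def
proof (rule UN_frac[OF a])
 interpret B: mult_set B T by (rule T)
 fix b t u assume c: "b : car R" "t : S" "u : S" and e: "u \<otimes> (t \<otimes> a) = u \<otimes> (s \<otimes> b)"
 have "h u \<otimes>\<^bsub>B\<^esub> (h t \<otimes>\<^bsub>B\<^esub> h a) = h u \<otimes>\<^bsub>B\<^esub> (h s \<otimes>\<^bsub>B\<^esub> h b)"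
  using arg_cong[OF e, of h] a c h by (simp add: ring_hom_mult)
 thus "loc_frac B T (h b) (h t) = loc_frac B T (h a) (h s)"
  using a c hS ring_hom_closed[OF h] by (subst B.frac_eq_iff) (auto intro!: bexI[of _ "h u"])
qed

text \<open>The extension given by the universal property of the localization. Elements of B are
  arbitrary objects, so a representative is chosen by SOME, where the operations of
  \<open>Loc\<close> can take a union.\<close>

definition loc_ext :: "('b, 'n) ring_scheme => ('a => 'b) => ('a \<times> 'a) set => 'b" where
 "loc_ext B h C = (let z = (SOME z. z : C) in h (fst z) \<otimes>\<^bsub>B\<^esub> inv\<^bsub>B\<^esub> h (snd z))"

lemma loc_ext_frac: assumes B: "cring B" and h: "h : ring_hom R B" and hS: "!!s. s : S ==> h s : Units B"
  and a: "a : car R" "s : S" shows "loc_ext B h (frac a s) = h a \<otimes>\<^bsub>B\<^esub> inv\<^bsub>B\<^esub> h s" proof -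
 interpret B: cring B by (rule B)
 define z where "z = (SOME z. z : frac a s)"
 have "(a, s) : frac a s" using a S_one by (auto simp: mem_frac loc_rel_iff)
 hence "z : frac a s" unfolding z_def by (rule someI)
 then obtain b t where bt: "z = (b, t)" "(b, t) : frac a s" by (cases z) auto
 then obtain u where c: "b : car R" "t : S" "u : S" and e: "u \<otimes> (t \<otimes> a) = u \<otimes> (s \<otimes> b)"
  by (auto simp: mem_frac loc_rel_iff)
 note hc = ring_hom_closed[OF h]
 note cc = hc[OF a(1)] hc[OF c(1)] hS[OF a(2)] hS[OF c(2)] hS[OF c(3)]
 have "h u \<otimes>\<^bsub>B\<^esub> (h t \<otimes>\<^bsub>B\<^esub> h a) = h u \<otimes>\<^bsub>B\<^esub> (h s \<otimes>\<^bsub>B\<^esub> h b)"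
  using arg_cong[OF e, of h] a c h by (simp add: ring_hom_mult)
 hence "h t \<otimes>\<^bsub>B\<^esub> h a = h s \<otimes>\<^bsub>B\<^esub> h b" using cc by (simp add: B.Units_l_cancel B.Units_closed)
 hence "inv\<^bsub>B\<^esub> h s \<otimes>\<^bsub>B\<^esub> inv\<^bsub>B\<^esub> h t \<otimes>\<^bsub>B\<^esub> (h t \<otimes>\<^bsub>B\<^esub> h a) = inv\<^bsub>B\<^esub> h s \<otimes>\<^bsub>B\<^esub> inv\<^bsub>B\<^esub> h t \<otimes>\<^bsub>B\<^esub> (h s \<otimes>\<^bsub>B\<^esub> h b)" by simp
 moreover have "inv\<^bsub>B\<^esub> h s \<otimes>\<^bsub>B\<^esub> inv\<^bsub>B\<^esub> h t \<otimes>\<^bsub>B\<^esub> (h t \<otimes>\<^bsub>B\<^esub> h a) = inv\<^bsub>B\<^esub> h s \<otimes>\<^bsub>B\<^esub> h a \<otimes>\<^bsub>B\<^esub> (inv\<^bsub>B\<^esub> h t \<otimes>\<^bsub>B\<^esub> h t)"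
  using cc by (simp only: B.m_ac B.m_closed B.Units_inv_closed B.Units_closed)
 moreover have "inv\<^bsub>B\<^esub> h s \<otimes>\<^bsub>B\<^esub> inv\<^bsub>B\<^esub> h t \<otimes>\<^bsub>B\<^esub> (h s \<otimes>\<^bsub>B\<^esub> h b) = inv\<^bsub>B\<^esub> h t \<otimes>\<^bsub>B\<^esub> h b \<otimes>\<^bsub>B\<^esub> (inv\<^bsub>B\<^esub> h s \<otimes>\<^bsub>B\<^esub> h s)"
  using cc by (simp only: B.m_ac B.m_closed B.Units_inv_closed B.Units_closed)
 ultimately have "h b \<otimes>\<^bsub>B\<^esub> inv\<^bsub>B\<^esub> h t = h a \<otimes>\<^bsub>B\<^esub> inv\<^bsub>B\<^esub> h s" using cc by (simp add: B.m_comm)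
 thus ?thesis unfolding loc_ext_def z_def[symmetric] bt by simp
qed

lemma loc_ext_hom: assumes B: "cring B" and h: "h : ring_hom R B" and hS: "!!s. s : S ==> h s : Units B"
 shows "loc_ext B h : ring_hom (Loc R S) B" proof -
 interpret B: cring B by (rule B)
 note lf = loc_ext_frac[OF B h hS]
 note hc = ring_hom_closed[OF h]
 have hone: "h \<one> = \<one>\<^bsub>B\<^esub>" by (rule ring_hom_one[OF h])
 show ?thesis proof (rule ring_hom_memI)
  fix z w assume zw: "z : car (Loc R S)" "w : car (Loc R S)"
  then obtain a b s where e: "a : car R" "b : car R" "s : S" "z = frac a s" "w = frac b s" by (rule Loc_common_denom2)
  show "loc_ext B h z : car B" using e hS hc by (simp add: lf)
  show "loc_ext B h (z \<otimes>\<^bsub>Loc R S\<^esub> w) = loc_ext B h z \<otimes>\<^bsub>B\<^esub> loc_ext B h w"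
   using e hS hc S_mult by (simp add: frac_mult lf ring_hom_mult[OF h] B.inv_mult_Units B.m_ac)
  show "loc_ext B h (z \<oplus>\<^bsub>Loc R S\<^esub> w) = loc_ext B h z \<oplus>\<^bsub>B\<^esub> loc_ext B h w"
   using e hS hc by (simp add: frac_add_same lf ring_hom_add[OF h] B.l_distr)
 qed (simp add: Loc_one lf S_one hone)
qed

subsection \<open>Operators on localizations\<close>

text \<open>With q = p^e, the operator is evaluated at (u s t)^(q-1) times the common value u t a =
  u s b. As phi is linear over q-th powers, this equals either numerator multiplied by u^q and by
  the denominator of the other fraction.\<close>

lemma DiffOp_frac_cong: assumes phi: "phi : DL p R e" and p: "p > 0"
  and c: "a : car R" "s : S" "b : car R" "t : S" "u : S" and e: "u \<otimes> (t \<otimes> a) = u \<otimes> (s \<otimes> b)"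
 shows "frac (phi (t [^] (p ^ e - 1) \<otimes> b)) (t [^] (p ^ e)) = frac (phi (s [^] (p ^ e - 1) \<otimes> a)) (s [^] (p ^ e))" proof -
 define k where "k = p ^ e - 1"
 have q: "p ^ e = Suc k" using p by (simp add: k_def)
 note D = DLD[OF phi, unfolded q]
 have cc: "u : car R" "s : car R" "t : car R" using c by auto
 have "u [^] Suc k \<otimes> (s [^] Suc k \<otimes> phi (t [^] k \<otimes> b)) = phi ((u \<otimes> s) [^] Suc k \<otimes> (t [^] k \<otimes> b))"
  using c cc D(2)[of "t [^] k \<otimes> b"] D(4)[of "u \<otimes> s" "t [^] k \<otimes> b"]  by (simp del: nat_pow_Suc add: nat_pow_distrib m_ac)
 also have "(u \<otimes> s) [^] Suc k \<otimes> (t [^] k \<otimes> b) = (u [^] k \<otimes> s [^] k \<otimes> t [^] k) \<otimes> (u \<otimes> (s \<otimes> b))"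
  using c cc by (simp add: nat_pow_distrib m_ac)
 also have "... = (u \<otimes> t) [^] Suc k \<otimes> (s [^] k \<otimes> a)"
  unfolding e[symmetric] using c cc by (simp add: nat_pow_distrib m_ac)
 also have "phi ... = u [^] Suc k \<otimes> (t [^] Suc k \<otimes> phi (s [^] k \<otimes> a))"
  using c cc D(2)[of "s [^] k \<otimes> a"] D(4)[of "u \<otimes> t" "s [^] k \<otimes> a"]  by (simp del: nat_pow_Suc add: nat_pow_distrib m_ac)
 finally show ?thesis unfolding q diff_Suc_1 by (intro frac_eqI2[of _ _ _ _ "u [^] Suc k"]) (use c cc D(2) S_pow S_mult in simp_all)
qed

text \<open>\<open>DiffOp_loc\<close> is evaluated at the least level l of phi. A larger e gives the
  same fraction, expanded by a p^l-th power of a power of s that phi lets pass.\<close>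

lemma DiffOp_loc_frac: assumes phi: "phi : DL p R e" and p: "p > 0" and c: "a : car R" "s : S"
 shows "DiffOp_loc p R S phi (frac a s) = frac (phi (s [^] (p ^ e - 1) \<otimes> a)) (s [^] (p ^ e))" proof -
 define l where "l = level p R phi"
 have l: "phi : DL p R l" "l <= e" using level_least[OF phi] by (simp_all add: l_def)
 have "DiffOp_loc p R S phi (frac a s) = frac (phi (s [^] (p ^ l - 1) \<otimes> a)) (s [^] (p ^ l))" unfolding DiffOp_loc_def Let_def using c
  by (simp add: l_def[symmetric] del: One_nat_def) (rule UN_frac[OF c], rule DiffOp_frac_cong[OF l(1) p c])
 also have "... = frac (phi (s [^] (p ^ e - 1) \<otimes> a)) (s [^] (p ^ e))" proof -
  obtain d where d: "e = l + d" using l(2) le_Suc_ex by blast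
  define m where "m = p ^ d - 1"
  have m: "p ^ e = p ^ l * m + p ^ l" using p by (simp add: d m_def power_add algebra_simps)
  hence m': "p ^ e - 1 = p ^ l * m + (p ^ l - 1)" using p by simp
  have sc: "s : car R" using c by simp
  have "s [^] (p ^ e - 1) \<otimes> a = (s [^] m) [^] (p ^ l) \<otimes> (s [^] (p ^ l - 1) \<otimes> a)"
   unfolding m' using sc c by (simp add: nat_pow_pow nat_pow_mult[symmetric] m_assoc mult.commute)
  hence "phi (s [^] (p ^ e - 1) \<otimes> a) = (s [^] m) [^] (p ^ l) \<otimes> phi (s [^] (p ^ l - 1) \<otimes> a)"
   using sc c DLD(4)[OF l(1)] by simp
  moreover have "s [^] (p ^ e) = (s [^] m) [^] (p ^ l) \<otimes> s [^] (p ^ l)"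
   unfolding m using sc by (simp add: nat_pow_pow nat_pow_mult mult.commute)
  ultimately show ?thesis using sc c DLD(2)[OF l(1)] S_pow by (simp add: frac_expand)
 qed
 finally show ?thesis .
qed

lemma DiffOp_loc_incl: assumes phi: "phi : DL p R e" and p: "p > 0" and c: "a : car R"
 shows "DiffOp_loc p R S phi (loc_incl R S a) = loc_incl R S (phi a)"
 unfolding loc_incl_def DiffOp_loc_frac[OF phi p c S_one] using c by simp

text \<open>Linearity over a q-th power c^q / t^q of the localization: with T = t^q the argument of
  phi acquires T^(q-1), which is the q-th power of t^(q-1). The operator releases it, and it cancels
  against a part of the new denominator.\<close>

lemma DiffOp_loc_level: assumes phi: "phi : DL p R e" and p: "p > 0"
 shows "DiffOp_loc p R S phi : DL p (Loc R S) e" proof -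
 define k where "k = p ^ e - 1"
 have q: "p ^ e = Suc k" using p by (simp add: k_def)
 note F = DiffOp_loc_frac[OF phi p, unfolded q diff_Suc_1]
 note D = DLD[OF phi, unfolded q]
 show ?thesis proof (rule DLI)
  have "DiffOp_loc p R S phi : extensional (car (Loc R S))" by (simp add: DiffOp_loc_def Let_def)
  moreover have "DiffOp_loc p R S phi z : car (Loc R S)" if z: "z : car (Loc R S)" for z proof -
   obtain a s where "a : car R" "s : S" "z = frac a s" using z by (auto simp: carrier_Loc)
   thus ?thesis using D(2) S_pow S_mult by (simp add: F)
  qed
  ultimately show "DiffOp_loc p R S phi : car (Loc R S) \<rightarrow>\<^sub>E car (Loc R S)" by (simp add: PiE_def)
 next
  fix z w assume zw: "z : car (Loc R S)" "w : car (Loc R S)"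
  obtain a b s where e: "a : car R" "b : car R" "s : S" "z = frac a s" "w = frac b s" by (rule Loc_common_denom2[OF zw])
  thus "DiffOp_loc p R S phi (z \<oplus>\<^bsub>Loc R S\<^esub> w) = DiffOp_loc p R S phi z \<oplus>\<^bsub>Loc R S\<^esub> DiffOp_loc p R S phi w"
   using D(2) S_pow S_mult by (simp add: frac_add_same F r_distr D(3))
 next
  fix z w assume zw: "z : car (Loc R S)" "w : car (Loc R S)"
  then obtain c t a s where e: "c : car R" "t : S" "z = frac c t" "a : car R" "s : S" "w = frac a s"
   by (auto simp: carrier_Loc)
  have cc: "s : car R" "t : car R" using e by auto
  define T C where "T = t [^] Suc k" and "C = c [^] Suc k"
  have TC: "T : S" "T : car R" "C : car R" "s [^] k \<otimes> a : car R" 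
   using e cc S_pow[OF e(2), of "Suc k"] unfolding T_def C_def by simp_all
  have Tk: "T [^] k = (t [^] k) [^] Suc k" unfolding T_def by (simp only: nat_pow_pow[OF cc(2)] mult.commute)
  have "phi ((T \<otimes> s) [^] k \<otimes> (C \<otimes> a)) = phi ((t [^] k) [^] Suc k \<otimes> (C \<otimes> (s [^] k \<otimes> a)))"
   by (rule arg_cong[of _ _ phi], subst nat_pow_distrib[OF TC(2) cc(1)], subst Tk)
    (use e cc TC in \<open>simp add: m_ac del: nat_pow_Suc Group.nat_pow_Suc\<close>)
  also have "... = (t [^] k) [^] Suc k \<otimes> (C \<otimes> phi (s [^] k \<otimes> a))"
   using D(4)[of "t [^] k" "C \<otimes> (s [^] k \<otimes> a)"] D(4)[of c "s [^] k \<otimes> a"] e(1) cc TC unfolding C_def by simp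
  finally have h1: "phi ((T \<otimes> s) [^] k \<otimes> (C \<otimes> a)) = (t [^] k) [^] Suc k \<otimes> (C \<otimes> phi (s [^] k \<otimes> a))" .
  have "(T \<otimes> s) [^] Suc k = T [^] Suc k \<otimes> s [^] Suc k" by (rule nat_pow_distrib[OF TC(2) cc(1)])
  also have "... = (t [^] k) [^] Suc k \<otimes> (T \<otimes> s [^] Suc k)"
   unfolding T_def pow_Suc_Suc[OF cc(2)] by (rule m_assoc) (use cc in auto)
  finally have h2: "(T \<otimes> s) [^] Suc k = (t [^] k) [^] Suc k \<otimes> (T \<otimes> s [^] Suc k)" .
  have "DiffOp_loc p R S phi (frac (C \<otimes> a) (T \<otimes> s)) = frac (phi ((T \<otimes> s) [^] k \<otimes> (C \<otimes> a))) ((T \<otimes> s) [^] Suc k)"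
   by (rule F) (use TC e S_mult in auto)
  also have "... = frac (C \<otimes> phi (s [^] k \<otimes> a)) (T \<otimes> s [^] Suc k)"
   unfolding h1 h2 by (rule frac_expand) (use TC D(2) e S_mult S_pow in auto)
  finally have "DiffOp_loc p R S phi (frac (c [^] Suc k \<otimes> a) (t [^] Suc k \<otimes> s)) =
    frac (c [^] Suc k \<otimes> phi (s [^] k \<otimes> a)) (t [^] Suc k \<otimes> s [^] Suc k)" unfolding T_def C_def .
  thus "DiffOp_loc p R S phi (z [^]\<^bsub>Loc R S\<^esub> p ^ e \<otimes>\<^bsub>Loc R S\<^esub> w) = z [^]\<^bsub>Loc R S\<^esub> p ^ e \<otimes>\<^bsub>Loc R S\<^esub> DiffOp_loc p R S phi w"
   unfolding q using e cc D(2) S_pow S_mult by (simp add: frac_pow frac_mult F)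
 qed
qed

lemma DiffOp_loc_hom: assumes p: "p > 0" shows "DiffOp_loc p R S : ring_hom (DiffOp p R) (DiffOp p (Loc R S))" proof -
 interpret L: cring "Loc R S" by (rule cring_Loc)
 have lev: "DiffOp_loc p R S phi : car (DiffOp p (Loc R S))" if "phi : car (DiffOp p R)" for phi
  using that DiffOp_loc_level[OF _ p] unfolding DiffOp_carrier by blast
 show ?thesis proof (rule ring_hom_memI)
  fix phi psi assume fc: "phi : car (DiffOp p R)" "psi : car (DiffOp p R)"
  then obtain e where f: "phi : DL p R e" "psi : DL p R e" using DiffOp_common by blast
  define k where "k = p ^ e - 1"
  have q: "p ^ e = Suc k" using p by (simp add: k_def)
  note F = DiffOp_loc_frac[OF _ p, of _ e, unfolded q diff_Suc_1]
  note DL = DiffOp_loc_level[OF _ p, of _ e]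
  note D1 = DLD[OF f(1), unfolded q] and D2 = DLD[OF f(2), unfolded q]
  have "DiffOp_loc p R S (compose (car R) phi psi) = compose (car (Loc R S)) (DiffOp_loc p R S phi) (DiffOp_loc p R S psi)"
  proof (rule DiffOp_ext[OF DL[OF DiffOp_level_compose[OF f]] L.DiffOp_level_compose[OF DL[OF f(1)] DL[OF f(2)]]])
   fix z assume zc: "z : car (Loc R S)"
   then obtain a s where e: "a : car R" "s : S" "z = frac a s" by (auto simp: carrier_Loc)
   have sc: "s : car R" using e by simp
   have pc: "psi (s [^] k \<otimes> a) : car R" using D2(2) e sc by simp
   have "(s [^] Suc k) [^] k \<otimes> psi (s [^] k \<otimes> a) = (s [^] k) [^] Suc k \<otimes> psi (s [^] k \<otimes> a)"
    by (simp only: nat_pow_pow[OF sc] mult.commute)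
   hence h1: "phi ((s [^] Suc k) [^] k \<otimes> psi (s [^] k \<otimes> a)) = (s [^] k) [^] Suc k \<otimes> phi (psi (s [^] k \<otimes> a))"
    using D1(4) sc pc by simp
   have h2: "(s [^] Suc k) [^] Suc k = (s [^] k) [^] Suc k \<otimes> s [^] Suc k" using sc by (rule pow_Suc_Suc)
   have "DiffOp_loc p R S phi (frac (psi (s [^] k \<otimes> a)) (s [^] Suc k)) =
     frac (phi ((s [^] Suc k) [^] k \<otimes> psi (s [^] k \<otimes> a))) ((s [^] Suc k) [^] Suc k)" by (rule F[OF f(1) pc S_pow[OF e(2)]])
   also have "... = frac (phi (psi (s [^] k \<otimes> a))) (s [^] Suc k)"
    unfolding h1 h2 by (rule frac_expand[OF D1(2)[OF pc] S_pow[OF e(2)] S_pow[OF S_pow[OF e(2)]]])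
   finally have "DiffOp_loc p R S phi (frac (psi (s [^] k \<otimes> a)) (s [^] Suc k)) = frac (phi (psi (s [^] k \<otimes> a))) (s [^] Suc k)" .
   thus "DiffOp_loc p R S (compose (car R) phi psi) z = compose (car (Loc R S)) (DiffOp_loc p R S phi) (DiffOp_loc p R S psi) z"
    using e sc zc F[OF DiffOp_level_compose[OF f]] F[OF f(2)] by (simp add: compose_def del: nat_pow_Suc)
  qed
  thus "DiffOp_loc p R S (phi \<otimes>\<^bsub>DiffOp p R\<^esub> psi) = DiffOp_loc p R S phi \<otimes>\<^bsub>DiffOp p (Loc R S)\<^esub> DiffOp_loc p R S psi"
   by (simp add: DiffOp_ops)
  have "DiffOp_loc p R S (\<lambda>a\<in>car R. phi a \<oplus> psi a) = (\<lambda>z\<in>car (Loc R S). DiffOp_loc p R S phi z \<oplus>\<^bsub>Loc R S\<^esub> DiffOp_loc p R S psi z)"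
  proof (rule DiffOp_ext[OF DL[OF DiffOp_level_add[OF f]] L.DiffOp_level_add[OF DL[OF f(1)] DL[OF f(2)]]])
   fix z assume zc: "z : car (Loc R S)"
   then obtain a s where e: "a : car R" "s : S" "z = frac a s" by (auto simp: carrier_Loc)
   thus "DiffOp_loc p R S (\<lambda>a\<in>car R. phi a \<oplus> psi a) z = (\<lambda>z\<in>car (Loc R S). DiffOp_loc p R S phi z \<oplus>\<^bsub>Loc R S\<^esub> DiffOp_loc p R S psi z) z"
    using zc D1(2) D2(2) S_pow S_mult by (simp add: F[OF f(1)] F[OF f(2)] F[OF DiffOp_level_add[OF f]] frac_add_same del: nat_pow_Suc)
  qed
  thus "DiffOp_loc p R S (phi \<oplus>\<^bsub>DiffOp p R\<^esub> psi) = DiffOp_loc p R S phi \<oplus>\<^bsub>DiffOp p (Loc R S)\<^esub> DiffOp_loc p R S psi"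
   by (simp add: DiffOp_ops)
 next
  show "DiffOp_loc p R S \<one>\<^bsub>DiffOp p R\<^esub> = \<one>\<^bsub>DiffOp p (Loc R S)\<^esub>" unfolding DiffOp_ops
  proof (rule DiffOp_ext[OF DiffOp_loc_level[OF DiffOp_level_one[of _ 0] p] L.DiffOp_level_one[of _ 0]])
   fix z assume zc: "z : car (Loc R S)"
   then obtain a s where e: "a : car R" "s : S" "z = frac a s" by (auto simp: carrier_Loc)
   thus "DiffOp_loc p R S (\<lambda>a\<in>car R. a) z = (\<lambda>a\<in>car (Loc R S). a) z"
    using DiffOp_loc_frac[OF DiffOp_level_one[of _ 0] p e(1,2)] zc by simp
  qed
 qed (rule lev)
qed

end

section \<open>Power series and polynomials\<close>

lemma finite_submultisets: "finite {a. a \<subseteq># (m :: 'i multiset)}" proof (induction m)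
 case (add x m)
 have "{a. a \<subseteq># add_mset x m} <= {a. a \<subseteq># m} \<union> add_mset x ` {a. a \<subseteq># m}" proof
  fix a assume a: "a : {a. a \<subseteq># add_mset x m}"
  show "a : {a. a \<subseteq># m} \<union> add_mset x ` {a. a \<subseteq># m}" proof (cases "x \<in># a")
   case True
   then obtain b where b: "a = add_mset x b" by (metis multi_member_split)
   hence "b \<subseteq># m" using a by simp thus ?thesis using b by blast
  next
   case False
   hence "count a y <= count m y" for y using a mset_subset_eq_count[of a "add_mset x m" y] by (cases "y = x") (auto simp: not_in_iff)
   hence "a \<subseteq># m" by (rule mset_subset_eqI) thus ?thesis by blast
  qed
 qed
 thus ?case using add finite_subset by blast
qed simp

lemma (in abelian_monoid) finsum_Sigma:
 assumes "finite A" "!!a. a : A ==> finite (B a)" "!!a b. a : A ==> b : B a ==> f a b : car G"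
 shows "(\<Oplus>a\<in>A. \<Oplus>b\<in>B a. f a b) = (\<Oplus>z\<in>Sigma A B. f (fst z) (snd z))" using assms proof (induction A)
 case (insert a A)
 have "Sigma (insert a A) B = Pair a ` B a \<union> Sigma A B" by auto
 moreover have "(\<Oplus>z\<in>Pair a ` B a \<union> Sigma A B. f (fst z) (snd z)) =
  (\<Oplus>z\<in>Pair a ` B a. f (fst z) (snd z)) \<oplus> (\<Oplus>z\<in>Sigma A B. f (fst z) (snd z))"
  by (rule finsum_Un_disjoint) (use insert in \<open>auto simp: finite_SigmaI\<close>)
 moreover have "(\<Oplus>z\<in>Pair a ` B a. f (fst z) (snd z)) = (\<Oplus>b\<in>B a. f a b)"
  by (subst finsum_reindex) (use insert in \<open>auto simp: inj_on_def\<close>)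
 moreover have "(\<Oplus>a\<in>insert a A. \<Oplus>b\<in>B a. f a b) = (\<Oplus>b\<in>B a. f a b) \<oplus> (\<Oplus>a\<in>A. \<Oplus>b\<in>B a. f a b)"
  by (rule finsum_insert) (use insert in \<open>auto intro!: finsum_closed\<close>)
 ultimately show ?case using insert by simp
qed simp

text \<open>Power series with the operations of \<open>MPoly\<close> but without restriction on
  support or variables. So \<open>MPoly R r\<close> is a subring with literally the same operations,
  and 1/(f_i - t_i) can be formed when f_i is a unit.\<close>

definition MPS :: "('a, 'm) ring_scheme => (nat multiset => 'a) ring" where
 "MPS R = \<lparr> carrier = {g. \<forall>m. g m : car R},
   monoid.mult = (%g h m. \<Oplus>\<^bsub>R\<^esub>a\<in>{a. a \<subseteq># m}. g a \<otimes>\<^bsub>R\<^esub> h (m - a)),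
   monoid.one = ring.indexed_const R \<one>\<^bsub>R\<^esub>, ring.zero = ring.indexed_const R \<zero>\<^bsub>R\<^esub>,
   ring.add = ring.indexed_padd R \<rparr>"

lemma MPS_sel:
 "g : car (MPS R) \<longleftrightarrow> (\<forall>m. g m : car R)"
 "(g \<otimes>\<^bsub>MPS R\<^esub> h) = (%m. \<Oplus>\<^bsub>R\<^esub>a\<in>{a. a \<subseteq># m}. g a \<otimes>\<^bsub>R\<^esub> h (m - a))"
 "\<one>\<^bsub>MPS R\<^esub> = ring.indexed_const R \<one>\<^bsub>R\<^esub>" "\<zero>\<^bsub>MPS R\<^esub> = ring.indexed_const R \<zero>\<^bsub>R\<^esub>"
 "g \<oplus>\<^bsub>MPS R\<^esub> h = ring.indexed_padd R g h" by (simp_all add: MPS_def)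

lemma MPoly_sel:
 "car (MPoly R r) = ring.indexed_pset R {1..r} (car R)"
 "(g \<otimes>\<^bsub>MPoly R r\<^esub> h) = g \<otimes>\<^bsub>MPS R\<^esub> h" "(g \<oplus>\<^bsub>MPoly R r\<^esub> h) = g \<oplus>\<^bsub>MPS R\<^esub> h"
 "\<one>\<^bsub>MPoly R r\<^esub> = \<one>\<^bsub>MPS R\<^esub>" "\<zero>\<^bsub>MPoly R r\<^esub> = \<zero>\<^bsub>MPS R\<^esub>"
 by (simp_all add: MPS_def MPoly_def)

lemma double_diff_mset: "a \<subseteq># m ==> m - (m - a) = a" by (rule multiset_eqI) (simp add: mset_subset_eq_count)

lemma MPoly_MPS: "MPoly R r = (MPS R)\<lparr>carrier := car (MPoly R r)\<rparr>" by (simp add: MPoly_def MPS_def)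

definition mon :: "('a, 'm) ring_scheme => 'a => nat multiset => (nat multiset => 'a)" where
 "mon R c a = (%m. if m = a then c else \<zero>\<^bsub>R\<^esub>)"

context cring begin

lemma MPS_carrier: "g : car (MPS R) \<longleftrightarrow> (\<forall>m. g m : car R)" by (rule MPS_sel)

lemma MPS_val [simp]: "g : car (MPS R) ==> g m : car R" unfolding MPS_sel by blast

lemma MPS_add: "(g \<oplus>\<^bsub>MPS R\<^esub> h) m = g m \<oplus> h m" by (simp only: MPS_sel indexed_padd_def)

lemma MPS_zero: "\<zero>\<^bsub>MPS R\<^esub> = (%m. \<zero>)" by (simp only: MPS_sel indexed_zero_def)

lemma MPS_one: "\<one>\<^bsub>MPS R\<^esub> = mon R \<one> {#}" by (simp only: MPS_sel mon_def indexed_const_def)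

lemma MPS_mult: "(g \<otimes>\<^bsub>MPS R\<^esub> h) m = (\<Oplus>a\<in>{a. a \<subseteq># m}. g a \<otimes> h (m - a))" by (simp only: MPS_sel)

lemma mon_closed [simp]: "c : car R ==> mon R c a : car (MPS R)" by (simp add: MPS_carrier mon_def)

lemma MPS_mult_single: assumes g: "g : car (MPS R)" and h: "h : car (MPS R)" and "a0 \<subseteq># m"
  and z: "!!a. a \<subseteq># m ==> a ~= a0 ==> g a \<otimes> h (m - a) = \<zero>"
 shows "(g \<otimes>\<^bsub>MPS R\<^esub> h) m = g a0 \<otimes> h (m - a0)" proof -
 have "(\<Oplus>a\<in>{a0}. g a \<otimes> h (m - a)) = (\<Oplus>a\<in>{a. a \<subseteq># m}. g a \<otimes> h (m - a))"
  by (rule add.finprod_mono_neutral_cong_left) (use assms finite_submultisets in auto) thus ?thesis using g h by (simp add: MPS_mult)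
qed

lemma mon_mult: assumes c: "c : car R" and h: "h : car (MPS R)"
 shows "(mon R c a \<otimes>\<^bsub>MPS R\<^esub> h) m = (if a \<subseteq># m then c \<otimes> h (m - a) else \<zero>)"
proof (cases "a \<subseteq># m")
 case True
 hence "(mon R c a \<otimes>\<^bsub>MPS R\<^esub> h) m = mon R c a a \<otimes> h (m - a)"
  by (intro MPS_mult_single mon_closed) (use c h in \<open>auto simp: mon_def\<close>) thus ?thesis using True by (simp add: mon_def)
next
 case False
 have "(mon R c a \<otimes>\<^bsub>MPS R\<^esub> h) m = (\<Oplus>b\<in>{b. b \<subseteq># m}. \<zero>)"
  unfolding MPS_mult by (rule finsum_cong') (use False h in \<open>auto simp: mon_def\<close>) thus ?thesis using False by simp
qed

lemma MPS_mult_closed: "g : car (MPS R) ==> h : car (MPS R) ==> g \<otimes>\<^bsub>MPS R\<^esub> h : car (MPS R)"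
 by (simp add: MPS_carrier MPS_mult finsum_closed)

lemma MPS_mult_comm: assumes g: "g : car (MPS R)" and h: "h : car (MPS R)"
 shows "g \<otimes>\<^bsub>MPS R\<^esub> h = h \<otimes>\<^bsub>MPS R\<^esub> g" proof
 fix m :: "nat multiset"
 have im: "(%a. m - a) ` {a. a \<subseteq># m} = {a. a \<subseteq># m}" proof (intro equalityI subsetI)
  fix a assume "a : {a. a \<subseteq># m}"
  hence "a = m - (m - a)" "m - a \<subseteq># m" by (auto simp: double_diff_mset)
  thus "a : (%a. m - a) ` {a. a \<subseteq># m}" by blast
 qed auto
 have inj: "inj_on (%a. m - a) {a. a \<subseteq># m}" proof (rule inj_onI)
  fix a b assume "a : {a. a \<subseteq># m}" "b : {a. a \<subseteq># m}" "m - a = m - b"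
  thus "a = b" by (metis double_diff_mset mem_Collect_eq)
 qed
 have "(h \<otimes>\<^bsub>MPS R\<^esub> g) m = (\<Oplus>a\<in>(%a. m - a) ` {a. a \<subseteq># m}. h a \<otimes> g (m - a))"
  by (simp add: MPS_mult im)
 also have "... = (\<Oplus>a\<in>{a. a \<subseteq># m}. h (m - a) \<otimes> g (m - (m - a)))" by (rule finsum_reindex) (use g h inj in auto)
 also have "... = (g \<otimes>\<^bsub>MPS R\<^esub> h) m"
  unfolding MPS_mult by (rule finsum_cong') (use g h in \<open>auto simp: double_diff_mset m_comm\<close>)
 finally show "(g \<otimes>\<^bsub>MPS R\<^esub> h) m = (h \<otimes>\<^bsub>MPS R\<^esub> g) m" ..
qed

text \<open>Both sides are sums over the ordered decompositions of m into three parts; T sends the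
  pair (b, c) of the one bracketing to the pair (b + c, b) of the other.\<close>

lemma MPS_mult_assoc: assumes g: "g : car (MPS R)" and h: "h : car (MPS R)" and k: "k : car (MPS R)"
 shows "g \<otimes>\<^bsub>MPS R\<^esub> h \<otimes>\<^bsub>MPS R\<^esub> k = g \<otimes>\<^bsub>MPS R\<^esub> (h \<otimes>\<^bsub>MPS R\<^esub> k)"
proof
 fix m :: "nat multiset"
 define D where "D = Sigma {b. b \<subseteq># m} (%b. {c. c \<subseteq># m - b})"
 define T :: "nat multiset \<times> nat multiset => nat multiset \<times> nat multiset" where "T z = (fst z + snd z, fst z)" for z
 have im: "T ` D = Sigma {a. a \<subseteq># m} (%a. {b. b \<subseteq># a})" proof (intro equalityI subsetI)
  fix z assume "z : T ` D"
  then obtain b c where z: "z = (b + c, b)" "b \<subseteq># m" "c \<subseteq># m - b" by (auto simp: D_def T_def)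
  hence "b + c \<subseteq># m" by (metis add.commute subset_eq_diff_conv subset_mset.le_diff_conv2)
  thus "z : Sigma {a. a \<subseteq># m} (%a. {b. b \<subseteq># a})" using z by simp
 next
  fix z assume "z : Sigma {a. a \<subseteq># m} (%a. {b. b \<subseteq># a})"
  then obtain a b where z: "z = (a, b)" "a \<subseteq># m" "b \<subseteq># a" by auto
  have "b \<subseteq># m" using z by (meson subset_mset.order_trans)
  moreover have "a - b \<subseteq># m - b" using z by (intro mset_subset_eqI) (simp add: diff_le_mono mset_subset_eq_count)
  moreover have "T (b, a - b) = z" using z by (simp add: T_def)
  ultimately show "z : T ` D" by (force simp: D_def)
 qed
 have inj: "inj_on T D" by (auto simp: inj_on_def T_def D_def)
 have "(g \<otimes>\<^bsub>MPS R\<^esub> h \<otimes>\<^bsub>MPS R\<^esub> k) m = (\<Oplus>a\<in>{a. a \<subseteq># m}. \<Oplus>b\<in>{b. b \<subseteq># a}. g b \<otimes> h (a - b) \<otimes> k (m - a))"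
  unfolding MPS_mult[of _ k] proof (rule finsum_cong'[OF refl])
  fix a
  show "(g \<otimes>\<^bsub>MPS R\<^esub> h) a \<otimes> k (m - a) = (\<Oplus>b\<in>{b. b \<subseteq># a}. g b \<otimes> h (a - b) \<otimes> k (m - a))"
   unfolding MPS_mult by (rule finsum_ldistr) (use g h k finite_submultisets in auto)
 qed (use g h k in \<open>auto intro!: finsum_closed\<close>)
 also have "... = (\<Oplus>z\<in>T ` D. g (snd z) \<otimes> h (fst z - snd z) \<otimes> k (m - fst z))"
  unfolding im by (rule finsum_Sigma) (use g h k finite_submultisets in auto)
 also have "... = (\<Oplus>z\<in>D. g (snd (T z)) \<otimes> h (fst (T z) - snd (T z)) \<otimes> k (m - fst (T z)))"
  by (rule finsum_reindex) (use g h k inj in auto)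
 also have "... = (\<Oplus>z\<in>D. g (fst z) \<otimes> (h (snd z) \<otimes> k (m - fst z - snd z)))"
  by (rule finsum_cong') (use g h k in \<open>auto simp: T_def m_assoc\<close>)
 also have "... = (\<Oplus>b\<in>{b. b \<subseteq># m}. \<Oplus>c\<in>{c. c \<subseteq># m - b}. g b \<otimes> (h c \<otimes> k (m - b - c)))"
  unfolding D_def by (rule finsum_Sigma[symmetric]) (use g h k finite_submultisets in auto)
 also have "... = (g \<otimes>\<^bsub>MPS R\<^esub> (h \<otimes>\<^bsub>MPS R\<^esub> k)) m" unfolding MPS_mult[of g]
 proof (rule finsum_cong'[OF refl])
  fix b
  show "(\<Oplus>c\<in>{c. c \<subseteq># m - b}. g b \<otimes> (h c \<otimes> k (m - b - c))) = g b \<otimes> (h \<otimes>\<^bsub>MPS R\<^esub> k) (m - b)"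
   unfolding MPS_mult by (rule finsum_rdistr[symmetric]) (use g h k finite_submultisets in auto)
 qed (use g h k MPS_mult_closed[OF h k] in auto)
 finally show "(g \<otimes>\<^bsub>MPS R\<^esub> h \<otimes>\<^bsub>MPS R\<^esub> k) m = (g \<otimes>\<^bsub>MPS R\<^esub> (h \<otimes>\<^bsub>MPS R\<^esub> k)) m" .
qed

lemma cring_MPS: "cring (MPS R)" proof (rule cringI)
 show "abelian_group (MPS R)" proof (rule abelian_groupI)
  fix g assume g: "g : car (MPS R)"
  have "(%m. \<ominus> g m) \<oplus>\<^bsub>MPS R\<^esub> g = \<zero>\<^bsub>MPS R\<^esub>"
   by (rule ext) (use g in \<open>simp add: MPS_add MPS_zero l_neg\<close>)
  moreover have "(%m. \<ominus> g m) : car (MPS R)" using g by (simp add: MPS_carrier)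
  ultimately show "\<exists>h\<in>car (MPS R). h \<oplus>\<^bsub>MPS R\<^esub> g = \<zero>\<^bsub>MPS R\<^esub>" by blast
 qed (auto simp: MPS_carrier fun_eq_iff MPS_add MPS_zero a_ac)
 show "comm_monoid (MPS R)" proof (rule comm_monoidI)
  fix g assume g: "g : car (MPS R)"
  show "\<one>\<^bsub>MPS R\<^esub> \<otimes>\<^bsub>MPS R\<^esub> g = g" by (rule ext) (use g in \<open>simp add: MPS_one mon_mult\<close>)
 qed (auto simp: MPS_one intro: MPS_mult_closed MPS_mult_assoc MPS_mult_comm)
 fix g h k assume c: "g : car (MPS R)" "h : car (MPS R)" "k : car (MPS R)"
 show "(g \<oplus>\<^bsub>MPS R\<^esub> h) \<otimes>\<^bsub>MPS R\<^esub> k = g \<otimes>\<^bsub>MPS R\<^esub> k \<oplus>\<^bsub>MPS R\<^esub> h \<otimes>\<^bsub>MPS R\<^esub> k"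
 proof
  fix m
  have "((g \<oplus>\<^bsub>MPS R\<^esub> h) \<otimes>\<^bsub>MPS R\<^esub> k) m = (\<Oplus>a\<in>{a. a \<subseteq># m}. g a \<otimes> k (m - a) \<oplus> h a \<otimes> k (m - a))"
   unfolding MPS_mult MPS_add by (rule finsum_cong') (use c in \<open>auto simp: l_distr\<close>)
  also have "... = (g \<otimes>\<^bsub>MPS R\<^esub> k \<oplus>\<^bsub>MPS R\<^esub> h \<otimes>\<^bsub>MPS R\<^esub> k) m"
   unfolding MPS_mult MPS_add by (rule finsum_addf) (use c in auto)
  finally show "((g \<oplus>\<^bsub>MPS R\<^esub> h) \<otimes>\<^bsub>MPS R\<^esub> k) m = (g \<otimes>\<^bsub>MPS R\<^esub> k \<oplus>\<^bsub>MPS R\<^esub> h \<otimes>\<^bsub>MPS R\<^esub> k) m" .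
 qed
qed

lemma MPS_minus: assumes g: "g : car (MPS R)" shows "(\<ominus>\<^bsub>MPS R\<^esub> g) m = \<ominus> g m" proof -
 interpret P: cring "MPS R" by (rule cring_MPS)
 have "(\<ominus>\<^bsub>MPS R\<^esub> g) m \<oplus> g m = \<zero>"
  using P.l_neg[OF g] MPS_add[of "\<ominus>\<^bsub>MPS R\<^esub> g" g m] by (simp add: MPS_zero)
 thus ?thesis using g by (simp add: minus_equality)
qed

lemma mon_mult_mon: assumes "c : car R" "d : car R"
 shows "mon R c a \<otimes>\<^bsub>MPS R\<^esub> mon R d b = mon R (c \<otimes> d) (a + b)" proof
 fix m show "(mon R c a \<otimes>\<^bsub>MPS R\<^esub> mon R d b) m = mon R (c \<otimes> d) (a + b) m"
  using assms by (auto simp: mon_mult) (auto simp: mon_def subset_mset.add_diff_inverse)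
qed

lemma mon_pow: "c : car R ==> mon R c a [^]\<^bsub>MPS R\<^esub> (n::nat) = mon R (c [^] n) (repeat_mset n a)"
 by (induction n) (simp_all add: MPS_one mon_mult_mon add.commute)

subsection \<open>Polynomials\<close>

lemma mon_MPoly: assumes c: "c : car R" and a: "set_mset a <= {1..r}" shows "mon R c a : car (MPoly R r)" using a
proof (induction a)
 case empty
 show ?case using indexed_pset.indexed_const[OF c, of "{1..r}"] by (simp only: MPoly_sel mon_def indexed_const_def)
next
 case (add i a)
 hence "indexed_pmult (mon R c a) i : car (MPoly R r)" unfolding MPoly_sel by (intro indexed_pset.indexed_pmult) auto
 moreover have "indexed_pmult (mon R c a) i = mon R c (add_mset i a)" by (auto simp: indexed_pmult_def mon_def fun_eq_iff)
 ultimately show ?case by simp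
qed

text \<open>Replaces the inductive generation of \<open>indexed_pset\<close> by a condition on
  supports. For the converse, a polynomial is rebuilt by removing one monomial of its support at a
  time.\<close>

lemma MPoly_carrier: "g : car (MPoly R r) \<longleftrightarrow>
 (\<forall>m. g m : car R) \<and> finite {m. g m ~= \<zero>} \<and> (\<forall>m. g m ~= \<zero> \<longrightarrow> set_mset m <= {1..r})"
 (is "_ \<longleftrightarrow> ?P g") proof
 assume "g : car (MPoly R r)"
 hence "g : indexed_pset {1..r} (car R)" by (simp only: MPoly_sel)
 thus "?P g" proof (induction rule: indexed_pset.induct)
  case (indexed_const k)
  have "finite {m :: nat multiset. indexed_const k m ~= \<zero>}" by (rule finite_subset[of _ "{{#}}"]) (auto simp: indexed_const_def)
  thus ?case using indexed_const by (auto simp: indexed_const_def)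
 next
  case (indexed_padd P Q)
  have "finite {m. indexed_padd P Q m ~= \<zero>}"
   by (rule finite_subset[of _ "{m. P m ~= \<zero>} \<union> {m. Q m ~= \<zero>}"]) (use indexed_padd in \<open>auto simp: indexed_padd_def\<close>)
  moreover have "set_mset m <= {1..r}" if "P m \<oplus> Q m ~= \<zero>" for m using that indexed_padd by (cases "P m = \<zero>") auto
  ultimately show ?case using indexed_padd by (simp add: indexed_padd_def)
 next
  case (indexed_pmult P i)
  have "finite {m. indexed_pmult P i m ~= \<zero>}" proof (rule finite_subset)
   show "finite (add_mset i ` {m. P m ~= \<zero>})" using indexed_pmult by blast
   show "{m. indexed_pmult P i m ~= \<zero>} <= add_mset i ` {m. P m ~= \<zero>}" proof
    fix m assume "m : {m. indexed_pmult P i m ~= \<zero>}"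
    hence "i \<in># m" "P (m - {#i#}) ~= \<zero>" by (auto simp: indexed_pmult_def split: if_splits)
    thus "m : add_mset i ` {m. P m ~= \<zero>}" by (intro image_eqI[of _ _ "m - {#i#}"]) auto
   qed
  qed
  moreover have "set_mset m <= {1..r}" if m: "indexed_pmult P i m ~= \<zero>" for m proof -
   have i: "i \<in># m" and "P (m - {#i#}) ~= \<zero>" using m by (auto simp: indexed_pmult_def split: if_splits)
   hence "set_mset (m - {#i#}) <= {1..r}" using indexed_pmult by blast
   moreover have "set_mset m = insert i (set_mset (m - {#i#}))" using i by (metis insert_DiffM set_mset_add_mset_insert)
   ultimately show ?thesis using indexed_pmult.hyps by auto
  qed
  ultimately show ?case using indexed_pmult by (simp add: indexed_pmult_def)
 qed
next
 assume P: "?P g"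
 have "?P g ==> g : car (MPoly R r)" if "finite M" "{m. g m ~= \<zero>} = M" for M using that
 proof (induction M arbitrary: g)
  case empty
  hence "g = mon R \<zero> {#}" by (auto simp: mon_def fun_eq_iff)
  thus ?case using mon_MPoly[of \<zero> "{#}"] by simp
 next
  case (insert a M)
  define h where "h = g(a := \<zero>)"
  have hM: "{m. h m ~= \<zero>} = M" using insert by (auto simp: h_def)
  have "?P h" unfolding hM using insert by (auto simp: h_def)
  hence h1: "h : car (MPoly R r)" using insert.IH[OF _ hM] by blast
  have "g a ~= \<zero>" using insert.prems by blast
  hence h2: "mon R (g a) a : car (MPoly R r)" using insert.prems by (intro mon_MPoly) auto
  have h3: "g = indexed_padd (mon R (g a) a) h" using insert.prems(1) by (auto simp: indexed_padd_def mon_def h_def fun_eq_iff)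
  show ?case using indexed_pset.indexed_padd[OF h2[unfolded MPoly_sel] h1[unfolded MPoly_sel]] h3 unfolding MPoly_sel by simp
 qed
 thus "g : car (MPoly R r)" using P by blast
qed

lemma MPoly_MPS_sub: "g : car (MPoly R r) ==> g : car (MPS R)" by (simp add: MPoly_carrier MPS_carrier)

lemma MPoly_ops:
 "(g \<otimes>\<^bsub>MPoly R r\<^esub> h) = g \<otimes>\<^bsub>MPS R\<^esub> h" "(g \<oplus>\<^bsub>MPoly R r\<^esub> h) = g \<oplus>\<^bsub>MPS R\<^esub> h"
 "\<one>\<^bsub>MPoly R r\<^esub> = \<one>\<^bsub>MPS R\<^esub>" "\<zero>\<^bsub>MPoly R r\<^esub> = \<zero>\<^bsub>MPS R\<^esub>"
 by (rule MPoly_sel)+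

lemma MPoly_pow: "g [^]\<^bsub>MPoly R r\<^esub> (n::nat) = g [^]\<^bsub>MPS R\<^esub> n" by (simp add: nat_pow_def MPoly_ops)

lemma MPS_mult_support: assumes "g : car (MPS R)" "h : car (MPS R)" "(g \<otimes>\<^bsub>MPS R\<^esub> h) m ~= \<zero>"
 shows "\<exists>a b. m = a + b \<and> g a ~= \<zero> \<and> h b ~= \<zero>" proof (rule ccontr)
 assume n: "\<not> ?thesis"
 have "g a \<otimes> h (m - a) = \<zero>" if "a \<subseteq># m" for a proof (cases "g a = \<zero>")
  case False
  hence "h (m - a) = \<zero>" using n that by (metis subset_mset.add_diff_inverse) thus ?thesis using assms by simp
 qed (use assms in simp)
 hence "(g \<otimes>\<^bsub>MPS R\<^esub> h) m = (\<Oplus>a\<in>{a. a \<subseteq># m}. \<zero>)" unfolding MPS_mult by (intro finsum_cong') auto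
 thus False using assms by simp
qed

lemma subcring_MPoly: "subcring (car (MPoly R r)) (MPS R)" proof -
 interpret P: cring "MPS R" by (rule cring_MPS)
 have "subring (car (MPoly R r)) (MPS R)" proof (rule P.subringI)
  show "car (MPoly R r) <= car (MPS R)" using MPoly_MPS_sub by blast
  show "\<one>\<^bsub>MPS R\<^esub> : car (MPoly R r)" unfolding MPS_one by (rule mon_MPoly) auto
 next
  fix g assume g: "g : car (MPoly R r)"
  have "(\<ominus>\<^bsub>MPS R\<^esub> g) m = \<ominus> g m" for m using g MPoly_MPS_sub MPS_minus by blast
  moreover have "\<ominus> g m = \<zero> \<longleftrightarrow> g m = \<zero>" for m using g by (simp add: MPoly_carrier add.inv_eq_1_iff)
  ultimately show "\<ominus>\<^bsub>MPS R\<^esub> g : car (MPoly R r)" using g by (simp add: MPoly_carrier)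
 next
  fix g h assume g: "g : car (MPoly R r)" and h: "h : car (MPoly R r)"
  show "g \<oplus>\<^bsub>MPS R\<^esub> h : car (MPoly R r)" using g h unfolding MPoly_sel MPS_sel by (rule indexed_pset.indexed_padd)
  have s: "m : (\<lambda>(a, b). a + b) ` ({a. g a ~= \<zero>} \<times> {b. h b ~= \<zero>})" if "(g \<otimes>\<^bsub>MPS R\<^esub> h) m ~= \<zero>" for m
   using MPS_mult_support[OF _ _ that] g h MPoly_MPS_sub by fast
  have "finite {m. (g \<otimes>\<^bsub>MPS R\<^esub> h) m ~= \<zero>}"
   by (rule finite_subset[of _ "(\<lambda>(a, b). a + b) ` ({a. g a ~= \<zero>} \<times> {b. h b ~= \<zero>})"])
    (use s g h in \<open>auto simp: MPoly_carrier\<close>)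
  moreover have "set_mset m <= {1..r}" if m: "(g \<otimes>\<^bsub>MPS R\<^esub> h) m ~= \<zero>" for m proof -
   obtain a b where "m = a + b" "g a ~= \<zero>" "h b ~= \<zero>" using s[OF m] by auto
   thus ?thesis using g h by (auto simp: MPoly_carrier)
  qed
  moreover have "g \<otimes>\<^bsub>MPS R\<^esub> h : car (MPS R)" using g h MPoly_MPS_sub by (intro MPS_mult_closed)
  ultimately show "g \<otimes>\<^bsub>MPS R\<^esub> h : car (MPoly R r)" by (simp add: MPoly_carrier MPS_carrier)
 qed
 thus ?thesis by (rule P.subcringI')
qed

lemma cring_MPoly: "cring (MPoly R r)" proof -
 interpret P: cring "MPS R" by (rule cring_MPS)
 show ?thesis using P.subcring_iff[of "car (MPoly R r)"] subcring_MPoly MPoly_MPS_sub MPoly_MPS[of R r] by (metis subsetI)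
qed

lemma MPoly_incl_hom: "(%g. g) : ring_hom (MPoly R r) (MPS R)" by (rule ring_hom_memI) (auto simp: MPoly_ops MPoly_MPS_sub)

lemma mpoly_map_hom: assumes B: "cring B" and h: "h : ring_hom R B" shows "mpoly_map h : ring_hom (MPoly R r) (MPoly B r)" proof -
 interpret B: cring B by (rule B)
 interpret h: ring_hom_cring R B h by (intro ring_hom_cring.intro ring_hom_cring_axioms.intro) (use h in \<open>auto intro: cring_axioms B\<close>)
 show ?thesis proof (rule ring_hom_memI)
  fix g assume g: "g : car (MPoly R r)"
  have "finite {m. mpoly_map h g m ~= \<zero>\<^bsub>B\<^esub>}"
   by (rule finite_subset[of _ "{m. g m ~= \<zero>}"]) (use g in \<open>auto simp: MPoly_carrier mpoly_map_def\<close>)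
  moreover have "set_mset m <= {1..r}" if "h (g m) ~= \<zero>\<^bsub>B\<^esub>" for m proof -
   have "g m ~= \<zero>" using that by auto thus ?thesis using g by (auto simp: MPoly_carrier)
  qed
  ultimately show "mpoly_map h g : car (MPoly B r)" using g by (simp add: MPoly_carrier B.MPoly_carrier mpoly_map_def)
 next
  fix f g assume g: "f : car (MPoly R r)" "g : car (MPoly R r)"
  hence fg: "!!m. f m : car R" "!!m. g m : car R" by (auto simp: MPoly_carrier)
  show "mpoly_map h (f \<otimes>\<^bsub>MPoly R r\<^esub> g) = mpoly_map h f \<otimes>\<^bsub>MPoly B r\<^esub> mpoly_map h g" proof
   fix m
   have "mpoly_map h (f \<otimes>\<^bsub>MPoly R r\<^esub> g) m = (\<Oplus>\<^bsub>B\<^esub>a\<in>{a. a \<subseteq># m}. (h \<circ> (%a. f a \<otimes> g (m - a))) a)"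
    unfolding mpoly_map_def MPoly_ops MPS_mult by (rule h.hom_finsum) (use fg in auto)
   also have "... = (\<Oplus>\<^bsub>B\<^esub>a\<in>{a. a \<subseteq># m}. h (f a) \<otimes>\<^bsub>B\<^esub> h (g (m - a)))"
    by (rule B.finsum_cong') (use fg in auto)
   finally show "mpoly_map h (f \<otimes>\<^bsub>MPoly R r\<^esub> g) m = (mpoly_map h f \<otimes>\<^bsub>MPoly B r\<^esub> mpoly_map h g) m"
    by (simp add: mpoly_map_def B.MPoly_ops B.MPS_mult)
  qed
  show "mpoly_map h (f \<oplus>\<^bsub>MPoly R r\<^esub> g) = mpoly_map h f \<oplus>\<^bsub>MPoly B r\<^esub> mpoly_map h g"
   using fg by (auto simp: mpoly_map_def MPoly_ops B.MPoly_ops MPS_add B.MPS_add)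
 next
  show "mpoly_map h \<one>\<^bsub>MPoly R r\<^esub> = \<one>\<^bsub>MPoly B r\<^esub>"
   by (auto simp: mpoly_map_def MPoly_ops B.MPoly_ops MPS_one B.MPS_one mon_def)
 qed
qed

lemma mpoly_map_mon:  assumes "h \<zero> = \<zero>\<^bsub>B\<^esub>" shows "mpoly_map h (mon R c a) = mon B (h c) a"
 using assms by (auto simp: mpoly_map_def mon_def)

lemma f_minus_t_eq: assumes "i : {1..r}" "f i : car R"
 shows "f_minus_t R r f i = mon R (f i) {#} \<ominus>\<^bsub>MPoly R r\<^esub> mon R \<one> {#i#}" and "f_minus_t R r f i : car (MPoly R r)"
proof -
 interpret P: cring "MPoly R r" by (rule cring_MPoly)
 have "indexed_const (f i) = mon R (f i) {#}" by (simp add: indexed_const_def mon_def)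
 moreover have "indexed_var i = mon R \<one> {#i#}"
  by (auto simp: indexed_var_def indexed_pmult_def indexed_const_def mon_def fun_eq_iff dest: multi_member_split)
 ultimately show eq: "f_minus_t R r f i = mon R (f i) {#} \<ominus>\<^bsub>MPoly R r\<^esub> mon R \<one> {#i#}" unfolding f_minus_t_def by simp
 show "f_minus_t R r f i : car (MPoly R r)" unfolding eq by (rule P.minus_closed) (use assms in \<open>auto intro!: mon_MPoly\<close>)
qed

subsection \<open>Products of series in one variable\<close>

definition PS :: "nat => (nat => 'a) => (nat multiset => 'a)" where
 "PS i c = (%m. if set_mset m <= {i} then c (count m i) else \<zero>)"

lemma PS_closed: "(!!k. c k : car R) ==> PS i c : car (MPS R)" by (simp add: PS_def MPS_carrier)

text \<open>The factors are series in distinct variables, and a monomial distributes over these in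
  one way only.\<close>

lemma finprod_PS: assumes "finite J" and c: "!!i k. c i k : car R"
 shows "(\<Otimes>\<^bsub>MPS R\<^esub>i\<in>J. PS i (c i)) m = (if set_mset m <= J then (\<Otimes>i\<in>J. c i (count m i)) else \<zero>)"
 using \<open>finite J\<close> proof (induction J arbitrary: m)
 case empty
 interpret P: cring "MPS R" by (rule cring_MPS)
 show ?case by (auto simp: MPS_one mon_def)
next
 case (insert i J)
 interpret P: cring "MPS R" by (rule cring_MPS)
 have cl: "(%i. PS i (c i)) : J \<rightarrow> car (MPS R)" "PS i (c i) : car (MPS R)" using c by (auto intro: PS_closed)
 define Q where "Q = (\<Otimes>\<^bsub>MPS R\<^esub>i\<in>J. PS i (c i))"
 have Q: "Q : car (MPS R)" unfolding Q_def using cl by simp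
 have IH: "Q m = (if set_mset m <= J then (\<Otimes>i\<in>J. c i (count m i)) else \<zero>)" for m unfolding Q_def by (rule insert.IH)
 have "(\<Otimes>\<^bsub>MPS R\<^esub>i\<in>insert i J. PS i (c i)) m = (PS i (c i) \<otimes>\<^bsub>MPS R\<^esub> Q) m"
  unfolding Q_def using insert cl by simp
 also have "... = PS i (c i) (rep (count m i) i) \<otimes> Q (m - rep (count m i) i)"
 proof (rule MPS_mult_single[OF cl(2) Q])
  show "rep (count m i) i \<subseteq># m" by (simp add: count_le_replicate_mset_subset_eq[symmetric])
  fix a assume a: "a \<subseteq># m" "a ~= rep (count m i) i"
  show "PS i (c i) a \<otimes> Q (m - a) = \<zero>" proof (cases "set_mset a <= {i} \<and> set_mset (m - a) <= J")
   case True
   have "i \<notin># m - a" using True insert by blast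
   hence "count m i <= count a i" by (simp add: not_in_iff)
   moreover have "count a i <= count m i" using a by (simp add: mset_subset_eq_count)
   ultimately have "count a i = count m i" by simp
   hence "a = rep (count m i) i" using True by (intro multiset_eqI) (auto simp: not_in_iff) thus ?thesis using a by simp
  next
   case False
   hence "PS i (c i) a = \<zero> \<or> Q (m - a) = \<zero>" by (auto simp: IH PS_def) thus ?thesis using cl(2) Q by auto
  qed
 qed
 also have "PS i (c i) (rep (count m i) i) = c i (count m i)" by (auto simp: PS_def)
 also have "Q (m - rep (count m i) i) = (if set_mset m <= insert i J then (\<Otimes>i\<in>J. c i (count m i)) else \<zero>)"
 proof -
  have "set_mset (m - rep (count m i) i) = set_mset m - {i}" by (auto simp: set_eq_iff in_diff_count)
  hence "set_mset (m - rep (count m i) i) <= J \<longleftrightarrow> set_mset m <= insert i J" by blast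
  moreover have "(\<Otimes>j\<in>J. c j (count (m - rep (count m i) i) j)) = (\<Otimes>j\<in>J. c j (count m j))"
   by (rule finprod_cong') (use insert c in auto)
  ultimately show ?thesis unfolding IH by simp
 qed
 finally show ?case using insert c by (auto simp: Pi_iff)
qed

lemma mult_diff_series: assumes u: "u : car R" and w: "w : car (MPS R)"
 shows "((mon R u {#} \<ominus>\<^bsub>MPS R\<^esub> mon R \<one> a) \<otimes>\<^bsub>MPS R\<^esub> w) m = u \<otimes> w m \<ominus> (if a \<subseteq># m then w (m - a) else \<zero>)"
proof -
 interpret P: cring "MPS R" by (rule cring_MPS)
 have "(mon R u {#} \<ominus>\<^bsub>MPS R\<^esub> mon R \<one> a) \<otimes>\<^bsub>MPS R\<^esub> w =
  mon R u {#} \<otimes>\<^bsub>MPS R\<^esub> w \<oplus>\<^bsub>MPS R\<^esub> \<ominus>\<^bsub>MPS R\<^esub> (mon R \<one> a \<otimes>\<^bsub>MPS R\<^esub> w)"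
  using u w by (simp add: a_minus_def P.l_distr P.l_minus) thus ?thesis using u w by (simp add: MPS_add MPS_minus mon_mult a_minus_def)
qed

text \<open>The geometric series: 1/(u^q - t^q) is the sum of t^k / u^(k+q) over the multiples k of
  q. Here k is the exponent of t, not the index of the term.\<close>

lemma inverse_diff_series: assumes u: "u : Units R" and q: "q > 0"
 shows "(mon R (u [^] q) {#} \<ominus>\<^bsub>MPS R\<^esub> mon R \<one> (rep q i)) \<otimes>\<^bsub>MPS R\<^esub>
  PS i (%k. if q dvd k then inv (u [^] (k + q)) else \<zero>) = \<one>\<^bsub>MPS R\<^esub>" proof
 fix m
 let ?c = "%k. if q dvd k then inv (u [^] (k + q)) else \<zero>"
 have uc: "u : car R" using u by auto
 have up: "u [^] (n::nat) : Units R" for n using u by (rule Units_pow_closed)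
 have cc: "?c k : car R" for k using up by auto
 have PSc: "PS i ?c : car (MPS R)" by (rule PS_closed[OF cc])
 let ?L = "((mon R (u [^] q) {#} \<ominus>\<^bsub>MPS R\<^esub> mon R \<one> (rep q i)) \<otimes>\<^bsub>MPS R\<^esub> PS i ?c) m"
 have L: "?L = u [^] q \<otimes> PS i ?c m \<ominus> (if rep q i \<subseteq># m then PS i ?c (m - rep q i) else \<zero>)"
  by (rule mult_diff_series[OF _ PSc]) (use uc in simp)
 show "?L = \<one>\<^bsub>MPS R\<^esub> m" proof (cases "set_mset m <= {i}")
  case False
  have "\<not> set_mset (m - rep q i) <= {i}" proof
   assume s: "set_mset (m - rep q i) <= {i}"
   obtain j where "j \<in># m" "j ~= i" using False by auto
   hence "j \<in># m - rep q i" by (simp add: in_diff_count)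
   thus False using s \<open>j ~= i\<close> by blast
  qed
  moreover have "m ~= {#}" using False by auto
  ultimately show ?thesis unfolding L using False uc by (simp add: PS_def MPS_one mon_def a_minus_def)
 next
  case True
  define k where "k = count m i"
  have mk: "m = rep k i" using True by (intro multiset_eqI) (auto simp: k_def not_in_iff)
  have sub: "rep q i \<subseteq># m \<longleftrightarrow> q <= k" by (simp add: mk subseteq_mset_def)
  have Pm: "PS i ?c m = ?c k" by (simp add: PS_def True k_def)
  have Pq: "PS i ?c (m - rep q i) = ?c (k - q)"  using True by (auto simp: PS_def k_def dest: in_diffD)
  have e: "u [^] q \<otimes> inv (u [^] (k + q)) = inv (u [^] k)" proof -
   have "inv (u [^] (k + q)) = inv (u [^] k) \<otimes> inv (u [^] q)" using up uc by (simp add: nat_pow_mult[symmetric] inv_mult_Units)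
   thus ?thesis using up uc by (simp add: m_lcomm[of _ "inv (u [^] k)"])
  qed
  show ?thesis proof (cases "k = 0")
   case True thus ?thesis unfolding L Pm sub Pq using q uc e by (simp add: mk MPS_one mon_def a_minus_def)
  next
   case False
   hence "\<one>\<^bsub>MPS R\<^esub> m = \<zero>" by (simp add: MPS_one mon_def mk)
   moreover have "?L = \<zero>" proof (cases "q dvd k")
    case True
    hence "q <= k" "q dvd k - q" using False by (auto simp: dvd_imp_le)
    thus ?thesis unfolding L Pm sub Pq using True e up uc by (simp add: a_minus_def r_neg)
   next
    case nd: False
    hence "q <= k ==> \<not> q dvd k - q" by (simp add: dvd_minus_self)
    thus ?thesis unfolding L Pm sub Pq using nd uc by (simp add: a_minus_def)
   qed
   ultimately show ?thesis by simp
  qed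
 qed
qed

subsection \<open>Frobenius\<close>

lemma binomial_expansion: assumes a: "a : car R" and b: "b : car R"
 shows "(a \<oplus> b) [^] (n::nat) = (\<Oplus>k\<in>{..n}. [(n choose k)] \<cdot>\<^bsub>R\<^esub> (a [^] k \<otimes> b [^] (n - k)))"
proof (induction n)
 case 0
 show ?case using a b by simp
next
 case (Suc n)
 let ?t = "%k. [(n choose k)] \<cdot>\<^bsub>R\<^esub> (a [^] k \<otimes> b [^] (n - k))"
 let ?A = "%k. [(n choose (k - 1))] \<cdot>\<^bsub>R\<^esub> (a [^] k \<otimes> b [^] (Suc n - k))"
 let ?A' = "%k. if k = 0 then \<zero> else ?A k"
 let ?C = "%k. [(n choose k)] \<cdot>\<^bsub>R\<^esub> (a [^] k \<otimes> b [^] (Suc n - k))"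
 have 1: "(\<Oplus>k\<in>{..n}. ?t k) \<otimes> a = (\<Oplus>k\<in>{..Suc n}. ?A' k)" proof -
  have "(\<Oplus>k\<in>{..n}. ?t k) \<otimes> a = (\<Oplus>k\<in>{..n}. ?t k \<otimes> a)" by (rule finsum_ldistr) (use a b in auto)
  also have "... = (\<Oplus>k\<in>{..n}. ?A' (Suc k))"
   by (rule finsum_cong') (use a b in \<open>auto simp: add_pow_ldistr add_pow_rdistr m_ac\<close>)
  also have "... = (\<Oplus>k\<in>{..Suc n}. ?A' k)" by (subst finsum_Suc2) (use a b in \<open>auto simp: Pi_iff\<close>)
  finally show ?thesis .
 qed
 have 2: "(\<Oplus>k\<in>{..n}. ?t k) \<otimes> b = (\<Oplus>k\<in>{..Suc n}. ?C k)" proof -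
  have "(\<Oplus>k\<in>{..n}. ?t k) \<otimes> b = (\<Oplus>k\<in>{..n}. ?t k \<otimes> b)" by (rule finsum_ldistr) (use a b in auto)
  also have "... = (\<Oplus>k\<in>{..n}. ?C k)" by (rule finsum_cong') (use a b in \<open>auto simp: add_pow_ldistr m_assoc Suc_diff_le\<close>)
  also have "... = (\<Oplus>k\<in>{..Suc n}. ?C k)" by (subst finsum_Suc) (use a b in \<open>auto simp: Pi_iff binomial_eq_0\<close>)
  finally show ?thesis .
 qed
 have "(a \<oplus> b) [^] Suc n = (\<Oplus>k\<in>{..n}. ?t k) \<otimes> a \<oplus> (\<Oplus>k\<in>{..n}. ?t k) \<otimes> b"
  using a b Suc by (simp add: r_distr)
 also have "... = (\<Oplus>k\<in>{..Suc n}. ?A' k \<oplus> ?C k)" unfolding 1 2 by (rule finsum_addf[symmetric]) (use a b in auto)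
 also have "... = (\<Oplus>k\<in>{..Suc n}. [(Suc n choose k)] \<cdot>\<^bsub>R\<^esub> (a [^] k \<otimes> b [^] (Suc n - k)))"
 proof (rule finsum_cong'[OF refl])
  fix k assume "k : {..Suc n}"
  show "?A' k \<oplus> ?C k = [(Suc n choose k)] \<cdot>\<^bsub>R\<^esub> (a [^] k \<otimes> b [^] (Suc n - k))"
   using a b by (cases k) (simp_all add: add.nat_pow_mult)
 qed (use a b in auto)
 finally show ?case .
qed

lemma add_pow_dvd_zero: fixes p n :: nat assumes p: "[p] \<cdot>\<^bsub>R\<^esub> \<one> = \<zero>" and "p dvd n" and x: "x : car R"
 shows "[n] \<cdot>\<^bsub>R\<^esub> x = \<zero>" proof -
 obtain k where k: "n = p * k" using \<open>p dvd n\<close> by auto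
 have "[p] \<cdot>\<^bsub>R\<^esub> x = \<zero>" using add_pow_ldistr[of \<one> x p] x p by simp
 thus ?thesis unfolding k using add.nat_pow_pow[OF x, of k p] by simp
qed

lemma frobenius_prime: fixes p :: nat
 assumes p: "Factorial_Ring.prime p" "[p] \<cdot>\<^bsub>R\<^esub> \<one> = \<zero>" and a: "a : car R" and b: "b : car R"
 shows "(a \<oplus> b) [^] p = a [^] p \<oplus> b [^] (p::nat)" proof -
 let ?t = "%k. [(p choose k)] \<cdot>\<^bsub>R\<^esub> (a [^] k \<otimes> b [^] (p - k))"
 have p1: "p > 1" using p(1) by (rule prime_gt_1_nat)
 have "(a \<oplus> b) [^] p = (\<Oplus>k\<in>{..p}. ?t k)" by (rule binomial_expansion[OF a b])
 also have "... = (\<Oplus>k\<in>{0, p}. ?t k)" proof (rule add.finprod_mono_neutral_cong_right)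
  fix k assume "k : {..p} - {0, p}"
  hence "p dvd p choose k" using p(1) p1 by (intro dvd_choose_prime) auto
  thus "?t k = \<zero>" using a b by (intro add_pow_dvd_zero[OF p(2)]) auto
 qed (use a b in auto)
 also have "... = a [^] p \<oplus> b [^] p" using p1 a b by (simp add: a_comm)
 finally show ?thesis .
qed

lemma frobenius: fixes p e :: nat
 assumes p: "Factorial_Ring.prime p" "[p] \<cdot>\<^bsub>R\<^esub> \<one> = \<zero>" and a: "a : car R" and b: "b : car R"
 shows "(a \<oplus> b) [^] (p ^ e) = a [^] (p ^ e) \<oplus> b [^] (p ^ e)" proof (induction e)
 case (Suc e)
 have pw: "x [^] (p ^ Suc e) = (x [^] (p ^ e)) [^] p" if "x : car R" for x unfolding power_Suc2 by (rule nat_pow_pow[symmetric, OF that])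
 have "(a \<oplus> b) [^] (p ^ Suc e) = ((a \<oplus> b) [^] (p ^ e)) [^] p" using a b by (intro pw) simp
 also have "... = (a [^] (p ^ e)) [^] p \<oplus> (b [^] (p ^ e)) [^] p" unfolding Suc by (rule frobenius_prime[OF p]) (use a b in auto)
 finally show ?case unfolding pw[OF a] pw[OF b] .
qed (use a b in simp)

text \<open>Follows from additivity applied to a = (a - b) + b, which avoids the sign of
  (-b)^(p^e).\<close>

lemma frobenius_diff: fixes p e :: nat
 assumes p: "Factorial_Ring.prime p" "[p] \<cdot>\<^bsub>R\<^esub> \<one> = \<zero>" and a: "a : car R" and b: "b : car R"
 shows "(a \<ominus> b) [^] (p ^ e) = a [^] (p ^ e) \<ominus> b [^] (p ^ e)" proof -
 have "a [^] (p ^ e) = ((a \<ominus> b) \<oplus> b) [^] (p ^ e)" using a b by (simp add: a_minus_def a_assoc l_neg)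
 also have "... = (a \<ominus> b) [^] (p ^ e) \<oplus> b [^] (p ^ e)" by (rule frobenius[OF p]) (use a b in auto)
 finally have "a [^] (p ^ e) \<ominus> b [^] (p ^ e) = (a \<ominus> b) [^] (p ^ e) \<oplus> b [^] (p ^ e) \<ominus> b [^] (p ^ e)" by simp
 also have "... = (a \<ominus> b) [^] (p ^ e)" by (subst a_minus_def, subst a_assoc) (use a b in \<open>simp_all add: r_neg\<close>)
 finally show ?thesis ..
qed

end

section \<open>The module \<open>C(\<int>\<^sub>p\<^sup>r, B) f\<^sup>s\<close>\<close>

lemma additive_map: assumes M: "abelian_group M" and N: "abelian_group N" and h: "!!x. x : car M ==> h x : car N"
   "!!x y. x : car M ==> y : car M ==> h (x \<oplus>\<^bsub>M\<^esub> y) = h x \<oplus>\<^bsub>N\<^esub> h y"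
 shows "h \<zero>\<^bsub>M\<^esub> = \<zero>\<^bsub>N\<^esub>"
  and "!!v A. v : A \<rightarrow> car M ==> h (\<Oplus>\<^bsub>M\<^esub>i\<in>A. v i) = (\<Oplus>\<^bsub>N\<^esub>i\<in>A. h (v i))"
  and "!!x n. x : car M ==> h ([(n::nat)] \<cdot>\<^bsub>M\<^esub> x) = [n] \<cdot>\<^bsub>N\<^esub> h x" proof -
 interpret M: abelian_group M by (rule M)
 interpret N: abelian_group N by (rule N)
 show z: "h \<zero>\<^bsub>M\<^esub> = \<zero>\<^bsub>N\<^esub>"
  using h(2)[of "\<zero>\<^bsub>M\<^esub>" "\<zero>\<^bsub>M\<^esub>"] h(1)[of "\<zero>\<^bsub>M\<^esub>"] by (simp add: N.add.l_cancel_one')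
 show "h (\<Oplus>\<^bsub>M\<^esub>i\<in>A. v i) = (\<Oplus>\<^bsub>N\<^esub>i\<in>A. h (v i))" if "v : A \<rightarrow> car M" for v and A :: "'z set"
  using that by (induction A rule: infinite_finite_induct) (auto simp: z h Pi_iff)
 show "h ([(n::nat)] \<cdot>\<^bsub>M\<^esub> x) = [n] \<cdot>\<^bsub>N\<^esub> h x" if "x : car M" for x n
  using that by (induction n) (auto simp: z h)
qed

text \<open>The condition on the characteristic is p 1 = 0, which the zero ring satisfies: R_f is
  zero when the product of the f_i is, and Theta is claimed to be an isomorphism in that case
  too.\<close>

locale unit_family = cring B for B :: "('b, 'n) ring_scheme" (structure) + fixes p r :: nat and f :: "nat => 'b"
 assumes p_prime: "Factorial_Ring.prime p" and char_p: "[p] \<cdot> \<one> = \<zero>"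
  and f_unit: "i : {1..r} ==> f i : Units B"
begin

lemma p_pos: "p > 0" and p_gt1: "p > 1" using p_prime prime_gt_0_nat prime_gt_1_nat by auto

definition fpw :: "(nat => nat) => 'b" where
 "fpw n = (\<Otimes>i\<in>{1..r}. f i [^] n i)"

lemma fpw_Units [simp]: "fpw n : Units B" proof -
 have "(\<Otimes>i\<in>J. f i [^] n i) : Units B" if "J <= {1..r}" for J proof -
  have "finite J" using that finite_subset by blast thus ?thesis using that proof (induction J)
   case (insert j J)
   have "f i [^] n i : Units B" if "i : insert j J" for i using that insert f_unit by (intro Units_pow_closed) auto
   thus ?case using insert by (subst finprod_insert) (auto intro!: Units_closed)
  qed simp
 qed
 thus ?thesis unfolding fpw_def by blast
qed

lemma fpw_closed [simp]: "fpw n : car B" using fpw_Units by (rule Units_closed)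

lemma f_pow [simp]: "i : {1..r} ==> f i [^] (k::nat) : car B" using f_unit Units_closed by auto

lemma fpw_cong: "(!!i. i : {1..r} ==> n i = m i) ==> fpw n = fpw m"
 unfolding fpw_def by (rule finprod_cong') simp_all

lemma fpw_add: "fpw (%i. n i + m i) = fpw n \<otimes> fpw m" proof -
 have "fpw (%i. n i + m i) = (\<Otimes>i\<in>{1..r}. f i [^] n i \<otimes> f i [^] m i)"
  unfolding fpw_def by (rule finprod_cong') (use f_unit Units_closed in \<open>auto simp: nat_pow_mult\<close>)
 also have "... = fpw n \<otimes> fpw m" unfolding fpw_def by (rule finprod_multf) simp_all
 finally show ?thesis .
qed

lemma fpw_zero: "(!!i. i : {1..r} ==> n i = 0) ==> fpw n = \<one>"
 unfolding fpw_def by (intro finprod_one_eqI) simp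

lemma fpw_mult: "fpw (%i. n i * k) = fpw n [^] (k::nat)" by (induction k) (simp_all add: fpw_zero fpw_add m_comm)

lemma fpw_inv_closed [simp]: "inv (fpw n) : car B" by simp

lemma fpw_cancel: "v : car B ==> v \<otimes> fpw n \<otimes> inv (fpw n) = v"
 "v : car B ==> v \<otimes> inv (fpw n) \<otimes> fpw n = v" by (simp_all add: m_assoc)

text \<open>The extra factor is a q-th power for q = p^e, so phi lets it pass and it cancels:
  conjugating phi by f^n depends on n modulo q only.\<close>

lemma tw_shift: assumes phi: "phi : DL p B e" and v: "v : car B"
  and n: "!!i. i : {1..r} ==> n' i = n i + k i * p ^ e"
 shows "phi (v \<otimes> fpw n') \<otimes> inv (fpw n') = phi (v \<otimes> fpw n) \<otimes> inv (fpw n)" proof -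
 have e: "fpw n' = fpw k [^] (p ^ e) \<otimes> fpw n"
  using fpw_cong[of n' "%i. n i + k i * p ^ e", OF n] by (simp add: fpw_add fpw_mult m_comm)
 have u: "fpw k [^] (p ^ e) : Units B" by (rule Units_pow_closed) simp
 have c: "phi (v \<otimes> fpw n) : car B" using DLD(2)[OF phi] v by simp
 have "phi (v \<otimes> fpw n') = fpw k [^] (p ^ e) \<otimes> phi (v \<otimes> fpw n)"
  unfolding e using v by (subst DLD(4)[OF phi, symmetric]) (simp_all add: m_ac)
 hence "phi (v \<otimes> fpw n') \<otimes> inv (fpw n') =
   fpw k [^] (p ^ e) \<otimes> phi (v \<otimes> fpw n) \<otimes> (inv (fpw k [^] (p ^ e)) \<otimes> inv (fpw n))"
  unfolding e using u by (simp add: inv_mult_Units)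
 also have "... = (fpw k [^] (p ^ e) \<otimes> inv (fpw k [^] (p ^ e))) \<otimes> (phi (v \<otimes> fpw n) \<otimes> inv (fpw n))"
  using u c by (simp only: m_ac m_closed Units_inv_closed Units_closed fpw_Units)
 also have "... = phi (v \<otimes> fpw n) \<otimes> inv (fpw n)" using u c by simp
 finally show ?thesis .
qed

text \<open>Formally phi(v f^x) / f^x, with the p-adic exponent x replaced by its truncation. The
  least level is taken to agree with \<open>Vfun\<close>; \<open>tw_eq\<close> allows any
  other.\<close>

definition tw :: "(nat => nat => int) => ('b => 'b) => 'b => 'b" where
 "tw x phi v = (let F = fpw (%i. trunc (x i) (level p B phi)) in phi (v \<otimes> F) \<otimes> inv F)"

lemma tw_eq: assumes phi: "phi : DL p B e" and x: "x : Ypts p r" and v: "v : car B"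
 shows "tw x phi v = phi (v \<otimes> fpw (%i. trunc (x i) e)) \<otimes> inv (fpw (%i. trunc (x i) e))" proof -
 define l where "l = level p B phi"
 have l: "phi : DL p B l" "l <= e" using level_least[OF phi] by (simp_all add: l_def)
 have "trunc (x i) e = trunc (x i) l + (trunc (x i) e div p ^ l) * p ^ l" if "i : {1..r}" for i
  using trunc_mod[OF Ypts_D[OF x that] l(2)] by (metis mod_div_mult_eq add.commute) thus ?thesis
  unfolding tw_def Let_def l_def[symmetric] by (rule tw_shift[OF l(1) v, symmetric])
qed

lemma tw_closed: "phi : car (DiffOp p B) ==> x : Ypts p r ==> v : car B ==> tw x phi v : car B"
 by (auto simp: DiffOp_carrier tw_eq DLD(2))

lemma tw_add_left:
 assumes "phi : car (DiffOp p B)" "psi : car (DiffOp p B)" and x: "x : Ypts p r" and v: "v : car B"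
 shows "tw x (phi \<oplus>\<^bsub>DiffOp p B\<^esub> psi) v = tw x phi v \<oplus> tw x psi v" proof -
 obtain e where e: "phi : DL p B e" "psi : DL p B e" using DiffOp_common assms by blast thus ?thesis
  using tw_eq[OF e(1) x v] tw_eq[OF e(2) x v] tw_eq[OF DiffOp_level_add[OF e] x v] v
  by (simp add: DiffOp_ops DLD(2)[OF e(1)] DLD(2)[OF e(2)] l_distr)
qed

lemma tw_add_right: assumes f: "phi : car (DiffOp p B)" and x: "x : Ypts p r" and v: "v : car B" "w : car B"
 shows "tw x phi (v \<oplus> w) = tw x phi v \<oplus> tw x phi w" proof -
 obtain e where e: "phi : DL p B e" using f DiffOp_carrier by blast
 show ?thesis using tw_eq[OF e x] v by (simp add: DLD[OF e] l_distr)
qed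

lemma tw_mult: assumes "phi : car (DiffOp p B)" "psi : car (DiffOp p B)" and x: "x : Ypts p r" and v: "v : car B"
 shows "tw x (phi \<otimes>\<^bsub>DiffOp p B\<^esub> psi) v = tw x phi (tw x psi v)" proof -
 obtain e where e: "phi : DL p B e" "psi : DL p B e" using DiffOp_common assms by blast
 have c: "tw x psi v : car B" using tw_closed assms by blast
 have d: "psi (v \<otimes> fpw (%i. trunc (x i) e)) : car B" using v DLD(2)[OF e(2)] by simp
 show ?thesis unfolding tw_eq[OF e(1) x c] unfolding tw_eq[OF e(2) x v] DiffOp_ops
   tw_eq[OF DiffOp_level_compose[OF e] x v] fpw_cancel(2)[OF d] using v by (simp add: compose_def)
qed

lemma tw_one: "x : Ypts p r ==> v : car B ==> tw x \<one>\<^bsub>DiffOp p B\<^esub> v = v"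
 using tw_eq[OF DiffOp_level_one[of p 0], of x v] by (simp add: DiffOp_ops fpw_cancel)

text \<open>The action in pointwise form, free of decompositions; \<open>fs_smult_eq\<close>
  identifies it with \<open>fs_smult\<close>.\<close>

definition act :: "((nat => nat => int) => 'b => 'b) => ((nat => nat => int) => 'b) => ((nat => nat => int) => 'b)" where
 "act P U = (\<lambda>x\<in>Ypts p r. tw x (P x) (U x))"

lemma tw_cong_pts: assumes phi: "phi : DL p B e" and x: "x : Ypts p r" "y : Ypts p r" and v: "v : car B"
  and "cong_pts r e x y" shows "tw x phi v = tw y phi v" proof -
 have "fpw (%i. trunc (x i) e) = fpw (%i. trunc (y i) e)" using assms(5) by (intro fpw_cong) (simp add: cong_pts_def trunc_def)
 thus ?thesis using tw_eq[OF phi _ v] x by simp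
qed

lemma CD_common_level: assumes P: "P : car (CF p r (DiffOp p B))"
 shows "\<exists>e. loc_const p r e P \<and> (\<forall>x\<in>Ypts p r. P x : DL p B e)" proof -
 obtain e where e: "loc_const p r e P" "!!x. x : Ypts p r ==> level p B (P x) <= e"
  using Cfun_bounded_level[OF p_pos P, of "level p B"] by blast
 hence "P x : DL p B e" if "x : Ypts p r" for x using DiffOp_level_level Cfun_val[OF P that] e(2)[OF that] by blast
 thus ?thesis using e by blast
qed

lemma act_closed: assumes P: "P : car (CF p r (DiffOp p B))" and U: "U : car (CF p r B)"
 shows "act P U : car (CF p r B)" proof -
 obtain d where d: "loc_const p r d P" "!!x. x : Ypts p r ==> P x : DL p B d"
  using CD_common_level[OF P] by blast
 obtain l where l: "loc_const p r l U" using CF_loc_const[OF p_pos U] by blast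
 show ?thesis proof (rule CF_I[OF p_pos, of _ _ _ "max d l"])
  show "act P U : Ypts p r \<rightarrow>\<^sub>E car B" unfolding act_def using tw_closed Cfun_val[OF P] Cfun_val[OF U] by auto
  show "loc_const p r (max d l) (act P U)" proof (rule loc_constI)
   fix x y assume x: "x : Ypts p r" and y: "y : Ypts p r" and c: "cong_pts r (max d l) x y"
   have P': "P x = P y" using loc_constD[OF loc_const_mono[OF d(1)] x y c] by simp
   have U': "U x = U y" using loc_constD[OF loc_const_mono[OF l] x y c] by simp
   have "tw x (P x) (U x) = tw y (P x) (U x)" by (rule tw_cong_pts[OF d(2)[OF x] x y Cfun_val[OF U x] cong_pts_mono[OF x y _ c]]) simp
   thus "act P U x = act P U y" using x y P' U' by (simp add: act_def)
  qed
 qed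
qed

lemma Vfun_eq: "x : Ypts p r ==> Vfun p r B f phi u x = tw x phi u" by (simp add: Vfun_def tw_def fpw_def Let_def)

lemma Vfun_closed: assumes phi: "phi : car (DiffOp p B)" and u: "u : car B"
 shows "Vfun p r B f phi u : car (CF p r B)" proof -
 have "Vfun p r B f phi u = act (\<lambda>x\<in>Ypts p r. phi) (\<lambda>x\<in>Ypts p r. u)"
  unfolding act_def Vfun_def tw_def fpw_def Let_def by (rule restrict_ext) simp
 thus ?thesis using act_closed[OF CF_const[OF p_pos phi] CF_const[OF p_pos u]] by simp
qed

text \<open>The values of the G i are taken among 0, ..., p - 1, so the scaling by them is by
  natural multiples, to which additivity of maps applies.\<close>

lemma decomp_val: assumes T: "ring T" and d: "Cfun_decomp p (Zp_space p r) T P n G v" and x: "x : Ypts p r"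
 shows "P x = (\<Oplus>\<^bsub>T\<^esub>i\<in>{..<n}. [nat (G i x)] \<cdot>\<^bsub>T\<^esub> v i)"
  and "!!i. i < n ==> G i x \<ge> 0" proof -
 interpret T: ring T by (rule T)
 have c: "G i : car (CF p r (Fp p))" "v i : car T" if "i < n" for i using d that by (auto simp: Cfun_decomp_def)
 show nn: "G i x \<ge> 0" if "i < n" for i using Cfun_val[OF c(1)[OF that] x] Fp_carrier[OF p_gt1] by simp
 have "P x = (\<Oplus>\<^bsub>CF p r T\<^esub>i\<in>{..<n}. Fp_scale (Zp_space p r) T (G i) (\<lambda>x\<in>Ypts p r. v i)) x"
  using d by (simp add: Cfun_decomp_def)
 also have "... = (\<Oplus>\<^bsub>T\<^esub>i\<in>{..<n}. Fp_scale (Zp_space p r) T (G i) (\<lambda>x\<in>Ypts p r. v i) x)"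
  by (rule CF_finsum[OF T p_pos _ x]) (auto intro!: Fp_scale_CF[OF T p_pos] CF_const[OF p_pos] c)
 also have "... = (\<Oplus>\<^bsub>T\<^esub>i\<in>{..<n}. [nat (G i x)] \<cdot>\<^bsub>T\<^esub> v i)"
  by (rule T.finsum_cong') (use c nn x in \<open>auto simp: Fp_scale_def add_pow_int_ge\<close>)
 finally show "P x = (\<Oplus>\<^bsub>T\<^esub>i\<in>{..<n}. [nat (G i x)] \<cdot>\<^bsub>T\<^esub> v i)" .
qed

text \<open>\<open>tw\<close> is additive in the operator and in the argument. At a point x every
  pair of decompositions therefore sums up to \<open>tw x (P x) (U x)\<close>, which is the
  uniqueness required by the THE; \<open>Cfun_decomp_exists\<close> gives existence.\<close>

lemma fs_smult_eq: assumes P: "P : car (CF p r (DiffOp p B))" and U: "U : car (CF p r B)"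
 shows "fs_smult p r B f P U = act P U" proof -
 let ?Y = "Zp_space p r" and ?D = "DiffOp p B"
 interpret D: ring ?D by (rule ring_DiffOp)
 interpret C: ring "CF p r B" by (rule ring_CF[OF ring_axioms p_pos])
 define Q where "Q W n G phi m H u \<longleftrightarrow> Cfun_decomp p ?Y ?D P n G phi \<and> Cfun_decomp p ?Y B U m H u \<and>
   W = (\<Oplus>\<^bsub>Cfun ?Y B\<^esub>i\<in>{..<n}. \<Oplus>\<^bsub>Cfun ?Y B\<^esub>j\<in>{..<m}.
      Fp_scale ?Y B (G i) (Fp_scale ?Y B (H j) (Vfun p r B f (phi i) (u j))))" for W and n :: nat and G phi and m :: nat and H u
 have uniq: "W = act P U" if q: "Q W n G phi m H u" for W n G phi m H u proof -
  have d1: "Cfun_decomp p ?Y ?D P n G phi" and d2: "Cfun_decomp p ?Y B U m H u" using q by (auto simp: Q_def)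
  have c: "G i : car (CF p r (Fp p))" "phi i : car ?D" if "i < n" for i using d1 that by (auto simp: Cfun_decomp_def)
  have c': "H j : car (CF p r (Fp p))" "u j : car B" if "j < m" for j using d2 that by (auto simp: Cfun_decomp_def)
  let ?F = "%i j. Fp_scale ?Y B (G i) (Fp_scale ?Y B (H j) (Vfun p r B f (phi i) (u j)))"
  have F: "?F i j : car (CF p r B)" if "i < n" "j < m" for i j
   by (intro Fp_scale_CF[OF ring_axioms p_pos] Vfun_closed c c') (use that in auto)
  hence F2: "(\<Oplus>\<^bsub>CF p r B\<^esub>j\<in>{..<m}. ?F i j) : car (CF p r B)" if "i < n" for i
   using that by (intro C.finsum_closed) auto
  have W: "W = (\<Oplus>\<^bsub>CF p r B\<^esub>i\<in>{..<n}. \<Oplus>\<^bsub>CF p r B\<^esub>j\<in>{..<m}. ?F i j)" using q by (simp add: Q_def)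
  show ?thesis proof (rule Cfun_ext)
   show "W : car (CF p r B)" unfolding W using F2 by (intro C.finsum_closed) auto
   show "act P U : car (CF p r B)" by (rule act_closed[OF P U])
   fix x assume x: "x : topspace ?Y"
   have Ux: "U x : car B" by (rule Cfun_val[OF U x])
   have cD: "(%i. [nat (G i x)] \<cdot>\<^bsub>?D\<^esub> phi i) : {..<n} \<rightarrow> car ?D" using c by auto
   have cB: "(%j. [nat (H j x)] \<cdot> u j) : {..<m} \<rightarrow> car B" using c' by auto
   have tl2: "tw x (\<Oplus>\<^bsub>?D\<^esub>i\<in>{..<n}. [nat (G i x)] \<cdot>\<^bsub>?D\<^esub> phi i) (U x) = (\<Oplus>i\<in>{..<n}. tw x ([nat (G i x)] \<cdot>\<^bsub>?D\<^esub> phi i) (U x))"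
    by (rule additive_map(2)[OF D.abelian_group_axioms abelian_group_axioms, of "%psi. tw x psi (U x)"])
     (use tw_closed[OF _ x Ux] tw_add_left[OF _ _ x Ux] cD in auto)
   have tl3: "tw x ([k] \<cdot>\<^bsub>?D\<^esub> psi) (U x) = [k] \<cdot> tw x psi (U x)" if "psi : car ?D" for psi and k :: nat
    by (rule additive_map(3)[OF D.abelian_group_axioms abelian_group_axioms, of "%psi. tw x psi (U x)"])
     (use tw_closed[OF _ x Ux] tw_add_left[OF _ _ x Ux] that in auto)
   have tr: "tw x psi (U x) = (\<Oplus>j\<in>{..<m}. [nat (H j x)] \<cdot> tw x psi (u j))" if "psi : car ?D" for psi proof -
    have t3: "tw x psi ([k] \<cdot> v) = [k] \<cdot> tw x psi v" if v: "v : car B" for v and k :: nat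
     by (rule additive_map(3)[OF abelian_group_axioms abelian_group_axioms, of "tw x psi"])
      (use tw_closed[OF \<open>psi : car ?D\<close> x] tw_add_right[OF \<open>psi : car ?D\<close> x] v in auto)
    have "tw x psi (U x) = (\<Oplus>j\<in>{..<m}. tw x psi ([nat (H j x)] \<cdot> u j))" unfolding decomp_val(1)[OF ring_axioms d2 x]
     by (rule additive_map(2)[OF abelian_group_axioms abelian_group_axioms, of "tw x psi"])
      (use tw_closed[OF that x] tw_add_right[OF that x] cB in auto)
    also have "... = (\<Oplus>j\<in>{..<m}. [nat (H j x)] \<cdot> tw x psi (u j))"
     by (rule finsum_cong') (use c' tw_closed[OF that x] t3 in auto)
    finally show ?thesis .
   qed
   have "act P U x = tw x (\<Oplus>\<^bsub>?D\<^esub>i\<in>{..<n}. [nat (G i x)] \<cdot>\<^bsub>?D\<^esub> phi i) (U x)"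
    using x decomp_val(1)[OF D.ring_axioms d1 x] by (simp add: act_def)
   also have "... = (\<Oplus>i\<in>{..<n}. tw x ([nat (G i x)] \<cdot>\<^bsub>?D\<^esub> phi i) (U x))" by (rule tl2)
   also have "... = (\<Oplus>i\<in>{..<n}. (\<Oplus>\<^bsub>CF p r B\<^esub>j\<in>{..<m}. ?F i j) x)" proof (rule finsum_cong'[OF refl])
    fix i assume i: "i : {..<n}"
    hence ci: "phi i : car ?D" using c by auto
    have vc: "[nat (H j x)] \<cdot> tw x (phi i) (u j) : car B" if "j < m" for j using tw_closed[OF ci x c'(2)[OF that]] by simp
    have "tw x ([nat (G i x)] \<cdot>\<^bsub>?D\<^esub> phi i) (U x) = [nat (G i x)] \<cdot> tw x (phi i) (U x)" by (rule tl3[OF ci])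
    also have "... = (\<Oplus>j\<in>{..<m}. [nat (G i x)] \<cdot> ([nat (H j x)] \<cdot> tw x (phi i) (u j)))" unfolding tr[OF ci]
     by (rule additive_map(2)[OF abelian_group_axioms abelian_group_axioms, of "%v. [nat (G i x)] \<cdot> v"])
      (use vc in \<open>auto simp: add.nat_pow_distrib\<close>)
    also have "... = (\<Oplus>j\<in>{..<m}. ?F i j x)" proof (rule finsum_cong'[OF refl])
     fix j assume j: "j : {..<m}"
     thus "[nat (G i x)] \<cdot> ([nat (H j x)] \<cdot> tw x (phi i) (u j)) = ?F i j x"
      using i x decomp_val(2)[OF D.ring_axioms d1 x] decomp_val(2)[OF ring_axioms d2 x] by (simp add: Fp_scale_def add_pow_int_ge Vfun_eq)
    qed (use F i Cfun_val[OF _ x] in blast)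
    also have "... = (\<Oplus>\<^bsub>CF p r B\<^esub>j\<in>{..<m}. ?F i j) x"
     by (rule CF_finsum[OF ring_axioms p_pos _ x, symmetric]) (use F i in auto)
    finally show "tw x ([nat (G i x)] \<cdot>\<^bsub>?D\<^esub> phi i) (U x) = (\<Oplus>\<^bsub>CF p r B\<^esub>j\<in>{..<m}. ?F i j) x" .
   qed (use F2 Cfun_val[OF _ x] in auto)
   also have "... = W x" unfolding W by (rule CF_finsum[OF ring_axioms p_pos _ x, symmetric]) (use F2 in auto)
   finally show "W x = act P U x" ..
  qed
 qed
 obtain n G phi where d1: "Cfun_decomp p ?Y ?D P n G phi" using Cfun_decomp_exists[OF D.ring_axioms p_gt1 P] by blast
 obtain m H u where d2: "Cfun_decomp p ?Y B U m H u" using Cfun_decomp_exists[OF ring_axioms p_gt1 U] by blast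
 have ex: "\<exists>W. Q W n G phi m H u" using d1 d2 by (simp add: Q_def)
 have "fs_smult p r B f P U = (THE W. \<exists>n G phi m H u. Q W n G phi m H u)" by (simp add: fs_smult_def Let_def Q_def)
 also have "... = act P U" proof (rule the_equality)
  show "\<exists>n G phi m H u. Q (act P U) n G phi m H u" using ex uniq by blast
  show "!!W. \<exists>n G phi m H u. Q W n G phi m H u ==> W = act P U" using uniq by blast
 qed
 finally show ?thesis .
qed

lemma fs_mod_sel:
 "car (fs_mod p r B f) = car (CF p r B)" "\<zero>\<^bsub>fs_mod p r B f\<^esub> = \<zero>\<^bsub>CF p r B\<^esub>"
 "U \<oplus>\<^bsub>fs_mod p r B f\<^esub> W = U \<oplus>\<^bsub>CF p r B\<^esub> W" "P \<odot>\<^bsub>fs_mod p r B f\<^esub> U = fs_smult p r B f P U"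
 by (simp_all add: fs_mod_def Let_def)

lemma left_module_fs: "left_module (CF p r (DiffOp p B)) (fs_mod p r B f)" proof -
 let ?M = "fs_mod p r B f" and ?D = "CF p r (DiffOp p B)"
 interpret D: ring ?D by (rule ring_CF[OF ring_DiffOp p_pos])
 interpret C: ring "CF p r B" by (rule ring_CF[OF ring_axioms p_pos])
 have "abelian_group ?M" proof (rule abelian_groupI)
  fix U assume "U : car ?M"
  thus "\<exists>W\<in>car ?M. W \<oplus>\<^bsub>?M\<^esub> U = \<zero>\<^bsub>?M\<^esub>"
   unfolding fs_mod_sel using C.l_neg C.a_inv_closed by blast
 qed (auto simp: fs_mod_sel C.a_ac)
 thus ?thesis proof (intro left_module.intro left_module_axioms.intro D.ring_axioms)
  fix P U assume c: "P : car ?D" "U : car ?M"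
  thus "P \<odot>\<^bsub>?M\<^esub> U : car ?M" by (simp add: fs_mod_sel fs_smult_eq act_closed)
 next
  fix P Q U assume c: "P : car ?D" "Q : car ?D" "U : car ?M"
  hence U: "U : car (CF p r B)" by (simp add: fs_mod_sel)
  note v = Cfun_val[OF c(1)] Cfun_val[OF c(2)] Cfun_val[OF U]
  have "act (P \<oplus>\<^bsub>?D\<^esub> Q) U = act P U \<oplus>\<^bsub>CF p r B\<^esub> act Q U"
   unfolding act_def Cfun_ops by (rule restrict_ext) (use v in \<open>simp add: tw_add_left\<close>)
  thus "(P \<oplus>\<^bsub>?D\<^esub> Q) \<odot>\<^bsub>?M\<^esub> U = P \<odot>\<^bsub>?M\<^esub> U \<oplus>\<^bsub>?M\<^esub> Q \<odot>\<^bsub>?M\<^esub> U"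
   using c U by (simp add: fs_mod_sel fs_smult_eq)
  have "act (P \<otimes>\<^bsub>?D\<^esub> Q) U = act P (act Q U)"
   unfolding act_def Cfun_ops by (rule restrict_ext) (use v in \<open>simp add: tw_mult\<close>)
  thus "(P \<otimes>\<^bsub>?D\<^esub> Q) \<odot>\<^bsub>?M\<^esub> U = P \<odot>\<^bsub>?M\<^esub> (Q \<odot>\<^bsub>?M\<^esub> U)"
   using c U by (simp add: fs_mod_sel fs_smult_eq act_closed)
 next
  fix P U W assume c: "P : car ?D" "U : car ?M" "W : car ?M"
  hence U: "U : car (CF p r B)" "W : car (CF p r B)" by (simp_all add: fs_mod_sel)
  note v = Cfun_val[OF c(1)] Cfun_val[OF U(1)] Cfun_val[OF U(2)]
  have "act P (U \<oplus>\<^bsub>CF p r B\<^esub> W) = act P U \<oplus>\<^bsub>CF p r B\<^esub> act P W"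
   unfolding act_def Cfun_ops by (rule restrict_ext) (use v in \<open>simp add: tw_add_right\<close>)
  thus "P \<odot>\<^bsub>?M\<^esub> (U \<oplus>\<^bsub>?M\<^esub> W) = P \<odot>\<^bsub>?M\<^esub> U \<oplus>\<^bsub>?M\<^esub> P \<odot>\<^bsub>?M\<^esub> W"
   using c U by (simp add: fs_mod_sel fs_smult_eq)
 next
  fix U assume "U : car ?M"
  hence U: "U : car (CF p r B)" by (simp add: fs_mod_sel)
  have "act \<one>\<^bsub>?D\<^esub> U = U" by (rule Cfun_ext[OF act_closed[OF D.one_closed U] U])
    (use Cfun_val[OF U] in \<open>simp add: act_def Cfun_ops tw_one\<close>)
  thus "\<one>\<^bsub>?D\<^esub> \<odot>\<^bsub>?M\<^esub> U = U" using U by (simp add: fs_mod_sel fs_smult_eq)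
 qed
qed

end

section \<open>Expansion of local cohomology classes\<close>

lemma (in comm_monoid) finprod_pow: assumes "h : J \<rightarrow> car G"
 shows "(\<Otimes>i\<in>J. h i) [^] (n::nat) = (\<Otimes>i\<in>J. h i [^] n)" proof (induction n)
 case (Suc n)
 have "(\<Otimes>i\<in>J. h i) [^] Suc n = (\<Otimes>i\<in>J. h i [^] n) \<otimes> (\<Otimes>i\<in>J. h i)" using Suc by simp
 also have "... = (\<Otimes>i\<in>J. h i [^] n \<otimes> h i)" by (rule finprod_multf[symmetric]) (use assms in auto)
 finally show ?case by simp
qed (use assms in simp)

context cring begin

lemma MPS_char: 
 fixes p :: nat assumes p: "[p] \<cdot> \<one> = \<zero>" shows "[p] \<cdot>\<^bsub>MPS R\<^esub> \<one>\<^bsub>MPS R\<^esub> = \<zero>\<^bsub>MPS R\<^esub>"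
proof
 fix m
 interpret P: cring "MPS R" by (rule cring_MPS)
 have "([p] \<cdot>\<^bsub>MPS R\<^esub> \<one>\<^bsub>MPS R\<^esub>) m = [p] \<cdot> (\<one>\<^bsub>MPS R\<^esub> m)"
  by (rule additive_map(3)[OF P.abelian_group_axioms abelian_group_axioms, of "%g. g m"]) (auto simp: MPS_add)
 also have "... = \<zero>" by (rule add_pow_dvd_zero[OF p]) simp_all
 finally show "([p] \<cdot>\<^bsub>MPS R\<^esub> \<one>\<^bsub>MPS R\<^esub>) m = \<zero>\<^bsub>MPS R\<^esub> m" by (simp add: MPS_zero)
qed

lemma MPoly_char:
 fixes p :: nat assumes p: "[p] \<cdot> \<one> = \<zero>" shows "[p] \<cdot>\<^bsub>MPoly R r\<^esub> \<one>\<^bsub>MPoly R r\<^esub> = \<zero>\<^bsub>MPoly R r\<^esub>"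
 using MPS_char[OF p] by (simp add: add_pow_def nat_pow_def MPoly_ops)

lemma MPoly_minus: assumes g: "g : car (MPoly R r)" shows "(\<ominus>\<^bsub>MPoly R r\<^esub> g) m = \<ominus> g m" proof -
 interpret P: cring "MPoly R r" by (rule cring_MPoly)
 have c: "g m : car R" "(\<ominus>\<^bsub>MPoly R r\<^esub> g) m : car R" using g P.a_inv_closed[OF g] by (auto simp: MPoly_carrier)
 have "(\<ominus>\<^bsub>MPoly R r\<^esub> g) m \<oplus> g m = \<zero>"
  using P.l_neg[OF g] MPS_add[of "\<ominus>\<^bsub>MPoly R r\<^esub> g" g m] by (simp add: MPoly_ops MPS_zero)
 thus ?thesis using c by (simp add: minus_equality)
qed

end

text \<open>The common frame of two situations: R inside R_f with \<sigma> the localization of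
  operators, and R = B with both maps the identity. Injectivity of \<iota> lets the kernel of the
  expansion map be computed over R; \<sigma> is controlled through its effect on the image of
  \<iota>.\<close>

locale bs_setup = unit_family B p r "%i. \<iota> (f i)" + R: cring R
 for B :: "('b, 'n) ring_scheme" (structure) and p r :: nat and R :: "('a, 'm) ring_scheme"
  and \<iota> :: "'a => 'b" and f :: "nat => 'a" and \<sigma> :: "('a => 'a) => 'b => 'b" +
 assumes char_R: "[p] \<cdot>\<^bsub>R\<^esub> \<one>\<^bsub>R\<^esub> = \<zero>\<^bsub>R\<^esub>"
  and \<iota>_hom: "\<iota> : ring_hom R B" and \<iota>_inj: "inj_on \<iota> (car R)"
  and f_car: "i : {1..r} ==> f i : car R" and \<sigma>_hom: "\<sigma> : ring_hom (DiffOp p R) (DiffOp p B)"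
  and \<sigma>_level: "phi : DL p R e ==> \<sigma> phi : DL p B e"
  and \<sigma>_\<iota>: "phi : DL p R e ==> a : car R ==> \<sigma> phi (\<iota> a) = \<iota> (phi a)"
begin

sublocale A: cring "MPoly R r" by (rule R.cring_MPoly)
sublocale MB: cring "MPS B" by (rule cring_MPS)
sublocale \<iota>: ring_hom_cring R B \<iota> by (intro ring_hom_cring.intro ring_hom_cring_axioms.intro R.cring_axioms cring_axioms \<iota>_hom)

abbreviation "A \<equiv> MPoly R r"
abbreviation "u \<equiv> %i. \<iota> (f i)"

definition ex :: "(nat multiset => 'a) => (nat multiset => 'b)" where "ex = mpoly_map \<iota>"

lemma ex_hom: "ex : ring_hom A (MPS B)" using ring_hom_trans[OF R.mpoly_map_hom[OF cring_axioms \<iota>_hom] MPoly_incl_hom, of r]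
 by (simp add: ex_def comp_def)

sublocale ex: ring_hom_cring A "MPS B" ex by (intro ring_hom_cring.intro ring_hom_cring_axioms.intro A.cring_axioms MB.cring_axioms ex_hom)

lemma ex_val: "ex a m = \<iota> (a m)" by (simp add: ex_def mpoly_map_def)

definition gi :: "nat => (nat multiset => 'a)" where "gi = f_minus_t R r f"
definition g :: "nat multiset => 'a" where "g = prod_f_minus_t R r f {1..r}"

lemma A_val [simp]: "a : car A ==> a m : car R" by (simp add: R.MPoly_carrier)

lemma gi_closed [simp]: "i : {1..r} ==> gi i : car A" unfolding gi_def using R.f_minus_t_eq(2) f_car by blast

lemma gi_eq: "i : {1..r} ==> gi i = mon R (f i) {#} \<ominus>\<^bsub>A\<^esub> mon R \<one>\<^bsub>R\<^esub> {#i#}"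
 unfolding gi_def using R.f_minus_t_eq(1) f_car by blast

lemma gi_Pi [simp]: "J <= {1..r} ==> gi : J \<rightarrow> car A" using gi_closed by blast

lemma g_eq: "g = (\<Otimes>\<^bsub>A\<^esub>i\<in>{1..r}. gi i)" by (simp add: g_def gi_def prod_f_minus_t_def)

lemma g_closed [simp]: "g : car A" unfolding g_eq by (intro A.finprod_closed gi_Pi) simp

lemma mon_A [simp]: "c : car R ==> set_mset a <= {1..r} ==> mon R c a : car A"
 by (rule R.mon_MPoly)

lemma gi_pow: assumes i: "i : {1..r}"
 shows "gi i [^]\<^bsub>A\<^esub> (p ^ e) = mon R (f i [^]\<^bsub>R\<^esub> (p ^ e)) {#} \<ominus>\<^bsub>A\<^esub> mon R \<one>\<^bsub>R\<^esub> (rep (p ^ e) i)"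
proof -
 have "gi i [^]\<^bsub>A\<^esub> (p ^ e) = mon R (f i) {#} [^]\<^bsub>A\<^esub> (p ^ e) \<ominus>\<^bsub>A\<^esub> mon R \<one>\<^bsub>R\<^esub> {#i#} [^]\<^bsub>A\<^esub> (p ^ e)"
  unfolding gi_eq[OF i] by (rule A.frobenius_diff[OF p_prime R.MPoly_char[OF char_R]]) (use i f_car in auto)
 thus ?thesis using i f_car by (simp add: R.MPoly_pow R.mon_pow)
qed

lemma ex_mon: "c : car R ==> ex (mon R c a) = mon B (\<iota> c) a" unfolding ex_def by (rule R.mpoly_map_mon) simp

lemma ex_gi_pow: assumes i: "i : {1..r}"
 shows "ex (gi i [^]\<^bsub>A\<^esub> (p ^ e)) = mon B (u i [^] (p ^ e)) {#} \<ominus>\<^bsub>MPS B\<^esub> mon B \<one> (rep (p ^ e) i)"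
proof -
 have "mon R (f i [^]\<^bsub>R\<^esub> (p ^ e)) {#} : car A" "mon R \<one>\<^bsub>R\<^esub> (rep (p ^ e) i) : car A"
  using i f_car by auto thus ?thesis unfolding gi_pow[OF i] a_minus_def using i f_car by (simp add: ex_mon)
qed

text \<open>The coefficients of 1/(f_i^q - t_i^q). The value zero for i outside {1..r}, where f_i
  need not be invertible, keeps them in B for all i.\<close>

definition wc :: "nat => nat => nat => 'b" where
 "wc q i k = (if i : {1..r} \<and> q dvd k then inv (u i [^] (k + q)) else \<zero>)"

text \<open>For J = {1..r} and q = p^e this is the expansion of 1/g^q; a smaller J occurs after one
  factor has been cancelled.\<close>

definition W :: "nat set => nat => (nat multiset => 'b)" where
 "W J q = (\<Otimes>\<^bsub>MPS B\<^esub>i\<in>J. PS i (wc q i))"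

lemma u_pow_Units: "i : {1..r} ==> u i [^] (k::nat) : Units B" using f_unit by (intro Units_pow_closed) auto

lemma wc_closed [simp]: "wc q i k : car B" using u_pow_Units by (simp add: wc_def)

lemma PS_wc_closed [simp]: "PS i (wc q i) : car (MPS B)" by (rule PS_closed) simp

lemma W_closed [simp]: "W J q : car (MPS B)" unfolding W_def by (intro MB.finprod_closed) auto

lemma ex_gi_inv: assumes i: "i : {1..r}"
 shows "ex (gi i [^]\<^bsub>A\<^esub> (p ^ e)) \<otimes>\<^bsub>MPS B\<^esub> PS i (wc (p ^ e) i) = \<one>\<^bsub>MPS B\<^esub>" proof -
 have "PS i (wc (p ^ e) i) = PS i (%k. if p ^ e dvd k then inv (u i [^] (k + p ^ e)) else \<zero>)"
  by (rule arg_cong[of _ _ "PS i"]) (use i in \<open>simp add: wc_def fun_eq_iff\<close>) thus ?thesis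
  unfolding ex_gi_pow[OF i] using inverse_diff_series[of "u i" "p ^ e" i] f_unit[OF i] p_pos by simp
qed

lemma ex_g_pow: "ex (g [^]\<^bsub>A\<^esub> (p ^ e)) = (\<Otimes>\<^bsub>MPS B\<^esub>i\<in>{1..r}. ex (gi i [^]\<^bsub>A\<^esub> (p ^ e)))" proof -
 have "g [^]\<^bsub>A\<^esub> (p ^ e) = (\<Otimes>\<^bsub>A\<^esub>i\<in>{1..r}. gi i [^]\<^bsub>A\<^esub> (p ^ e))"
  unfolding g_eq by (rule A.finprod_pow) simp thus ?thesis by (simp add: ex.hom_finprod comp_def Pi_iff)
qed

lemma ex_g_inv: "ex (g [^]\<^bsub>A\<^esub> (p ^ e)) \<otimes>\<^bsub>MPS B\<^esub> W {1..r} (p ^ e) = \<one>\<^bsub>MPS B\<^esub>" proof -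
 have "ex (g [^]\<^bsub>A\<^esub> (p ^ e)) \<otimes>\<^bsub>MPS B\<^esub> W {1..r} (p ^ e) =
  (\<Otimes>\<^bsub>MPS B\<^esub>i\<in>{1..r}. ex (gi i [^]\<^bsub>A\<^esub> (p ^ e)) \<otimes>\<^bsub>MPS B\<^esub> PS i (wc (p ^ e) i))"
  unfolding ex_g_pow W_def by (rule MB.finprod_multf[symmetric]) (auto simp: Pi_iff)
 also have "... = \<one>\<^bsub>MPS B\<^esub>" by (rule MB.finprod_one_eqI) (rule ex_gi_inv)
 finally show ?thesis .
qed

lemma ex_g_Units: "ex g : Units (MPS B)" proof -
 have "ex g \<otimes>\<^bsub>MPS B\<^esub> W {1..r} 1 = \<one>\<^bsub>MPS B\<^esub>" using ex_g_inv[of 0] by simp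
 moreover from this have "W {1..r} 1 \<otimes>\<^bsub>MPS B\<^esub> ex g = \<one>\<^bsub>MPS B\<^esub>" by (simp add: MB.m_comm)
 ultimately show ?thesis unfolding Units_def using ex.hom_closed[OF g_closed] W_closed by blast
qed

lemma inv_ex_g: "inv\<^bsub>MPS B\<^esub> (ex (g [^]\<^bsub>A\<^esub> (p ^ e))) = W {1..r} (p ^ e)" by (rule MB.comm_inv_char[OF _ _ ex_g_inv]) auto

lemma fpw_inv: "(\<Otimes>i\<in>{1..r}. inv (u i [^] n i)) = inv (fpw n)" proof -
 have "fpw n \<otimes> (\<Otimes>i\<in>{1..r}. inv (u i [^] n i)) = (\<Otimes>i\<in>{1..r}. u i [^] n i \<otimes> inv (u i [^] n i))"
  unfolding fpw_def by (rule finprod_multf[symmetric]) (use u_pow_Units in auto)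
 also have "... = \<one>" by (rule finprod_one_eqI) (use u_pow_Units in auto)
 finally have "inv (fpw n) = (\<Otimes>i\<in>{1..r}. inv (u i [^] n i))" by (intro comm_inv_char) (use u_pow_Units in auto) thus ?thesis ..
qed

text \<open>Only exponents divisible by q occur in 1/g^q, which is where the congruences modulo q
  come from.\<close>

lemma W_val: "W {1..r} q m =
 (if set_mset m <= {1..r} \<and> (\<forall>i\<in>{1..r}. q dvd count m i) then inv (fpw (%i. count m i + q)) else \<zero>)" proof -
 have 1: "W {1..r} q m = (if set_mset m <= {1..r} then (\<Otimes>i\<in>{1..r}. wc q i (count m i)) else \<zero>)"
  unfolding W_def by (rule finprod_PS) auto
 show ?thesis proof (cases "\<forall>i\<in>{1..r}. q dvd count m i")
  case True
  have "(\<Otimes>i\<in>{1..r}. wc q i (count m i)) = (\<Otimes>i\<in>{1..r}. inv (u i [^] (count m i + q)))"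
   by (rule finprod_cong') (use True u_pow_Units in \<open>auto simp: wc_def\<close>) thus ?thesis unfolding 1 fpw_inv using True by simp
 next
  case False
  then obtain i where i: "i : {1..r}" "\<not> q dvd count m i" by blast
  have "(\<Otimes>j\<in>insert i ({1..r} - {i}). wc q j (count m j)) = wc q i (count m i) \<otimes> (\<Otimes>j\<in>{1..r} - {i}. wc q j (count m j))"
   by (rule finprod_insert) auto
  also have "... = \<zero> \<otimes> (\<Otimes>j\<in>{1..r} - {i}. wc q j (count m j))" using i(2) by (simp add: wc_def[of q i])
  also have "... = \<zero>" by (rule l_null, rule finprod_closed) auto
  also have "insert i ({1..r} - {i}) = {1..r}" using i by auto
  finally have "(\<Otimes>i\<in>{1..r}. wc q i (count m i)) = \<zero>" . thus ?thesis unfolding 1 using False by auto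
 qed
qed

subsection \<open>The localization\<close>

abbreviation "S \<equiv> cech_set R r f"
abbreviation "AS \<equiv> Loc A S"

lemma S_eq: "S = range (\<lambda>n::nat. g [^]\<^bsub>A\<^esub> n)" by (simp add: cech_set_def powers_def g_def)

lemma g_pow_S [simp]: "g [^]\<^bsub>A\<^esub> (n::nat) : S" unfolding S_eq by blast

sublocale L: mult_set A S proof (unfold_locales)
 show "S <= car A" unfolding S_eq by auto
 show "\<one>\<^bsub>A\<^esub> : S" using g_pow_S[of 0] by simp
 show "s \<otimes>\<^bsub>A\<^esub> t : S" if "s : S" "t : S" for s t using that unfolding S_eq by (auto simp: A.nat_pow_mult)
qed

sublocale AS: cring AS by (rule L.cring_Loc)

definition exL :: "((nat multiset => 'a) \<times> (nat multiset => 'a)) set => (nat multiset => 'b)" where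
 "exL = L.loc_ext (MPS B) ex"

lemma ex_S: "s : S ==> ex s : Units (MPS B)" unfolding S_eq using ex_g_Units by (auto intro: MB.Units_pow_closed)

lemma exL_frac: "a : car A ==> s : S ==> exL (L.frac a s) = ex a \<otimes>\<^bsub>MPS B\<^esub> inv\<^bsub>MPS B\<^esub> ex s"
 unfolding exL_def by (rule L.loc_ext_frac[OF MB.cring_axioms ex_hom ex_S])

lemma exL_frac_q: "a : car A ==> exL (L.frac a (g [^]\<^bsub>A\<^esub> (p ^ e))) = ex a \<otimes>\<^bsub>MPS B\<^esub> W {1..r} (p ^ e)"
 by (simp only: exL_frac[OF _ g_pow_S] inv_ex_g)

lemma exL_hom: "exL : ring_hom AS (MPS B)" unfolding exL_def by (rule L.loc_ext_hom[OF MB.cring_axioms ex_hom ex_S])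

text \<open>Since n < p^n, the denominator g^n divides g^(p^e) for e at least n. The claim covers
  all large e so that a fraction and an operator can be brought to a common level.\<close>

lemma AS_rep: assumes "z : car AS"
 shows "\<exists>E. \<forall>e\<ge>E. \<exists>a\<in>car A. z = L.frac a (g [^]\<^bsub>A\<^esub> (p ^ e))" proof -
 obtain a n where a: "a : car A" "z = L.frac a (g [^]\<^bsub>A\<^esub> (n::nat))" proof -
  obtain a s where as: "a : car A" "s : S" "z = L.frac a s" using assms unfolding L.carrier_Loc by blast
  then obtain n where "s = g [^]\<^bsub>A\<^esub> (n::nat)" unfolding S_eq by blast thus ?thesis using as that by blast
 qed
 show ?thesis proof (intro exI[of _ n] allI impI)
  fix e assume "n <= e"
  have "e < p ^ e" using p_gt1 by (simp add: power_gt_expt)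
  hence le: "p ^ e = (p ^ e - n) + n" using \<open>n <= e\<close> by simp
  have "L.frac (g [^]\<^bsub>A\<^esub> (p ^ e - n) \<otimes>\<^bsub>A\<^esub> a) (g [^]\<^bsub>A\<^esub> (p ^ e)) = z"
   unfolding a(2) using a(1) L.frac_expand[of a "g [^]\<^bsub>A\<^esub> n" "g [^]\<^bsub>A\<^esub> (p ^ e - n)"] le by (simp add: A.nat_pow_mult)
  thus "\<exists>a\<in>car A. z = L.frac a (g [^]\<^bsub>A\<^esub> (p ^ e))"
   using a(1) by (intro bexI[of _ "g [^]\<^bsub>A\<^esub> (p ^ e - n) \<otimes>\<^bsub>A\<^esub> a"]) simp_all
 qed
qed

subsection \<open>Eventual values\<close>

text \<open>\<open>evx x Q\<close>: the property \<open>Q\<close> holds for all exponents \<open>N\<close> that are large in every coordinate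
 and \<open>p\<close>-adically close to \<open>-1 - x\<close>.\<close>

definition evx :: "(nat => nat => int) => (nat multiset => bool) => bool" where
 "evx x Q \<longleftrightarrow> (\<exists>E K. \<forall>N. set_mset N <= {1..r} \<longrightarrow>
  (\<forall>i\<in>{1..r}. K <= count N i \<and> p ^ E dvd Suc (count N i + trunc (x i) E)) \<longrightarrow> Q N)"

lemma evxI:
 assumes "!!N. set_mset N <= {1..r} ==> (!!i. i : {1..r} ==> K <= count N i) ==>
  (!!i. i : {1..r} ==> p ^ E dvd Suc (count N i + trunc (x i) E)) ==> Q N"
 shows "evx x Q" unfolding evx_def using assms by blast

lemma evx_mono: "evx x Q ==> (!!N. Q N ==> Q' N) ==> evx x Q'" unfolding evx_def by blast

text \<open>The truncations of x_i at E and at e differ by a multiple of p^e.\<close>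

lemma dvd_trunc_mono: assumes x: "x : Ypts p r" and i: "i : {1..r}" and "e <= E" and d: "p ^ E dvd Suc (k + trunc (x i) E)"
 shows "p ^ e dvd Suc (k + trunc (x i) e)" proof -
 have "p ^ e dvd Suc (k + trunc (x i) E)" using d \<open>e <= E\<close> by (meson le_imp_power_dvd dvd_trans)
 moreover have "Suc (k + trunc (x i) E) = Suc (k + trunc (x i) e) + (trunc (x i) E div p ^ e) * p ^ e"
  using trunc_mod[OF Ypts_D[OF x i] \<open>e <= E\<close>] div_mult_mod_eq[of "trunc (x i) E" "p ^ e"] by simp
 ultimately show ?thesis by (metis dvd_add_left_iff dvd_triv_right)
qed

lemma evx_conj: assumes x: "x : Ypts p r" and "evx x Q" "evx x Q'" shows "evx x (%N. Q N \<and> Q' N)" proof -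
 obtain E K where 1: "!!N. set_mset N <= {1..r} ==>
  (\<forall>i\<in>{1..r}. K <= count N i \<and> p ^ E dvd Suc (count N i + trunc (x i) E)) ==> Q N"
  using assms(2) unfolding evx_def by blast
 obtain E' K' where 2: "!!N. set_mset N <= {1..r} ==>
  (\<forall>i\<in>{1..r}. K' <= count N i \<and> p ^ E' dvd Suc (count N i + trunc (x i) E')) ==> Q' N"
  using assms(3) unfolding evx_def by blast
 show ?thesis proof (rule evxI[where K = "max K K'" and E = "max E E'"])
  fix N :: "nat multiset" assume N: "set_mset N <= {1..r}" "!!i. i : {1..r} ==> max K K' <= count N i"
   "!!i. i : {1..r} ==> p ^ max E E' dvd Suc (count N i + trunc (x i) (max E E'))"
  have "Q N" by (rule 1[OF N(1)]) (use N dvd_trunc_mono[OF x _ _ N(3)] in auto)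
  moreover have "Q' N" by (rule 2[OF N(1)]) (use N dvd_trunc_mono[OF x _ _ N(3)] in auto)
  ultimately show "Q N \<and> Q' N" ..
 qed
qed

lemma evx_ex: assumes x: "x : Ypts p r" and "evx x Q" shows "\<exists>N. set_mset N <= {1..r} \<and> Q N" proof -
 obtain E K where 1: "!!N. set_mset N <= {1..r} ==>
  (\<forall>i\<in>{1..r}. K <= count N i \<and> p ^ E dvd Suc (count N i + trunc (x i) E)) ==> Q N"
  using assms(2) unfolding evx_def by blast
 \<comment> \<open>The representative p^E - 1 - x of -1 - x modulo p^E, moved up by p^E K so that it
   reaches the bound K.\<close>
 define n where "n i = p ^ E * (K + 1) - 1 - trunc (x i) E" for i
 define N where "N = (\<Sum>i\<in>{1..r}. rep (n i) i)"
 have c: "count N i = n i" if "i : {1..r}" for i using that by (simp add: N_def count_sum)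
 have "set_mset N <= {1..r}" unfolding N_def by (auto simp: set_mset_sum split: if_splits)
 moreover have "K <= count N i \<and> p ^ E dvd Suc (count N i + trunc (x i) E)" if i: "i : {1..r}" for i proof -
  have t: "trunc (x i) E < p ^ E" by (rule trunc_less[OF Ypts_D[OF x i]])
  have "K <= p ^ E * K" using p_pos by simp
  moreover have "p ^ E * (K + 1) = p ^ E * K + p ^ E" by simp
  ultimately have "n i + 1 + trunc (x i) E = p ^ E * (K + 1)" "K <= n i" using t unfolding n_def by linarith+
  thus ?thesis unfolding c[OF i] by (metis Suc_eq_plus1 add.commute add.left_commute dvd_triv_left)
 qed
 ultimately show ?thesis using 1 by blast
qed

text \<open>The coefficients of 1/g are the powers f^(-N-1); the factor f^(N+1) makes the class
  delta correspond to 1.\<close>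

definition isLam :: "((nat multiset => 'a) \<times> (nat multiset => 'a)) set => (nat => nat => int) => 'b => bool" where
 "isLam z x c \<longleftrightarrow> evx x (%N. exL z N \<otimes> fpw (%i. Suc (count N i)) = c)"

definition Lam :: "((nat multiset => 'a) \<times> (nat multiset => 'a)) set => (nat => nat => int) => 'b" where
 "Lam z = (\<lambda>x\<in>Ypts p r. THE c. isLam z x c)"

lemma isLam_unique: assumes x: "x : Ypts p r" and "isLam z x c" "isLam z x d" shows "c = d"
 using evx_ex[OF x evx_conj[OF x assms(2,3)[unfolded isLam_def]]] by blast

lemma Lam_eq: assumes "x : Ypts p r" and "isLam z x c" shows "Lam z x = c" using assms isLam_unique unfolding Lam_def by (simp add: the_equality)

definition fR :: "(nat => nat) => 'a" where "fR n = (\<Otimes>\<^bsub>R\<^esub>i\<in>{1..r}. f i [^]\<^bsub>R\<^esub> n i)"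

lemma fR_closed [simp]: "fR n : car R" unfolding fR_def by (rule R.finprod_closed) (use f_car in auto)

lemma \<iota>_fR: "\<iota> (fR n) = fpw n" proof -
 have "\<iota> (fR n) = (\<Otimes>i\<in>{1..r}. (\<iota> \<circ> (%i. f i [^]\<^bsub>R\<^esub> n i)) i)"
  unfolding fR_def by (rule \<iota>.hom_finprod) (use f_car in auto)
 also have "... = fpw n" unfolding fpw_def by (rule finprod_cong') (use f_car f_pow in auto)
 finally show ?thesis .
qed

definition supp_at :: "nat => (nat multiset => 'a) => (nat => nat => int) => nat multiset set" where
 "supp_at e a x = {m. a m ~= \<zero>\<^bsub>R\<^esub> \<and> (\<forall>i\<in>{1..r}. count m i mod p ^ e = p ^ e - 1 - trunc (x i) e)}"

text \<open>With q = p^e, modulo the f_i^q - t_i^q every polynomial is an R-combination of the t^b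
  with all b_i < q. This is the coefficient of a at b_i = q - 1 - x_i, with x_i truncated at e,
  obtained by replacing each t_i^q by f_i^q.\<close>

definition rho :: "nat => (nat multiset => 'a) => (nat => nat => int) => 'a" where
 "rho e a x = (\<Oplus>\<^bsub>R\<^esub>m\<in>supp_at e a x. a m \<otimes>\<^bsub>R\<^esub> fR (%i. (count m i div p ^ e) * p ^ e))"

lemma rho_closed [simp]: "a : car A ==> rho e a x : car R" unfolding rho_def by (rule R.finsum_closed) auto

text \<open>The number (n mod q) + t + 1 is divisible by q and lies strictly between 0 and 2 q, so
  it equals q.\<close>

lemma complement_mod: fixes q t n :: nat assumes "t < q" "q dvd Suc (n + t)" shows "n mod q = q - 1 - t" proof -
 have q: "q > 0" using assms by simp
 have "Suc (n mod q + t) mod q = Suc (n + t) mod q" by (metis add_Suc mod_Suc_eq mod_add_left_eq)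
 hence "q dvd Suc (n mod q + t)" using assms(2) by (simp add: mod_eq_0_iff_dvd)
 then obtain k where k: "Suc (n mod q + t) = q * k" by blast
 have "n mod q < q" using q by simp
 hence "q * k < q * 2" using k assms(1) by linarith
 hence "k < 2" by simp
 moreover have "k ~= 0" using k by (intro notI) simp
 ultimately have "k = 1" by simp thus ?thesis using k by simp
qed

text \<open>For large N the coefficient of t^N in a / g^q is the sum of a_m f^(-(N - m + q)) over
  the m congruent to N modulo q. Multiplication by f^(N+1) leaves a_m f^(m + 1 - q). As m has
  residue q - 1 - x, the exponent is q (m div q) - x, and N has disappeared.\<close>

lemma isLam_frac: assumes a: "a : car A" and x: "x : Ypts p r"
 shows "isLam (L.frac a (g [^]\<^bsub>A\<^esub> (p ^ e))) x (\<iota> (rho e a x) \<otimes> inv (fpw (%i. trunc (x i) e)))" proof -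
 define q where "q = p ^ e"
 have q: "q > 0" using p_pos by (simp add: q_def)
 define t where "t i = trunc (x i) e" for i
 have t: "t i < q" if "i : {1..r}" for i unfolding t_def q_def by (rule trunc_less[OF Ypts_D[OF x that]])
 have fin: "finite {m. a m ~= \<zero>\<^bsub>R\<^esub>}" using a by (simp add: R.MPoly_carrier)
 \<comment> \<open>Beyond this bound every monomial of a divides t^N, so no term of the product is
   cut off.\<close>
 define K where "K = Max (insert 0 (size ` {m. a m ~= \<zero>\<^bsub>R\<^esub>}))"
 have K: "count m i <= K" if "a m ~= \<zero>\<^bsub>R\<^esub>" for m i proof -
  have "size m <= K" unfolding K_def using that fin by (intro Max_ge) auto
  moreover have "count m i <= size m" by (rule count_le_size)
  ultimately show ?thesis by simp
 qed
 show ?thesis unfolding isLam_def proof (rule evxI[where K = K and E = e])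
  fix N :: "nat multiset" assume N: "set_mset N <= {1..r}" "!!i. i : {1..r} ==> K <= count N i"
   "!!i. i : {1..r} ==> p ^ e dvd Suc (count N i + trunc (x i) e)"
  define T where "T = supp_at e a x"
  have Nm: "count N i mod q = q - 1 - t i" if "i : {1..r}" for i using complement_mod[OF t[OF that]] N(3)[OF that] by (simp add: q_def t_def)
  have sub: "m \<subseteq># N" if "a m ~= \<zero>\<^bsub>R\<^esub>" for m proof (rule mset_subset_eqI)
   fix i show "count m i <= count N i" proof (cases "i : {1..r}")
    case True thus ?thesis using K[OF that] N(2) by (meson order_trans)
   next
    case False
    have "set_mset m <= {1..r}" using a that unfolding R.MPoly_carrier by blast
    hence "i \<notin># m" using False by blast thus ?thesis by (simp add: not_in_iff)
   qed
  qed
  have TN: "T <= {m. m \<subseteq># N}" using sub by (auto simp: T_def supp_at_def)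
  have trm: "\<iota> (a m) \<otimes> W {1..r} q (N - m) \<otimes> fpw (%i. Suc (count N i)) =
    \<iota> (a m \<otimes>\<^bsub>R\<^esub> fR (%i. (count m i div q) * q)) \<otimes> inv (fpw t)" if m: "m : T" for m proof -
   have am: "a m ~= \<zero>\<^bsub>R\<^esub>" and mm: "!!i. i : {1..r} ==> count m i mod q = q - 1 - t i"
    using m by (auto simp: T_def supp_at_def q_def t_def)
   have le: "count m i <= count N i" for i using sub[OF am] by (rule mset_subset_eq_count)
   have dv: "q dvd count (N - m) i" if "i : {1..r}" for i using mod_eq_dvd_iff_nat[OF le[of i], of q] mm[OF that] Nm[OF that] by simp
   have sN: "set_mset (N - m) <= {1..r}" using N(1) by (meson in_diffD subset_iff)
   have W: "W {1..r} q (N - m) = inv (fpw (%i. count (N - m) i + q))" unfolding W_val using sN dv by auto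
   \<comment> \<open>The cancellation of N, in an additive form that avoids negative exponents:
     coordinatewise N + 1 + x = (N - m + q) + q (m div q).\<close>
   have e1: "fpw (%i. Suc (count N i)) \<otimes> fpw t = fpw (%i. count (N - m) i + q) \<otimes> fpw (%i. (count m i div q) * q)"
    unfolding fpw_add[symmetric] proof (rule fpw_cong)
    fix i assume i: "i : {1..r}"
    have "count m i = (count m i div q) * q + (q - 1 - t i)" using mm[OF i] by (metis div_mult_mod_eq)
    thus "Suc (count N i) + t i = count (N - m) i + q + count m i div q * q" using t[OF i] le[of i] by simp
   qed
   have "inv (fpw (%i. count (N - m) i + q)) \<otimes> fpw (%i. Suc (count N i)) =
    inv (fpw (%i. count (N - m) i + q)) \<otimes> (fpw (%i. Suc (count N i)) \<otimes> fpw t) \<otimes> inv (fpw t)"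
    by (simp add: m_assoc)
   also have "... = fpw (%i. (count m i div q) * q) \<otimes> inv (fpw t)" unfolding e1 by (simp add: m_assoc[symmetric])
   finally show ?thesis unfolding W using a by (simp add: m_assoc \<iota>_fR)
  qed
  have zero: "\<iota> (a m) \<otimes> W {1..r} q (N - m) = \<zero>" if m: "m : {m. m \<subseteq># N} - T" for m
  proof (cases "a m = \<zero>\<^bsub>R\<^esub>")
   case False
   have le: "count m i <= count N i" for i using sub[OF False] by (rule mset_subset_eq_count)
   obtain i where i: "i : {1..r}" "count m i mod q ~= q - 1 - t i" using m False by (auto simp: T_def supp_at_def q_def t_def)
   hence "\<not> q dvd count (N - m) i" using mod_eq_dvd_iff_nat[OF le[of i], of q] Nm[OF i(1)] by simp
   hence "W {1..r} q (N - m) = \<zero>" unfolding W_val using i(1) by auto thus ?thesis using a by simp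
  qed simp
  have "exL (L.frac a (g [^]\<^bsub>A\<^esub> q)) N = (\<Oplus>m\<in>{m. m \<subseteq># N}. \<iota> (a m) \<otimes> W {1..r} q (N - m))"
   unfolding q_def using a by (simp add: exL_frac_q MPS_mult ex_val)
  also have "... = (\<Oplus>m\<in>T. \<iota> (a m) \<otimes> W {1..r} q (N - m))"
   by (rule add.finprod_mono_neutral_cong_right[OF finite_submultisets TN zero]) (use a MPS_val[OF W_closed] in auto)
  finally have "exL (L.frac a (g [^]\<^bsub>A\<^esub> q)) N \<otimes> fpw (%i. Suc (count N i)) =
    (\<Oplus>m\<in>T. \<iota> (a m) \<otimes> W {1..r} q (N - m)) \<otimes> fpw (%i. Suc (count N i))" by simp
  also have "... = (\<Oplus>m\<in>T. \<iota> (a m) \<otimes> W {1..r} q (N - m) \<otimes> fpw (%i. Suc (count N i)))"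
   by (rule finsum_ldistr) (use a MPS_val[OF W_closed] finite_subset[OF TN finite_submultisets] in auto)
  also have "... = (\<Oplus>m\<in>T. \<iota> (a m \<otimes>\<^bsub>R\<^esub> fR (%i. (count m i div q) * q)) \<otimes> inv (fpw t))"
   by (rule finsum_cong'[OF refl _ trm]) (use a in auto)
  also have "... = (\<Oplus>m\<in>T. \<iota> (a m \<otimes>\<^bsub>R\<^esub> fR (%i. (count m i div q) * q))) \<otimes> inv (fpw t)"
   by (rule finsum_ldistr[symmetric]) (use a finite_subset[OF TN finite_submultisets] in auto)
  also have "(\<Oplus>m\<in>T. \<iota> (a m \<otimes>\<^bsub>R\<^esub> fR (%i. (count m i div q) * q))) = \<iota> (rho e a x)"
   unfolding rho_def T_def q_def by (subst \<iota>.hom_finsum) (use a in \<open>auto simp: comp_def\<close>)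
  finally show "exL (L.frac a (g [^]\<^bsub>A\<^esub> (p ^ e))) N \<otimes> fpw (%i. Suc (count N i)) =
    \<iota> (rho e a x) \<otimes> inv (fpw (%i. trunc (x i) e))" by (simp add: q_def t_def[abs_def])
 qed
qed

lemma Lam_frac: assumes a: "a : car A" and x: "x : Ypts p r"
 shows "Lam (L.frac a (g [^]\<^bsub>A\<^esub> (p ^ e))) x = \<iota> (rho e a x) \<otimes> inv (fpw (%i. trunc (x i) e))"
 by (rule Lam_eq[OF x isLam_frac[OF a x]])

lemma isLam_Lam: assumes z: "z : car AS" and x: "x : Ypts p r" shows "isLam z x (Lam z x)" proof -
 obtain e a where "a : car A" "z = L.frac a (g [^]\<^bsub>A\<^esub> (p ^ e))" using AS_rep[OF z] by blast
 thus ?thesis using isLam_frac[OF _ x] Lam_frac[OF _ x] by simp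
qed

text \<open>The formula at level e depends on x through its truncation at e, so e is also a level of
  \<open>Lam z\<close>.\<close>

lemma Lam_closed: assumes z: "z : car AS" shows "Lam z : car (CF p r B)" proof -
 obtain e a where a: "a : car A" and z: "z = L.frac a (g [^]\<^bsub>A\<^esub> (p ^ e))" using AS_rep[OF z] by blast
 show ?thesis proof (rule CF_I[OF p_pos, of _ _ _ e])
  have "Lam z : extensional (Ypts p r)" by (simp add: Lam_def)
  moreover have "Lam z x : car B" if "x : Ypts p r" for x unfolding z Lam_frac[OF a that] using a by simp
  ultimately show "Lam z : Ypts p r \<rightarrow>\<^sub>E car B" by (simp add: PiE_def)
  show "loc_const p r e (Lam z)" proof (rule loc_constI)
   fix x y assume xy: "x : Ypts p r" "y : Ypts p r" "cong_pts r e x y"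
   hence t: "trunc (x i) e = trunc (y i) e" if "i : {1..r}" for i using that by (simp add: cong_pts_def trunc_def)
   have "supp_at e a x = supp_at e a y" unfolding supp_at_def using t by simp
   hence "rho e a x = rho e a y" by (simp add: rho_def)
   moreover have "fpw (%i. trunc (x i) e) = fpw (%i. trunc (y i) e)" by (rule fpw_cong) (rule t)
   ultimately show "Lam z x = Lam z y" unfolding z Lam_frac[OF a xy(1)] Lam_frac[OF a xy(2)] by simp
  qed
 qed
qed

lemma exL_closed: "z : car AS ==> exL z N : car B" using ring_hom_closed[OF exL_hom] by simp

text \<open>The description by eventual coefficients is additive at once, with no common denominator
  to be found.\<close>

lemma Lam_add: assumes z: "z : car AS" and w: "w : car AS"
 shows "Lam (z \<oplus>\<^bsub>AS\<^esub> w) = Lam z \<oplus>\<^bsub>CF p r B\<^esub> Lam w" proof (rule Cfun_ext)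
 interpret C: ring "CF p r B" by (rule ring_CF[OF ring_axioms p_pos])
 show "Lam (z \<oplus>\<^bsub>AS\<^esub> w) : car (CF p r B)" "Lam z \<oplus>\<^bsub>CF p r B\<^esub> Lam w : car (CF p r B)"
  using z w by (auto intro: Lam_closed)
 fix x assume x: "x : Ypts p r"
 have "isLam (z \<oplus>\<^bsub>AS\<^esub> w) x (Lam z x \<oplus> Lam w x)" unfolding isLam_def
  by (rule evx_mono[OF evx_conj[OF x isLam_Lam[OF z x, unfolded isLam_def] isLam_Lam[OF w x, unfolded isLam_def]]])
   (use z w in \<open>auto simp: ring_hom_add[OF exL_hom] MPS_add l_distr exL_closed\<close>)
 thus "Lam (z \<oplus>\<^bsub>AS\<^esub> w) x = (Lam z \<oplus>\<^bsub>CF p r B\<^esub> Lam w) x" using Lam_eq[OF x] x by (simp add: Cfun_ops)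
qed

end

declare One_nat_def [simp del]

context bs_setup begin

subsection \<open>The kernel\<close>

lemma fR_zero: "(!!i. i : {1..r} ==> n i = 0) ==> fR n = \<one>\<^bsub>R\<^esub>"
 unfolding fR_def by (rule R.finprod_one_eqI) simp

lemma Suc_pow_split: "i : {1..r} ==> g = prod_f_minus_t R r f ({1..r} - {i}) \<otimes>\<^bsub>A\<^esub> gi i"
 and h_closed [simp]: "prod_f_minus_t R r f ({1..r} - {i}) : car A" proof -
 have h: "prod_f_minus_t R r f ({1..r} - {i}) = (\<Otimes>\<^bsub>A\<^esub>j\<in>{1..r} - {i}. gi j)" by (simp add: prod_f_minus_t_def gi_def)
 show "prod_f_minus_t R r f ({1..r} - {i}) : car A" unfolding h by (intro A.finprod_closed gi_Pi) auto
 assume i: "i : {1..r}"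
 have "(\<Otimes>\<^bsub>A\<^esub>j\<in>insert i ({1..r} - {i}). gi j) = gi i \<otimes>\<^bsub>A\<^esub> (\<Otimes>\<^bsub>A\<^esub>j\<in>{1..r} - {i}. gi j)"
  by (rule A.finprod_insert) (use i in auto)
 moreover have "insert i ({1..r} - {i}) = {1..r}" using i by auto
 ultimately have "g = gi i \<otimes>\<^bsub>A\<^esub> (\<Otimes>\<^bsub>A\<^esub>j\<in>{1..r} - {i}. gi j)" by (simp add: g_eq)
 also have "... = (\<Otimes>\<^bsub>A\<^esub>j\<in>{1..r} - {i}. gi j) \<otimes>\<^bsub>A\<^esub> gi i"
  by (rule A.m_comm) (use i in \<open>auto intro!: A.finprod_closed\<close>)
 finally show "g = prod_f_minus_t R r f ({1..r} - {i}) \<otimes>\<^bsub>A\<^esub> gi i" unfolding h .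
qed

text \<open>With h the product of the factors other than f_i - t_i, 1/h^n = (f_i - t_i)^n /
  g^n.\<close>

lemma cech_image_frac: assumes i: "i : {1..r}" and a: "a : car A"
 shows "loc_incl A S a \<otimes>\<^bsub>AS\<^esub> inv\<^bsub>AS\<^esub> (loc_incl A S (prod_f_minus_t R r f ({1..r} - {i}) [^]\<^bsub>A\<^esub> (n::nat))) =
  L.frac (a \<otimes>\<^bsub>A\<^esub> gi i [^]\<^bsub>A\<^esub> n) (g [^]\<^bsub>A\<^esub> n)" proof -
 let ?h = "prod_f_minus_t R r f ({1..r} - {i})"
 have gn: "g [^]\<^bsub>A\<^esub> n = ?h [^]\<^bsub>A\<^esub> n \<otimes>\<^bsub>A\<^esub> gi i [^]\<^bsub>A\<^esub> n"
  using Suc_pow_split[OF i] A.nat_pow_distrib[OF h_closed gi_closed[OF i]] by simp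
 have "loc_incl A S (?h [^]\<^bsub>A\<^esub> n) \<otimes>\<^bsub>AS\<^esub> L.frac (gi i [^]\<^bsub>A\<^esub> n) (g [^]\<^bsub>A\<^esub> n) = \<one>\<^bsub>AS\<^esub>"
 proof -
  have "loc_incl A S (?h [^]\<^bsub>A\<^esub> n) \<otimes>\<^bsub>AS\<^esub> L.frac (gi i [^]\<^bsub>A\<^esub> n) (g [^]\<^bsub>A\<^esub> n) = L.frac (g [^]\<^bsub>A\<^esub> n) (g [^]\<^bsub>A\<^esub> n)"
   unfolding loc_incl_def using i by (simp add: L.frac_mult L.S_one flip: gn)
  also have "... = \<one>\<^bsub>AS\<^esub>" unfolding L.Loc_one by (rule L.frac_eqI) (simp_all add: L.S_one)
  finally show ?thesis .
 qed
 hence "inv\<^bsub>AS\<^esub> (loc_incl A S (?h [^]\<^bsub>A\<^esub> n)) = L.frac (gi i [^]\<^bsub>A\<^esub> n) (g [^]\<^bsub>A\<^esub> n)"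
  by (intro AS.comm_inv_char) (use i ring_hom_closed[OF L.loc_incl_hom] in auto)
 thus ?thesis using a i by (simp add: loc_incl_def L.frac_mult L.S_one)
qed

lemma cech_image_eq: assumes i: "i : {1..r}"
 shows "cech_image R r f i = {L.frac (a \<otimes>\<^bsub>A\<^esub> gi i [^]\<^bsub>A\<^esub> n) (g [^]\<^bsub>A\<^esub> n) | a (n::nat). a : car A}"
 unfolding cech_image_def Let_def using cech_image_frac[OF i] by (intro Collect_cong) metis

text \<open>Over the denominator g^q, the factor (f_i - t_i)^q of the numerator cancels against one
  factor of 1/g^q. What remains is a polynomial times a series without t_i; its coefficients vanish
  as soon as the exponent of t_i exceeds the degree of the polynomial.\<close>

lemma Lam_cech_image: assumes i: "i : {1..r}" and y: "y : cech_image R r f i"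
 shows "y : car AS" "Lam y = \<zero>\<^bsub>CF p r B\<^esub>" proof -
 let ?h = "prod_f_minus_t R r f ({1..r} - {i})"
 obtain a and n :: nat where a: "a : car A" and y: "y = L.frac (a \<otimes>\<^bsub>A\<^esub> gi i [^]\<^bsub>A\<^esub> n) (g [^]\<^bsub>A\<^esub> n)"
  using y unfolding cech_image_eq[OF i] by blast
 show yc: "y : car AS" unfolding y using a i by simp
 \<comment> \<open>The exponent n of the fraction is arbitrary, whereas expansions are available for
   powers of p; n < p^n.\<close>
 define q where "q = p ^ n"
 have "n < q" unfolding q_def using p_gt1 by (simp add: power_gt_expt)
 hence q: "q = (q - n) + n" by simp
 define b where "b = a \<otimes>\<^bsub>A\<^esub> ?h [^]\<^bsub>A\<^esub> (q - n)"
 have b: "b : car A" using a by (simp add: b_def)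
 have gq: "g [^]\<^bsub>A\<^esub> (q - n) = ?h [^]\<^bsub>A\<^esub> (q - n) \<otimes>\<^bsub>A\<^esub> gi i [^]\<^bsub>A\<^esub> (q - n)"
  using Suc_pow_split[OF i] A.nat_pow_distrib[OF h_closed gi_closed[OF i]] by simp
 have "y = L.frac (g [^]\<^bsub>A\<^esub> (q - n) \<otimes>\<^bsub>A\<^esub> (a \<otimes>\<^bsub>A\<^esub> gi i [^]\<^bsub>A\<^esub> n)) (g [^]\<^bsub>A\<^esub> (q - n) \<otimes>\<^bsub>A\<^esub> g [^]\<^bsub>A\<^esub> n)"
  unfolding y using a i by (simp add: L.frac_expand)
 also have "g [^]\<^bsub>A\<^esub> (q - n) \<otimes>\<^bsub>A\<^esub> g [^]\<^bsub>A\<^esub> n = g [^]\<^bsub>A\<^esub> q" using q by (simp add: A.nat_pow_mult)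
 also have "g [^]\<^bsub>A\<^esub> (q - n) \<otimes>\<^bsub>A\<^esub> (a \<otimes>\<^bsub>A\<^esub> gi i [^]\<^bsub>A\<^esub> n) = b \<otimes>\<^bsub>A\<^esub> (gi i [^]\<^bsub>A\<^esub> (q - n) \<otimes>\<^bsub>A\<^esub> gi i [^]\<^bsub>A\<^esub> n)"
  unfolding gq b_def using a i by (simp add: A.m_ac)
 also have "gi i [^]\<^bsub>A\<^esub> (q - n) \<otimes>\<^bsub>A\<^esub> gi i [^]\<^bsub>A\<^esub> n = gi i [^]\<^bsub>A\<^esub> q" using q i by (simp add: A.nat_pow_mult)
 finally have yq: "y = L.frac (b \<otimes>\<^bsub>A\<^esub> gi i [^]\<^bsub>A\<^esub> q) (g [^]\<^bsub>A\<^esub> q)" .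
 let ?J = "{1..r} - {i}"
 have Wi: "W {1..r} q = PS i (wc q i) \<otimes>\<^bsub>MPS B\<^esub> W ?J q" proof -
  have "W (insert i ?J) q = PS i (wc q i) \<otimes>\<^bsub>MPS B\<^esub> W ?J q" unfolding W_def by (rule MB.finprod_insert) auto
  moreover have "insert i ?J = {1..r}" using i by auto
  ultimately show ?thesis by simp
 qed
 have "exL y = (ex b \<otimes>\<^bsub>MPS B\<^esub> ex (gi i [^]\<^bsub>A\<^esub> q)) \<otimes>\<^bsub>MPS B\<^esub> (PS i (wc q i) \<otimes>\<^bsub>MPS B\<^esub> W ?J q)"
  unfolding yq q_def using b i Wi by (subst exL_frac_q) (simp_all add: q_def)
 also have "... = ex b \<otimes>\<^bsub>MPS B\<^esub> ((ex (gi i [^]\<^bsub>A\<^esub> q) \<otimes>\<^bsub>MPS B\<^esub> PS i (wc q i)) \<otimes>\<^bsub>MPS B\<^esub> W ?J q)"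
  using b i ex.hom_closed[of b] ex.hom_closed[of "gi i [^]\<^bsub>A\<^esub> q"] PS_wc_closed W_closed
  by (simp only: MB.m_assoc MB.m_closed A.nat_pow_closed gi_closed)
 also have "... = ex b \<otimes>\<^bsub>MPS B\<^esub> W ?J q" unfolding q_def ex_gi_inv[OF i] by simp
 finally have exy: "exL y = ex b \<otimes>\<^bsub>MPS B\<^esub> W ?J q" .
 have fin: "finite {m. b m ~= \<zero>\<^bsub>R\<^esub>}" using b by (simp add: R.MPoly_carrier)
 define K where "K = Max (insert 0 (size ` {m. b m ~= \<zero>\<^bsub>R\<^esub>}))"
 have K: "count m i <= K" if "b m ~= \<zero>\<^bsub>R\<^esub>" for m proof -
  have "size m <= K" unfolding K_def using that fin by (intro Max_ge) auto
  moreover have "count m i <= size m" by (rule count_le_size)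
  ultimately show ?thesis by simp
 qed
 have z: "exL y N = \<zero>" if N: "Suc K <= count N i" for N proof (rule ccontr)
  assume "exL y N ~= \<zero>"
  then obtain m m' where m: "N = m + m'" "ex b m ~= \<zero>" "W ?J q m' ~= \<zero>"
   using MPS_mult_support[OF ex.hom_closed[OF b] W_closed] unfolding exy by blast
  have "b m ~= \<zero>\<^bsub>R\<^esub>" using m(2) by (auto simp: ex_val)
  hence "count m i <= K" by (rule K)
  moreover have "set_mset m' <= ?J" using m(3) finprod_PS[of ?J "wc q" m'] unfolding W_def by (auto split: if_splits)
  hence "count m' i = 0" by (auto simp: not_in_iff[symmetric])
  ultimately show False using N m(1) by simp
 qed
 show "Lam y = \<zero>\<^bsub>CF p r B\<^esub>" proof (rule Cfun_ext)
  interpret C: ring "CF p r B" by (rule ring_CF[OF ring_axioms p_pos])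
  show "Lam y : car (CF p r B)" "\<zero>\<^bsub>CF p r B\<^esub> : car (CF p r B)" using Lam_closed[OF yc] by auto
  fix x assume x: "x : Ypts p r"
  have "isLam y x \<zero>" unfolding isLam_def proof (rule evxI[where K = "Suc K" and E = 0])
   fix N :: "nat multiset" assume "!!i. i : {1..r} ==> Suc K <= count N i"
   hence "exL y N = \<zero>" using i by (intro z) blast
   thus "exL y N \<otimes> fpw (%i. Suc (count N i)) = \<zero>" by simp
  qed
  thus "Lam y x = \<zero>\<^bsub>CF p r B\<^esub> x" using Lam_eq[OF x] x by (simp add: Cfun_ops)
 qed
qed

text \<open>The ideal generated by the f_i^q - t_i^q for q = p^e. It turns out to consist of the
  numerators a for which a / g^q is a Cech boundary.\<close>

definition Qset :: "nat => (nat multiset => 'a) set" where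
 "Qset e = {(\<Oplus>\<^bsub>A\<^esub>i\<in>{1..r}. c i \<otimes>\<^bsub>A\<^esub> gi i [^]\<^bsub>A\<^esub> (p ^ e)) | c. c : {1..r} \<rightarrow> car A}"

lemma Qset_term_closed [simp]: "c : {1..r} \<rightarrow> car A ==> (%i. c i \<otimes>\<^bsub>A\<^esub> gi i [^]\<^bsub>A\<^esub> (n::nat)) : {1..r} \<rightarrow> car A"
 by (auto simp: Pi_iff)

lemma Qset_closed: "k : Qset e ==> k : car A"
 unfolding Qset_def by (auto simp del: atLeastAtMost_iff intro!: A.finsum_closed)

lemma Qset_add: assumes "k : Qset e" "l : Qset e" shows "k \<oplus>\<^bsub>A\<^esub> l : Qset e" proof -
 obtain c d where c: "c : {1..r} \<rightarrow> car A" "k = (\<Oplus>\<^bsub>A\<^esub>i\<in>{1..r}. c i \<otimes>\<^bsub>A\<^esub> gi i [^]\<^bsub>A\<^esub> (p ^ e))"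
  and d: "d : {1..r} \<rightarrow> car A" "l = (\<Oplus>\<^bsub>A\<^esub>i\<in>{1..r}. d i \<otimes>\<^bsub>A\<^esub> gi i [^]\<^bsub>A\<^esub> (p ^ e))"
  using assms unfolding Qset_def by blast
 have "k \<oplus>\<^bsub>A\<^esub> l = (\<Oplus>\<^bsub>A\<^esub>i\<in>{1..r}. c i \<otimes>\<^bsub>A\<^esub> gi i [^]\<^bsub>A\<^esub> (p ^ e) \<oplus>\<^bsub>A\<^esub> d i \<otimes>\<^bsub>A\<^esub> gi i [^]\<^bsub>A\<^esub> (p ^ e))"
  unfolding c(2) d(2) by (rule A.finsum_addf[symmetric]) (use c(1) d(1) in auto)
 also have "... = (\<Oplus>\<^bsub>A\<^esub>i\<in>{1..r}. (c i \<oplus>\<^bsub>A\<^esub> d i) \<otimes>\<^bsub>A\<^esub> gi i [^]\<^bsub>A\<^esub> (p ^ e))"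
  by (rule A.finsum_cong') (use c(1) d(1) in \<open>auto simp: A.l_distr Pi_iff\<close>)
 finally show ?thesis unfolding Qset_def using c(1) d(1)
  by (intro CollectI exI[of _ "%i. c i \<oplus>\<^bsub>A\<^esub> d i"]) (auto simp: Pi_iff)
qed

lemma Qset_zero: "\<zero>\<^bsub>A\<^esub> : Qset e" proof -
 have "(\<Oplus>\<^bsub>A\<^esub>i\<in>{1..r}. \<zero>\<^bsub>A\<^esub> \<otimes>\<^bsub>A\<^esub> gi i [^]\<^bsub>A\<^esub> (p ^ e)) = \<zero>\<^bsub>A\<^esub>"
  by (rule A.add.finprod_one_eqI) simp
 thus ?thesis unfolding Qset_def by (intro CollectI exI[of _ "%i. \<zero>\<^bsub>A\<^esub>"]) auto
qed

lemma Qset_single: assumes i: "i : {1..r}" and a: "a : car A"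
 shows "a \<otimes>\<^bsub>A\<^esub> gi i [^]\<^bsub>A\<^esub> (p ^ e) : Qset e" proof -
 let ?c = "%j. if j = i then a else \<zero>\<^bsub>A\<^esub>"
 have "(\<Oplus>\<^bsub>A\<^esub>j\<in>{1..r}. ?c j \<otimes>\<^bsub>A\<^esub> gi j [^]\<^bsub>A\<^esub> (p ^ e)) = (\<Oplus>\<^bsub>A\<^esub>j\<in>{1..r}. if i = j then a \<otimes>\<^bsub>A\<^esub> gi j [^]\<^bsub>A\<^esub> (p ^ e) else \<zero>\<^bsub>A\<^esub>)"
  by (rule A.finsum_cong') (use a in auto)
 also have "... = a \<otimes>\<^bsub>A\<^esub> gi i [^]\<^bsub>A\<^esub> (p ^ e)" by (rule A.finsum_singleton[OF i]) (use a in auto)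
 finally show ?thesis unfolding Qset_def using a by (intro CollectI exI[of _ ?c]) auto
qed

lemma Qset_finsum: assumes "h : M \<rightarrow> Qset e" shows "(\<Oplus>\<^bsub>A\<^esub>m\<in>M. h m) : Qset e" using assms
proof (induction M rule: infinite_finite_induct)
 case (insert m M)
 thus ?case using Qset_closed[of _ e] by (subst A.finsum_insert) (auto simp: Pi_iff intro: Qset_add)
qed (use Qset_zero in auto)

definition red :: "nat => nat multiset => nat multiset" where
 "red q m = (\<Sum>i\<in>{1..r}. rep (count m i mod q) i)"

lemma count_red: "count (red q m) i = (if i : {1..r} then count m i mod q else 0)" by (simp add: red_def count_sum)

lemma set_red: "set_mset (red q m) <= {1..r}" proof
 fix i assume "i \<in># red q m"
 hence "count (red q m) i ~= 0" by simp
 thus "i : {1..r}" unfolding count_red by (auto split: if_splits)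
qed

text \<open>Modulo \<open>Qset\<close> a factor t_i^q may be replaced by f_i^q; the induction
  removes one such block at a time until all exponents are below q.\<close>

lemma mon_red: assumes c: "c : car R" and m: "set_mset m <= {1..r}"
 shows "mon R c m \<ominus>\<^bsub>A\<^esub> mon R (c \<otimes>\<^bsub>R\<^esub> fR (%i. (count m i div p ^ e) * p ^ e)) (red (p ^ e) m) : Qset e"
 using c m proof (induction "size m" arbitrary: c m rule: less_induct)
 case less
 define q where "q = p ^ e"
 have q: "q > 0" using p_pos by (simp add: q_def)
 show ?case proof (cases "\<forall>i\<in>{1..r}. count m i < q")
  case True
  have "red q m = m" by (rule multiset_eqI) (use True less.prems(2) in \<open>auto simp: count_red not_in_iff[symmetric]\<close>)
  moreover have "fR (%i. (count m i div q) * q) = \<one>\<^bsub>R\<^esub>" unfolding fR_def by (rule R.finprod_one_eqI) (use True in auto)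
  ultimately show ?thesis using less.prems Qset_zero by (simp add: q_def[symmetric] a_minus_def A.r_neg)
 next
  case False
  then obtain i where i: "i : {1..r}" "q <= count m i" by (auto simp: not_less)
  define m' where "m' = m - rep q i"
  have mm: "m = m' + rep q i" using i(2) by (simp add: m'_def count_le_replicate_mset_subset_eq)
  have m': "set_mset m' <= {1..r}" using less.prems(2) unfolding m'_def by (meson in_diffD subset_iff)
  \<comment> \<open>The replacement of one t_i^q by f_i^q: c t^m and d t^(m') differ by -c t^(m')
    times (f_i - t_i)^q.\<close>
  define d where "d = c \<otimes>\<^bsub>R\<^esub> f i [^]\<^bsub>R\<^esub> q"
  have fi: "f i : car R" using f_car i by blast
  have d: "d : car R" using less.prems(1) fi by (simp add: d_def)
  have "size m' < size m" using q by (simp add: mm)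
  from less.hyps[OF this d m'] have IH: "mon R d m' \<ominus>\<^bsub>A\<^esub> mon R (d \<otimes>\<^bsub>R\<^esub> fR (%i. (count m' i div q) * q)) (red q m') : Qset e"
   by (simp add: q_def)
  have rd: "red q m' = red q m" by (rule multiset_eqI) (simp add: count_red mm)
  have "f i [^]\<^bsub>R\<^esub> q \<otimes>\<^bsub>R\<^esub> fR (%j. (count m' j div q) * q) = fR (%j. (count m j div q) * q)"
  proof -
   have "fR (%j. (count m j div q) * q) = (\<Otimes>\<^bsub>R\<^esub>j\<in>{1..r}. (if i = j then f j [^]\<^bsub>R\<^esub> q else \<one>\<^bsub>R\<^esub>) \<otimes>\<^bsub>R\<^esub> f j [^]\<^bsub>R\<^esub> ((count m' j div q) * q))"
    unfolding fR_def by (rule R.finprod_cong') (use f_car q in \<open>auto simp: mm R.nat_pow_mult add_mult_distrib add.commute\<close>)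
   also have "... = (\<Otimes>\<^bsub>R\<^esub>j\<in>{1..r}. if i = j then f j [^]\<^bsub>R\<^esub> q else \<one>\<^bsub>R\<^esub>) \<otimes>\<^bsub>R\<^esub> fR (%j. (count m' j div q) * q)"
    unfolding fR_def by (rule R.finprod_multf) (use f_car in auto)
   also have "(\<Otimes>\<^bsub>R\<^esub>j\<in>{1..r}. if i = j then f j [^]\<^bsub>R\<^esub> q else \<one>\<^bsub>R\<^esub>) = f i [^]\<^bsub>R\<^esub> q"
    by (rule R.finprod_singleton[OF i(1)]) (use f_car in auto)
   finally show ?thesis ..
  qed
  hence df: "d \<otimes>\<^bsub>R\<^esub> fR (%j. (count m' j div q) * q) = c \<otimes>\<^bsub>R\<^esub> fR (%j. (count m j div q) * q)"
   unfolding d_def using less.prems(1) fi by (simp add: R.m_assoc)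
  have mc: "mon R c m' : car A" using less.prems(1) m' by simp
  have tq: "mon R \<one>\<^bsub>R\<^esub> (rep q i) : car A" "mon R (f i [^]\<^bsub>R\<^esub> q) {#} : car A"
   using i fi by auto
  have "\<ominus>\<^bsub>A\<^esub> mon R c m' \<otimes>\<^bsub>A\<^esub> gi i [^]\<^bsub>A\<^esub> q = mon R c m' \<otimes>\<^bsub>A\<^esub> mon R \<one>\<^bsub>R\<^esub> (rep q i) \<ominus>\<^bsub>A\<^esub> mon R c m' \<otimes>\<^bsub>A\<^esub> mon R (f i [^]\<^bsub>R\<^esub> q) {#}"
   unfolding q_def gi_pow[OF i(1)] unfolding q_def[symmetric]
   using mc tq by (simp add: a_minus_def A.r_distr A.l_minus A.r_minus A.minus_add A.a_comm)
  also have "... = mon R c m \<ominus>\<^bsub>A\<^esub> mon R d m'" using less.prems(1) fi by (simp add: R.MPoly_ops R.mon_mult_mon mm d_def)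
  finally have 1: "mon R c m \<ominus>\<^bsub>A\<^esub> mon R d m' : Qset e"
   using Qset_single[OF i(1) A.a_inv_closed[OF mc], of e] unfolding q_def[symmetric] by simp
  let ?C = "mon R (c \<otimes>\<^bsub>R\<^esub> fR (%j. (count m j div q) * q)) (red q m)"
  have cl: "mon R c m : car A" "mon R d m' : car A" "?C : car A" using less.prems d m' set_red by auto
  have "mon R c m \<ominus>\<^bsub>A\<^esub> ?C = (mon R c m \<ominus>\<^bsub>A\<^esub> mon R d m') \<oplus>\<^bsub>A\<^esub> (mon R d m' \<ominus>\<^bsub>A\<^esub> ?C)"
   using cl by (simp add: a_minus_def A.a_assoc A.r_neg1) thus ?thesis using Qset_add[OF 1 IH[unfolded rd df]] by (simp add: q_def)
 qed
qed

lemma A_finsum_val: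
 "h : M \<rightarrow> car A ==> (\<Oplus>\<^bsub>A\<^esub>m\<in>M. h m) b = (\<Oplus>\<^bsub>R\<^esub>m\<in>M. h m b)"
 by (rule additive_map(2)[OF A.abelian_group_axioms R.abelian_group_axioms, of "%g. g b"]) (auto simp: R.MPoly_ops R.MPS_add)

lemma mon_sum: assumes a: "a : car A" shows "(\<Oplus>\<^bsub>A\<^esub>m\<in>{m. a m ~= \<zero>\<^bsub>R\<^esub>}. mon R (a m) m) = a"
proof
 fix b
 define M where "M = {m. a m ~= \<zero>\<^bsub>R\<^esub>}"
 have fin: "finite M" and sM: "!!m. m : M ==> set_mset m <= {1..r}" using a by (auto simp: R.MPoly_carrier M_def)
 have "(\<Oplus>\<^bsub>A\<^esub>m\<in>M. mon R (a m) m) b = (\<Oplus>\<^bsub>R\<^esub>m\<in>M. mon R (a m) m b)"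
  by (rule A_finsum_val) (use a sM in auto)
 also have "... = (\<Oplus>\<^bsub>R\<^esub>m\<in>M. if b = m then a m else \<zero>\<^bsub>R\<^esub>)"
  by (rule R.finsum_cong') (use a in \<open>auto simp: mon_def\<close>)
 also have "... = a b" proof (cases "b : M")
  case True thus ?thesis by (rule R.finsum_singleton) (use a fin in auto)
 next
  case False
  hence "(\<Oplus>\<^bsub>R\<^esub>m\<in>M. if b = m then a m else \<zero>\<^bsub>R\<^esub>) = \<zero>\<^bsub>R\<^esub>" by (intro R.add.finprod_one_eqI) auto
  thus ?thesis using False by (simp add: M_def)
 qed
 finally show "(\<Oplus>\<^bsub>A\<^esub>m\<in>{m. a m ~= \<zero>\<^bsub>R\<^esub>}. mon R (a m) m) b = a b" by (simp add: M_def)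
qed

text \<open>Summing \<open>mon_red\<close> over the monomials of a writes a, modulo
  \<open>Qset\<close>, in terms of the t^b with b_i < q. The coefficients are the values of
  \<open>rho\<close>, and all of these vanish by assumption.\<close>

lemma rho_zero_imp_Qset: assumes a: "a : car A" and z: "!!x. x : Ypts p r ==> rho e a x = \<zero>\<^bsub>R\<^esub>"
 shows "a : Qset e" proof -
 define q where "q = p ^ e"
 have q: "q > 0" using p_pos by (simp add: q_def)
 define M where "M = {m. a m ~= \<zero>\<^bsub>R\<^esub>}"
 have fin: "finite M" and sM: "!!m. m : M ==> set_mset m <= {1..r}" using a by (auto simp: R.MPoly_carrier M_def)
 let ?t = "%m. a m \<otimes>\<^bsub>R\<^esub> fR (%i. (count m i div q) * q)"
 have tc: "?t m : car R" for m using a by simp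
 have cl: "(%m. mon R (a m) m) : M \<rightarrow> car A" "(%m. mon R (?t m) (red q m)) : M \<rightarrow> car A"
  using a sM set_red tc by auto
 have s1: "(\<Oplus>\<^bsub>A\<^esub>m\<in>M. mon R (a m) m) = a" unfolding M_def by (rule mon_sum[OF a])
 have s2: "(\<Oplus>\<^bsub>A\<^esub>m\<in>M. mon R (?t m) (red q m)) = \<zero>\<^bsub>A\<^esub>" proof
  fix b
  have "(\<Oplus>\<^bsub>A\<^esub>m\<in>M. mon R (?t m) (red q m)) b = (\<Oplus>\<^bsub>R\<^esub>m\<in>M. mon R (?t m) (red q m) b)" by (rule A_finsum_val[OF cl(2)])
  also have "... = (\<Oplus>\<^bsub>R\<^esub>m\<in>{m : M. red q m = b}. ?t m)"
   by (rule R.add.finprod_mono_neutral_cong_right) (use fin tc in \<open>auto simp: mon_def\<close>)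
  also have "... = \<zero>\<^bsub>R\<^esub>" proof (cases "{m : M. red q m = b} = {}")
   case False
   hence bq: "count b i < q" if "i : {1..r}" for i using q that by (auto simp: count_red)
   \<comment> \<open>The point with truncations q - 1 - b_i, at which \<open>rho\<close> is the
     coefficient of t^b.\<close>
   define x where "x = (\<lambda>i\<in>{1..r}. Zp_of_int p (int (q - 1 - count b i)))"
   have x: "x : Ypts p r" using Zp_of_int_carrier[OF p_pos] by (auto simp: topspace_Zp_space x_def)
   have t: "trunc (x i) e = q - 1 - count b i" if "i : {1..r}" for i using that q by (simp add: x_def trunc_Zp_of_int q_def[symmetric])
   have "{m : M. red q m = b} = supp_at e a x" unfolding supp_at_def M_def mem_Collect_eq proof (rule Collect_cong)
    fix m
    have "red q m = b \<longleftrightarrow> (\<forall>i\<in>{1..r}. count m i mod q = count b i)" proof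
     assume *: "\<forall>i\<in>{1..r}. count m i mod q = count b i"
     show "red q m = b" proof (rule multiset_eqI)
      fix i
      have "i \<notin> {1..r} ==> count b i = 0" using False set_red by (auto simp: count_red simp del: atLeastAtMost_iff)
      thus "count (red q m) i = count b i" using * by (auto simp: count_red simp del: atLeastAtMost_iff)
     qed
    qed (auto simp: count_red)
    also have "... \<longleftrightarrow> (\<forall>i\<in>{1..r}. count m i mod p ^ e = p ^ e - 1 - trunc (x i) e)"
    proof (intro ball_cong refl)
     fix i assume i: "i : {1..r}"
     have "q - 1 - trunc (x i) e = count b i" using t[OF i] bq[OF i] by simp
     thus "count m i mod q = count b i \<longleftrightarrow> count m i mod p ^ e = p ^ e - 1 - trunc (x i) e" by (simp add: q_def)
    qed
    finally show "a m ~= \<zero>\<^bsub>R\<^esub> \<and> red q m = b \<longleftrightarrow>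
     a m ~= \<zero>\<^bsub>R\<^esub> \<and> (\<forall>i\<in>{1..r}. count m i mod p ^ e = p ^ e - 1 - trunc (x i) e)" by simp
   qed
   thus ?thesis using z[OF x] by (simp add: rho_def q_def)
  next
   case True
   show ?thesis unfolding True by simp
  qed
  finally show "(\<Oplus>\<^bsub>A\<^esub>m\<in>M. mon R (?t m) (red q m)) b = \<zero>\<^bsub>A\<^esub> b" by (simp add: R.MPoly_ops R.MPS_zero)
 qed
 have "(\<Oplus>\<^bsub>A\<^esub>m\<in>M. mon R (a m) m \<ominus>\<^bsub>A\<^esub> mon R (?t m) (red q m)) \<oplus>\<^bsub>A\<^esub> (\<Oplus>\<^bsub>A\<^esub>m\<in>M. mon R (?t m) (red q m)) =
  (\<Oplus>\<^bsub>A\<^esub>m\<in>M. (mon R (a m) m \<ominus>\<^bsub>A\<^esub> mon R (?t m) (red q m)) \<oplus>\<^bsub>A\<^esub> mon R (?t m) (red q m))"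
  by (rule A.finsum_addf[symmetric]) (use cl in auto)
 also have "... = (\<Oplus>\<^bsub>A\<^esub>m\<in>M. mon R (a m) m)"
  by (rule A.finsum_cong') (use cl in \<open>auto simp: a_minus_def A.a_assoc A.l_neg Pi_iff\<close>)
 finally have "a = (\<Oplus>\<^bsub>A\<^esub>m\<in>M. mon R (a m) m \<ominus>\<^bsub>A\<^esub> mon R (?t m) (red q m))"
  unfolding s1 s2 using cl by (simp add: A.finsum_closed Pi_iff)
 also have "... : Qset e" by (rule Qset_finsum) (use mon_red a sM in \<open>auto simp: q_def\<close>)
 finally show ?thesis .
qed

text \<open>The powers of the f_i are units of B and \<iota> is injective, so \<open>rho\<close>
  itself vanishes.\<close>

lemma Lam_zero_Qset: assumes a: "a : car A" and z: "Lam (L.frac a (g [^]\<^bsub>A\<^esub> (p ^ e))) = \<zero>\<^bsub>CF p r B\<^esub>"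
 shows "a : Qset e" proof (rule rho_zero_imp_Qset[OF a])
 fix x assume x: "x : Ypts p r"
 have "\<iota> (rho e a x) \<otimes> inv (fpw (%i. trunc (x i) e)) = \<zero>"
  using fun_cong[OF z, of x] x unfolding Lam_frac[OF a x] by (simp add: Cfun_ops)
 hence "\<iota> (rho e a x) \<otimes> inv (fpw (%i. trunc (x i) e)) \<otimes> fpw (%i. trunc (x i) e) = \<zero>" by simp
 hence "\<iota> (rho e a x) = \<iota> \<zero>\<^bsub>R\<^esub>" using a by (simp add: fpw_cancel(2))
 thus "rho e a x = \<zero>\<^bsub>R\<^esub>" using inj_onD[OF \<iota>_inj] a by simp
qed

lemma frac_finsum: assumes "h : M \<rightarrow> car A" "s : S"
 shows "L.frac (\<Oplus>\<^bsub>A\<^esub>i\<in>M. h i) s = (\<Oplus>\<^bsub>AS\<^esub>i\<in>M. L.frac (h i) s)"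
 by (rule additive_map(2)[OF A.abelian_group_axioms AS.abelian_group_axioms, of "%a. L.frac a s"])
  (use assms in \<open>auto simp: L.frac_add_same\<close>)

lemma Qset_bound: assumes "a : Qset e" shows "L.frac a (g [^]\<^bsub>A\<^esub> (p ^ e)) : cech_bound R r f" proof -
 obtain c where c: "c : {1..r} \<rightarrow> car A" "a = (\<Oplus>\<^bsub>A\<^esub>i\<in>{1..r}. c i \<otimes>\<^bsub>A\<^esub> gi i [^]\<^bsub>A\<^esub> (p ^ e))"
  using assms unfolding Qset_def by blast
 have "L.frac a (g [^]\<^bsub>A\<^esub> (p ^ e)) = (\<Oplus>\<^bsub>AS\<^esub>i\<in>{1..r}. L.frac (c i \<otimes>\<^bsub>A\<^esub> gi i [^]\<^bsub>A\<^esub> (p ^ e)) (g [^]\<^bsub>A\<^esub> (p ^ e)))"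
  unfolding c(2) by (rule frac_finsum) (use c(1) in auto)
 moreover have "\<forall>i\<in>{1..r}. L.frac (c i \<otimes>\<^bsub>A\<^esub> gi i [^]\<^bsub>A\<^esub> (p ^ e)) (g [^]\<^bsub>A\<^esub> (p ^ e)) : cech_image R r f i"
  using c(1) cech_image_eq by blast
 ultimately show ?thesis unfolding cech_bound_def by blast
qed

text \<open>\<open>Lam\<close> is additive and vanishes on each Cech image; conversely a fraction
  over g^(p^e) with \<open>Lam\<close> zero has its numerator in \<open>Qset\<close>. This is what
  makes \<open>Lam\<close> injective on local cohomology.\<close>

lemma cech_bound_eq: "cech_bound R r f = {z : car AS. Lam z = \<zero>\<^bsub>CF p r B\<^esub>}" proof (intro equalityI subsetI)
 interpret C: ring "CF p r B" by (rule ring_CF[OF ring_axioms p_pos])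
 fix z assume "z : cech_bound R r f"
 then obtain y where y: "z = (\<Oplus>\<^bsub>AS\<^esub>i\<in>{1..r}. y i)" "\<forall>i\<in>{1..r}. y i : cech_image R r f i"
  unfolding cech_bound_def by blast
 have yc: "y : {1..r} \<rightarrow> car AS" using y(2) Lam_cech_image(1) by blast
 have "Lam z = (\<Oplus>\<^bsub>CF p r B\<^esub>i\<in>{1..r}. Lam (y i))" unfolding y(1)
  by (rule additive_map(2)[OF AS.abelian_group_axioms C.abelian_group_axioms Lam_closed Lam_add yc])
 also have "... = \<zero>\<^bsub>CF p r B\<^esub>" by (rule C.add.finprod_one_eqI) (use y(2) Lam_cech_image(2) in blast)
 finally show "z : {z : car AS. Lam z = \<zero>\<^bsub>CF p r B\<^esub>}" using yc y(1) by simp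
next
 fix z assume z: "z : {z : car AS. Lam z = \<zero>\<^bsub>CF p r B\<^esub>}"
 then obtain e a where a: "a : car A" "z = L.frac a (g [^]\<^bsub>A\<^esub> (p ^ e))" using AS_rep[of z] by blast
 thus "z : cech_bound R r f" using Lam_zero_Qset[OF a(1)] Qset_bound z by blast
qed

subsection \<open>Operators on local cohomology classes\<close>

text \<open>The denominator is a q-th power for q = p^e, so an operator of level e acts on the
  numerator alone.\<close>

lemma DiffOp_loc_frac_q: assumes phi: "phi : DL p A e" and a: "a : car A"
 shows "DiffOp_loc p A S phi (L.frac a (g [^]\<^bsub>A\<^esub> (p ^ e))) = L.frac (phi a) (g [^]\<^bsub>A\<^esub> (p ^ e))" proof -
 define k where "k = p ^ e - 1"
 have q: "p ^ e = Suc k" using p_pos by (simp add: k_def)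
 define w where "w = g [^]\<^bsub>A\<^esub> k"
 have w: "w : car A" by (simp add: w_def)
 have sw: "w [^]\<^bsub>A\<^esub> (p ^ e) : S" unfolding w_def by (simp only: A.nat_pow_pow[OF g_closed] g_pow_S)
 have 1: "(g [^]\<^bsub>A\<^esub> (p ^ e)) [^]\<^bsub>A\<^esub> (p ^ e - 1) = w [^]\<^bsub>A\<^esub> (p ^ e)"
  unfolding w_def k_def[symmetric] by (simp only: A.nat_pow_pow[OF g_closed] mult.commute)
 have 2: "(g [^]\<^bsub>A\<^esub> (p ^ e)) [^]\<^bsub>A\<^esub> (p ^ e) = w [^]\<^bsub>A\<^esub> (p ^ e) \<otimes>\<^bsub>A\<^esub> g [^]\<^bsub>A\<^esub> (p ^ e)"
  unfolding w_def q by (rule A.pow_Suc_Suc) simp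
 have "DiffOp_loc p A S phi (L.frac a (g [^]\<^bsub>A\<^esub> (p ^ e))) =
   L.frac (phi (w [^]\<^bsub>A\<^esub> (p ^ e) \<otimes>\<^bsub>A\<^esub> a)) (w [^]\<^bsub>A\<^esub> (p ^ e) \<otimes>\<^bsub>A\<^esub> g [^]\<^bsub>A\<^esub> (p ^ e))"
  by (subst L.DiffOp_loc_frac[OF phi p_pos a g_pow_S]) (simp only: 1 2)
 also have "phi (w [^]\<^bsub>A\<^esub> (p ^ e) \<otimes>\<^bsub>A\<^esub> a) = w [^]\<^bsub>A\<^esub> (p ^ e) \<otimes>\<^bsub>A\<^esub> phi a"
  by (rule DLD(4)[OF phi w a])
 also have "L.frac (w [^]\<^bsub>A\<^esub> (p ^ e) \<otimes>\<^bsub>A\<^esub> phi a) (w [^]\<^bsub>A\<^esub> (p ^ e) \<otimes>\<^bsub>A\<^esub> g [^]\<^bsub>A\<^esub> (p ^ e)) = L.frac (phi a) (g [^]\<^bsub>A\<^esub> (p ^ e))"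
  by (rule L.frac_expand[OF DLD(2)[OF phi a] g_pow_S sw])
 finally show ?thesis .
qed

text \<open>The generators of \<open>Qset\<close> are q-th powers, and phi is linear over
  these.\<close>

lemma Qset_DiffOp: assumes phi: "phi : DL p A e" and a: "a : Qset e" shows "phi a : Qset e" proof -
 obtain c where c: "c : {1..r} \<rightarrow> car A" "a = (\<Oplus>\<^bsub>A\<^esub>i\<in>{1..r}. c i \<otimes>\<^bsub>A\<^esub> gi i [^]\<^bsub>A\<^esub> (p ^ e))"
  using a unfolding Qset_def by blast
 have "phi a = (\<Oplus>\<^bsub>A\<^esub>i\<in>{1..r}. phi (c i \<otimes>\<^bsub>A\<^esub> gi i [^]\<^bsub>A\<^esub> (p ^ e)))"
  unfolding c(2) by (rule A.DiffOp_finsum[OF phi]) (use c(1) in simp)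
 also have "... : Qset e" proof (rule Qset_finsum, rule funcsetI)
  fix i assume i: "i : {1..r}"
  hence ci: "c i : car A" using c(1) by blast
  have "phi (c i \<otimes>\<^bsub>A\<^esub> gi i [^]\<^bsub>A\<^esub> (p ^ e)) = phi (gi i [^]\<^bsub>A\<^esub> (p ^ e) \<otimes>\<^bsub>A\<^esub> c i)"
   using ci i by (simp add: A.m_comm)
  also have "... = phi (c i) \<otimes>\<^bsub>A\<^esub> gi i [^]\<^bsub>A\<^esub> (p ^ e)"
   using ci i DLD(4)[OF phi gi_closed[OF i] ci] DLD(2)[OF phi ci] by (simp add: A.m_comm)
  finally show "phi (c i \<otimes>\<^bsub>A\<^esub> gi i [^]\<^bsub>A\<^esub> (p ^ e)) : Qset e"
   using Qset_single[OF i DLD(2)[OF phi ci]] by simp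
 qed
 finally show ?thesis .
qed

lemma DiffOp_loc_closed: "phi : DL p A e ==> z : car AS ==> DiffOp_loc p A S phi z : car AS"
 by (rule DLD(2)[OF L.DiffOp_loc_level[OF _ p_pos]])

lemma Lam_DiffOp_zero: assumes phi: "phi : DL p A e" and z: "z : car AS" "Lam z = \<zero>\<^bsub>CF p r B\<^esub>"
 shows "Lam (DiffOp_loc p A S phi z) = \<zero>\<^bsub>CF p r B\<^esub>" proof -
 obtain E where E: "!!e. e \<ge> E ==> \<exists>a\<in>car A. z = L.frac a (g [^]\<^bsub>A\<^esub> (p ^ e))" using AS_rep[OF z(1)] by blast
 define d where "d = max e E"
 obtain a where a: "a : car A" "z = L.frac a (g [^]\<^bsub>A\<^esub> (p ^ d))" using E[of d] by (auto simp: d_def)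
 have phid: "phi : DL p A d" by (rule A.DiffOp_level_mono[OF phi]) (simp add: d_def)
 have "a : Qset d" using Lam_zero_Qset[OF a(1)] z(2) a(2) by simp
 hence "phi a : Qset d" by (rule Qset_DiffOp[OF phid])
 hence "L.frac (phi a) (g [^]\<^bsub>A\<^esub> (p ^ d)) : cech_bound R r f" by (rule Qset_bound)
 thus ?thesis unfolding a(2) DiffOp_loc_frac_q[OF phid a(1)] cech_bound_eq by blast
qed

section \<open>The operators Delta(P) on polynomials and on expansions\<close>

definition pt :: "nat multiset => nat => nat => int" where
 "pt m = (\<lambda>i\<in>{1..r}. Zp_of_int p (- int (count m i) - 1))"

lemma pt_Ypts: "pt m : Ypts p r" using Zp_of_int_carrier[OF p_pos] by (auto simp: topspace_Zp_space pt_def)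

lemma Delta_val: "a : car A ==> Delta p r R P a m = P (pt m) (a m)" by (simp add: Delta_def pt_def)

text \<open>The exponents m collected in \<open>supp_at\<close> are those whose evaluation point -m
  - 1 in \<open>Delta\<close> is congruent to x.\<close>

lemma pt_cong: assumes x: "x : Ypts p r" and m: "!!i. i : {1..r} ==> count m i mod p ^ e = p ^ e - 1 - trunc (x i) e"
 shows "cong_pts r e (pt m) x" unfolding cong_pts_def proof
 fix i assume i: "i : {1..r}"
 have xi: "x i : car (Zp p)" by (rule Ypts_D[OF x i])
 have t: "trunc (x i) e < p ^ e" by (rule trunc_less[OF xi])
 have "count m i + 1 + trunc (x i) e = (count m i div p ^ e + 1) * p ^ e"
  using div_mult_mod_eq[of "count m i" "p ^ e"] m[OF i] t by (simp add: algebra_simps)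
 hence "int (count m i) + 1 + int (trunc (x i) e) = (int (count m i div p ^ e) + 1) * int (p ^ e)"
  by (metis (mono_tags, lifting) of_nat_1 of_nat_add of_nat_mult)
 hence "- int (count m i) - 1 = int (trunc (x i) e) + (- int (count m i div p ^ e) - 1) * int (p ^ e)" by (simp add: algebra_simps)
 hence "(- int (count m i) - 1) mod int p ^ e = int (trunc (x i) e) mod int p ^ e" by (metis mod_mult_self1 of_nat_power)
 also have "... = x i e" using int_trunc[OF xi] xi by (simp add: Zp_carrier)
 finally show "pt m i e = x i e" using i by (simp add: pt_def Zp_of_int_def)
qed

text \<open>By Frobenius the q-th power of a polynomial is the sum of the q-th powers of its terms,
  so linearity over terms k^q t^b with q dividing b suffices. The set C of elements whose q-th power
  passes through phi contains the constants and is closed under sums and under multiplication by a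
  variable.\<close>

lemma DiffOp_levelI_mon: assumes ext: "phi : car A \<rightarrow>\<^sub>E car A"
  and add: "!!a b. a : car A ==> b : car A ==> phi (a \<oplus>\<^bsub>A\<^esub> b) = phi a \<oplus>\<^bsub>A\<^esub> phi b"
  and monD: "!!k b a. k : car R ==> set_mset b <= {1..r} ==> (!!i. p ^ e dvd count b i) ==> a : car A ==>
   phi (mon R (k [^]\<^bsub>R\<^esub> (p ^ e)) b \<otimes>\<^bsub>A\<^esub> a) = mon R (k [^]\<^bsub>R\<^esub> (p ^ e)) b \<otimes>\<^bsub>A\<^esub> phi a"
 shows "phi : DL p A e" proof -
 define q where "q = p ^ e"
 note monD = monD[folded q_def]
 have cl: "phi a : car A" if "a : car A" for a using ext that by blast
 define C where "C = {c : car A. \<forall>a\<in>car A. phi (c [^]\<^bsub>A\<^esub> q \<otimes>\<^bsub>A\<^esub> a) = c [^]\<^bsub>A\<^esub> q \<otimes>\<^bsub>A\<^esub> phi a}"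
 have "c : C" if c: "c : car A" for c proof -
  have "c : ring.indexed_pset R {1..r} (car R)" using c by (simp only: MPoly_sel) thus ?thesis
  proof (induction rule: R.indexed_pset.induct)
   case (indexed_const k)
   have kk: "R.indexed_const k = mon R k {#}" by (simp add: R.indexed_const_def mon_def)
   have kc: "mon R k {#} : car A" using indexed_const by simp
   have "mon R k {#} [^]\<^bsub>A\<^esub> q = mon R (k [^]\<^bsub>R\<^esub> q) {#}" using indexed_const by (simp add: R.MPoly_pow R.mon_pow)
   thus ?case unfolding kk C_def using kc monD[OF indexed_const, of "{#}"] by simp
  next
   case (indexed_padd c d)
   have e: "R.indexed_padd c d = c \<oplus>\<^bsub>A\<^esub> d" by (simp only: R.MPoly_ops MPS_sel)
   have cd: "c : car A" "d : car A" using indexed_padd by (auto simp: C_def)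
   have fr: "(c \<oplus>\<^bsub>A\<^esub> d) [^]\<^bsub>A\<^esub> q = c [^]\<^bsub>A\<^esub> q \<oplus>\<^bsub>A\<^esub> d [^]\<^bsub>A\<^esub> q"
    unfolding q_def by (rule A.frobenius[OF p_prime R.MPoly_char[OF char_R] cd])
   show ?case unfolding e C_def proof (intro CollectI conjI ballI)
    show "c \<oplus>\<^bsub>A\<^esub> d : car A" using cd by simp
    fix a assume a: "a : car A"
    have "phi (c [^]\<^bsub>A\<^esub> q \<otimes>\<^bsub>A\<^esub> a) = c [^]\<^bsub>A\<^esub> q \<otimes>\<^bsub>A\<^esub> phi a" "phi (d [^]\<^bsub>A\<^esub> q \<otimes>\<^bsub>A\<^esub> a) = d [^]\<^bsub>A\<^esub> q \<otimes>\<^bsub>A\<^esub> phi a"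
     using indexed_padd a by (auto simp: C_def)
    thus "phi ((c \<oplus>\<^bsub>A\<^esub> d) [^]\<^bsub>A\<^esub> q \<otimes>\<^bsub>A\<^esub> a) = (c \<oplus>\<^bsub>A\<^esub> d) [^]\<^bsub>A\<^esub> q \<otimes>\<^bsub>A\<^esub> phi a"
     unfolding fr using cd a cl by (simp add: A.l_distr add)
   qed
  next
   case (indexed_pmult c i)
   have cc: "c : car A" using indexed_pmult by (simp add: C_def)
   have t: "mon R \<one>\<^bsub>R\<^esub> {#i#} : car A" using indexed_pmult by simp
   have e: "R.indexed_pmult c i = mon R \<one>\<^bsub>R\<^esub> {#i#} \<otimes>\<^bsub>A\<^esub> c"
    by (rule HOL.ext) (use R.MPoly_MPS_sub[OF cc] cc in \<open>simp add: R.MPoly_ops R.mon_mult R.indexed_pmult_def\<close>)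
   have tq: "mon R \<one>\<^bsub>R\<^esub> {#i#} [^]\<^bsub>A\<^esub> q = mon R (\<one>\<^bsub>R\<^esub> [^]\<^bsub>R\<^esub> q) (rep q i)"
    by (simp add: R.MPoly_pow R.mon_pow)
   have tqc: "mon R (\<one>\<^bsub>R\<^esub> [^]\<^bsub>R\<^esub> q) (rep q i) : car A" using indexed_pmult by auto
   have pw: "(mon R \<one>\<^bsub>R\<^esub> {#i#} \<otimes>\<^bsub>A\<^esub> c) [^]\<^bsub>A\<^esub> q = mon R (\<one>\<^bsub>R\<^esub> [^]\<^bsub>R\<^esub> q) (rep q i) \<otimes>\<^bsub>A\<^esub> c [^]\<^bsub>A\<^esub> q"
    using A.nat_pow_distrib[OF t cc, of q] tq by simp
   show ?case unfolding e C_def proof (intro CollectI conjI ballI)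
    show "mon R \<one>\<^bsub>R\<^esub> {#i#} \<otimes>\<^bsub>A\<^esub> c : car A" using t cc by simp
    fix a assume a: "a : car A"
    let ?T = "mon R (\<one>\<^bsub>R\<^esub> [^]\<^bsub>R\<^esub> q) (rep q i)"
    have "phi (?T \<otimes>\<^bsub>A\<^esub> (c [^]\<^bsub>A\<^esub> q \<otimes>\<^bsub>A\<^esub> a)) = ?T \<otimes>\<^bsub>A\<^esub> phi (c [^]\<^bsub>A\<^esub> q \<otimes>\<^bsub>A\<^esub> a)"
     by (rule monD) (use indexed_pmult a cc in auto)
    also have "phi (c [^]\<^bsub>A\<^esub> q \<otimes>\<^bsub>A\<^esub> a) = c [^]\<^bsub>A\<^esub> q \<otimes>\<^bsub>A\<^esub> phi a" using indexed_pmult a by (simp add: C_def)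
    finally show "phi ((mon R \<one>\<^bsub>R\<^esub> {#i#} \<otimes>\<^bsub>A\<^esub> c) [^]\<^bsub>A\<^esub> q \<otimes>\<^bsub>A\<^esub> a) = (mon R \<one>\<^bsub>R\<^esub> {#i#} \<otimes>\<^bsub>A\<^esub> c) [^]\<^bsub>A\<^esub> q \<otimes>\<^bsub>A\<^esub> phi a"
     unfolding pw using tqc cc a cl by (simp add: A.m_assoc)
   qed
  qed
 qed
 thus ?thesis using add ext unfolding q_def by (intro DLI) (auto simp: C_def q_def)
qed

text \<open>Multiplication by t^b with all b_i divisible by p^e moves the evaluation point -m - 1
  within its residue class, and P is constant there.\<close>

lemma Delta_level: assumes P: "loc_const p r e P" "!!x. x : Ypts p r ==> P x : DL p R e"
 shows "Delta p r R P : DL p A e" proof -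
 define q where "q = p ^ e"
 have q: "q > 0" using p_pos by (simp add: q_def)
 let ?D = "Delta p r R P"
 note D = DLD[OF P(2)[OF pt_Ypts]]
 have z: "P (pt m) \<zero>\<^bsub>R\<^esub> = \<zero>\<^bsub>R\<^esub>" for m by (rule R.DiffOp_zero[OF P(2)[OF pt_Ypts]])
 have cl: "?D a : car A" if a: "a : car A" for a unfolding R.MPoly_carrier proof (intro conjI allI impI)
  show "?D a m : car R" for m using a D(2) by (simp add: Delta_val)
  have "{m. ?D a m ~= \<zero>\<^bsub>R\<^esub>} <= {m. a m ~= \<zero>\<^bsub>R\<^esub>}" using z by (auto simp: Delta_val[OF a])
  thus "finite {m. ?D a m ~= \<zero>\<^bsub>R\<^esub>}" using a finite_subset unfolding R.MPoly_carrier by blast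
  show "set_mset m <= {1..r}" if "?D a m ~= \<zero>\<^bsub>R\<^esub>" for m proof -
   have "a m ~= \<zero>\<^bsub>R\<^esub>" using that z by (auto simp: Delta_val[OF a])
   thus ?thesis using a unfolding R.MPoly_carrier by blast
  qed
 qed
 have add: "?D (a \<oplus>\<^bsub>A\<^esub> b) = ?D a \<oplus>\<^bsub>A\<^esub> ?D b" if "a : car A" "b : car A" for a b
  by (rule HOL.ext) (use that D in \<open>simp add: Delta_val R.MPoly_ops(2) R.MPS_add A.a_closed[unfolded R.MPoly_ops(2)]\<close>)
 have monD: "?D (mon R (k [^]\<^bsub>R\<^esub> q) b \<otimes>\<^bsub>A\<^esub> a) = mon R (k [^]\<^bsub>R\<^esub> q) b \<otimes>\<^bsub>A\<^esub> ?D a"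
  if k: "k : car R" and b: "set_mset b <= {1..r}" and bq: "!!i. q dvd count b i" and a: "a : car A" for k b a proof
  fix m
  have kc: "k [^]\<^bsub>R\<^esub> q : car R" using k by simp
  have ac: "mon R (k [^]\<^bsub>R\<^esub> q) b \<otimes>\<^bsub>A\<^esub> a : car A" using kc b a by simp
  have pm: "P (pt m) = P (pt (m - b))" if "b \<subseteq># m" proof (rule loc_constD[OF P(1) pt_Ypts pt_Ypts])
   show "cong_pts r e (pt m) (pt (m - b))" unfolding cong_pts_def proof
    fix i assume i: "i : {1..r}"
    obtain l where l: "count b i = q * l" using bq by blast
    have "count b i <= count m i" using that by (rule mset_subset_eq_count)
    hence "- int (count m i) - 1 = (- int (count (m - b) i) - 1) + (- int l) * int q" using l by (simp add: of_nat_diff algebra_simps)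
    hence "(- int (count m i) - 1) mod int q = (- int (count (m - b) i) - 1) mod int q" by (metis mod_mult_self1)
    thus "pt m i e = pt (m - b) i e" using i by (simp add: pt_def Zp_of_int_def q_def)
   qed
  qed
  have aS: "a : car (MPS R)" "?D a : car (MPS R)" using R.MPoly_MPS_sub a cl by blast+
  show "?D (mon R (k [^]\<^bsub>R\<^esub> q) b \<otimes>\<^bsub>A\<^esub> a) m = (mon R (k [^]\<^bsub>R\<^esub> q) b \<otimes>\<^bsub>A\<^esub> ?D a) m"
   unfolding Delta_val[OF ac] unfolding R.MPoly_ops R.mon_mult[OF kc aS(1)] R.mon_mult[OF kc aS(2)]
   using pm D(4)[OF k] a z by (simp add: q_def Delta_val)
 qed
 show ?thesis proof (rule DiffOp_levelI_mon)
  show "?D : car A \<rightarrow>\<^sub>E car A" using cl by (auto simp: PiE_def Delta_def)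
 qed (use add monD in \<open>auto simp: q_def\<close>)
qed

lemma supp_at_finite: "a : car A ==> finite (supp_at e a x)"
 unfolding R.MPoly_carrier supp_at_def by (rule finite_subset[of _ "{m. a m ~= \<zero>\<^bsub>R\<^esub>}"]) auto

lemma fR_mult: "fR (%i. n i * k) = fR n [^]\<^bsub>R\<^esub> (k::nat)" proof -
 have "fR (%i. n i * k) = (\<Otimes>\<^bsub>R\<^esub>i\<in>{1..r}. (f i [^]\<^bsub>R\<^esub> n i) [^]\<^bsub>R\<^esub> k)"
  unfolding fR_def by (rule R.finprod_cong') (use f_car in \<open>auto simp: R.nat_pow_pow\<close>)
 also have "... = fR n [^]\<^bsub>R\<^esub> k" unfolding fR_def by (rule R.finprod_pow[symmetric]) (use f_car in auto)
 finally show ?thesis .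
qed

text \<open>Every exponent m that enters \<open>rho\<close> has its evaluation point congruent to x,
  so \<open>Delta\<close> applies P x to the coefficient of t^m. The accompanying factor f^(q (m div
  q)) is a q-th power that P x lets pass.\<close>

lemma rho_Delta: assumes P: "loc_const p r e P" "!!x. x : Ypts p r ==> P x : DL p R e"
  and a: "a : car A" and x: "x : Ypts p r" shows "rho e (Delta p r R P a) x = P x (rho e a x)" proof -
 note D = DLD[OF P(2)[OF x]]
 have z: "P x \<zero>\<^bsub>R\<^esub> = \<zero>\<^bsub>R\<^esub>" by (rule R.DiffOp_zero[OF P(2)[OF x]])
 let ?F = "%m. fR (%i. (count m i div p ^ e) * p ^ e)"
 have Pm: "P (pt m) = P x" if "!!i. i : {1..r} ==> count m i mod p ^ e = p ^ e - 1 - trunc (x i) e" for m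
  by (rule loc_constD[OF P(1) pt_Ypts x pt_cong[OF x that]])
 have sub: "supp_at e (Delta p r R P a) x <= supp_at e a x"
  unfolding supp_at_def using R.DiffOp_zero[OF P(2)[OF pt_Ypts]] by (auto simp: Delta_val[OF a])
 have val: "Delta p r R P a m = P x (a m)" if "m : supp_at e a x" for m using that Pm[of m] by (simp add: Delta_val[OF a] supp_at_def)
 have "rho e (Delta p r R P a) x = (\<Oplus>\<^bsub>R\<^esub>m\<in>supp_at e a x. P x (a m) \<otimes>\<^bsub>R\<^esub> ?F m)" unfolding rho_def
 proof (rule R.add.finprod_mono_neutral_cong_left[OF supp_at_finite[OF a] sub])
  fix m assume m: "m : supp_at e a x - supp_at e (Delta p r R P a) x"
  hence "Delta p r R P a m = \<zero>\<^bsub>R\<^esub>" by (auto simp: supp_at_def)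
  hence "P x (a m) = \<zero>\<^bsub>R\<^esub>" using m val[of m] by simp
  thus "P x (a m) \<otimes>\<^bsub>R\<^esub> ?F m = \<zero>\<^bsub>R\<^esub>" by simp
 next
  fix m assume "m : supp_at e (Delta p r R P a) x"
  thus "Delta p r R P a m \<otimes>\<^bsub>R\<^esub> ?F m = P x (a m) \<otimes>\<^bsub>R\<^esub> ?F m" using val[of m] sub by auto
 qed (use a D(2) in auto)
 also have "... = (\<Oplus>\<^bsub>R\<^esub>m\<in>supp_at e a x. P x (a m \<otimes>\<^bsub>R\<^esub> ?F m))" proof (rule R.finsum_cong'[OF refl])
  fix m
  show "P x (a m) \<otimes>\<^bsub>R\<^esub> ?F m = P x (a m \<otimes>\<^bsub>R\<^esub> ?F m)"
   using D(4)[of "fR (%i. count m i div p ^ e)" "a m"] a D(2) by (simp add: fR_mult R.m_comm)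
 qed (use a D(2) in auto)
 also have "... = P x (rho e a x)" unfolding rho_def by (rule R.DiffOp_finsum[OF P(2)[OF x], symmetric]) (use a in auto)
 finally show ?thesis .
qed

definition CD_map :: "((nat => nat => int) => 'a => 'a) => ((nat => nat => int) => 'b => 'b)" where
 "CD_map P = (\<lambda>x\<in>Ypts p r. \<sigma> (P x))"

lemma CD_R_common_level: assumes P: "P : car (CF p r (DiffOp p R))"
 shows "\<exists>e. loc_const p r e P \<and> (\<forall>x\<in>Ypts p r. P x : DL p R e)" proof -
 obtain e where e: "loc_const p r e P" "!!x. x : Ypts p r ==> level p R (P x) <= e"
  using Cfun_bounded_level[OF p_pos P, of "level p R"] by blast
 hence "P x : DL p R e" if "x : Ypts p r" for x using R.DiffOp_level_level Cfun_val[OF P that] e(2)[OF that] by blast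
 thus ?thesis using e by blast
qed

lemma CD_map_hom: "CD_map : ring_hom (CF p r (DiffOp p R)) (CF p r (DiffOp p B))" proof (rule ring_hom_memI)
 fix P assume P: "P : car (CF p r (DiffOp p R))"
 show "CD_map P : car (CF p r (DiffOp p B))"
  unfolding CD_map_def using CF_lift2[OF p_pos P P, of "%a b. \<sigma> a"] ring_hom_closed[OF \<sigma>_hom] by blast
next
 fix P Q assume P: "P : car (CF p r (DiffOp p R))" "Q : car (CF p r (DiffOp p R))"
 note v = Cfun_val[OF P(1)] Cfun_val[OF P(2)]
 show "CD_map (P \<otimes>\<^bsub>CF p r (DiffOp p R)\<^esub> Q) = CD_map P \<otimes>\<^bsub>CF p r (DiffOp p B)\<^esub> CD_map Q"
  unfolding CD_map_def Cfun_ops by (rule restrict_ext) (use v in \<open>simp add: ring_hom_mult[OF \<sigma>_hom]\<close>)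
 show "CD_map (P \<oplus>\<^bsub>CF p r (DiffOp p R)\<^esub> Q) = CD_map P \<oplus>\<^bsub>CF p r (DiffOp p B)\<^esub> CD_map Q"
  unfolding CD_map_def Cfun_ops by (rule restrict_ext) (use v in \<open>simp add: ring_hom_add[OF \<sigma>_hom]\<close>)
next
 show "CD_map \<one>\<^bsub>CF p r (DiffOp p R)\<^esub> = \<one>\<^bsub>CF p r (DiffOp p B)\<^esub>"
  unfolding CD_map_def Cfun_ops by (rule restrict_ext) (simp add: ring_hom_one[OF \<sigma>_hom])
qed

text \<open>At a level common to P and the fraction, the operator acts on the numerator and
  \<open>rho_Delta\<close> moves P x outside. The value of \<open>Lam\<close> is \<open>rho\<close>
  divided by f^x, and this division turns P x into its twist by f^x.\<close>

lemma Lam_Delta: assumes P: "P : car (CF p r (DiffOp p R))" and z: "z : car AS"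
 shows "DiffOp_loc p A S (Delta p r R P) z : car AS" and "Lam (DiffOp_loc p A S (Delta p r R P) z) = act (CD_map P) (Lam z)" proof -
 obtain e where e: "loc_const p r e P" "!!x. x : Ypts p r ==> P x : DL p R e"
  using CD_R_common_level[OF P] by blast
 obtain E where E: "!!e. e \<ge> E ==> \<exists>a\<in>car A. z = L.frac a (g [^]\<^bsub>A\<^esub> (p ^ e))" using AS_rep[OF z] by blast
 define d where "d = max e E"
 obtain a where a: "a : car A" "z = L.frac a (g [^]\<^bsub>A\<^esub> (p ^ d))" using E[of d] by (auto simp: d_def)
 have d: "loc_const p r d P" "!!x. x : Ypts p r ==> P x : DL p R d"
  using loc_const_mono[OF e(1), of d] R.DiffOp_level_mono[OF e(2), of _ d] by (auto simp: d_def)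
 have lev: "Delta p r R P : DL p A d" by (rule Delta_level[OF d])
 show c: "DiffOp_loc p A S (Delta p r R P) z : car AS" by (rule DiffOp_loc_closed[OF lev z])
 have Da: "Delta p r R P a : car A" by (rule DLD(2)[OF lev a(1)])
 show "Lam (DiffOp_loc p A S (Delta p r R P) z) = act (CD_map P) (Lam z)" proof (rule Cfun_ext)
  show "Lam (DiffOp_loc p A S (Delta p r R P) z) : car (CF p r B)" by (rule Lam_closed[OF c])
  show "act (CD_map P) (Lam z) : car (CF p r B)" by (rule act_closed[OF ring_hom_closed[OF CD_map_hom P] Lam_closed[OF z]])
  fix x assume x: "x : Ypts p r"
  let ?t = "fpw (%i. trunc (x i) d)"
  have r: "rho d a x : car R" using a by simp
  have "Lam (DiffOp_loc p A S (Delta p r R P) z) x = \<iota> (P x (rho d a x)) \<otimes> inv ?t"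
   unfolding a(2) DiffOp_loc_frac_q[OF lev a(1)] Lam_frac[OF Da x] by (subst rho_Delta[OF d a(1) x]) simp_all
  also have "\<iota> (P x (rho d a x)) = \<sigma> (P x) (\<iota> (rho d a x))" by (rule \<sigma>_\<iota>[OF d(2)[OF x] r, symmetric])
  also have "\<iota> (rho d a x) = Lam z x \<otimes> ?t" unfolding a(2) Lam_frac[OF a(1) x] using r by (simp add: fpw_cancel(2))
  also have "\<sigma> (P x) (Lam z x \<otimes> ?t) \<otimes> inv ?t = tw x (\<sigma> (P x)) (Lam z x)"
   by (rule tw_eq[OF \<sigma>_level[OF d(2)[OF x]] x Cfun_val[OF Lam_closed[OF z] x], symmetric])
  finally show "Lam (DiffOp_loc p A S (Delta p r R P) z) x = act (CD_map P) (Lam z) x" using x by (simp add: act_def CD_map_def)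
 qed
qed

text \<open>Computed at level 0, where q = 1: all truncations are zero and the constant monomial is
  the only contribution.\<close>

lemma Lam_delta_rep: "Lam (L.frac \<one>\<^bsub>A\<^esub> g) = \<one>\<^bsub>CF p r B\<^esub>" proof (rule Cfun_ext)
 interpret C: ring "CF p r B" by (rule ring_CF[OF ring_axioms p_pos])
 have gS: "g : S" using g_pow_S[of 1] by simp
 show "Lam (L.frac \<one>\<^bsub>A\<^esub> g) : car (CF p r B)" using gS by (intro Lam_closed) simp
 show "\<one>\<^bsub>CF p r B\<^esub> : car (CF p r B)" by simp
 fix x assume x: "x : Ypts p r"
 have t0: "trunc (x i) 0 = 0" if "i : {1..r}" for i using trunc_less[OF Ypts_D[OF x that], of 0] by simp
 have "rho 0 \<one>\<^bsub>A\<^esub> x = (\<Oplus>\<^bsub>R\<^esub>m\<in>{{#}}. \<one>\<^bsub>A\<^esub> m \<otimes>\<^bsub>R\<^esub> fR (%i. (count m i div p ^ 0) * p ^ 0))"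
  unfolding rho_def by (rule R.add.finprod_mono_neutral_cong_left)
   (use t0 in \<open>auto simp: supp_at_def R.MPoly_ops R.MPS_one mon_def fR_zero split: if_splits\<close>)
 also have "... = \<one>\<^bsub>R\<^esub>" by (simp add: R.MPoly_ops R.MPS_one mon_def fR_zero)
 finally have "Lam (L.frac \<one>\<^bsub>A\<^esub> (g [^]\<^bsub>A\<^esub> (p ^ 0))) x = \<iota> \<one>\<^bsub>R\<^esub> \<otimes> inv (fpw (%i. trunc (x i) 0))"
  using Lam_frac[OF A.one_closed x, of 0] by simp
 also have "fpw (%i. trunc (x i) 0) = \<one>" by (rule fpw_zero) (rule t0)
 finally show "Lam (L.frac \<one>\<^bsub>A\<^esub> g) x = \<one>\<^bsub>CF p r B\<^esub> x" using x by (simp add: Cfun_ops)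
qed

end

section \<open>Powers of ideals and differential operators\<close>

text \<open>Finite sums of elements of Q. When Q is stable under multiplication by R, this is
  already the ideal generated by Q, and its induction rule carries no coefficients.\<close>

inductive_set addspan :: "('a, 'm) ring_scheme => 'a set => 'a set" for R Q where
 zero: "\<zero>\<^bsub>R\<^esub> : addspan R Q"
| add: "x : Q ==> y : addspan R Q ==> x \<oplus>\<^bsub>R\<^esub> y : addspan R Q"

locale ideal_family = cring R for R :: "('a, 'm) ring_scheme" (structure) + fixes r :: nat and f :: "nat => 'a"
 assumes f_closed: "i : {1..r} ==> f i : car R"
begin

definition mono :: "(nat => nat) => 'a" where "mono n = (\<Otimes>i\<in>{1..r}. f i [^] n i)"
definition wt :: "(nat => nat) => nat" where "wt c = (\<Sum>i\<in>{1..r}. c i)"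
definition I where "I = Idl (f ` {1..r})"
abbreviation pw :: "nat => 'a set" where "pw n \<equiv> I [^]\<^bsub>ideals_set R\<^esub> n"

lemma mono_closed [simp]: "mono n : car R" unfolding mono_def by (rule finprod_closed) (use f_closed in auto)

lemma mono_add: "mono (%i. n i + m i) = mono n \<otimes> mono m" proof -
 have "mono (%i. n i + m i) = (\<Otimes>i\<in>{1..r}. f i [^] n i \<otimes> f i [^] m i)"
  unfolding mono_def by (rule finprod_cong') (use f_closed in \<open>auto simp: nat_pow_mult\<close>)
 also have "... = mono n \<otimes> mono m" unfolding mono_def by (rule finprod_multf) (use f_closed in auto)
 finally show ?thesis .
qed

lemma mono_cong: "(!!i. i : {1..r} ==> n i = m i) ==> mono n = mono m"
 unfolding mono_def by (rule finprod_cong') (use f_closed in auto)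

lemma wt_cong: "(!!i. i : {1..r} ==> n i = m i) ==> wt n = wt m" unfolding wt_def by (rule sum.cong) auto

lemma mono_mult: "mono (%i. n i * k) = mono n [^] (k::nat)" proof -
 have "mono (%i. n i * k) = (\<Otimes>i\<in>{1..r}. (f i [^] n i) [^] k)"
  unfolding mono_def by (rule finprod_cong') (use f_closed in \<open>auto simp: nat_pow_pow\<close>)
 also have "... = mono n [^] k" unfolding mono_def by (rule finprod_pow[symmetric]) (use f_closed in auto)
 finally show ?thesis .
qed

lemma mono_zero: "(!!i. i : {1..r} ==> n i = 0) ==> mono n = \<one>"
 unfolding mono_def by (rule finprod_one_eqI) simp

definition unitv :: "nat => nat => nat" where "unitv i j = (if j = i then 1 else 0)"

lemma wt_add: "wt (%i. n i + m i) = wt n + wt m" by (simp add: wt_def sum.distrib)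

lemma wt_unitv: "i : {1..r} ==> wt (unitv i) = 1" by (simp add: wt_def unitv_def)

lemma mono_unitv: assumes i: "i : {1..r}" shows "mono (unitv i) = f i" proof -
 have "mono (unitv i) = (\<Otimes>j\<in>{1..r}. if i = j then f j else \<one>)"
  unfolding mono_def by (rule finprod_cong') (use f_closed in \<open>auto simp: unitv_def\<close>)
 also have "... = f i" by (rule finprod_singleton[OF i]) (use f_closed in auto)
 finally show ?thesis .
qed

lemma wt_Suc_split: assumes "wt c = Suc n" shows "\<exists>i\<in>{1..r}. \<exists>c'. wt c' = n \<and> mono c = mono c' \<otimes> f i" proof -
 have "\<exists>i\<in>{1..r}. c i ~= 0" proof (rule ccontr)
  assume "\<not> ?thesis"
  hence "wt c = 0" by (simp add: wt_def)
  thus False using assms by simp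
 qed
 then obtain i where i: "i : {1..r}" "c i ~= 0" by blast
 define c' where "c' j = c j - unitv i j" for j
 have e: "c j = c' j + unitv i j" for j using i(2) by (simp add: c'_def unitv_def)
 have "wt c = wt c' + 1" using wt_cong[of c "%j. c' j + unitv i j"] e by (simp add: wt_add wt_unitv[OF i(1)])
 moreover have "mono c = mono c' \<otimes> f i" using mono_cong[of c "%j. c' j + unitv i j"] e by (simp add: mono_add mono_unitv[OF i(1)])
 ultimately show ?thesis using i(1) assms by auto
qed

lemma f_sub: "f ` {1..r} <= car R" using f_closed by blast

lemma I_ideal: "ideal I R" unfolding I_def by (rule genideal_ideal[OF f_sub])

lemma f_I: "i : {1..r} ==> f i : I" unfolding I_def using genideal_self[OF f_sub] by blast

lemma pw_0: "pw 0 = car R" by (simp add: ideals_set_def)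

lemma pw_Suc: "pw (Suc n) = ideal_prod R (pw n) I" by (simp add: ideals_set_def)

lemma pw_ideal: "ideal (pw n) R" by (induction n) (simp_all only: pw_0 pw_Suc oneideal ideal_prod_is_ideal[OF _ I_ideal])

lemma pw_Suc_sub: "pw (Suc n) <= pw n" unfolding pw_Suc using ideal_prod_inter[OF pw_ideal I_ideal] by blast

lemma pw_antimono: "n <= m ==> pw m <= pw n" proof (induction m rule: dec_induct)
 case (step m) thus ?case using pw_Suc_sub by blast
qed blast

lemma mono_pw: "wt c = n ==> mono c : pw n" proof (induction n arbitrary: c)
 case 0 show ?case by (simp only: pw_0 mono_closed)
next
 case (Suc n)
 then obtain i c' where "i : {1..r}" "wt c' = n" "mono c = mono c' \<otimes> f i" using wt_Suc_split by blast
 thus ?case unfolding pw_Suc using Suc.IH f_I by (auto intro: ideal_prod.prod)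
qed

text \<open>Induction on n with the colon ideal (K : I) in place of K: it contains the monomials of
  weight n because K contains those of weight n + 1. Statements about I^n are thereby tested on
  monomials.\<close>

lemma pw_least: "ideal K R ==> (!!c. wt c = n ==> mono c : K) ==> pw n <= K"
proof (induction n arbitrary: K)
 case 0
 have "mono (%i. 0) : K" by (rule 0) (simp add: wt_def)
 hence "\<one> : K" by (simp add: mono_zero)
 hence "K = car R" by (rule ideal.one_imp_carrier[OF 0(1)])
 thus ?case unfolding pw_0 by simp
next
 case (Suc n)
 interpret K: ideal K R by (rule Suc.prems)
 \<comment> \<open>The colon ideal (K : J), with J arbitrary because it is used for J = I and for a
   single monomial.\<close>
 have colon: "ideal {a : car R. \<forall>j\<in>J. a \<otimes> j : K} R" if J: "J <= car R" for J
 proof (rule idealI[OF ring_axioms])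
  show "subgroup {a : car R. \<forall>j\<in>J. a \<otimes> j : K} (add_monoid R)" proof (rule add.subgroupI)
   have "\<zero> : {a : car R. \<forall>j\<in>J. a \<otimes> j : K}" using J by auto
   thus "{a : car R. \<forall>j\<in>J. a \<otimes> j : K} ~= {}" by blast
  next
   fix a assume "a : {a : car R. \<forall>j\<in>J. a \<otimes> j : K}"
   thus "\<ominus> a : {a : car R. \<forall>j\<in>J. a \<otimes> j : K}" using J by (auto simp: l_minus)
  next
   fix a b assume "a : {a : car R. \<forall>j\<in>J. a \<otimes> j : K}" "b : {a : car R. \<forall>j\<in>J. a \<otimes> j : K}"
   hence "a \<oplus> b : car R" "\<forall>j\<in>J. (a \<oplus> b) \<otimes> j : K" using J by (auto simp: l_distr)
   hence "a \<oplus> b : {a : car R. \<forall>j\<in>J. a \<otimes> j : K}" by blast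
   thus "a \<oplus> b : {a : car R. \<forall>j\<in>J. a \<otimes> j : K}" by simp
  qed blast
 next
  fix a x assume a: "a : {a : car R. \<forall>j\<in>J. a \<otimes> j : K}" and x: "x : car R"
  have "x \<otimes> a \<otimes> j : K" if "j : J" for j using a x J that K.I_l_closed[of "a \<otimes> j" x] by (auto simp: m_assoc)
  thus "x \<otimes> a : {a : car R. \<forall>j\<in>J. a \<otimes> j : K}" using a x by auto
  thus "a \<otimes> x : {a : car R. \<forall>j\<in>J. a \<otimes> j : K}" using a x m_comm[of a x] by simp
 qed
 have Ic: "I <= car R" using ideal.Icarr[OF I_ideal] by blast
 have 1: "mono c : {a : car R. \<forall>j\<in>I. a \<otimes> j : K}" if c: "wt c = n" for c proof -
  have "I <= {a : car R. \<forall>j\<in>{mono c}. a \<otimes> j : K}" unfolding I_def proof (rule genideal_minimal[OF colon])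
   show "f ` {1..r} <= {a : car R. \<forall>j\<in>{mono c}. a \<otimes> j : K}" proof
    fix y assume "y : f ` {1..r}"
    then obtain i where i: "i : {1..r}" "y = f i" by blast
    have "mono (%j. unitv i j + c j) : K" by (rule Suc.prems(2)) (simp add: wt_add wt_unitv[OF i(1)] c)
    thus "y : {a : car R. \<forall>j\<in>{mono c}. a \<otimes> j : K}" using i f_closed by (simp add: mono_add mono_unitv)
   qed
  qed simp
  thus ?thesis using Ic by (auto simp: m_comm)
 qed
 have "pw n <= {a : car R. \<forall>j\<in>I. a \<otimes> j : K}" by (rule Suc.IH[OF colon[OF Ic] 1])
 show ?case proof
  fix y assume "y : pw (Suc n)"
  hence "y : ideal_prod R (pw n) I" by (simp only: pw_Suc)
  thus "y : K" proof (induction rule: ideal_prod.induct)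
   case (prod i j) thus ?case using \<open>pw n <= _\<close> by blast
  next
   case (sum a b) thus ?case by simp
  qed
 qed
qed

subsection \<open>The ideals \<open>D\<^sup>e \<cdot> I\<^sup>n\<close>\<close>

definition Dn :: "nat => nat => nat => 'a set" where
 "Dn p e n = DiffOp_ideal p R e (pw n)"

text \<open>Coefficients from R are absent: multiplications before or after phi are absorbed into
  phi.\<close>

definition Dgen :: "nat => nat => nat => 'a set" where
 "Dgen p e n = {phi (mono c) | phi c. phi : DL p R e \<and> wt c = n}"

lemma Dgen_sub: "Dgen p e n <= car R" unfolding Dgen_def using DLD(2) by fastforce

lemma addspan_sub: "Q <= car R ==> addspan R Q <= car R" proof
 fix x assume "Q <= car R" "x : addspan R Q"
 from this(2,1) show "x : car R" by induction auto
qed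

lemma addspan_plus: assumes Q: "Q <= car R" and x: "x : addspan R Q" and y: "y : addspan R Q"
 shows "x \<oplus> y : addspan R Q" using x proof induction
 case zero thus ?case using y addspan_sub[OF Q] by auto
next
 case (add x z)
 hence "x : car R" "z : car R" "y : car R" using Q addspan_sub[OF Q] y by auto
 hence "x \<oplus> z \<oplus> y = x \<oplus> (z \<oplus> y)" by (rule a_assoc)
 thus ?case using add addspan.add by metis
qed

lemma addspan_map: assumes Q: "Q <= car R" and h: "!!x. x : Q ==> h x : Q'" "h \<zero> = \<zero>"
  "!!x y. x : car R ==> y : car R ==> h (x \<oplus> y) = h x \<oplus> h y"
  and x: "x : addspan R Q" shows "h x : addspan R Q'" using x proof induction
 case zero thus ?case using h(2) addspan.zero[of R Q'] by simp
next
 case (add x y)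
 hence "h (x \<oplus> y) = h x \<oplus> h y" using Q addspan_sub[OF Q] by (intro h(3)) auto
 thus ?case using addspan.add[OF h(1)[OF add(1)] add.IH] by simp
qed

lemma addspan_base: "Q <= car R ==> x : Q ==> x : addspan R Q"
 using addspan.add[OF _ addspan.zero, of x Q R] by auto

lemma addspan_ideal:
 assumes Q: "Q <= car R" and m: "!!a x. a : car R ==> x : Q ==> a \<otimes> x : Q"
 shows "ideal (addspan R Q) R" proof (rule idealI[OF ring_axioms])
 have mm: "a \<otimes> x : addspan R Q" if a: "a : car R" and x: "x : addspan R Q" for a x
  by (rule addspan_map[OF Q _ _ _ x]) (use a m in \<open>auto simp: r_distr\<close>)
 have c: "!!x. x : addspan R Q ==> x : car R" using addspan_sub[OF Q] by blast
 show "subgroup (addspan R Q) (add_monoid R)" proof (rule add.subgroupI)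
  show "addspan R Q ~= {}" using addspan.zero by blast
  fix x assume x: "x : addspan R Q"
  have "(\<ominus> \<one>) \<otimes> x = \<ominus> x" using c[OF x] by (simp add: l_minus)
  thus "\<ominus> x : addspan R Q" using mm[OF _ x, of "\<ominus> \<one>"] by simp
 next
  fix x y assume "x : addspan R Q" "y : addspan R Q"
  thus "x \<oplus> y : addspan R Q" by (rule addspan_plus[OF Q])
 next
  show "addspan R Q <= car R" using c by blast
 qed
 fix a x assume "a : addspan R Q" "x : car R"
 thus "x \<otimes> a : addspan R Q" "a \<otimes> x : addspan R Q" using mm[of x a] c m_comm by auto
qed

lemma DiffOp_premult: assumes phi: "phi : DL p R e" and a: "a : car R"
 shows "(\<lambda>x\<in>car R. phi (a \<otimes> x)) : DL p R e"
 by (rule DLI) (use a in \<open>auto simp: DLD[OF phi] r_distr m_lcomm[of a]\<close>)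

lemma DiffOp_postmult: assumes phi: "phi : DL p R e" and a: "a : car R"
 shows "(\<lambda>x\<in>car R. a \<otimes> phi x) : DL p R e"
 by (rule DLI) (use a in \<open>auto simp: DLD[OF phi] r_distr m_lcomm[of a]\<close>)

lemma Dgen_mult: assumes a: "a : car R" and x: "x : Dgen p e n" shows "a \<otimes> x : Dgen p e n" proof -
 obtain phi c where phi: "phi : DL p R e" "wt c = n" "x = phi (mono c)" using x unfolding Dgen_def by blast
 have "a \<otimes> x = (\<lambda>x\<in>car R. a \<otimes> phi x) (mono c)" using phi(3) by simp
 thus ?thesis unfolding Dgen_def using DiffOp_postmult[OF phi(1) a] phi(2) by blast
qed

lemma Dgen_ideal: "ideal (addspan R (Dgen p e n)) R" by (rule addspan_ideal[OF Dgen_sub Dgen_mult])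

lemma Dn_gen_sub: "(\<Union>phi\<in>DL p R e. phi ` pw n) <= car R"
 using DLD(2) ideal.Icarr[OF pw_ideal] by fastforce

text \<open>The elements sent into K by all operators of level e form an ideal J, since a
  multiplication can be absorbed into the operator; so \<open>pw_least\<close> applies to J.\<close>

lemma DiffOp_pw: assumes phi: "phi : DL p R e" and K: "ideal K R"
  and g: "!!phi c. phi : DL p R e ==> wt c = n ==> phi (mono c) : K" and a: "a : pw n"
 shows "phi a : K" proof -
 interpret K: ideal K R by (rule K)
 define J where "J = {a : car R. \<forall>phi\<in>DL p R e. phi a : K}"
 have "ideal J R" proof (rule idealI[OF ring_axioms])
  show "subgroup J (add_monoid R)" proof (rule add.subgroupI)
   have "\<zero> : J" unfolding J_def by (simp add: DiffOp_zero)
   thus "J ~= {}" by blast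
  next
   fix a assume a: "a : J"
   have "phi (\<ominus> a) = \<ominus> phi a" if phi: "phi : DL p R e" for phi proof -
    have ac: "a : car R" using a by (simp add: J_def)
    have "phi (\<ominus> a) \<oplus> phi a = \<zero>"
     using DLD(3)[OF phi, of "\<ominus> a" a] ac DiffOp_zero[OF phi] by (simp add: l_neg)
    thus ?thesis using DLD(2)[OF phi] ac by (simp add: minus_equality)
   qed
   moreover have "phi a : K" if "phi : DL p R e" for phi using a that by (simp add: J_def)
   ultimately have "phi (\<ominus> a) : K" if "phi : DL p R e" for phi using K.a_inv_closed that by metis
   moreover have "\<ominus> a : car R" using a by (simp add: J_def)
   ultimately show "\<ominus> a : J" unfolding J_def by blast
  next
   fix a b assume a: "a : J" and b: "b : J"
   hence ab: "a : car R" "b : car R" by (simp_all add: J_def)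
   hence "phi (a \<oplus> b) : K" if "phi : DL p R e" for phi
    using a b that unfolding J_def by (simp add: DLD(3)[OF that])
   hence "a \<oplus> b : J" unfolding J_def using ab by blast
   thus "a \<oplus> b : J" .
  next
   show "J <= car R" unfolding J_def by blast
  qed
 next
  fix a x assume a: "a : J" and x: "x : car R"
  have "phi (x \<otimes> a) : K" if phi: "phi : DL p R e" for phi
   using a DiffOp_premult[OF phi x] unfolding J_def by force
  thus "x \<otimes> a : J" using a x by (auto simp: J_def)
  thus "a \<otimes> x : J" using a x by (simp add: J_def m_comm)
 qed
 hence "pw n <= J" by (rule pw_least) (simp add: J_def g) thus ?thesis using a phi by (auto simp: J_def)
qed

lemma Dn_eq: "Dn p e n = addspan R (Dgen p e n)" proof
 show "Dn p e n <= addspan R (Dgen p e n)" unfolding Dn_def DiffOp_ideal_def proof (rule genideal_minimal[OF Dgen_ideal], clarify)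
  fix phi a assume "phi : DL p R e" "a : pw n"
  moreover have "psi (mono c) : addspan R (Dgen p e n)" if "psi : DL p R e" "wt c = n" for psi c proof -
   have "psi (mono c) : Dgen p e n" unfolding Dgen_def using that by blast thus ?thesis by (rule addspan_base[OF Dgen_sub])
  qed
  ultimately show "phi a : addspan R (Dgen p e n)" using DiffOp_pw[OF _ Dgen_ideal] by blast
 qed
 interpret D: ideal "Dn p e n" R unfolding Dn_def DiffOp_ideal_def by (rule genideal_ideal[OF Dn_gen_sub])
 show "addspan R (Dgen p e n) <= Dn p e n" proof
  fix x assume "x : addspan R (Dgen p e n)"
  thus "x : Dn p e n" proof (induction rule: addspan.induct)
   case zero show ?case by (rule D.zero_closed)
  next
   case (add x y)
   hence "x : (\<Union>phi\<in>DL p R e. phi ` pw n)" unfolding Dgen_def using mono_pw by blast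
   hence "x : Dn p e n" unfolding Dn_def DiffOp_ideal_def using genideal_self[OF Dn_gen_sub] by blast
   thus ?case using add.IH by (rule D.a_closed)
  qed
 qed
qed

lemma Dn_ideal: "ideal (Dn p e n) R" unfolding Dn_eq by (rule Dgen_ideal)

lemma Dn_closed: "x : Dn p e n ==> x : car R" using ideal.Icarr[OF Dn_ideal] .

lemma Dn_gen: "phi : DL p R e ==> wt c = n ==> phi (mono c) : Dn p e n"
 unfolding Dn_eq by (rule addspan_base[OF Dgen_sub], unfold Dgen_def, blast)

lemma Dn_induct [consumes 1, case_names zero gen add]: assumes "x : Dn p e n" and "P \<zero>"
  and "!!phi c. phi : DL p R e ==> wt c = n ==> P (phi (mono c))"
  and "!!x y. x : Dn p e n ==> y : Dn p e n ==> P x ==> P y ==> P (x \<oplus> y)"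
 shows "P x" using assms(1) unfolding Dn_eq proof (induction rule: addspan.induct)
 case (add x y)
 have "P x" using add(1) assms(3) by (auto simp: Dgen_def)
 thus ?case using add assms(4) addspan_base[OF Dgen_sub add(1)] by (simp add: Dn_eq)
qed (rule assms(2))

text \<open>With q = p^e the monomial f^(d q) is a q-th power, so phi(f^c) f^(d q) = phi(f^(c + d
  q)), and the power of I grows by the full weight of d q. This is what makes conditions at
  different levels comparable.\<close>

lemma Dn_mult_mono: assumes x: "x : Dn p e n" shows "x \<otimes> mono (%i. d i * p ^ e) : Dn p e (n + wt d * p ^ e)" using x
proof (induction rule: Dn_induct)
 case zero show ?case using additive_subgroup.zero_closed[OF ideal.axioms(1)[OF Dn_ideal]] mono_closed by (simp only: l_null)
next
 case (gen phi c)
 have "phi (mono (%i. d i * p ^ e + c i)) = mono d [^] (p ^ e) \<otimes> phi (mono c)"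
  unfolding mono_add mono_mult by (rule DLD(4)[OF gen(1) mono_closed mono_closed])
 also have "... = phi (mono c) \<otimes> mono (%i. d i * p ^ e)"
  unfolding mono_mult by (rule m_comm) (use DLD(2)[OF gen(1) mono_closed] in simp_all)
 finally have "phi (mono c) \<otimes> mono (%i. d i * p ^ e) = phi (mono (%i. d i * p ^ e + c i))" by (rule sym)
 moreover have "wt (%i. d i * p ^ e + c i) = n + wt d * p ^ e" using gen(2) unfolding wt_add by (simp add: wt_def sum_distrib_right)
 ultimately show ?case using Dn_gen[OF gen(1), of "%i. d i * p ^ e + c i"] by simp
next
 case (add x y)
 have "(x \<oplus> y) \<otimes> mono (%i. d i * p ^ e) = x \<otimes> mono (%i. d i * p ^ e) \<oplus> y \<otimes> mono (%i. d i * p ^ e)"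
  by (rule l_distr[OF Dn_closed[OF add(1)] Dn_closed[OF add(2)] mono_closed])
 thus ?case using additive_subgroup.a_closed[OF ideal.axioms(1)[OF Dn_ideal] add(3,4)] by (simp only:)
qed

text \<open>One factor f_i of the monomial is absorbed into the operator.\<close>

lemma Dn_Suc_sub: "Dn p e (Suc n) <= Dn p e n" proof
 fix x assume "x : Dn p e (Suc n)"
 thus "x : Dn p e n" proof (induction rule: Dn_induct)
  case zero show ?case by (rule additive_subgroup.zero_closed[OF ideal.axioms(1)[OF Dn_ideal]])
 next
  case (gen phi c)
  obtain i c' where i: "i : {1..r}" "wt c' = n" "mono c = mono c' \<otimes> f i" using wt_Suc_split[OF gen(2)] by blast
  have "phi (mono c) = (\<lambda>x\<in>car R. phi (f i \<otimes> x)) (mono c')" using i f_closed by (simp add: m_comm)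
  thus ?case using Dn_gen[OF DiffOp_premult[OF gen(1) f_closed[OF i(1)]] i(2)] by simp
 next
  case (add x y)
  thus ?case using additive_subgroup.a_closed[OF ideal.axioms(1)[OF Dn_ideal] add(3,4)] by (simp only:)
 qed
qed

lemma Dn_antimono: "n <= m ==> Dn p e m <= Dn p e n" proof (induction m rule: dec_induct)
 case (step m) thus ?case using Dn_Suc_sub by blast
qed blast

lemma Dn_mono_level: "e <= e' ==> Dn p e n <= Dn p e' n" proof
 fix x assume "e <= e'" "x : Dn p e n"
 from this(2) show "x : Dn p e' n" proof (induction rule: Dn_induct)
  case zero show ?case by (rule additive_subgroup.zero_closed[OF ideal.axioms(1)[OF Dn_ideal]])
 next
  case (gen phi c)
  thus ?case using Dn_gen DiffOp_level_mono[OF gen(1) \<open>e <= e'\<close>] by blast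
 next
  case (add x y)
  thus ?case using additive_subgroup.a_closed[OF ideal.axioms(1)[OF Dn_ideal] add(3,4)] by (simp only:)
 qed
qed

lemma Dn_DiffOp: "phi : DL p R e ==> x : Dn p e n ==> phi x : Dn p e n" proof -
 assume phi: "phi : DL p R e" and "x : Dn p e n"
 from this(2) show "phi x : Dn p e n" proof (induction rule: Dn_induct)
  case zero thus ?case using additive_subgroup.zero_closed[OF ideal.axioms(1)[OF Dn_ideal]] by (simp add: DiffOp_zero[OF phi])
 next
  case (gen psi c)
  have "phi (psi (mono c)) = compose (car R) phi psi (mono c)" by (simp add: compose_def)
  thus ?case using Dn_gen[OF DiffOp_level_compose[OF phi gen(1)] gen(2)] by simp
 next
  case (add x y)
  have "phi (x \<oplus> y) = phi x \<oplus> phi y" by (rule DLD(3)[OF phi Dn_closed[OF add(1)] Dn_closed[OF add(2)]])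
  thus ?case using additive_subgroup.a_closed[OF ideal.axioms(1)[OF Dn_ideal] add(3,4)] by (simp only:)
 qed
qed

text \<open>If \<open>D\<^sup>eI\<^sup>n\<close> stabilizes at \<open>n\<close>, then it does so for all higher levels, since \<open>D\<^sup>e'D\<^sup>e = D\<^sup>e'\<close>.\<close>

lemma Dn_stable_level: assumes le: "e <= e'" and st: "Dn p e n <= Dn p e m" shows "Dn p e' n <= Dn p e' m" proof
 fix x assume "x : Dn p e' n"
 thus "x : Dn p e' m" proof (induction rule: Dn_induct)
  case zero show ?case by (rule additive_subgroup.zero_closed[OF ideal.axioms(1)[OF Dn_ideal]])
 next
  case (gen phi c)
  have "(\<lambda>a\<in>car R. a) (mono c) : Dn p e n" by (rule Dn_gen[OF DiffOp_level_one gen(2)])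
  hence "mono c : Dn p e' m" using st Dn_mono_level[OF le] by auto
  thus ?case by (rule Dn_DiffOp[OF gen(1)])
 next
  case (add x y)
  thus ?case using additive_subgroup.a_closed[OF ideal.axioms(1)[OF Dn_ideal] add(3,4)] by (simp only:)
 qed
qed

end

context bs_setup begin

sublocale F: ideal_family R r f by (intro ideal_family.intro ideal_family_axioms.intro R.cring_axioms f_car)

lemma mono_fR: "F.mono n = fR n" by (simp add: F.mono_def fR_def)

lemma \<iota>_mono: "\<iota> (F.mono n) = fpw n" by (simp add: mono_fR \<iota>_fR)

abbreviation "CB \<equiv> CF p r B"

lemma ring_CB: "ring CB" by (rule ring_CF[OF ring_axioms p_pos])

lemma ring_CDR: "ring (CD p r R)" by (rule ring_CF[OF R.ring_DiffOp p_pos])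

section \<open>The embedding of H into C(Z_p^r, B) f^s\<close>

definition fsR :: "((nat => nat => int) => 'a => 'a, (nat => nat => int) => 'b) module" where
 "fsR = restrict_scalars CD_map (fs_mod p r B u)"

lemma left_module_fsR: "left_module (CD p r R) fsR" unfolding fsR_def by (rule left_module_restrict_scalars[OF left_module_fs CD_map_hom ring_CDR])

lemma fsR_sel: "car fsR = car CB" "\<zero>\<^bsub>fsR\<^esub> = \<zero>\<^bsub>CB\<^esub>" "U \<oplus>\<^bsub>fsR\<^esub> V = U \<oplus>\<^bsub>CB\<^esub> V"
 by (simp_all add: fsR_def restrict_scalars_def fs_mod_sel)

lemma fsR_smult: "P : car (CD p r R) ==> U : car CB ==> P \<odot>\<^bsub>fsR\<^esub> U = act (CD_map P) U"
 by (simp add: fsR_def restrict_scalars_def fs_mod_sel fs_smult_eq ring_hom_closed[OF CD_map_hom])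

abbreviation "bd \<equiv> cech_bound R r f"

lemma abelian_group_eqI: assumes N: "abelian_group N"
  and eq: "car M = car N" "\<zero>\<^bsub>M\<^esub> = \<zero>\<^bsub>N\<^esub>" "ring.add M = ring.add N"
 shows "abelian_group M" proof -
 interpret N: abelian_group N by (rule N)
 show ?thesis proof (rule abelian_groupI)
  show "\<exists>y\<in>car M. y \<oplus>\<^bsub>M\<^esub> x = \<zero>\<^bsub>M\<^esub>" if "x : car M" for x
   using that N.l_neg N.a_inv_closed unfolding eq by blast
 qed (auto simp: eq N.a_ac)
qed

text \<open>Scalars are restricted before the quotient is formed, so that
  \<open>kernel_quotient\<close> applies; \<open>H_mod_eq\<close> shows that the order does not
  matter.\<close>

definition Mtop where "Mtop = restrict_scalars (Delta p r R) (cech_top p r R f)"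

lemma Mtop_sel: "car Mtop = car AS" "\<zero>\<^bsub>Mtop\<^esub> = \<zero>\<^bsub>AS\<^esub>" "ring.add Mtop = ring.add AS"
  "P \<odot>\<^bsub>Mtop\<^esub> z = DiffOp_loc p A S (Delta p r R P) z"
 by (simp_all add: Mtop_def restrict_scalars_def cech_top_def Loc_module_def)

sublocale KQ: kernel_quotient Mtop fsR Lam bd proof (intro kernel_quotient.intro kernel_quotient_axioms.intro)
 show "abelian_group Mtop" by (rule abelian_group_eqI[OF AS.is_abelian_group Mtop_sel(1-3)])
 show "abelian_group fsR" by (rule left_module.axioms(2)[OF left_module_fsR])
qed (simp_all add: Mtop_sel fsR_sel Lam_closed Lam_add cech_bound_eq)

abbreviation LamH where "LamH \<equiv> KQ.quot_map"

abbreviation coset :: "((nat multiset => 'a) \<times> (nat multiset => 'a)) set => ((nat multiset => 'a) \<times> (nat multiset => 'a)) set set" where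
 "coset z \<equiv> bd +>\<^bsub>cech_top p r R f\<^esub> z"

lemma coset_Mtop: "bd +>\<^bsub>Mtop\<^esub> z = coset z" by (simp add: a_r_coset_def' Mtop_sel cech_top_def Loc_module_def)

lemma LamH_coset: "z : car AS ==> LamH (coset z) = Lam z" using KQ.quot_map_coset[of z] by (simp add: Mtop_sel coset_Mtop)

lemma coset_eq: "z : car AS ==> coset z = {y : car AS. Lam y = Lam z}"
 using KQ.coset_eq[of z] by (simp add: Mtop_sel coset_Mtop)

lemma loc_coh_carrier: "C : car (loc_coh p r R f) \<longleftrightarrow> (\<exists>z\<in>car AS. C = coset z)"
 by (auto simp: loc_coh_def quot_module_def A_RCOSETS_def' a_r_coset_def' cech_top_def Loc_module_def)

abbreviation "HR \<equiv> H_mod p r R f"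

lemma H_mod_eq: "HR = quot_module Mtop bd" proof -
 have "a_r_coset Mtop = a_r_coset (cech_top p r R f)"
  "a_rcosets\<^bsub>Mtop\<^esub> bd = a_rcosets\<^bsub>cech_top p r R f\<^esub> bd"
  "set_add Mtop = set_add (cech_top p r R f)"
  by (simp_all add: fun_eq_iff Mtop_sel cech_top_def Loc_module_def a_r_coset_def' A_RCOSETS_def' set_add_def') thus ?thesis
  by (simp add: H_mod_def loc_coh_def quot_module_def restrict_scalars_def Mtop_sel cech_top_def Loc_module_def)
qed

lemma H_carrier: "car (HR) = car (loc_coh p r R f)" by (simp add: H_mod_def restrict_scalars_def)

lemma H_smult: "P \<odot>\<^bsub>HR\<^esub> C = Delta p r R P \<odot>\<^bsub>loc_coh p r R f\<^esub> C"
 by (simp add: H_mod_def restrict_scalars_def)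

text \<open>An operator phi that is not of the form Delta(P) comes with no formula for its effect on
  \<open>Lam\<close>. It is enough that two representatives differ by a boundary and that phi
  preserves boundaries, which is \<open>Lam_DiffOp_zero\<close>.\<close>

lemma loc_coh_smult: assumes phi: "phi : DL p A e" and z: "z : car AS"
 shows "phi \<odot>\<^bsub>loc_coh p r R f\<^esub> coset z = coset (DiffOp_loc p A S phi z)" proof -
 interpret C: ring CB by (rule ring_CB)
 note D = DLD[OF L.DiffOp_loc_level[OF phi p_pos]]
 have "coset (DiffOp_loc p A S phi y) = coset (DiffOp_loc p A S phi z)" if "y : coset z" for y proof -
  have y: "y : car AS" "Lam y = Lam z" using that by (auto simp: coset_eq[OF z])
  define k where "k = y \<ominus>\<^bsub>AS\<^esub> z"
  have k: "k : car AS" using y z by (simp add: k_def)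
  have yk: "y = k \<oplus>\<^bsub>AS\<^esub> z" using y z by (simp add: k_def AS.minus_eq AS.a_assoc AS.l_neg)
  have "Lam z = Lam k \<oplus>\<^bsub>CB\<^esub> Lam z" using y(2) unfolding yk Lam_add[OF k z] by (rule sym)
  hence "Lam k = \<zero>\<^bsub>CB\<^esub>" using C.add.r_cancel_one'[OF Lam_closed[OF z] Lam_closed[OF k]] by blast
  hence "Lam (DiffOp_loc p A S phi k) = \<zero>\<^bsub>CB\<^esub>" by (rule Lam_DiffOp_zero[OF phi k])
  hence "Lam (DiffOp_loc p A S phi y) = Lam (DiffOp_loc p A S phi z)"
   unfolding yk D(3)[OF k z] Lam_add[OF D(2)[OF k] D(2)[OF z]] using Lam_closed[OF D(2)[OF z]] by simp
  thus ?thesis unfolding coset_eq[OF D(2)[OF y(1)]] coset_eq[OF D(2)[OF z]] by simp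
 qed
 hence "(\<Union>y\<in>coset z. coset (DiffOp_loc p A S phi y)) = (\<Union>y\<in>coset z. coset (DiffOp_loc p A S phi z))"
  by (rule SUP_cong[OF refl])
 moreover have "coset z ~= {}" using z by (auto simp: coset_eq)
 ultimately show ?thesis by (simp add: loc_coh_def quot_module_def cech_top_def Loc_module_def)
qed

lemma LamH_hom: "left_module_hom (CD p r R) (HR) fsR LamH" unfolding H_mod_eq
 by (rule KQ.quot_map_hom[OF left_module_fsR]) (simp_all add: Mtop_sel Lam_Delta fsR_smult Lam_closed)

lemma left_module_H: "left_module (CD p r R) (HR)" using LamH_hom by (simp add: left_module_hom_def)

lemma LamH_inj: "inj_on LamH (car (HR))" using KQ.inj_quot_map unfolding H_mod_eq .

lemma LamH_closed: "C : car (HR) ==> LamH C : car CB"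
 using LamH_hom unfolding left_module_hom_def fsR_sel by blast

lemma delta_eq: "delta p r R f = coset (L.frac \<one>\<^bsub>A\<^esub> g)" by (simp add: delta_def g_def)

lemma g_S: "g : S" using g_pow_S[of 1] by simp

text \<open>In the form g^(q-1) / g^q with q = p^e, delta can be acted upon through its numerator by
  operators of level e.\<close>

lemma frac_delta: "L.frac \<one>\<^bsub>A\<^esub> g = L.frac (g [^]\<^bsub>A\<^esub> (p ^ e - 1)) (g [^]\<^bsub>A\<^esub> (p ^ e))" proof -
 have "g [^]\<^bsub>A\<^esub> (p ^ e) = g [^]\<^bsub>A\<^esub> (p ^ e - 1) \<otimes>\<^bsub>A\<^esub> g"
  using p_pos A.nat_pow_Suc[of g "p ^ e - 1"] by simp
 thus ?thesis using L.frac_expand[of "\<one>\<^bsub>A\<^esub>" g "g [^]\<^bsub>A\<^esub> (p ^ e - 1)"] g_S by simp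
qed

lemma smult_delta: assumes phi: "phi : DL p A e"
 shows "phi \<odot>\<^bsub>loc_coh p r R f\<^esub> delta p r R f = coset (L.frac (phi (g [^]\<^bsub>A\<^esub> (p ^ e - 1))) (g [^]\<^bsub>A\<^esub> (p ^ e)))"
  and "phi \<odot>\<^bsub>loc_coh p r R f\<^esub> delta p r R f : car (HR)"
  and "LamH (phi \<odot>\<^bsub>loc_coh p r R f\<^esub> delta p r R f) = Lam (L.frac (phi (g [^]\<^bsub>A\<^esub> (p ^ e - 1))) (g [^]\<^bsub>A\<^esub> (p ^ e)))"
proof -
 let ?a = "g [^]\<^bsub>A\<^esub> (p ^ e - 1)"
 have c: "L.frac (phi ?a) (g [^]\<^bsub>A\<^esub> (p ^ e)) : car AS" by (rule L.frac_closed[OF DLD(2)[OF phi] g_pow_S]) simp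
 show 1: "phi \<odot>\<^bsub>loc_coh p r R f\<^esub> delta p r R f = coset (L.frac (phi ?a) (g [^]\<^bsub>A\<^esub> (p ^ e)))"
  unfolding delta_eq frac_delta[of e] by (subst loc_coh_smult[OF phi]) (simp_all add: DiffOp_loc_frac_q[OF phi])
 show "phi \<odot>\<^bsub>loc_coh p r R f\<^esub> delta p r R f : car (HR)"
  unfolding 1 H_carrier loc_coh_carrier using c by blast
 show "LamH (phi \<odot>\<^bsub>loc_coh p r R f\<^esub> delta p r R f) = Lam (L.frac (phi ?a) (g [^]\<^bsub>A\<^esub> (p ^ e)))"
  unfolding 1 by (rule LamH_coset[OF c])
qed

lemma delta_H: "delta p r R f : car (HR)" "LamH (delta p r R f) = \<one>\<^bsub>CB\<^esub>" proof -
 have c: "L.frac \<one>\<^bsub>A\<^esub> g : car AS" using g_S by simp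
 show "delta p r R f : car (HR)" unfolding H_carrier loc_coh_carrier delta_eq using c by blast
 show "LamH (delta p r R f) = \<one>\<^bsub>CB\<^esub>" unfolding delta_eq LamH_coset[OF c] by (rule Lam_delta_rep)
qed

definition mult_op :: "((nat => nat => int) => 'a) => ((nat => nat => int) => 'a => 'a)" where
 "mult_op U = (\<lambda>x\<in>Ypts p r. \<lambda>b\<in>car R. U x \<otimes>\<^bsub>R\<^esub> b)"

lemma mult_DiffOp: "a : car R ==> (\<lambda>b\<in>car R. a \<otimes>\<^bsub>R\<^esub> b) : DL p R e"
 by (rule DLI) (auto simp: R.r_distr R.m_lcomm)

lemma mult_op_closed: assumes U: "U : car (CF p r R)" shows "mult_op U : car (CD p r R)" unfolding mult_op_def
 using CF_lift2[OF p_pos U U, of "%a c. \<lambda>b\<in>car R. a \<otimes>\<^bsub>R\<^esub> b" "DiffOp p R"] mult_DiffOp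
 by (auto simp: DiffOp_carrier)

text \<open>Theta applies \<open>Delta\<close> of a multiplication operator to delta, whose value is
  1. Multiplication operators have level 0, where the twist is by f^0 = 1.\<close>

lemma LamH_Theta: assumes U: "U : car (CF p r R)"
 shows "Theta p r R f U : car (HR)" "LamH (Theta p r R f U) = (\<lambda>x\<in>Ypts p r. \<iota> (U x))" proof -
 interpret H: left_module "CD p r R" "HR" by (rule left_module_H)
 interpret C: ring CB by (rule ring_CB)
 note P = mult_op_closed[OF U]
 have Th: "Theta p r R f U = mult_op U \<odot>\<^bsub>HR\<^esub> delta p r R f" by (simp add: Theta_def H_smult mult_op_def)
 show "Theta p r R f U : car (HR)" unfolding Th by (rule H.smult_closed[OF P delta_H(1)])
 have "LamH (Theta p r R f U) = mult_op U \<odot>\<^bsub>fsR\<^esub> LamH (delta p r R f)"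
  using LamH_hom P delta_H(1) unfolding Th left_module_hom_def by blast
 also have "... = act (CD_map (mult_op U)) \<one>\<^bsub>CB\<^esub>" by (simp add: delta_H(2) fsR_smult P)
 also have "... = (\<lambda>x\<in>Ypts p r. \<iota> (U x))" unfolding act_def proof (rule restrict_ext)
  fix x assume x: "x : Ypts p r"
  have Ux: "U x : car R" by (rule Cfun_val[OF U x])
  define h where "h = (\<lambda>b\<in>car R. U x \<otimes>\<^bsub>R\<^esub> b)"
  have h: "h : DL p R 0" unfolding h_def by (rule mult_DiffOp[OF Ux])
  have t0: "fpw (%i. trunc (x i) 0) = \<one>" by (rule fpw_zero) (use trunc_less[OF Ypts_D[OF x], of _ 0] in auto)
  have "tw x (\<sigma> h) \<one> = \<sigma> h (\<iota> \<one>\<^bsub>R\<^esub>)"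
   using tw_eq[OF \<sigma>_level[OF h] x, of \<one>] \<sigma>_\<iota>[OF h R.one_closed] DLD(2)[OF h R.one_closed] by (simp add: t0)
  also have "... = \<iota> (U x)" using \<sigma>_\<iota>[OF h R.one_closed] Ux by (simp add: h_def)
  finally show "tw x (CD_map (mult_op U) x) (\<one>\<^bsub>CB\<^esub> x) = \<iota> (U x)"
   using x by (simp add: CD_map_def mult_op_def h_def Cfun_ops)
 qed
 finally show "LamH (Theta p r R f U) = (\<lambda>x\<in>Ypts p r. \<iota> (U x))" .
qed

subsection \<open>The filtration \<open>S\<^sup>k\<close> of \<open>C(\<int>\<^sub>p\<^sup>r, B)\<close>\<close>

definition tr :: "nat => (nat => nat => int) => nat => nat" where "tr e x i = trunc (x i) e"

definition Sat :: "nat => nat => ((nat => nat => int) => 'b) => bool" where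
 "Sat k e U \<longleftrightarrow> loc_const p r e U \<and>
  (\<forall>x\<in>Ypts p r. \<exists>d\<in>F.Dn p e (F.wt (tr e x) + k). U x \<otimes> fpw (tr e x) = \<iota> d)"

definition Sk :: "nat => ((nat => nat => int) => 'b) set" where
 "Sk k = {U : car CB. \<exists>e. Sat k e U}"

text \<open>Raising the level multiplies f^x by some f^(c q) with q = p^e, and
  \<open>Dn_mult_mono\<close> raises the required power of I by exactly the weight of c q.\<close>

lemma Sat_mono: assumes U: "U : car CB" and s: "Sat k e U" and le: "e <= e'" shows "Sat k e' U" unfolding Sat_def proof (intro conjI ballI)
 show "loc_const p r e' U" using s loc_const_mono[OF _ le] unfolding Sat_def by blast
 fix x assume x: "x : Ypts p r"
 obtain d where d: "d : F.Dn p e (F.wt (tr e x) + k)" "U x \<otimes> fpw (tr e x) = \<iota> d" using s x unfolding Sat_def by blast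
 define c where "c i = trunc (x i) e' div p ^ e" for i
 have sp: "tr e' x i = tr e x i + c i * p ^ e" if "i : {1..r}" for i
  using trunc_mod[OF Ypts_D[OF x that] le] by (metis mod_div_mult_eq add.commute tr_def c_def)
 have "fpw (tr e' x) = fpw (tr e x) \<otimes> \<iota> (F.mono (%i. c i * p ^ e))"
  unfolding \<iota>_mono fpw_add[symmetric] by (rule fpw_cong) (rule sp)
 moreover have "U x : car B" by (rule Cfun_val[OF U x])
 ultimately have "U x \<otimes> fpw (tr e' x) = U x \<otimes> fpw (tr e x) \<otimes> \<iota> (F.mono (%i. c i * p ^ e))"
  by (simp add: m_assoc)
 also have "... = \<iota> (d \<otimes>\<^bsub>R\<^esub> F.mono (%i. c i * p ^ e))" using F.Dn_closed[OF d(1)] by (simp add: d(2))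
 finally have eq: "U x \<otimes> fpw (tr e' x) = \<iota> (d \<otimes>\<^bsub>R\<^esub> F.mono (%i. c i * p ^ e))" .
 have "F.wt (tr e' x) = F.wt (tr e x) + F.wt c * p ^ e" using F.wt_cong[OF sp] by (simp add: F.wt_add) (simp add: F.wt_def sum_distrib_right)
 hence "d \<otimes>\<^bsub>R\<^esub> F.mono (%i. c i * p ^ e) : F.Dn p e (F.wt (tr e' x) + k)"
  using F.Dn_mult_mono[OF d(1), of c] by (simp add: ac_simps)
 thus "\<exists>d\<in>F.Dn p e' (F.wt (tr e' x) + k). U x \<otimes> fpw (tr e' x) = \<iota> d" using eq F.Dn_mono_level[OF le] by blast
qed

lemma Sat_add: assumes U: "U : car CB" "V : car CB" and s: "Sat k e U" "Sat k e V" shows "Sat k e (U \<oplus>\<^bsub>CB\<^esub> V)"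
 unfolding Sat_def proof (intro conjI ballI)
 have l: "loc_const p r e U" "loc_const p r e V" using s unfolding Sat_def by auto
 have "U x \<oplus> V x = U y \<oplus> V y" if "x : Ypts p r" "y : Ypts p r" "cong_pts r e x y" for x y
  by (simp only: loc_constD[OF l(1) that] loc_constD[OF l(2) that])
 hence "(U \<oplus>\<^bsub>CB\<^esub> V) x = (U \<oplus>\<^bsub>CB\<^esub> V) y" if "x : Ypts p r" "y : Ypts p r" "cong_pts r e x y" for x y
  unfolding Cfun_ops restrict_apply'[OF that(1)] restrict_apply'[OF that(2)] using that by blast
 thus "loc_const p r e (U \<oplus>\<^bsub>CB\<^esub> V)" by (rule loc_constI)
 fix x assume x: "x : Ypts p r"
 obtain d where d: "d : F.Dn p e (F.wt (tr e x) + k)" "U x \<otimes> fpw (tr e x) = \<iota> d" using s x unfolding Sat_def by blast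
 obtain d' where d': "d' : F.Dn p e (F.wt (tr e x) + k)" "V x \<otimes> fpw (tr e x) = \<iota> d'" using s x unfolding Sat_def by blast
 have "(U x \<oplus> V x) \<otimes> fpw (tr e x) = \<iota> (d \<oplus>\<^bsub>R\<^esub> d')"
  using d d' F.Dn_closed[OF d(1)] F.Dn_closed[OF d'(1)] Cfun_val[OF U(1) x] Cfun_val[OF U(2) x] by (simp add: l_distr)
 moreover have "d \<oplus>\<^bsub>R\<^esub> d' : F.Dn p e (F.wt (tr e x) + k)"
  by (rule additive_subgroup.a_closed[OF ideal.axioms(1)[OF F.Dn_ideal] d(1) d'(1)])
 ultimately show "\<exists>d\<in>F.Dn p e (F.wt (tr e x) + k). (U \<oplus>\<^bsub>CB\<^esub> V) x \<otimes> fpw (tr e x) = \<iota> d"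
  using x by (auto simp: Cfun_ops)
qed

lemma Sk_zero: "\<zero>\<^bsub>CB\<^esub> : Sk k" proof -
 interpret C: ring CB by (rule ring_CB)
 have "Sat k 0 \<zero>\<^bsub>CB\<^esub>" unfolding Sat_def proof (intro conjI ballI)
  show "loc_const p r 0 \<zero>\<^bsub>CB\<^esub>" by (intro loc_constI) (simp add: Cfun_ops)
  fix x assume "x : Ypts p r"
  thus "\<exists>d\<in>F.Dn p 0 (F.wt (tr 0 x) + k). \<zero>\<^bsub>CB\<^esub> x \<otimes> fpw (tr 0 x) = \<iota> d"
   by (intro bexI[of _ "\<zero>\<^bsub>R\<^esub>"] additive_subgroup.zero_closed[OF ideal.axioms(1)[OF F.Dn_ideal]]) (simp add: Cfun_ops)
 qed
 thus ?thesis unfolding Sk_def using C.zero_closed by blast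
qed

lemma Sk_add: "U : Sk k ==> V : Sk k ==> U \<oplus>\<^bsub>CB\<^esub> V : Sk k" proof -
 interpret C: ring CB by (rule ring_CB)
 assume "U : Sk k" "V : Sk k"
 then obtain e e' where c: "U : car CB" "V : car CB" and s: "Sat k e U" "Sat k e' V" unfolding Sk_def by blast
 have "Sat k (max e e') (U \<oplus>\<^bsub>CB\<^esub> V)" by (rule Sat_add[OF c Sat_mono[OF c(1) s(1)] Sat_mono[OF c(2) s(2)]]) simp_all
 thus ?thesis unfolding Sk_def using c C.a_closed by blast
qed

text \<open>At a level E above those of P and U, the twist of P x is conjugation by f^x with x
  truncated at E, and P x maps each ideal D^E I^n into itself.\<close>

lemma Sk_smult: assumes P: "P : car (CD p r R)" and "U : Sk k" shows "act (CD_map P) U : Sk k" proof -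
 obtain e where U: "U : car CB" and s: "Sat k e U" using assms(2) unfolding Sk_def by blast
 obtain e' where e': "loc_const p r e' P" "!!x. x : Ypts p r ==> P x : DL p R e'"
  using CD_R_common_level[OF P] by blast
 have c: "act (CD_map P) U : car CB" by (rule act_closed[OF ring_hom_closed[OF CD_map_hom P] U])
 obtain e'' where e'': "loc_const p r e'' (act (CD_map P) U)" using CF_loc_const[OF p_pos c] by blast
 define E where "E = max (max e e') e''"
 have sE: "Sat k E U" by (rule Sat_mono[OF U s]) (simp add: E_def)
 have PE: "P x : DL p R E" if "x : Ypts p r" for x by (rule R.DiffOp_level_mono[OF e'(2)[OF that]]) (simp add: E_def)
 have "Sat k E (act (CD_map P) U)" unfolding Sat_def proof (intro conjI ballI)
  show "loc_const p r E (act (CD_map P) U)" by (rule loc_const_mono[OF e'']) (simp add: E_def)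
  fix x assume x: "x : Ypts p r"
  obtain d where d: "d : F.Dn p E (F.wt (tr E x) + k)" "U x \<otimes> fpw (tr E x) = \<iota> d" using sE x unfolding Sat_def by blast
  have "act (CD_map P) U x = tw x (\<sigma> (P x)) (U x)" using x by (simp add: act_def CD_map_def)
  also have "... = \<sigma> (P x) (\<iota> d) \<otimes> inv (fpw (tr E x))"
   using tw_eq[OF \<sigma>_level[OF PE[OF x]] x Cfun_val[OF U x]] d(2) by (simp add: tr_def[abs_def])
  also have "\<sigma> (P x) (\<iota> d) = \<iota> (P x d)" by (rule \<sigma>_\<iota>[OF PE[OF x] F.Dn_closed[OF d(1)]])
  finally have "act (CD_map P) U x \<otimes> fpw (tr E x) = \<iota> (P x d)"
   using DLD(2)[OF PE[OF x] F.Dn_closed[OF d(1)]] by (simp add: fpw_cancel)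
  thus "\<exists>d\<in>F.Dn p E (F.wt (tr E x) + k). act (CD_map P) U x \<otimes> fpw (tr E x) = \<iota> d"
   using F.Dn_DiffOp[OF PE[OF x] d(1)] by blast
 qed
 thus ?thesis unfolding Sk_def using c by blast
qed

lemma Sk_antimono: "k <= l ==> Sk l <= Sk k" proof
 fix U assume "k <= l" "U : Sk l"
 then obtain e where "U : car CB" "Sat l e U" unfolding Sk_def by blast
 moreover have "F.Dn p e (F.wt (tr e x) + l) <= F.Dn p e (F.wt (tr e x) + k)" for x
  by (rule F.Dn_antimono) (simp add: \<open>k <= l\<close>)
 ultimately show "U : Sk k" unfolding Sk_def Sat_def by blast
qed

lemma Sk_submodule: "submodule (Sk k) (CD p r R) fsR" proof -
 interpret M: left_module "CD p r R" fsR by (rule left_module_fsR)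
 show ?thesis proof (rule M.submoduleI_left)
  show "Sk k <= car fsR" unfolding Sk_def fsR_sel by blast
  show "\<zero>\<^bsub>fsR\<^esub> : Sk k" unfolding fsR_sel by (rule Sk_zero)
  show "U \<oplus>\<^bsub>fsR\<^esub> V : Sk k" if "U : Sk k" "V : Sk k" for U V unfolding fsR_sel by (rule Sk_add[OF that])
  show "P \<odot>\<^bsub>fsR\<^esub> U : Sk k" if "P : car (CD p r R)" "U : Sk k" for P U proof -
   have "U : car CB" using that(2) unfolding Sk_def by blast thus ?thesis using Sk_smult[OF that] by (simp add: fsR_smult that)
  qed
 qed
qed

end

lemma (in abelian_monoid) finsum_mem:
 assumes "H <= car G" "\<zero> : H" "!!x y. x : H ==> y : H ==> x \<oplus> y : H" "h : M \<rightarrow> H"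
 shows "(\<Oplus>m\<in>M. h m) : H" using assms(4) proof (induction M rule: infinite_finite_induct)
 case (insert m M)
 hence "h m : H" "h : M \<rightarrow> car G" "h m : car G" "(\<Oplus>m\<in>M. h m) : H" using assms(1) by auto
 thus ?case using insert.hyps assms(3) by simp
qed (use assms(2) in simp_all)

lemma (in ideal) finsum_ideal: "h : M \<rightarrow> I ==> (\<Oplus>m\<in>M. h m) : I" by (rule finsum_mem) (use Icarr in auto)

context bs_setup begin

subsection \<open>The \<open>V\<close>-filtration\<close>

definition Tset :: "nat => (nat multiset => 'a) set" where
 "Tset n = {w : car A. \<forall>m. w m ~= \<zero>\<^bsub>R\<^esub> \<longrightarrow> n <= size m}"

lemma Tset_ideal: "ideal (Tset n) A" proof (rule idealI[OF A.ring_axioms])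
 show "subgroup (Tset n) (add_monoid A)" proof (rule A.add.subgroupI)
  show "Tset n <= car A" unfolding Tset_def by blast
  have "\<zero>\<^bsub>A\<^esub> : Tset n" using A.zero_closed unfolding Tset_def by (simp add: R.MPoly_ops R.MPS_zero)
  thus "Tset n ~= {}" by blast
  fix a assume a: "a : Tset n"
  thus "\<ominus>\<^bsub>A\<^esub> a : Tset n" by (auto simp: Tset_def R.MPoly_minus)
  fix b assume b: "b : Tset n"
  have "a m ~= \<zero>\<^bsub>R\<^esub> \<or> b m ~= \<zero>\<^bsub>R\<^esub>" if "a m \<oplus>\<^bsub>R\<^esub> b m ~= \<zero>\<^bsub>R\<^esub>" for m
   using that by auto
  thus "a \<oplus>\<^bsub>A\<^esub> b : Tset n" using a b A.a_closed[of a b] unfolding Tset_def by (auto simp: R.MPoly_ops R.MPS_add)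
 qed
next
 fix a w assume a: "a : Tset n" and w: "w : car A"
 have "n <= size m" if "(w \<otimes>\<^bsub>A\<^esub> a) m ~= \<zero>\<^bsub>R\<^esub>" for m proof -
  have "w : car (MPS R)" "a : car (MPS R)" using a w R.MPoly_MPS_sub unfolding Tset_def by blast+
  moreover have "(w \<otimes>\<^bsub>MPS R\<^esub> a) m ~= \<zero>\<^bsub>R\<^esub>" using that unfolding R.MPoly_ops .
  ultimately obtain b c where "m = b + c" "a c ~= \<zero>\<^bsub>R\<^esub>" using R.MPS_mult_support by blast
  thus ?thesis using a unfolding Tset_def by force
 qed
 thus "w \<otimes>\<^bsub>A\<^esub> a : Tset n" using a w unfolding Tset_def by blast
 thus "a \<otimes>\<^bsub>A\<^esub> w : Tset n" using a w A.m_comm[of a w] unfolding Tset_def by simp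
qed

definition mset_of :: "(nat => nat) => nat multiset" where
 "mset_of n = (\<Sum>i\<in>{1..r}. rep (n i) i)"

lemma count_mset_of: "count (mset_of n) i = (if i : {1..r} then n i else 0)" by (simp add: mset_of_def count_sum)

lemma set_mset_of: "set_mset (mset_of n) <= {1..r}" proof
 fix i assume "i \<in># mset_of n"
 hence "count (mset_of n) i ~= 0" by simp
 thus "i : {1..r}" by (auto simp: count_mset_of split: if_splits)
qed

lemma mset_of_count: "set_mset m <= {1..r} ==> mset_of (count m) = m"
 by (rule multiset_eqI) (auto simp: count_mset_of not_in_iff[symmetric])

lemma size_mset_of: "size (mset_of n) = F.wt n" by (simp add: mset_of_def F.wt_def size_multiset_sum)

sublocale FT: ideal_family A r "%i. mon R \<one>\<^bsub>R\<^esub> {#i#}"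
 by (intro ideal_family.intro ideal_family_axioms.intro A.cring_axioms mon_A) auto

lemma FT_mono: "FT.mono n = mon R \<one>\<^bsub>R\<^esub> (mset_of n)" proof -
 have "(\<Otimes>\<^bsub>A\<^esub>i\<in>J. mon R \<one>\<^bsub>R\<^esub> {#i#} [^]\<^bsub>A\<^esub> n i) = mon R \<one>\<^bsub>R\<^esub> (\<Sum>i\<in>J. rep (n i) i)"
  if "finite J" "J <= {1..r}" for J using that proof (induction J)
  case empty thus ?case by (simp add: R.MPoly_ops R.MPS_one)
 next
  case (insert i J)
  have c: "mon R \<one>\<^bsub>R\<^esub> {#j#} [^]\<^bsub>A\<^esub> n j : car A" if "j : insert i J" for j
   using that insert.prems by (intro A.nat_pow_closed mon_A) auto
  have "(\<Otimes>\<^bsub>A\<^esub>i\<in>insert i J. mon R \<one>\<^bsub>R\<^esub> {#i#} [^]\<^bsub>A\<^esub> n i) =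
   mon R \<one>\<^bsub>R\<^esub> {#i#} [^]\<^bsub>A\<^esub> n i \<otimes>\<^bsub>A\<^esub> (\<Otimes>\<^bsub>A\<^esub>i\<in>J. mon R \<one>\<^bsub>R\<^esub> {#i#} [^]\<^bsub>A\<^esub> n i)"
   by (rule A.finprod_insert) (use insert.hyps c in auto)
  also have "... = mon R \<one>\<^bsub>R\<^esub> (rep (n i) i) \<otimes>\<^bsub>A\<^esub> mon R \<one>\<^bsub>R\<^esub> (\<Sum>i\<in>J. rep (n i) i)"
   using insert by (simp add: R.MPoly_pow R.mon_pow)
  also have "... = mon R \<one>\<^bsub>R\<^esub> (\<Sum>i\<in>insert i J. rep (n i) i)"
   using insert.hyps by (simp add: R.MPoly_ops R.mon_mult_mon)
  finally show ?case .
 qed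
 from this[of "{1..r}"] show ?thesis unfolding FT.mono_def mset_of_def by simp
qed

text \<open>The results on powers of I are reused for the ideal of R[t] generated by the variables,
  whose monomials are those of t; \<open>pw_least\<close> bounds its powers from above.\<close>

lemma t_power_eq: "t_power R r j = Tset (nat j)" proof -
 have v: "ring.indexed_var R i = mon R \<one>\<^bsub>R\<^esub> {#i#}" for i
  by (auto simp: R.indexed_var_def R.indexed_pmult_def R.indexed_const_def mon_def fun_eq_iff dest: multi_member_split)
 have "FT.pw n = Tset n" for n proof
  show "FT.pw n <= Tset n" proof (rule FT.pw_least[OF Tset_ideal])
   fix c assume "FT.wt c = n"
   hence "size (mset_of c) = n" by (simp add: size_mset_of FT.wt_def F.wt_def)
   moreover have "m = mset_of c" if "mon R \<one>\<^bsub>R\<^esub> (mset_of c) m ~= \<zero>\<^bsub>R\<^esub>" for m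
    using that unfolding mon_def by presburger
   moreover have "mon R \<one>\<^bsub>R\<^esub> (mset_of c) : car A" by (rule mon_A[OF R.one_closed set_mset_of])
   ultimately show "FT.mono c : Tset n" unfolding FT_mono Tset_def by blast
  qed
  interpret P: ideal "FT.pw n" A by (rule FT.pw_ideal)
  show "Tset n <= FT.pw n" proof
   fix w assume w: "w : Tset n"
   hence wc: "w : car A" unfolding Tset_def by blast
   have "mon R (w m) m : FT.pw n" if m: "w m ~= \<zero>\<^bsub>R\<^esub>" for m proof -
    have s: "set_mset m <= {1..r}" using wc m unfolding R.MPoly_carrier by blast
    have sz: "n <= size m" using w m unfolding Tset_def by blast
    have "FT.wt (count m) = size m" using size_mset_of[of "count m"] by (simp add: mset_of_count[OF s] FT.wt_def F.wt_def)
    hence "FT.mono (count m) : FT.pw n" using FT.mono_pw FT.pw_antimono[OF sz] by blast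
    hence "mon R \<one>\<^bsub>R\<^esub> m : FT.pw n" by (simp add: FT_mono mset_of_count[OF s])
    moreover have "mon R (w m) {#} : car A" using wc by simp
    ultimately have "mon R (w m) {#} \<otimes>\<^bsub>A\<^esub> mon R \<one>\<^bsub>R\<^esub> m : FT.pw n" by (rule P.I_l_closed)
    thus ?thesis using wc by (simp add: R.MPoly_ops R.mon_mult_mon)
   qed
   hence "(\<Oplus>\<^bsub>A\<^esub>m\<in>{m. w m ~= \<zero>\<^bsub>R\<^esub>}. mon R (w m) m) : FT.pw n" by (intro P.finsum_ideal) blast
   thus "w : FT.pw n" unfolding mon_sum[OF wc] .
  qed
 qed
 thus ?thesis unfolding t_power_def FT.I_def[symmetric] v by simp
qed

lemma Tset_antimono: "n <= m ==> Tset m <= Tset n" unfolding Tset_def by (auto intro: le_trans)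

text \<open>For negative j the condition asks that phi map R[t] into <t>^(j+k); this follows from
  the case n = 0 since the powers decrease.\<close>

lemma V_filt_iff:
 "phi : V_filt p r R (int k) \<longleftrightarrow> (\<exists>e. phi : DL p A e) \<and> (\<forall>n. phi ` Tset n <= Tset (n + k))"
proof -
 have "(\<forall>j. phi ` Tset (nat j) <= Tset (nat (j + int k))) \<longleftrightarrow> (\<forall>n. phi ` Tset n <= Tset (n + k))"
 proof (intro iffI allI)
  fix n assume "\<forall>j. phi ` Tset (nat j) <= Tset (nat (j + int k))"
  from this[rule_format, of "int n"] show "phi ` Tset n <= Tset (n + k)" by (simp flip: of_nat_add)
 next
  fix j assume "\<forall>n. phi ` Tset n <= Tset (n + k)"
  moreover have "Tset (nat j + k) <= Tset (nat (j + int k))" by (rule Tset_antimono) simp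
  ultimately show "phi ` Tset (nat j) <= Tset (nat (j + int k))" by blast
 qed
 thus ?thesis unfolding V_filt_def t_power_eq DiffOp_carrier by blast
qed

section \<open>The coefficients of g^(p^e - 1)\<close>

definition G :: "nat => (nat multiset => 'a)" where "G e = g [^]\<^bsub>A\<^esub> (p ^ e - 1)"

lemma G_closed [simp]: "G e : car A" by (simp add: G_def)

text \<open>The telescoping product of f - t with the sum of f^(q-1-k) t^k over k < q. It replaces
  the binomial expansion of (f - t)^(q-1) and the reduction of its coefficients modulo p.\<close>

lemma ex_gi_geom: assumes i: "i : {1..r}"
 shows "ex (gi i) \<otimes>\<^bsub>MPS B\<^esub> PS i (%k. if k < p ^ e then u i [^] (p ^ e - 1 - k) else \<zero>) = ex (gi i [^]\<^bsub>A\<^esub> (p ^ e))"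
proof (rule HOL.ext)
 fix m
 define q where "q = p ^ e"
 have q: "q > 0" using p_pos by (simp add: q_def)
 have uc: "u i : car B" using i f_car by simp
 let ?w = "PS i (%k. if k < q then u i [^] (q - 1 - k) else \<zero>)"
 have w: "?w : car (MPS B)" by (rule PS_closed) (use uc in auto)
 have "ex (gi i [^]\<^bsub>A\<^esub> (p ^ 0)) = mon B (u i [^] (p ^ 0)) {#} \<ominus>\<^bsub>MPS B\<^esub> mon B \<one> (rep (p ^ 0) i)"
  by (rule ex_gi_pow[OF i])
 moreover have "rep 1 i = {#i#}" by (simp add: One_nat_def)
 ultimately have "ex (gi i) = mon B (u i) {#} \<ominus>\<^bsub>MPS B\<^esub> mon B \<one> {#i#}" using uc i by simp
 hence L: "(ex (gi i) \<otimes>\<^bsub>MPS B\<^esub> ?w) m = u i \<otimes> ?w m \<ominus> (if {#i#} \<subseteq># m then ?w (m - {#i#}) else \<zero>)"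
  by (simp only: mult_diff_series[OF uc w])
 have e1: "ex (gi i [^]\<^bsub>A\<^esub> q) = mon B (u i [^] q) {#} \<oplus>\<^bsub>MPS B\<^esub> \<ominus>\<^bsub>MPS B\<^esub> mon B \<one> (rep q i)"
  unfolding q_def ex_gi_pow[OF i] by (rule MB.minus_eq)
 have rr: "ex (gi i [^]\<^bsub>A\<^esub> q) m = (if m = {#} then u i [^] q else \<zero>) \<ominus> (if m = rep q i then \<one> else \<zero>)"
  unfolding e1 MPS_add MPS_minus[OF mon_closed[OF one_closed]] by (simp add: mon_def minus_eq)
 show "(ex (gi i) \<otimes>\<^bsub>MPS B\<^esub> PS i (%k. if k < p ^ e then u i [^] (p ^ e - 1 - k) else \<zero>)) m = ex (gi i [^]\<^bsub>A\<^esub> (p ^ e)) m"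
  unfolding q_def[symmetric] L rr proof (cases "set_mset m <= {i}")
  case True
  define k where "k = count m i"
  have m: "m = rep k i" using True by (intro multiset_eqI) (auto simp: k_def not_in_iff[symmetric])
  have pS: "u i \<otimes> u i [^] (n::nat) = u i [^] Suc n" for n using uc by (simp add: m_comm)
  \<comment> \<open>The exponents 0 and q keep the boundary terms f^q and -1 of the telescoping sum;
    strictly between them two equal terms cancel, and above q there is nothing.\<close>
  consider "k = 0" | "0 < k" "k < q" | "k = q" | "q < k" by linarith
  thus "u i \<otimes> ?w m \<ominus> (if {#i#} \<subseteq># m then ?w (m - {#i#}) else \<zero>) =
   (if m = {#} then u i [^] q else \<zero>) \<ominus> (if m = rep q i then \<one> else \<zero>)" proof cases
   case 1
   have "u i \<otimes> u i [^] (q - 1) = u i [^] q" using pS[of "q - 1"] q by simp thus ?thesis using 1 q by (simp add: m PS_def)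
  next
   case 2
   then obtain l where l: "k = Suc l" using not0_implies_Suc by blast
   have "u i \<otimes> u i [^] (q - 1 - k) = u i [^] (q - 1 - l)" using pS[of "q - 1 - k"] 2 l by (simp add: Suc_diff_Suc)
   moreover have "m - {#i#} = rep l i" by (simp add: m l)
   moreover have "rep (Suc l) i ~= rep q i" using 2 l by (metis count_replicate_mset nat_neq_iff)
   ultimately show ?thesis using 2 q uc l by (simp add: m PS_def minus_eq r_neg)
  next
   case 3
   then obtain l where l: "q = Suc l" using q not0_implies_Suc by blast
   have "m - {#i#} = rep l i" unfolding m 3 l by simp
   hence b: "?w (m - {#i#}) = \<one>" by (simp add: PS_def l)
   have a: "?w m = \<zero>" using m 3 by (simp add: PS_def)
   have mq: "m = rep q i" using m 3 by (simp only:)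
   hence "count m i ~= 0" using l by (simp only: count_replicate_mset) simp
   hence "{#i#} \<subseteq># m" "m ~= {#}" by auto
   hence "(if {#i#} \<subseteq># m then ?w (m - {#i#}) else \<zero>) = \<one>" "(if m = {#} then u i [^] q else \<zero>) = \<zero>"
    using b by (simp_all only: if_True if_False refl) thus ?thesis unfolding a using mq uc by (simp only: if_True refl r_null)
  next
   case 4
   then obtain l where l: "k = Suc l" using not0_implies_Suc[of k] by auto
   have "m - {#i#} = rep l i" by (simp add: m l)
   moreover have "rep (Suc l) i ~= rep q i" using 4 l by (metis count_replicate_mset nat_neq_iff)
   ultimately show ?thesis using 4 q uc l by (simp add: m PS_def)
  qed
 next
  case False
  then obtain j where j: "j \<in># m" "j ~= i" by blast
  hence "j \<in># m - {#i#}" by (simp add: in_diff_count)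
  hence "\<not> set_mset (m - {#i#}) <= {i}" using j by blast
  moreover have "m ~= {#}" "m ~= rep q i" using j by (auto split: if_splits)
  ultimately show "u i \<otimes> ?w m \<ominus> (if {#i#} \<subseteq># m then ?w (m - {#i#}) else \<zero>) =
   (if m = {#} then u i [^] q else \<zero>) \<ominus> (if m = rep q i then \<one> else \<zero>)" using False uc by (simp add: PS_def)
 qed
qed

text \<open>As g g^(q-1) = g^q, and by \<open>ex_gi_geom\<close> the product of the truncated
  geometric series satisfies the same equation, invertibility of g among the series over B
  identifies the two. So the coefficient at t^m is a monomial in the f_i of weight r (q-1) - |m|;
  both inclusions between V^k delta and S^k rest on this.\<close>

lemma G_val:
 "G e m = (if set_mset m <= {1..r} \<and> (\<forall>i\<in>{1..r}. count m i < p ^ e)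
  then fR (%i. p ^ e - 1 - count m i) else \<zero>\<^bsub>R\<^esub>)" proof -
 define q where "q = p ^ e"
 define c where "c i k = (if i : {1..r} \<and> k < q then u i [^] (q - 1 - k) else \<zero>)" for i k
 have cc: "c i k : car B" for i k using f_car by (simp add: c_def)
 have PSc: "PS i (c i) : car (MPS B)" for i by (rule PS_closed) (rule cc)
 let ?P = "\<Otimes>\<^bsub>MPS B\<^esub>i\<in>{1..r}. PS i (c i)"
 have P: "?P : car (MPS B)" by (rule MB.finprod_closed) (use PSc in auto)
 have c1: "c i = (%k. if k < p ^ e then u i [^] (p ^ e - 1 - k) else \<zero>)" if "i : {1..r}" for i
  using that by (simp add: c_def q_def fun_eq_iff)
 have exg: "ex g = (\<Otimes>\<^bsub>MPS B\<^esub>i\<in>{1..r}. ex (gi i))" unfolding g_eq by (subst ex.hom_finprod) (auto simp: comp_def)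
 have "ex g \<otimes>\<^bsub>MPS B\<^esub> ?P = (\<Otimes>\<^bsub>MPS B\<^esub>i\<in>{1..r}. ex (gi i) \<otimes>\<^bsub>MPS B\<^esub> PS i (c i))"
  unfolding exg by (rule MB.finprod_multf[symmetric]) (use PSc in auto)
 also have "... = ex (g [^]\<^bsub>A\<^esub> q)" unfolding q_def ex_g_pow by (rule MB.finprod_cong') (use c1 ex_gi_geom in auto)
 also have "g [^]\<^bsub>A\<^esub> q = g \<otimes>\<^bsub>A\<^esub> G e"
  using p_pos A.nat_pow_Suc[of g "q - 1"] A.m_comm[of g "G e"] by (simp add: G_def q_def)
 also have "ex (g \<otimes>\<^bsub>A\<^esub> G e) = ex g \<otimes>\<^bsub>MPS B\<^esub> ex (G e)" by simp
 finally have "?P = ex (G e)" using ex_g_Units P by (simp add: MB.Units_l_cancel)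
 hence "\<iota> (G e m) = ?P m" by (simp add: ex_val)
 also have "?P m = (if set_mset m <= {1..r} then (\<Otimes>i\<in>{1..r}. c i (count m i)) else \<zero>)"
  by (rule finprod_PS) (auto simp: cc)
 also have "... = \<iota> (if set_mset m <= {1..r} \<and> (\<forall>i\<in>{1..r}. count m i < q) then fR (%i. q - 1 - count m i) else \<zero>\<^bsub>R\<^esub>)"
 proof (cases "\<forall>i\<in>{1..r}. count m i < q")
  case True
  have "(\<Otimes>i\<in>{1..r}. c i (count m i)) = fpw (%i. q - 1 - count m i)"
   unfolding fpw_def by (rule finprod_cong') (use True f_car in \<open>auto simp: c_def\<close>)
  thus ?thesis using True by (simp add: \<iota>_fR)
 next
  case False
  then obtain i where i: "i : {1..r}" "\<not> count m i < q" by blast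
  have "(\<Otimes>j\<in>insert i ({1..r} - {i}). c j (count m j)) = c i (count m i) \<otimes> (\<Otimes>j\<in>{1..r} - {i}. c j (count m j))"
   by (rule finprod_insert) (auto simp: cc)
  also have "... = \<zero> \<otimes> (\<Otimes>j\<in>{1..r} - {i}. c j (count m j))" using i(2) by (simp add: c_def[of i])
  also have "... = \<zero>" by (rule l_null, rule finprod_closed) (auto simp: cc)
  also have "insert i ({1..r} - {i}) = {1..r}" using i by auto
  finally show ?thesis using False by auto
 qed
 finally show ?thesis unfolding q_def by (rule inj_onD[OF \<iota>_inj]) auto
qed

end

section \<open>V^k delta described by operators on R[t]\<close>

context bs_setup begin

abbreviation "VR \<equiv> V_delta p r R f"

definition VD :: "nat => ((nat => nat => int) => 'b) set" where
 "VD k = LamH ` VR (int k)"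

definition Vop :: "nat => nat => ((nat multiset => 'a) => (nat multiset => 'a)) => bool" where
 "Vop k e phi \<longleftrightarrow> phi : DL p A e \<and> (\<forall>n. phi ` Tset n <= Tset (n + k))"

definition Lval :: "nat => (nat multiset => 'a) => ((nat => nat => int) => 'b)" where
 "Lval e a = Lam (L.frac a (g [^]\<^bsub>A\<^esub> (p ^ e)))"

lemma Lval_level:
 "phi : DL p A e ==> LamH (phi \<odot>\<^bsub>loc_coh p r R f\<^esub> delta p r R f) = Lval e (phi (G e))"
 unfolding Lval_def G_def by (rule smult_delta(3))

lemma V_delta_iff: "Z : VR (int k) \<longleftrightarrow> (\<exists>e phi. Vop k e phi \<and> Z = phi \<odot>\<^bsub>loc_coh p r R f\<^esub> delta p r R f)"
 unfolding V_delta_def image_iff Bex_def V_filt_iff Vop_def by blast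

lemma V_delta_H: "VR (int k) <= car (HR)" using smult_delta(2) by (auto simp: V_delta_iff Vop_def)

text \<open>Since delta = g^(q-1) / g^q, an operator of level e sends it to phi(g^(q-1)) / g^q;
  local cohomology drops out of the description.\<close>

lemma VD_iff: "U : VD k \<longleftrightarrow> (\<exists>e phi. Vop k e phi \<and> U = Lval e (phi (G e)))" proof
 assume "U : VD k"
 then obtain Z where "U = LamH Z" "Z : VR (int k)" unfolding VD_def by (rule imageE)
 then obtain e phi where 1: "Vop k e phi" "U = LamH (phi \<odot>\<^bsub>loc_coh p r R f\<^esub> delta p r R f)"
  unfolding V_delta_iff by blast
 hence "phi : DL p A e" unfolding Vop_def by blast
 hence "U = Lval e (phi (G e))" unfolding 1(2) by (rule Lval_level)
 thus "\<exists>e phi. Vop k e phi \<and> U = Lval e (phi (G e))" using 1(1) by (intro exI conjI)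
next
 assume "\<exists>e phi. Vop k e phi \<and> U = Lval e (phi (G e))"
 then obtain e phi where 1: "Vop k e phi" "U = Lval e (phi (G e))" by blast
 have "phi : DL p A e" using 1(1) unfolding Vop_def by (rule conjunct1)
 hence U: "U = LamH (phi \<odot>\<^bsub>loc_coh p r R f\<^esub> delta p r R f)" unfolding 1(2) by (rule Lval_level[symmetric])
 have "phi \<odot>\<^bsub>loc_coh p r R f\<^esub> delta p r R f : VR (int k)" unfolding V_delta_iff using 1(1) by blast
 thus "U : VD k" unfolding VD_def U by (rule imageI)
qed

lemma Vop_closed: "Vop k e phi ==> a : car A ==> phi a : car A"
 using DLD(2)[of phi p A e] unfolding Vop_def by simp

lemma Vop_mono: "Vop k e phi ==> e <= e' ==> Vop k e' phi" unfolding Vop_def using A.DiffOp_level_mono by blast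

text \<open>Both sides are the value of \<open>LamH\<close> at phi applied to delta.\<close>

lemma Vop_level: "Vop k e phi ==> e <= e' ==> Lval e' (phi (G e')) = Lval e (phi (G e))" proof -
 assume "Vop k e phi" "e <= e'"
 hence 1: "phi : DL p A e" "phi : DL p A e'" using A.DiffOp_level_mono unfolding Vop_def by blast+
 show "Lval e' (phi (G e')) = Lval e (phi (G e))" using Lval_level[OF 1(1)] Lval_level[OF 1(1)] Lval_level[OF 1(2)] by (simp only:)
qed

lemma VD_add: assumes "U : VD k" "V : VD k" shows "U \<oplus>\<^bsub>CB\<^esub> V : VD k" proof -
 obtain e1 phi1 e2 phi2 where 1: "Vop k e1 phi1" "U = Lval e1 (phi1 (G e1))" and 2: "Vop k e2 phi2" "V = Lval e2 (phi2 (G e2))"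
  using assms unfolding VD_iff by blast
 define e where "e = max e1 e2"
 have le: "e1 <= e" "e2 <= e" by (simp_all add: e_def)
 have v: "Vop k e phi1" "Vop k e phi2" using Vop_mono[OF 1(1) le(1)] Vop_mono[OF 2(1) le(2)] .
 define phi where "phi = (\<lambda>a\<in>car A. phi1 a \<oplus>\<^bsub>A\<^esub> phi2 a)"
 have "phi a : Tset (n + k)" if a: "a : Tset n" for n a proof -
  have "a : car A" using a unfolding Tset_def by blast
  moreover have "phi1 a : Tset (n + k)" "phi2 a : Tset (n + k)" using v a unfolding Vop_def by blast+
  ultimately show ?thesis unfolding phi_def using additive_subgroup.a_closed[OF ideal.axioms(1)[OF Tset_ideal]] by simp
 qed
 moreover have "phi : DL p A e" unfolding phi_def by (rule A.DiffOp_level_add) (use v in \<open>simp_all add: Vop_def\<close>)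
 ultimately have V: "Vop k e phi" unfolding Vop_def by blast
 have c: "phi1 (G e) : car A" "phi2 (G e) : car A" using Vop_closed[OF v(1) G_closed] Vop_closed[OF v(2) G_closed] .
 have "Lval e (phi (G e)) = Lval e (phi1 (G e)) \<oplus>\<^bsub>CB\<^esub> Lval e (phi2 (G e))" unfolding Lval_def phi_def using c
  by (subst Lam_add[symmetric]) (auto simp: L.frac_add_same intro!: L.frac_closed)
 also have "... = U \<oplus>\<^bsub>CB\<^esub> V" unfolding 1(2) 2(2) Vop_level[OF 1(1) le(1)] Vop_level[OF 2(1) le(2)] ..
 finally show ?thesis unfolding VD_iff using V by metis
qed

lemma Lval_eq:
 "a : car A ==> x : Ypts p r ==> Lval e a x = \<iota> (rho e a x) \<otimes> inv (fpw (tr e x))"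
 unfolding Lval_def tr_def by (rule Lam_frac)

lemma Lval_closed: "a : car A ==> Lval e a : car CB"
 unfolding Lval_def by (rule Lam_closed) (auto intro!: L.frac_closed)

lemma VD_carrier: "VD k <= car CB" proof
 fix U assume "U : VD k"
 then obtain e phi where V: "Vop k e phi" and U: "U = Lval e (phi (G e))" unfolding VD_iff by blast
 show "U : car CB" unfolding U by (rule Lval_closed[OF Vop_closed[OF V G_closed]])
qed

lemma VD_zero: "\<zero>\<^bsub>CB\<^esub> : VD k" proof -
 define phi where "phi = (\<lambda>a\<in>car A. \<zero>\<^bsub>A\<^esub>)"
 have "phi a : Tset (n + k)" if a: "a : Tset n" for n a
  using a additive_subgroup.zero_closed[OF ideal.axioms(1)[OF Tset_ideal]] unfolding Tset_def phi_def by simp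
 hence V: "Vop k 0 phi" using A.DiffOp_level_zero unfolding Vop_def phi_def by blast
 have "Lval 0 (phi (G 0)) = \<zero>\<^bsub>CB\<^esub>" proof (rule Cfun_ext)
  interpret C: ring CB by (rule ring_CB)
  show "\<zero>\<^bsub>CB\<^esub> : car CB" by simp
  show "Lval 0 (phi (G 0)) : car CB" by (rule Lval_closed) (simp add: phi_def)
  fix x assume x: "x : Ypts p r"
  have "rho 0 \<zero>\<^bsub>A\<^esub> x = \<zero>\<^bsub>R\<^esub>" by (simp add: rho_def supp_at_def R.MPoly_ops R.MPS_zero)
  thus "Lval 0 (phi (G 0)) x = \<zero>\<^bsub>CB\<^esub> x" using x by (simp add: Lval_eq phi_def Cfun_ops)
 qed
 thus ?thesis unfolding VD_iff using V by metis
qed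

subsection \<open>\<open>V\<^sup>k \<delta>\<close> is contained in \<open>S\<^sup>k\<close>\<close>

lemma coeff_sum: assumes phi: "phi : DL p A e" and w: "w : car A"
 shows "phi w b = (\<Oplus>\<^bsub>R\<^esub>m\<in>{m. w m ~= \<zero>\<^bsub>R\<^esub>}. phi (mon R (w m) m) b)" proof -
 have c: "mon R (w m) m : car A" if "m : {m. w m ~= \<zero>\<^bsub>R\<^esub>}" for m
  using w that unfolding R.MPoly_carrier[of w] by (intro mon_A) blast+
 have "phi w b = phi (\<Oplus>\<^bsub>A\<^esub>m\<in>{m. w m ~= \<zero>\<^bsub>R\<^esub>}. mon R (w m) m) b" by (simp only: mon_sum[OF w])
 also have "... = (\<Oplus>\<^bsub>A\<^esub>m\<in>{m. w m ~= \<zero>\<^bsub>R\<^esub>}. phi (mon R (w m) m)) b"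
  using A.DiffOp_finsum[OF phi, of "%m. mon R (w m) m" "{m. w m ~= \<zero>\<^bsub>R\<^esub>}"] c by (simp only: Pi_I)
 also have "... = (\<Oplus>\<^bsub>R\<^esub>m\<in>{m. w m ~= \<zero>\<^bsub>R\<^esub>}. phi (mon R (w m) m) b)"
  by (rule A_finsum_val) (use c DLD(2)[OF phi] in blast)
 finally show ?thesis .
qed

text \<open>These are the matrix entries of phi with respect to the monomials in t. They connect
  operators on R[t] with the ideals D^e I^n of R.\<close>

lemma coeff_level: assumes phi: "phi : DL p A e" and m: "set_mset m <= {1..r}"
 shows "(\<lambda>v\<in>car R. phi (mon R v m) b) : DL p R e" proof (rule DLI)
 note D = DLD[OF phi]
 show "(\<lambda>v\<in>car R. phi (mon R v m) b) : car R \<rightarrow>\<^sub>E car R" using D(2)[OF mon_A[OF _ m]] by auto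
 fix a c assume a: "a : car R" and c: "c : car R"
 have "mon R (a \<oplus>\<^bsub>R\<^esub> c) m = mon R a m \<oplus>\<^bsub>A\<^esub> mon R c m"
  using a c by (auto simp: R.MPoly_ops R.MPS_add mon_def)
 hence "phi (mon R (a \<oplus>\<^bsub>R\<^esub> c) m) = phi (mon R a m) \<oplus>\<^bsub>A\<^esub> phi (mon R c m)"
  using D(3)[OF mon_A[OF a m] mon_A[OF c m]] by simp
 thus "(\<lambda>v\<in>car R. phi (mon R v m) b) (a \<oplus>\<^bsub>R\<^esub> c) =
   (\<lambda>v\<in>car R. phi (mon R v m) b) a \<oplus>\<^bsub>R\<^esub> (\<lambda>v\<in>car R. phi (mon R v m) b) c"
  using a c by (simp add: R.MPoly_ops R.MPS_add)
 have P: "mon R a {#} [^]\<^bsub>A\<^esub> (p ^ e) = mon R (a [^]\<^bsub>R\<^esub> (p ^ e)) {#}" using a by (simp add: R.MPoly_pow R.mon_pow)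
 have "mon R (a [^]\<^bsub>R\<^esub> (p ^ e) \<otimes>\<^bsub>R\<^esub> c) m = mon R a {#} [^]\<^bsub>A\<^esub> (p ^ e) \<otimes>\<^bsub>A\<^esub> mon R c m"
  unfolding P using a c by (simp add: R.MPoly_ops R.mon_mult_mon)
 hence "phi (mon R (a [^]\<^bsub>R\<^esub> (p ^ e) \<otimes>\<^bsub>R\<^esub> c) m) = mon R (a [^]\<^bsub>R\<^esub> (p ^ e)) {#} \<otimes>\<^bsub>A\<^esub> phi (mon R c m)"
  using D(4)[OF mon_A[OF a, of "{#}"] mon_A[OF c m]] P by simp
 moreover have "phi (mon R c m) : car (MPS R)" by (rule R.MPoly_MPS_sub[OF D(2)[OF mon_A[OF c m]]])
 ultimately have "phi (mon R (a [^]\<^bsub>R\<^esub> (p ^ e) \<otimes>\<^bsub>R\<^esub> c) m) b = a [^]\<^bsub>R\<^esub> (p ^ e) \<otimes>\<^bsub>R\<^esub> phi (mon R c m) b"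
  using a by (simp add: R.MPoly_ops R.mon_mult)
 thus "(\<lambda>v\<in>car R. phi (mon R v m) b) (a [^]\<^bsub>R\<^esub> (p ^ e) \<otimes>\<^bsub>R\<^esub> c) =
   a [^]\<^bsub>R\<^esub> (p ^ e) \<otimes>\<^bsub>R\<^esub> (\<lambda>v\<in>car R. phi (mon R v m) b) c" using a c by simp
qed

lemma wt_complement: assumes "!!i. i : {1..r} ==> n i + m i = d i" shows "F.wt n + F.wt m = F.wt d"
 using F.wt_cong[of "%i. n i + m i" d] assms by (simp add: F.wt_add)

text \<open>A count of weights. The term t^m of g^(q-1) has a coefficient of weight r (q-1) - |m|;
  its contribution at t^b, multiplied by f^(c q) with c = b div q, lies in D^e I^n for n = r (q-1) -
  |m| + |c| q. Now r (q-1) + |c| q = |b| + |x|, and the filtration forces |b| to be at least |m| +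
  k, so n is at least |x| + k.\<close>

lemma rho_Vop: assumes V: "Vop k e phi" and x: "x : Ypts p r" shows "rho e (phi (G e)) x : F.Dn p e (F.wt (tr e x) + k)" proof -
 define q where "q = p ^ e"
 have q: "q > 0" using p_pos by (simp add: q_def)
 have phi: "phi : DL p A e" using V unfolding Vop_def by blast
 note D = DLD[OF phi]
 interpret J: ideal "F.Dn p e (F.wt (tr e x) + k)" R by (rule F.Dn_ideal)
 have "phi (G e) b \<otimes>\<^bsub>R\<^esub> fR (%i. (count b i div q) * q) : F.Dn p e (F.wt (tr e x) + k)"
  if b: "b : supp_at e (phi (G e)) x" for b proof -
  define c where "c i = count b i div q" for i
  have bs: "set_mset b <= {1..r}" using b D(2)[OF G_closed] unfolding supp_at_def R.MPoly_carrier by blast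
  have bc: "count b i + tr e x i = q - 1 + c i * q" if i: "i : {1..r}" for i proof -
   have "count b i mod q = q - 1 - tr e x i" using b i unfolding supp_at_def q_def tr_def by blast
   moreover have "tr e x i < q" unfolding tr_def q_def by (rule trunc_less[OF Ypts_D[OF x i]])
   ultimately have "count b i mod q + tr e x i = q - 1" by simp
   moreover have "count b i = c i * q + count b i mod q" by (simp add: c_def)
   ultimately show ?thesis by linarith
  qed
  have szb: "size b = F.wt (count b)" using size_mset_of[of "count b"] mset_of_count[OF bs] by simp
  have e1: "size b + F.wt (tr e x) = F.wt (%i. q - 1) + F.wt c * q"
   using wt_complement[of "count b" "tr e x" "%i. (q - 1) + c i * q"] bc szb by (simp add: F.wt_add) (simp add: F.wt_def sum_distrib_right)
  have t: "phi (mon R (G e m) m) b \<otimes>\<^bsub>R\<^esub> fR (%i. c i * q) : F.Dn p e (F.wt (tr e x) + k)"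
   if m: "G e m ~= \<zero>\<^bsub>R\<^esub>" for m proof (cases "phi (mon R (G e m) m) b = \<zero>\<^bsub>R\<^esub>")
   case True thus ?thesis by simp
  next
   case False
   have ms: "set_mset m <= {1..r}" and mq: "!!i. i : {1..r} ==> count m i < q"
    and Gm: "G e m = F.mono (%i. q - 1 - count m i)" using m unfolding G_val[of e m] mono_fR q_def by (auto split: if_splits)
   have "mon R (G e m) m : Tset (size m)" unfolding Tset_def using mon_A[OF _ ms, of "G e m"] by (auto simp: mon_def split: if_splits)
   hence "phi (mon R (G e m) m) : Tset (size m + k)" using V unfolding Vop_def by blast
   hence sz: "size m + k <= size b" using False unfolding Tset_def by blast
   have szm: "size m = F.wt (count m)" using size_mset_of[of "count m"] mset_of_count[OF ms] by simp
   have e2: "F.wt (%i. q - 1 - count m i) + size m = F.wt (%i. q - 1)" unfolding szm by (rule wt_complement) (use mq in fastforce)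
   have "(\<lambda>v\<in>car R. phi (mon R v m) b) (F.mono (%i. q - 1 - count m i)) : F.Dn p e (F.wt (%i. q - 1 - count m i))"
    by (rule F.Dn_gen[OF coeff_level[OF phi ms] refl])
   hence "phi (mon R (G e m) m) b : F.Dn p e (F.wt (%i. q - 1 - count m i))" by (simp add: Gm)
   from F.Dn_mult_mono[OF this, of c]
   have "phi (mon R (G e m) m) b \<otimes>\<^bsub>R\<^esub> fR (%i. c i * q) : F.Dn p e (F.wt (%i. q - 1 - count m i) + F.wt c * q)"
    by (simp add: mono_fR q_def)
   moreover have "F.wt (tr e x) + k <= F.wt (%i. q - 1 - count m i) + F.wt c * q" using e1 e2 sz by linarith
   ultimately show ?thesis using F.Dn_antimono by blast
  qed
  have cl: "(%m. phi (mon R (G e m) m) b) : {m. G e m ~= \<zero>\<^bsub>R\<^esub>} \<rightarrow> car R" proof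
   fix m assume m: "m : {m. G e m ~= \<zero>\<^bsub>R\<^esub>}"
   hence "set_mset m <= {1..r}" using G_closed[of e] unfolding R.MPoly_carrier by blast
   thus "phi (mon R (G e m) m) b : car R" using D(2)[OF mon_A, of "G e m" m] by simp
  qed
  have fin: "finite {m. G e m ~= \<zero>\<^bsub>R\<^esub>}" using G_closed[of e] unfolding R.MPoly_carrier by blast
  have "phi (G e) b \<otimes>\<^bsub>R\<^esub> fR (%i. c i * q) =
   (\<Oplus>\<^bsub>R\<^esub>m\<in>{m. G e m ~= \<zero>\<^bsub>R\<^esub>}. phi (mon R (G e m) m) b \<otimes>\<^bsub>R\<^esub> fR (%i. c i * q))"
   unfolding coeff_sum[OF phi G_closed] by (rule R.finsum_ldistr[OF fin fR_closed cl])
  also have "... : F.Dn p e (F.wt (tr e x) + k)" by (rule J.finsum_ideal) (use t in blast)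
  finally show ?thesis by (simp add: c_def)
 qed
 thus ?thesis unfolding rho_def q_def by (intro J.finsum_ideal) blast
qed

lemma VD_sub_Sk: "VD k <= Sk k" proof
 fix U assume "U : VD k"
 then obtain e phi where V: "Vop k e phi" and U: "U = Lval e (phi (G e))" unfolding VD_iff by blast
 have c: "phi (G e) : car A" by (rule Vop_closed[OF V G_closed])
 have "Sat k e U" unfolding Sat_def proof (intro conjI ballI)
  show "loc_const p r e U" proof (rule loc_constI)
   fix x y assume x: "x : Ypts p r" and y: "y : Ypts p r" and "cong_pts r e x y"
   hence t: "!!i. i : {1..r} ==> trunc (x i) e = trunc (y i) e" by (simp add: cong_pts_def trunc_def)
   have "supp_at e (phi (G e)) x = supp_at e (phi (G e)) y" unfolding supp_at_def using t by auto
   hence "rho e (phi (G e)) x = rho e (phi (G e)) y" by (simp add: rho_def)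
   moreover have "fpw (tr e x) = fpw (tr e y)" by (rule fpw_cong) (simp add: tr_def t)
   ultimately show "U x = U y" unfolding U Lval_eq[OF c x] Lval_eq[OF c y] by (simp only:)
  qed
  fix x assume x: "x : Ypts p r"
  have "U x \<otimes> fpw (tr e x) = \<iota> (rho e (phi (G e)) x)" unfolding U Lval_eq[OF c x] using c by (simp add: fpw_cancel)
  thus "\<exists>d\<in>F.Dn p e (F.wt (tr e x) + k). U x \<otimes> fpw (tr e x) = \<iota> d" using rho_Vop[OF V x] by blast
 qed
 thus "U : Sk k" unfolding Sk_def U using Lval_closed[OF c] by blast
qed

end

context bs_setup begin

subsection \<open>\<open>S\<^sup>k\<close> is contained in \<open>V\<^sup>k \<delta>\<close>\<close>

text \<open>A matrix unit, for a with entries below q: a term v t^(a + n) with n divisible by q goes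
  to psi(v) t^(b + n), and all other terms go to 0.\<close>

definition Eop :: "nat multiset => nat multiset => nat => ('a => 'a) => (nat multiset => 'a) => (nat multiset => 'a)" where
 "Eop a b q psi = (\<lambda>w\<in>car A. %m. if b \<subseteq># m \<and> (\<forall>i. q dvd count (m - b) i) then psi (w (a + (m - b))) else \<zero>\<^bsub>R\<^esub>)"

lemma Eop_closed: assumes b: "set_mset b <= {1..r}" and psi: "psi : DL p R e" and w: "w : car A"
 shows "Eop a b q psi w : car A" proof -
 have w1: "!!m. w m : car R" "finite {m. w m ~= \<zero>\<^bsub>R\<^esub>}" "!!m. w m ~= \<zero>\<^bsub>R\<^esub> ==> set_mset m <= {1..r}"
  using w unfolding R.MPoly_carrier by blast+
 have nz: "b \<subseteq># m \<and> w (a + (m - b)) ~= \<zero>\<^bsub>R\<^esub>" if "Eop a b q psi w m ~= \<zero>\<^bsub>R\<^esub>" for m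
  using that w R.DiffOp_zero[OF psi] by (auto simp: Eop_def split: if_splits)
 have "finite {m. Eop a b q psi w m ~= \<zero>\<^bsub>R\<^esub>}"
 proof (rule inj_on_finite[of "%m. a + (m - b)" _ "{m. w m ~= \<zero>\<^bsub>R\<^esub>}"])
  show "inj_on (%m. a + (m - b)) {m. Eop a b q psi w m ~= \<zero>\<^bsub>R\<^esub>}" proof (rule inj_onI)
   fix m n assume "m : {m. Eop a b q psi w m ~= \<zero>\<^bsub>R\<^esub>}" "n : {m. Eop a b q psi w m ~= \<zero>\<^bsub>R\<^esub>}"
   hence s: "b \<subseteq># m" "b \<subseteq># n" using nz by blast+
   assume "a + (m - b) = a + (n - b)"
   hence "m - b = n - b" by simp
   thus "m = n" using s by (metis subset_mset.diff_add)
  qed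
 qed (use nz w1(2) in blast)+
 moreover have "set_mset m <= {1..r}" if "Eop a b q psi w m ~= \<zero>\<^bsub>R\<^esub>" for m proof -
  have "m = b + (m - b)" using nz[OF that] by simp
  hence "set_mset m <= set_mset b \<union> set_mset (m - b)" by (metis set_mset_union order_refl)
  moreover have "set_mset (a + (m - b)) <= {1..r}" using w1(3) nz[OF that] by blast
  hence "set_mset (m - b) <= {1..r}" unfolding set_mset_union by blast
  ultimately show ?thesis using b by blast
 qed
 moreover have "Eop a b q psi w m : car R" for m using w w1(1) DLD(2)[OF psi] by (simp add: Eop_def)
 ultimately show ?thesis unfolding R.MPoly_carrier by blast
qed

text \<open>The entries of s and n are multiples of q, and adding something below q to n does not
  reach the next multiple.\<close>

lemma mset_shift_iff: assumes q: "q > 0" and a: "!!i. count a i < q" and s: "!!i. q dvd count s i" and n: "!!i. q dvd count n i"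
 shows "s \<subseteq># a + n \<longleftrightarrow> s \<subseteq># n" proof -
 have "count s i <= count a i + count n i \<longleftrightarrow> count s i <= count n i" for i proof -
  obtain s' n' where sn: "count s i = q * s'" "count n i = q * n'" using s[of i] n[of i] by (auto elim!: dvdE)
  have "s' <= n'" if "q * s' <= count a i + q * n'" proof -
   have "q * s' < q * n' + q" using that a[of i] by linarith
   also have "... = q * Suc n'" by simp
   finally have "s' < Suc n'" by (simp only: mult_less_cancel1) thus ?thesis by simp
  qed
  moreover have "q * s' <= count a i + q * n'" if "s' <= n'" using mult_le_mono2[OF that, of q] by linarith
  ultimately show ?thesis unfolding sn using q by auto
 qed
 thus ?thesis by (simp add: subseteq_mset_def)
qed

text \<open>A factor k^q t^s with q dividing s preserves the residue classes that \<open>Eop\<close>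
  selects. The bound on a excludes that t^s divides t^(a + n) without dividing t^n.\<close>

lemma Eop_level: assumes b: "set_mset b <= {1..r}" and a: "!!i. count a i < p ^ e" and psi: "psi : DL p R e"
 shows "Eop a b (p ^ e) psi : DL p A e" proof (rule DiffOp_levelI_mon)
 note D = DLD[OF psi]
 show "Eop a b (p ^ e) psi : car A \<rightarrow>\<^sub>E car A" using Eop_closed[OF b psi] by (auto simp: Eop_def)
 show "Eop a b (p ^ e) psi (v \<oplus>\<^bsub>A\<^esub> w) = Eop a b (p ^ e) psi v \<oplus>\<^bsub>A\<^esub> Eop a b (p ^ e) psi w"
  if v: "v : car A" and w: "w : car A" for v w proof (rule HOL.ext)
  fix m
  have "v \<oplus>\<^bsub>A\<^esub> w : car A" using v w by simp
  thus "Eop a b (p ^ e) psi (v \<oplus>\<^bsub>A\<^esub> w) m = (Eop a b (p ^ e) psi v \<oplus>\<^bsub>A\<^esub> Eop a b (p ^ e) psi w) m"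
   using v w D(3) by (simp add: Eop_def R.MPoly_ops R.MPS_add)
 qed
 fix k s w assume k: "k : car R" and s: "set_mset s <= {1..r}" and sd: "!!i. p ^ e dvd count s i" and w: "w : car A"
 have kp: "k [^]\<^bsub>R\<^esub> (p ^ e) : car R" using k by simp
 define K where "K = k [^]\<^bsub>R\<^esub> (p ^ e)"
 have mc: "mon R K s \<otimes>\<^bsub>A\<^esub> w : car A" using kp s w by (simp add: K_def)
 have val: "(mon R K s \<otimes>\<^bsub>A\<^esub> v) m = (if s \<subseteq># m then K \<otimes>\<^bsub>R\<^esub> v (m - s) else \<zero>\<^bsub>R\<^esub>)" if "v : car A" for v m
  unfolding R.MPoly_ops by (rule R.mon_mult) (use kp R.MPoly_MPS_sub[OF that] in \<open>simp_all add: K_def\<close>)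
 show "Eop a b (p ^ e) psi (mon R (k [^]\<^bsub>R\<^esub> (p ^ e)) s \<otimes>\<^bsub>A\<^esub> w) = mon R (k [^]\<^bsub>R\<^esub> (p ^ e)) s \<otimes>\<^bsub>A\<^esub> Eop a b (p ^ e) psi w"
  unfolding K_def[symmetric] proof (rule HOL.ext)
  fix m
  let ?C = "%m. b \<subseteq># m \<and> (\<forall>i. p ^ e dvd count (m - b) i)"
  have L: "Eop a b (p ^ e) psi (mon R K s \<otimes>\<^bsub>A\<^esub> w) m =
   (if ?C m then psi (if s \<subseteq># a + (m - b) then K \<otimes>\<^bsub>R\<^esub> w (a + (m - b) - s) else \<zero>\<^bsub>R\<^esub>) else \<zero>\<^bsub>R\<^esub>)"
   unfolding Eop_def restrict_apply'[OF mc] val[OF w] ..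
  have Rt: "(mon R K s \<otimes>\<^bsub>A\<^esub> Eop a b (p ^ e) psi w) m =
   (if s \<subseteq># m then K \<otimes>\<^bsub>R\<^esub> (if ?C (m - s) then psi (w (a + (m - s - b))) else \<zero>\<^bsub>R\<^esub>) else \<zero>\<^bsub>R\<^esub>)"
   unfolding val[OF Eop_closed[OF b psi w]] unfolding Eop_def restrict_apply'[OF w] ..
  show "Eop a b (p ^ e) psi (mon R K s \<otimes>\<^bsub>A\<^esub> w) m = (mon R K s \<otimes>\<^bsub>A\<^esub> Eop a b (p ^ e) psi w) m"
  proof (cases "?C m \<and> s \<subseteq># m - b")
   case True
   have m: "m = s + (m - b - s) + b" using True by (metis subset_mset.add_diff_inverse subset_mset.diff_add)
   define n where "n = m - b - s"
   have mn: "m = s + n + b" using m by (simp add: n_def)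
   have "!!i. p ^ e dvd count n i"  proof -
    fix i
    have "p ^ e dvd count (m - b) i" using True by blast
    thus "p ^ e dvd count n i" using sd[of i] by (simp add: mn dvd_add_right_iff)
   qed
   hence C: "?C (m - s)" by (simp add: mn)
   have "s \<subseteq># m" by (simp add: mn)
   moreover have "s \<subseteq># a + (m - b)" by (simp add: mn)
   moreover have "a + (m - b) - s = a + n" "m - s - b = n" by (simp_all add: mn)
   moreover have "w (a + n) : car R" using w by simp
   ultimately show ?thesis unfolding L Rt using True C D(4)[OF k] by (simp add: K_def)
  next
   case False
   have "Eop a b (p ^ e) psi (mon R K s \<otimes>\<^bsub>A\<^esub> w) m = \<zero>\<^bsub>R\<^esub>" proof (cases "?C m")
    case True
    have "s \<subseteq># a + (m - b) \<longleftrightarrow> s \<subseteq># m - b"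
     by (rule mset_shift_iff[where q = "p ^ e"]) (use p_pos a sd True in auto)
    hence "\<not> s \<subseteq># a + (m - b)" using False True by blast
    thus ?thesis unfolding L by (simp only: if_False R.DiffOp_zero[OF psi] if_cancel)
   next
    case False
    show ?thesis unfolding L if_not_P[OF False] ..
   qed
   moreover have "\<not> (s \<subseteq># m \<and> ?C (m - s))" proof
    assume c: "s \<subseteq># m \<and> ?C (m - s)"
    define n where "n = m - s - b"
    have mn: "m = s + (n + b)" using c by (metis n_def subset_mset.add_diff_inverse subset_mset.diff_add)
    have "?C m" using c sd by (auto simp: mn)
    moreover have "s \<subseteq># m - b" by (simp add: mn)
    ultimately show False using False by blast
   qed
   hence "(mon R K s \<otimes>\<^bsub>A\<^esub> Eop a b (p ^ e) psi w) m = \<zero>\<^bsub>R\<^esub>" unfolding Rt using kp by (auto simp: K_def)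
   ultimately show ?thesis by simp
  qed
 qed
qed

lemma Eop_Vop: assumes b: "set_mset b <= {1..r}" and a: "!!i. count a i < p ^ e" and psi: "psi : DL p R e"
  and sz: "size a + k <= size b" shows "Vop k e (Eop a b (p ^ e) psi)" unfolding Vop_def proof (intro conjI allI subsetI)
 show "Eop a b (p ^ e) psi : DL p A e" by (rule Eop_level[OF b a psi])
 fix n y assume "y : Eop a b (p ^ e) psi ` Tset n"
 then obtain w where w: "w : Tset n" and y: "y = Eop a b (p ^ e) psi w" by blast
 have wc: "w : car A" using w unfolding Tset_def by blast
 have "n + k <= size m" if "y m ~= \<zero>\<^bsub>R\<^esub>" for m proof -
  have nz: "b \<subseteq># m" "w (a + (m - b)) ~= \<zero>\<^bsub>R\<^esub>"
   using that wc R.DiffOp_zero[OF psi] unfolding y by (auto simp: Eop_def split: if_splits)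
  have "n <= size (a + (m - b))" using w nz(2) unfolding Tset_def by blast
  hence "n <= size a + size (m - b)" by (simp only: size_union)
  moreover have "size m = size b + size (m - b)" using nz(1) by (metis size_union subset_mset.add_diff_inverse)
  ultimately show ?thesis using sz by simp
 qed
 thus "y : Tset (n + k)" unfolding Tset_def y using Eop_closed[OF b psi wc] by blast
qed

text \<open>All exponents of g^(q-1) are below q, so among the exponents a + n with n divisible by q
  only n = 0 contributes.\<close>

lemma Eop_G: assumes b: "set_mset b <= {1..r}" and psi: "psi : DL p R e"
 shows "Eop a b (p ^ e) psi (G e) = mon R (psi (G e a)) b" proof (rule HOL.ext)
 fix m
 show "Eop a b (p ^ e) psi (G e) m = mon R (psi (G e a)) b m" proof (cases "m = b")
  case True thus ?thesis by (simp add: Eop_def mon_def)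
 next
  case False
  have "psi (G e (a + (m - b))) = \<zero>\<^bsub>R\<^esub>" if c: "b \<subseteq># m" "\<forall>i. p ^ e dvd count (m - b) i" proof -
   have "m - b ~= {#}" using False c(1) by (metis add.right_neutral subset_mset.add_diff_inverse)
   then obtain i where i: "i \<in># m - b" by blast
   hence "count (m - b) i > 0" by (simp only: count_greater_zero_iff)
   hence "p ^ e <= count (m - b) i" using c(2) dvd_imp_le by blast
   hence "p ^ e <= count (a + (m - b)) i" "i \<in># a + (m - b)" using i by auto
   hence "G e (a + (m - b)) = \<zero>\<^bsub>R\<^esub>" unfolding G_val by (meson leD subsetD)
   thus ?thesis by (simp add: R.DiffOp_zero[OF psi])
  qed
  thus ?thesis using False by (simp add: Eop_def mon_def)
 qed
qed

text \<open>The division by f^c matches the factor f^x in \<open>Sat\<close>, so that on the residue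
  class c the condition becomes one on v.\<close>

definition ind :: "nat => (nat => nat) => 'b => ((nat => nat => int) => 'b)" where
 "ind e c v = (\<lambda>x\<in>Ypts p r. if \<forall>i\<in>{1..r}. tr e x i = c i then v \<otimes> inv (fpw c) else \<zero>)"

lemma tr_cong: "cong_pts r e x y ==> i : {1..r} ==> tr e x i = tr e y i" by (simp add: cong_pts_def tr_def trunc_def)

lemma ind_closed: "v : car B ==> ind e c v : car CB"
 by (rule CF_I[OF p_pos, of _ _ _ e]) (auto simp: ind_def tr_cong intro!: loc_constI)

lemma ind_add: "v : car B ==> w : car B ==> ind e c (v \<oplus> w) = ind e c v \<oplus>\<^bsub>CB\<^esub> ind e c w"
 by (auto simp: ind_def Cfun_ops l_distr fun_eq_iff)

lemma ind_zero: "ind e c \<zero> = \<zero>\<^bsub>CB\<^esub>" by (auto simp: ind_def Cfun_ops fun_eq_iff)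

lemma rho_mon: assumes v: "v : car R" and x: "x : Ypts p r"
 shows "rho e (mon R v b) x = (if \<forall>i\<in>{1..r}. count b i mod p ^ e = p ^ e - 1 - tr e x i
  then v \<otimes>\<^bsub>R\<^esub> fR (%i. (count b i div p ^ e) * p ^ e) else \<zero>\<^bsub>R\<^esub>)"
proof (cases "v ~= \<zero>\<^bsub>R\<^esub> \<and> (\<forall>i\<in>{1..r}. count b i mod p ^ e = p ^ e - 1 - tr e x i)")
 case True
 hence "supp_at e (mon R v b) x = {b}" by (auto simp: supp_at_def mon_def tr_def) thus ?thesis using True v by (simp add: rho_def mon_def)
next
 case False
 hence "supp_at e (mon R v b) x = {}" by (auto simp: supp_at_def mon_def tr_def) thus ?thesis using False by (auto simp: rho_def)
qed

lemma fR_mono_add: "fR (%i. n i + m i) = fR n \<otimes>\<^bsub>R\<^esub> fR m" using F.mono_add by (simp add: mono_fR)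

text \<open>A matrix unit is applied to g^(q-1). The choice a_i = q - 1 - (c_i mod q) makes the
  coefficient at t^a equal to f^(c mod q). The choice b_i = q - 1 - d_i + q (c_i div q) selects the
  residue class d and supplies the missing factor f^(q (c div q)). Then |b| - |a| = |c| - |d| = k,
  so the operator lies in V^k.\<close>

lemma ind_gen_VD:
 assumes psi: "psi : DL p R e" and wc: "F.wt c = F.wt d + k" and d: "!!i. i : {1..r} ==> d i < p ^ e"
 shows "ind e d (\<iota> (psi (F.mono c))) : VD k" proof -
 define q where "q = p ^ e"
 have q: "q > 0" using p_pos by (simp add: q_def)
 note dq = d[folded q_def]
 define a where "a = mset_of (%i. q - 1 - c i mod q)"
 define b where "b = mset_of (%i. (q - 1 - d i) + (c i div q) * q)"
 have as: "set_mset a <= {1..r}" and bs: "set_mset b <= {1..r}" unfolding a_def b_def by (rule set_mset_of)+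
 have ac: "count a i < q" for i using q by (simp add: a_def count_mset_of)
 have "F.wt (%i. q - 1 - c i mod q) + F.wt c = F.wt (%i. (q - 1) + (c i div q) * q)" proof (rule wt_complement)
  fix i
  have "c i mod q < q" "c i = (c i div q) * q + c i mod q" using q by simp_all
  thus "q - 1 - c i mod q + c i = q - 1 + (c i div q) * q" by linarith
 qed
 moreover have "F.wt (%i. (q - 1 - d i) + (c i div q) * q) + F.wt d = F.wt (%i. (q - 1) + (c i div q) * q)"
  by (rule wt_complement) (use dq in fastforce)
 ultimately have sz: "size a + k <= size b" using wc by (simp add: a_def b_def size_mset_of)
 have V: "Vop k e (Eop a b (p ^ e) psi)" by (rule Eop_Vop[OF bs _ psi sz]) (use ac in \<open>simp add: q_def\<close>)
 have Ga: "G e a = fR (%i. c i mod q)" proof -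
  have "fR (%i. q - 1 - count a i) = fR (%i. c i mod q)" unfolding mono_fR[symmetric] proof (rule F.mono_cong)
   fix i assume i: "i : {1..r}"
   have "c i mod q <= q - 1" using q mod_less_divisor[of q "c i"] by linarith
   thus "q - 1 - count a i = c i mod q" using i by (simp add: a_def count_mset_of)
  qed
  thus ?thesis unfolding G_val using as ac by (simp add: q_def)
 qed
 define v where "v = psi (G e a)"
 have v: "v : car R" unfolding v_def by (rule DLD(2)[OF psi]) simp
 have vm: "v \<otimes>\<^bsub>R\<^esub> fR (%i. (c i div q) * q) = psi (F.mono c)" proof -
  have P: "fR (%i. (c i div q) * q) = fR (%i. c i div q) [^]\<^bsub>R\<^esub> (p ^ e)" unfolding fR_mult q_def ..
  have "F.mono c = fR (%i. (c i div q) * q + c i mod q)" unfolding mono_fR by simp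
  also have "... = fR (%i. c i div q) [^]\<^bsub>R\<^esub> (p ^ e) \<otimes>\<^bsub>R\<^esub> G e a" unfolding fR_mono_add P Ga ..
  also have "psi ... = fR (%i. c i div q) [^]\<^bsub>R\<^esub> (p ^ e) \<otimes>\<^bsub>R\<^esub> v"
   unfolding v_def by (rule DLD(4)[OF psi]) simp_all
  finally show ?thesis unfolding P using v by (simp add: R.m_comm)
 qed
 have cb: "count b i mod q = q - 1 - d i" "count b i div q = c i div q" if "i : {1..r}" for i proof -
  have aux: "(y + l * q) mod q = y \<and> (y + l * q) div q = l" if "y < q" for y l using that by simp
  have "count b i = (q - 1 - d i) + (c i div q) * q" using that by (simp add: b_def count_mset_of)
  thus "count b i mod q = q - 1 - d i" "count b i div q = c i div q" using aux[of "q - 1 - d i" "c i div q"] q by simp_all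
 qed
 have mc: "mon R v b : car A" by (rule mon_A[OF v bs])
 have "Lval e (Eop a b (p ^ e) psi (G e)) = ind e d (\<iota> (psi (F.mono c)))" unfolding Eop_G[OF bs psi] v_def[symmetric]
 proof (rule Cfun_ext)
  show "Lval e (mon R v b) : car CB" by (rule Lval_closed[OF mc])
  have pc: "psi (F.mono c) : car R" by (rule DLD(2)[OF psi]) simp
  thus "ind e d (\<iota> (psi (F.mono c))) : car CB" by (intro ind_closed) simp
  fix x assume x: "x : Ypts p r"
  have t: "tr e x i < q" if "i : {1..r}" for i unfolding tr_def q_def by (rule trunc_less[OF Ypts_D[OF x that]])
  have iff: "(\<forall>i\<in>{1..r}. count b i mod q = q - 1 - tr e x i) \<longleftrightarrow> (\<forall>i\<in>{1..r}. tr e x i = d i)"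
  proof (rule ball_cong[OF refl])
   fix i assume i: "i : {1..r}"
   show "(count b i mod q = q - 1 - tr e x i) = (tr e x i = d i)" using cb(1)[OF i] t[OF i] dq[OF i] by auto
  qed
  have fe: "fR (%i. (count b i div q) * q) = fR (%i. (c i div q) * q)"
   unfolding mono_fR[symmetric] by (rule F.mono_cong) (use cb in simp)
  show "Lval e (mon R v b) x = ind e d (\<iota> (psi (F.mono c))) x" proof (cases "\<forall>i\<in>{1..r}. tr e x i = d i")
   case True
   hence "fpw (tr e x) = fpw d" by (intro fpw_cong) blast thus ?thesis
    unfolding Lval_eq[OF mc x] rho_mon[OF v x] ind_def restrict_apply'[OF x] q_def[symmetric] iff fe vm using True by simp
  next
   case False thus ?thesis
    unfolding Lval_eq[OF mc x] rho_mon[OF v x] ind_def restrict_apply'[OF x] q_def[symmetric] iff if_not_P[OF False] by simp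
  qed
 qed
 thus ?thesis unfolding VD_iff using V by metis
qed

lemma ind_mem:
 assumes H: "\<zero>\<^bsub>CB\<^esub> : H" "!!U V. U : H ==> V : H ==> U \<oplus>\<^bsub>CB\<^esub> V : H"
  and gen: "!!psi n. psi : DL p R e ==> F.wt n = F.wt c + k ==> ind e c (\<iota> (psi (F.mono n))) : H"
  and d: "d : F.Dn p e (F.wt c + k)" shows "ind e c (\<iota> d) : H" using d proof (induction rule: F.Dn_induct)
 case zero thus ?case using H(1) by (simp add: ind_zero)
next
 case (gen phi n) thus ?case by (rule assms(3))
next
 case (add x y)
 have "ind e c (\<iota> (x \<oplus>\<^bsub>R\<^esub> y)) = ind e c (\<iota> x) \<oplus>\<^bsub>CB\<^esub> ind e c (\<iota> y)"
  using F.Dn_closed[OF add(1)] F.Dn_closed[OF add(2)] by (simp add: ind_add)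
 thus ?case using H(2)[OF add(3,4)] by simp
qed

definition ptn :: "(nat => nat) => (nat => nat => int)" where
 "ptn c = (\<lambda>i\<in>{1..r}. Zp_of_int p (int (c i)))"

lemma ptn_Ypts: "ptn c : Ypts p r" by (auto simp: topspace_Zp_space ptn_def Zp_of_int_carrier[OF p_pos])

lemma tr_ptn: "i : {1..r} ==> tr e (ptn c) i = c i mod p ^ e" by (simp add: tr_def ptn_def trunc_Zp_of_int)

lemma tr_cong_pts: assumes "x : Ypts p r" "y : Ypts p r" "!!i. i : {1..r} ==> tr e x i = tr e y i"
 shows "cong_pts r e x y" unfolding cong_pts_def using assms trunc_eq_iff[OF Ypts_D Ypts_D] unfolding tr_def by blast

text \<open>An element of S^k is the finite sum of its restrictions to residue classes, and each
  restriction is a sum of functions \<open>ind\<close> at generators psi(f^n) of D^e I^(|c| + k).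
  The criterion serves for V^k delta and for the span of the elements Bd.\<close>

lemma Sk_least:
 assumes H: "H <= car CB" "\<zero>\<^bsub>CB\<^esub> : H" "!!U V. U : H ==> V : H ==> U \<oplus>\<^bsub>CB\<^esub> V : H"
  and gen: "!!e psi n c. psi : DL p R e ==> F.wt n = F.wt c + k ==>
   (!!i. i : {1..r} ==> c i < p ^ e) ==> ind e c (\<iota> (psi (F.mono n))) : H"
 shows "Sk k <= H" proof
 fix U assume "U : Sk k"
 then obtain e where U: "U : car CB" and s: "Sat k e U" unfolding Sk_def by blast
 define q where "q = p ^ e"
 have q: "q > 0" using p_pos by (simp add: q_def)
 have lc: "loc_const p r e U" using s unfolding Sat_def by blast
 define Q where "Q c d \<longleftrightarrow> d : F.Dn p e (F.wt c + k) \<and> U (ptn c) \<otimes> fpw c = \<iota> d" for c d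
 have Qex: "\<exists>d. Q c d" if c: "!!i. i : {1..r} ==> c i < q" for c proof -
  obtain d where d: "d : F.Dn p e (F.wt (tr e (ptn c)) + k)" "U (ptn c) \<otimes> fpw (tr e (ptn c)) = \<iota> d"
   using s ptn_Ypts unfolding Sat_def by blast
  have "tr e (ptn c) i = c i" if "i : {1..r}" for i using c[OF that] that by (simp add: tr_ptn q_def)
  hence "F.wt (tr e (ptn c)) = F.wt c" "fpw (tr e (ptn c)) = fpw c" using F.wt_cong fpw_cong by blast+
  thus ?thesis using d unfolding Q_def by auto
 qed
 define D where "D c = (SOME d. Q c d)" for c
 define C where "C = {1..r} \<rightarrow>\<^sub>E {..<q}"
 have fC: "finite C" unfolding C_def by (intro finite_PiE) auto
 have Cq: "c i < q" if "c : C" "i : {1..r}" for c i using that unfolding C_def by blast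
 have DQ: "Q c (D c)" if "c : C" for c unfolding D_def by (rule someI_ex[OF Qex]) (use Cq[OF that] in blast)
 have iV: "ind e c (\<iota> (D c)) : H" if "c : C" for c proof (rule ind_mem[OF H(2,3)])
  show "D c : F.Dn p e (F.wt c + k)" using DQ[OF that] unfolding Q_def by blast
  show "ind e c (\<iota> (psi (F.mono n))) : H" if "psi : DL p R e" "F.wt n = F.wt c + k" for psi n
   by (rule gen[OF that]) (use Cq[OF \<open>c : C\<close>] in \<open>simp add: q_def\<close>)
 qed
 interpret CB: ring CB by (rule ring_CB)
 have sumV: "(\<Oplus>\<^bsub>CB\<^esub>c\<in>C. ind e c (\<iota> (D c))) : H" by (rule CB.finsum_mem[OF H]) (use iV in auto)
 have "U = (\<Oplus>\<^bsub>CB\<^esub>c\<in>C. ind e c (\<iota> (D c)))" proof (rule Cfun_ext[OF U])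
  show "(\<Oplus>\<^bsub>CB\<^esub>c\<in>C. ind e c (\<iota> (D c))) : car CB" using sumV H(1) by blast
  fix x assume x: "x : Ypts p r"
  define c0 where "c0 = restrict (tr e x) {1..r}"
  have c0: "c0 : C" unfolding c0_def C_def q_def tr_def using trunc_less[OF Ypts_D[OF x]] by auto
  have c0i: "i : {1..r} ==> tr e x i = c0 i" for i by (simp add: c0_def)
  have eqc: "(\<forall>i\<in>{1..r}. tr e x i = c i) \<longleftrightarrow> c0 = c" if "c : C" for c proof
   assume "\<forall>i\<in>{1..r}. tr e x i = c i"
   thus "c0 = c" using c0 that unfolding C_def by (intro PiE_ext[of c0 "{1..r}" _ c]) (auto simp: c0_def)
  qed (use c0i in blast)
  have Dc: "D c : car R" if "c : C" for c using DQ[OF that] F.Dn_closed unfolding Q_def by blast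
  have "(\<Oplus>\<^bsub>CB\<^esub>c\<in>C. ind e c (\<iota> (D c))) x = (\<Oplus>c\<in>C. ind e c (\<iota> (D c)) x)"
   by (rule CF_finsum[OF ring_axioms p_pos _ x]) (use Dc ind_closed in auto)
  also have "... = (\<Oplus>c\<in>C. if c0 = c then \<iota> (D c) \<otimes> inv (fpw c) else \<zero>)"
   by (rule finsum_cong') (use Dc eqc x in \<open>auto simp: ind_def\<close>)
  also have "... = \<iota> (D c0) \<otimes> inv (fpw c0)" by (rule finsum_singleton[OF c0 fC]) (use Dc in auto)
  also have "\<iota> (D c0) = U (ptn c0) \<otimes> fpw c0" using DQ[OF c0] unfolding Q_def by simp
  also have "U (ptn c0) = U x" proof (rule loc_constD[OF lc ptn_Ypts x tr_cong_pts[OF ptn_Ypts x]])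
   fix i assume i: "i : {1..r}"
   show "tr e (ptn c0) i = tr e x i" using c0i[OF i] Cq[OF c0 i] i by (simp add: tr_ptn q_def)
  qed
  also have "U x \<otimes> fpw c0 \<otimes> inv (fpw c0) = U x" by (rule fpw_cancel(1)[OF Cfun_val[OF U x]])
  finally show "U x = (\<Oplus>\<^bsub>CB\<^esub>c\<in>C. ind e c (\<iota> (D c))) x" by simp
 qed
 thus "U : H" using sumV by simp
qed

lemma Sk_sub_VD: "Sk k <= VD k" proof (rule Sk_least[OF VD_carrier VD_zero])
 show "!!U V. U : VD k ==> V : VD k ==> U \<oplus>\<^bsub>CB\<^esub> V : VD k" by (rule VD_add)
 fix e psi and n c :: "nat => nat"
 assume "psi : DL p R e" "F.wt n = F.wt c + k" "!!i. i : {1..r} ==> c i < p ^ e"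
 thus "ind e c (\<iota> (psi (F.mono n))) : VD k" by (rule ind_gen_VD)
qed

theorem LamH_V_delta: "LamH ` VR (int k) = Sk k" using VD_sub_Sk Sk_sub_VD unfolding VD_def by blast

end

section \<open>The generators \<open>Bd\<^sup>[\<^sup>\<alpha>\<^sup>] f\<^sup>[\<^sup>\<alpha>\<^sup>] f\<^sup>s\<close>\<close>

text \<open>The coefficients are padded with zeros to the union of the two index sets.\<close>

lemma (in left_module) cyclic_sum_add:
 assumes v: "v : J \<rightarrow> car M" and x: "x : cyclic_sum T M v J" and y: "y : cyclic_sum T M v J"
 shows "x \<oplus>\<^bsub>M\<^esub> y : cyclic_sum T M v J" proof -
 obtain C c where C: "finite C" "C <= J" "c : C \<rightarrow> car T" "x = (\<Oplus>\<^bsub>M\<^esub>j\<in>C. c j \<odot>\<^bsub>M\<^esub> v j)"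
  using x unfolding cyclic_sum_def by blast
 obtain D d where D: "finite D" "D <= J" "d : D \<rightarrow> car T" "y = (\<Oplus>\<^bsub>M\<^esub>j\<in>D. d j \<odot>\<^bsub>M\<^esub> v j)"
  using y unfolding cyclic_sum_def by blast
 have ext: "(\<Oplus>\<^bsub>M\<^esub>j\<in>E. h j \<odot>\<^bsub>M\<^esub> v j) = (\<Oplus>\<^bsub>M\<^esub>j\<in>C \<union> D. (if j : E then h j else \<zero>\<^bsub>T\<^esub>) \<odot>\<^bsub>M\<^esub> v j)"
  if "E <= C \<union> D" "h : E \<rightarrow> car T" for E h by (rule M.add.finprod_mono_neutral_cong_left)
   (use that C(1,2) D(1,2) v in \<open>auto simp: Pi_iff subset_iff intro!: smult_closed\<close>)
 let ?c = "%j. if j : C then c j else \<zero>\<^bsub>T\<^esub>" and ?d = "%j. if j : D then d j else \<zero>\<^bsub>T\<^esub>"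
 have c1: "?c j : car T" "?d j : car T" for j using C(3) D(3) by auto
 have vJ: "v j : car M" if "j : C \<union> D" for j using that v C(2) D(2) by auto
 have "x \<oplus>\<^bsub>M\<^esub> y = (\<Oplus>\<^bsub>M\<^esub>j\<in>C \<union> D. ?c j \<odot>\<^bsub>M\<^esub> v j) \<oplus>\<^bsub>M\<^esub> (\<Oplus>\<^bsub>M\<^esub>j\<in>C \<union> D. ?d j \<odot>\<^bsub>M\<^esub> v j)"
  unfolding C(4) D(4) using ext[of C c] ext[of D d] C(3) D(3) by simp
 also have "... = (\<Oplus>\<^bsub>M\<^esub>j\<in>C \<union> D. ?c j \<odot>\<^bsub>M\<^esub> v j \<oplus>\<^bsub>M\<^esub> ?d j \<odot>\<^bsub>M\<^esub> v j)"
  by (rule M.finsum_addf[symmetric]) (use c1 vJ smult_closed in blast)+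
 also have "... = (\<Oplus>\<^bsub>M\<^esub>j\<in>C \<union> D. (?c j \<oplus>\<^bsub>T\<^esub> ?d j) \<odot>\<^bsub>M\<^esub> v j)"
 proof (rule M.finsum_cong'[OF refl])
  show "(%j. (?c j \<oplus>\<^bsub>T\<^esub> ?d j) \<odot>\<^bsub>M\<^esub> v j) : C \<union> D \<rightarrow> car M"
   using c1 vJ smult_closed T.a_closed by blast
  show "?c j \<odot>\<^bsub>M\<^esub> v j \<oplus>\<^bsub>M\<^esub> ?d j \<odot>\<^bsub>M\<^esub> v j = (?c j \<oplus>\<^bsub>T\<^esub> ?d j) \<odot>\<^bsub>M\<^esub> v j" if "j : C \<union> D" for j
   by (rule smult_l_distr[OF c1 vJ[OF that], symmetric])
 qed
 finally have "x \<oplus>\<^bsub>M\<^esub> y = (\<Oplus>\<^bsub>M\<^esub>j\<in>C \<union> D. (?c j \<oplus>\<^bsub>T\<^esub> ?d j) \<odot>\<^bsub>M\<^esub> v j)" .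
 moreover have "(%j. ?c j \<oplus>\<^bsub>T\<^esub> ?d j) : C \<union> D \<rightarrow> car T" using c1 T.a_closed by blast
 ultimately show ?thesis unfolding cyclic_sum_def using C(1,2) D(1,2)
  by (intro CollectI exI[of _ "C \<union> D"] exI[of _ "%j. ?c j \<oplus>\<^bsub>T\<^esub> ?d j"]) auto
qed

lemma (in left_module) cyclic_sum_zero: "\<zero>\<^bsub>M\<^esub> : cyclic_sum T M v J"
 unfolding cyclic_sum_def by (intro CollectI exI[of _ "{}"] exI[of _ "%_. \<zero>\<^bsub>T\<^esub>"]) auto

lemma (in left_module) cyclic_sum_gen: assumes "j : J" "v j : car M" "a : car T"
 shows "a \<odot>\<^bsub>M\<^esub> v j : cyclic_sum T M v J" unfolding cyclic_sum_def
 by (intro CollectI exI[of _ "{j}"] exI[of _ "%_. a"]) (use assms in \<open>auto simp: smult_closed\<close>)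

lemma (in left_module) cyclic_sum_least: assumes H: "submodule H T M" and v: "v : J \<rightarrow> H"
 shows "cyclic_sum T M v J <= H" proof
 interpret H: submodule H T M by (rule H)
 fix x assume "x : cyclic_sum T M v J"
 then obtain C c where C: "finite C" "C <= J" "c : C \<rightarrow> car T" "x = (\<Oplus>\<^bsub>M\<^esub>j\<in>C. c j \<odot>\<^bsub>M\<^esub> v j)"
  unfolding cyclic_sum_def by blast
 have Hc: "H <= car M" using H.subset by simp
 have H0: "\<zero>\<^bsub>M\<^esub> : H" using H.one_closed by simp
 have Hp: "!!x y. x : H ==> y : H ==> x \<oplus>\<^bsub>M\<^esub> y : H" using H.m_closed by simp
 have "c j \<odot>\<^bsub>M\<^esub> v j : H" if "j : C" for j using C(2,3) v that H.smult_closed by (auto simp: Pi_iff subset_iff)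
 thus "x : H" unfolding C(4) by (intro M.finsum_mem[OF Hc H0 Hp]) auto
qed

text \<open>This is the form in which \<open>BS_functional_eq\<close> expresses membership: a
  coefficient for every index, finitely many of them nonzero.\<close>

lemma (in left_module) cyclic_sum_iff: assumes v: "v : J \<rightarrow> car M" shows "x : cyclic_sum T M v J \<longleftrightarrow>
  (\<exists>P\<in>J \<rightarrow> car T. finite {j : J. P j ~= \<zero>\<^bsub>T\<^esub>} \<and> x = (\<Oplus>\<^bsub>M\<^esub>j\<in>{j : J. P j ~= \<zero>\<^bsub>T\<^esub>}. P j \<odot>\<^bsub>M\<^esub> v j))"
proof
 assume "x : cyclic_sum T M v J"
 then obtain C c where C: "finite C" "C <= J" "c : C \<rightarrow> car T" "x = (\<Oplus>\<^bsub>M\<^esub>j\<in>C. c j \<odot>\<^bsub>M\<^esub> v j)"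
  unfolding cyclic_sum_def by blast
 define P where "P j = (if j : C then c j else \<zero>\<^bsub>T\<^esub>)" for j
 have P: "P : J \<rightarrow> car T" using C(3) by (auto simp: P_def)
 have sub: "{j : J. P j ~= \<zero>\<^bsub>T\<^esub>} <= C" by (auto simp: P_def)
 have "(\<Oplus>\<^bsub>M\<^esub>j\<in>{j : J. P j ~= \<zero>\<^bsub>T\<^esub>}. P j \<odot>\<^bsub>M\<^esub> v j) = (\<Oplus>\<^bsub>M\<^esub>j\<in>C. c j \<odot>\<^bsub>M\<^esub> v j)"
 proof (rule M.add.finprod_mono_neutral_cong_left[OF C(1) sub])
  fix j assume "j : C - {j : J. P j ~= \<zero>\<^bsub>T\<^esub>}"
  hence "c j = \<zero>\<^bsub>T\<^esub>" "v j : car M" using C(2) v by (auto simp: P_def)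
  thus "c j \<odot>\<^bsub>M\<^esub> v j = \<zero>\<^bsub>M\<^esub>" by simp
 next
  show "(%j. c j \<odot>\<^bsub>M\<^esub> v j) : C \<rightarrow> car M" using C(2,3) v smult_closed by blast
 qed (auto simp: P_def split: if_splits)
 thus "\<exists>P\<in>J \<rightarrow> car T. finite {j : J. P j ~= \<zero>\<^bsub>T\<^esub>} \<and> x = (\<Oplus>\<^bsub>M\<^esub>j\<in>{j : J. P j ~= \<zero>\<^bsub>T\<^esub>}. P j \<odot>\<^bsub>M\<^esub> v j)"
  using P finite_subset[OF sub C(1)] C(4) by (intro bexI[of _ P]) auto
next
 assume "\<exists>P\<in>J \<rightarrow> car T. finite {j : J. P j ~= \<zero>\<^bsub>T\<^esub>} \<and> x = (\<Oplus>\<^bsub>M\<^esub>j\<in>{j : J. P j ~= \<zero>\<^bsub>T\<^esub>}. P j \<odot>\<^bsub>M\<^esub> v j)"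
 then obtain P where "P : J \<rightarrow> car T" "finite {j : J. P j ~= \<zero>\<^bsub>T\<^esub>}"
  "x = (\<Oplus>\<^bsub>M\<^esub>j\<in>{j : J. P j ~= \<zero>\<^bsub>T\<^esub>}. P j \<odot>\<^bsub>M\<^esub> v j)" by blast
 thus "x : cyclic_sum T M v J"
  unfolding cyclic_sum_def by (intro CollectI exI[of _ "{j : J. P j ~= \<zero>\<^bsub>T\<^esub>}"] exI[of _ P]) auto
qed

subsection \<open>Binomial coefficients modulo \<open>p\<close>\<close>

text \<open>Vandermonde's identity for (1 + X)^p (1 + X)^n, where modulo p the first factor is 1 +
  X^p.\<close>

lemma choose_add_prime: assumes p: "Factorial_Ring.prime (p::nat)"
 shows "[(p + n) choose k = (n choose k) + (if p <= k then n choose (k - p) else 0)] (mod p)" proof -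
 have p0: "p > 0" using p prime_gt_0_nat by blast
 have "(p + n) choose k = (\<Sum>j\<le>k. (p choose j) * (n choose (k - j)))" by (rule vandermonde[symmetric])
 also have "[... = (\<Sum>j\<le>k. (if j = 0 \<or> j = p then n choose (k - j) else 0))] (mod p)" proof (rule cong_sum)
  fix j
  consider "j = 0" | "j = p" | "0 < j" "j < p" | "p < j" by linarith
  thus "[(p choose j) * (n choose (k - j)) = (if j = 0 \<or> j = p then n choose (k - j) else 0)] (mod p)" proof cases
   case 3
   hence "p dvd (p choose j)" using p by (intro dvd_choose_prime) auto thus ?thesis using 3 by (simp add: cong_0_iff)
  next
   case 4
   hence "p choose j = 0" by (rule binomial_eq_0) thus ?thesis using 4 p0 by (simp only: mult_0 cong_refl if_False) simp
  qed (use p0 in auto)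
 qed
 also have "(\<Sum>j\<le>k. (if j = 0 \<or> j = p then n choose (k - j) else 0)) = (\<Sum>j\<in>{..k} \<inter> {0, p}. n choose (k - j))"
  by (subst sum.inter_restrict) (auto intro!: sum.cong)
 also have "... = (n choose k) + (if p <= k then n choose (k - p) else 0)" proof (cases "p <= k")
  case True
  hence "{..k} \<inter> {0, p} = {0, p}" by auto thus ?thesis using True p0 by simp
 next
  case False
  hence "{..k} \<inter> {0, p} = {0}" by auto thus ?thesis using False by simp
 qed
 finally show ?thesis .
qed

text \<open>Lucas's theorem for the lowest digit. Increasing N by one adds p to the upper entry, and
  \<open>choose_add_prime\<close> then matches Pascal's rule for N.\<close>

lemma lucas_step: assumes p: "Factorial_Ring.prime (p::nat)" and "n < p" "k < p"
 shows "[(p * N + n) choose (p * K + k) = (N choose K) * (n choose k)] (mod p)" proof (induction N arbitrary: K)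
 case 0
 show ?case proof (cases K)
  case (Suc L)
  hence "n < p * K + k" using assms(2) by simp
  hence z: "(p * 0 + n) choose (p * K + k) = 0" by (simp only: mult_0_right add_0 binomial_eq_0)
  moreover have "0 choose K = 0" using Suc by simp
  ultimately show ?thesis by (simp only: mult_0 cong_refl)
 qed simp
next
 case (Suc N)
 have "[(p + (p * N + n)) choose (p * K + k) = ((p * N + n) choose (p * K + k)) +
   (if p <= p * K + k then (p * N + n) choose (p * K + k - p) else 0)] (mod p)" by (rule choose_add_prime[OF p])
 also have "[((p * N + n) choose (p * K + k)) +
   (if p <= p * K + k then (p * N + n) choose (p * K + k - p) else 0) = (Suc N choose K) * (n choose k)] (mod p)" proof (cases K)
  case 0 thus ?thesis using assms(3) Suc.IH[of 0] by simp
 next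
  case (Suc L)
  hence "p <= p * K + k" "p * K + k - p = p * L + k" by simp_all
  moreover have "[((p * N + n) choose (p * K + k)) + ((p * N + n) choose (p * L + k)) =
   (N choose K) * (n choose k) + (N choose L) * (n choose k)] (mod p)" by (rule cong_add[OF Suc.IH Suc.IH])
  moreover have "(N choose K) * (n choose k) + (N choose L) * (n choose k) = (Suc N choose K) * (n choose k)" using Suc by (simp add: algebra_simps)
  ultimately show ?thesis by simp
 qed
 finally show ?case by (simp add: ac_simps)
qed

text \<open>The binomial coefficient divides n!, which is prime to p for n < p.\<close>

lemma not_dvd_choose_small: assumes p: "Factorial_Ring.prime (p::nat)" and "k <= n" "n < p" shows "\<not> p dvd (n choose k)" proof
 assume "p dvd (n choose k)"
 hence "p dvd fact k * fact (n - k) * (n choose k)" by simp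
 also have "... = fact n" using binomial_fact_lemma[OF assms(2)] by simp
 finally show False using p assms(3) by (simp add: prime_dvd_fact_iff)
qed

lemma not_dvd_choose_digits:
 assumes p: "Factorial_Ring.prime (p::nat)" and "!!j. j < N ==> k j <= n j" "!!j. j < N ==> n j < p"
 shows "\<not> p dvd ((\<Sum>j<N. n j * p ^ j) choose (\<Sum>j<N. k j * p ^ j))" using assms(2,3) proof (induction N arbitrary: k n)
 case 0
 have "\<not> p dvd 1" using p prime_gt_1_nat[of p] by auto
 thus ?case by simp
next
 case (Suc N)
 have split: "(\<Sum>j<Suc N. h j * p ^ j) = p * (\<Sum>j<N. h (Suc j) * p ^ j) + h 0" for h :: "nat => nat"
  by (simp add: sum.lessThan_Suc_shift sum_distrib_left ac_simps del: sum.lessThan_Suc)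
 have "k 0 <= n 0" "n 0 < p" using Suc.prems[of 0] by simp_all
 hence "[((\<Sum>j<Suc N. n j * p ^ j) choose (\<Sum>j<Suc N. k j * p ^ j)) =
  ((\<Sum>j<N. n (Suc j) * p ^ j) choose (\<Sum>j<N. k (Suc j) * p ^ j)) * (n 0 choose k 0)] (mod p)"
  unfolding split by (intro lucas_step[OF p]) simp_all
 moreover have "\<not> p dvd ((\<Sum>j<N. n (Suc j) * p ^ j) choose (\<Sum>j<N. k (Suc j) * p ^ j))" by (rule Suc.IH) (use Suc.prems in auto)
 moreover have "\<not> p dvd (n 0 choose k 0)" by (rule not_dvd_choose_small[OF p]) fact+
 ultimately show ?case using p by (simp add: cong_dvd_iff prime_dvd_mult_iff)
qed

lemma digit_sum: "(\<Sum>j<N. (a div p ^ j mod p) * p ^ j) = a mod p ^ N" for a p :: nat proof (induction N)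
 case (Suc N)
 thus ?case by (simp add: mod_mult2_eq[of a "p ^ N" p, unfolded mult.commute[of "p ^ N" p]] ac_simps)
qed simp

lemma (in monoid) int_pow_nat_mult: assumes u: "u : Units G" and z: "z + int n \<ge> 0"
 shows "u [^] (z::int) \<otimes> u [^] n = u [^] nat (z + int n)" proof (cases "z < 0")
 case True
 have uc: "u : car G" using u by blast
 have pU: "u [^] nat (- z) : Units G" using u by (rule Units_pow_closed)
 have n: "nat (- z) + nat (z + int n) = n" using True z by linarith
 have "u [^] z = inv (u [^] nat (- z))" using True by (simp only: int_pow_def2 if_True)
 moreover have "u [^] n = u [^] nat (- z) \<otimes> u [^] nat (z + int n)"
  using nat_pow_mult[OF uc, of "nat (- z)" "nat (z + int n)"] unfolding n by (rule sym)
 moreover have "inv (u [^] nat (- z)) \<otimes> (u [^] nat (- z) \<otimes> u [^] nat (z + int n)) = u [^] nat (z + int n)"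
  using pU uc by (subst m_assoc[symmetric]) simp_all
 ultimately show ?thesis by (simp only:)
next
 case False
 have uc: "u : car G" using u by blast
 have "nat (z + int n) = nat z + n" using False by linarith
 moreover have "u [^] z = u [^] nat z" using False by (simp only: int_pow_def2 if_False)
 ultimately show ?thesis by (simp only: nat_pow_mult[OF uc])
qed

lemma (in monoid) int_pow_Units_closed: "u : Units G ==> u [^] (z::int) : car G" proof -
 assume "u : Units G"
 hence "u [^] n : Units G" for n :: nat by (rule Units_pow_closed)
 hence "u [^] nat z : car G" "inv (u [^] nat (- z)) : car G" by (blast intro: Units_inv_closed)+
 thus "u [^] (z::int) : car G" by (simp only: int_pow_def2 if_True if_False split: if_split) simp
qed

lemma Fun_exp_split: assumes "finite {j. \<alpha> i j ~= (0::int)}"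
 shows "Fun_exp p \<alpha> i = (\<Sum>j | \<alpha> i j > 0. \<alpha> i j * int p ^ j) - int (Fun_neg p \<alpha> i)" proof -
 have f: "finite {j. \<alpha> i j > 0}" "finite {j. \<alpha> i j < 0}" by (rule finite_subset[OF _ assms], force)+
 have "{j. \<alpha> i j ~= 0} = {j. \<alpha> i j > 0} \<union> {j. \<alpha> i j < 0}" by auto
 hence "Fun_exp p \<alpha> i = (\<Sum>j | \<alpha> i j > 0. \<alpha> i j * int p ^ j) + (\<Sum>j | \<alpha> i j < 0. \<alpha> i j * int p ^ j)"
  unfolding Fun_exp_def using f by (simp add: sum.union_disjoint disjoint_iff)
 also have "(\<Sum>j | \<alpha> i j < 0. \<alpha> i j * int p ^ j) = - int (Fun_neg p \<alpha> i)"
  unfolding Fun_neg_def by (simp add: sum_negf[symmetric] del: sum_negf)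
 finally show ?thesis by simp
qed

lemma Fun_set_finite: assumes "\<alpha> : Fun_set p r" shows "finite {j. \<alpha> i j ~= 0}" proof (rule finite_imageD)
 show "finite (Pair i ` {j. \<alpha> i j ~= 0})"
  by (rule finite_subset[of _ "{(i, j). \<alpha> i j ~= 0}"]) (use assms in \<open>auto simp: Fun_set_def\<close>)
qed (auto intro: inj_onI)

text \<open>\<open>Fun_neg\<close> is the negative part of the exponent, so f^[\<alpha>] f^n has no
  negative exponents once n dominates it.\<close>

lemma Fun_exp_ge: assumes "\<alpha> : Fun_set p r" shows "Fun_exp p \<alpha> i + int (Fun_neg p \<alpha> i) \<ge> 0" proof -
 have "(\<Sum>j | \<alpha> i j > 0. \<alpha> i j * int p ^ j) \<ge> 0" by (rule sum_nonneg) auto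
 thus ?thesis unfolding Fun_exp_split[of \<alpha> i p, OF Fun_set_finite[OF assms]] by linarith
qed

context bs_setup begin

definition BdF :: "(nat => nat => int) => ((nat => nat => int) => 'b)" where
 "BdF \<alpha> = Fp_scale (Zp_space p r) B (Bfun p r (Fun_neg p \<alpha>))
  (\<lambda>x\<in>Ypts p r. \<Otimes>i\<in>{1..r}. u i [^] Fun_exp p \<alpha> i)"

definition BdS :: "nat => ((nat => nat => int) => 'b) set" where
 "BdS k = cyclic_sum (CD p r R) fsR BdF {\<alpha> : Fun_set p r. Fun_norm p r \<alpha> = int k}"

text \<open>The LEAST inside \<open>Bfun\<close>, named so that it can be compared with other
  levels.\<close>

definition Blev :: "(nat => nat) => nat" where "Blev k = (LEAST e. \<forall>i\<in>{1..r}. k i < p ^ e)"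

lemma Blev: "i : {1..r} ==> k i < p ^ Blev k" proof -
 have "\<forall>i\<in>{1..r}. k i < p ^ (\<Sum>i\<in>{1..r}. k i)" proof
  fix i assume i: "i : {1..r}"
  have "k i <= (\<Sum>i\<in>{1..r}. k i)" by (rule member_le_sum[OF i]) auto
  also have "... < p ^ (\<Sum>i\<in>{1..r}. k i)" using p_gt1 by (simp add: power_gt_expt)
  finally show "k i < p ^ (\<Sum>i\<in>{1..r}. k i)" .
 qed
 hence "\<forall>i\<in>{1..r}. k i < p ^ Blev k" unfolding Blev_def by (rule LeastI)
 thus "i : {1..r} ==> k i < p ^ Blev k" by blast
qed

lemma Blev_le: "(!!i. i : {1..r} ==> k i < p ^ e) ==> Blev k <= e" unfolding Blev_def by (rule Least_le) blast

definition Bco :: "(nat => nat) => (nat => nat => int) => nat" where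
 "Bco k x = (\<Prod>i\<in>{1..r}. tr (Blev k) x i choose k i) mod p"

lemma Bfun_eq: "x : Ypts p r ==> Bfun p r k x = int (Bco k x)" by (simp add: Bfun_def Let_def Blev_def Bco_def tr_def zmod_int)

lemma Bco_cong: "cong_pts r (Blev k) x y ==> Bco k x = Bco k y"
 unfolding Bco_def by (intro arg_cong2[where f = "(mod)"] prod.cong refl) (simp add: tr_cong)

lemma Bfun_CF: "Bfun p r k : car (CF p r (Fp p))" proof (rule CF_I[OF p_pos, where e = "Blev k"])
 have "Bco k x < p" for x unfolding Bco_def by (rule mod_less_divisor[OF p_pos])
 hence "int (Bco k x) : car (Fp p)" for x unfolding Fp_carrier[OF p_gt1] by (simp add: zle_diff1_eq)
 thus "Bfun p r k : Ypts p r \<rightarrow>\<^sub>E car (Fp p)" by (intro PiE_I) (simp_all only: Bfun_eq, simp add: Bfun_def Let_def)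
 show "loc_const p r (Blev k) (Bfun p r k)" by (rule loc_constI) (simp add: Bfun_eq Bco_cong)
qed

lemma u_int_pow: "i : {1..r} ==> u i [^] (z::int) : car B" using f_unit by (rule int_pow_Units_closed)

lemma prod_int_pow_closed: "(\<Otimes>i\<in>{1..r}. u i [^] (z i::int)) : car B" by (rule finprod_closed) (use u_int_pow in auto)

lemma prod_int_pow: assumes "!!i. i : {1..r} ==> z i + int (n i) \<ge> 0"
 shows "(\<Otimes>i\<in>{1..r}. u i [^] (z i::int)) \<otimes> fpw n = fpw (%i. nat (z i + int (n i)))" proof -
 have "(\<Otimes>i\<in>{1..r}. u i [^] z i) \<otimes> fpw n = (\<Otimes>i\<in>{1..r}. u i [^] z i \<otimes> u i [^] n i)"
  unfolding fpw_def by (rule finprod_multf[symmetric]) (use u_int_pow f_pow in auto)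
 also have "... = fpw (%i. nat (z i + int (n i)))" unfolding fpw_def proof (rule finprod_cong'[OF refl])
  show "(%i. u i [^] nat (z i + int (n i))) : {1..r} \<rightarrow> car B" by (rule Pi_I, rule f_pow)
  show "u i [^] z i \<otimes> u i [^] n i = u i [^] nat (z i + int (n i))" if "i : {1..r}" for i
   by (rule int_pow_nat_mult[OF f_unit[OF that] assms[OF that]])
 qed
 finally show ?thesis .
qed

lemma BdF_closed: "BdF \<alpha> : car CB"
 unfolding BdF_def by (rule Fp_scale_CF[OF ring_axioms p_pos Bfun_CF CF_const[OF p_pos prod_int_pow_closed]])

lemma BdF_val:
 "x : Ypts p r ==> BdF \<alpha> x = [Bco (Fun_neg p \<alpha>) x] \<cdot> (\<Otimes>i\<in>{1..r}. u i [^] Fun_exp p \<alpha> i)"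
 by (simp add: BdF_def Fp_scale_def Bfun_eq add_pow_def int_pow_int)

lemma add_pow_mult_fpw:
 "v : car B ==> ([(m::nat)] \<cdot> v) \<otimes> fpw n = [m] \<cdot> (v \<otimes> fpw n)" by (rule add_pow_ldistr) auto

lemma wt_int:  assumes a: "Fun_norm p r \<alpha> = int k" and nn: "!!i. i : {1..r} ==> Fun_exp p \<alpha> i + int (n i) \<ge> 0"
 shows "F.wt (%i. nat (Fun_exp p \<alpha> i + int (n i))) = F.wt n + k" proof -
 have "int (F.wt (%i. nat (Fun_exp p \<alpha> i + int (n i)))) = (\<Sum>i\<in>{1..r}. Fun_exp p \<alpha> i + int (n i))"
  unfolding F.wt_def of_nat_sum by (rule sum.cong[OF refl]) (simp add: nn)
 also have "... = int (F.wt n + k)" using a by (simp add: sum.distrib Fun_norm_def F.wt_def)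
 finally show ?thesis by linarith
qed

text \<open>If the truncation of x dominates \<open>Fun_neg\<close>, then f^[\<alpha>] f^x is a
  monomial of weight |x| + k. Otherwise one of the binomial coefficients is zero: Bd switches off
  exactly the points at which a negative exponent could survive.\<close>

lemma BdF_Sk: assumes \<alpha>: "\<alpha> : Fun_set p r" "Fun_norm p r \<alpha> = int k" shows "BdF \<alpha> : Sk k" proof -
 define e where "e = Blev (Fun_neg p \<alpha>)"
 have "Sat k e (BdF \<alpha>)" unfolding Sat_def proof (intro conjI ballI)
  show "loc_const p r e (BdF \<alpha>)" by (rule loc_constI) (simp add: BdF_val e_def Bco_cong)
  fix x assume x: "x : Ypts p r"
  interpret J: ideal "F.Dn p e (F.wt (tr e x) + k)" R by (rule F.Dn_ideal)
  let ?v = "\<Otimes>i\<in>{1..r}. u i [^] Fun_exp p \<alpha> i"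
  show "\<exists>d\<in>F.Dn p e (F.wt (tr e x) + k). BdF \<alpha> x \<otimes> fpw (tr e x) = \<iota> d"
  proof (cases "\<forall>i\<in>{1..r}. Fun_neg p \<alpha> i <= tr e x i")
   case True
   have nn: "Fun_exp p \<alpha> i + int (tr e x i) \<ge> 0" if "i : {1..r}" for i
    using Fun_exp_ge[OF \<alpha>(1), of i] True[rule_format, OF that] by linarith
   define c where "c i = nat (Fun_exp p \<alpha> i + int (tr e x i))" for i
   have "F.wt c = F.wt (tr e x) + k" unfolding c_def by (rule wt_int[OF \<alpha>(2) nn])
   hence m: "F.mono c : F.Dn p e (F.wt (tr e x) + k)" using F.Dn_gen[OF R.DiffOp_level_one, of c "F.wt (tr e x) + k"] by simp
   have "?v \<otimes> fpw (tr e x) = \<iota> (F.mono c)" unfolding \<iota>_mono c_def by (rule prod_int_pow[OF nn])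
   hence "BdF \<alpha> x \<otimes> fpw (tr e x) = [Bco (Fun_neg p \<alpha>) x] \<cdot> \<iota> (F.mono c)"
    unfolding BdF_val[OF x] add_pow_mult_fpw[OF prod_int_pow_closed] by simp
   also have "... = \<iota> (([Bco (Fun_neg p \<alpha>) x] \<cdot>\<^bsub>R\<^esub> \<one>\<^bsub>R\<^esub>) \<otimes>\<^bsub>R\<^esub> F.mono c)"
    using additive_map(3)[OF R.abelian_group_axioms abelian_group_axioms, of \<iota> "F.mono c" "Bco (Fun_neg p \<alpha>) x"]
     R.add_pow_ldistr[of "\<one>\<^bsub>R\<^esub>" "F.mono c"] by simp
   finally have "BdF \<alpha> x \<otimes> fpw (tr e x) = \<iota> (([Bco (Fun_neg p \<alpha>) x] \<cdot>\<^bsub>R\<^esub> \<one>\<^bsub>R\<^esub>) \<otimes>\<^bsub>R\<^esub> F.mono c)" .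
   moreover have "([Bco (Fun_neg p \<alpha>) x] \<cdot>\<^bsub>R\<^esub> \<one>\<^bsub>R\<^esub>) \<otimes>\<^bsub>R\<^esub> F.mono c : F.Dn p e (F.wt (tr e x) + k)"
    by (rule J.I_l_closed[OF m]) simp
   ultimately show ?thesis by blast
  next
   case False
   then obtain i where i: "i : {1..r}" "tr e x i < Fun_neg p \<alpha> i" by force
   hence "(\<Prod>i\<in>{1..r}. tr (Blev (Fun_neg p \<alpha>)) x i choose Fun_neg p \<alpha> i) = 0" unfolding e_def by (intro prod_zero) auto
   hence "Bco (Fun_neg p \<alpha>) x = 0" unfolding Bco_def by (simp only: mod_0)
   hence "BdF \<alpha> x = \<zero>" unfolding BdF_val[OF x] by simp thus ?thesis by (intro bexI[of _ "\<zero>\<^bsub>R\<^esub>"]) simp_all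
  qed
 qed
 thus ?thesis unfolding Sk_def using BdF_closed by blast
qed

lemma BdS_sub_Sk: "BdS k <= Sk k" proof -
 interpret M: left_module "CD p r R" fsR by (rule left_module_fsR)
 show ?thesis unfolding BdS_def by (rule M.cyclic_sum_least[OF Sk_submodule]) (use BdF_Sk in auto)
qed

section \<open>The elements Bd generate S^k\<close>

definition digit :: "nat => nat => nat" where "digit n j = n div p ^ j mod p"

lemma digit_less: "digit n j < p" using p_pos by (simp add: digit_def)

lemma digit_zero: "n < p ^ j ==> digit n j = 0" by (simp add: digit_def)

text \<open>An \<alpha> with f^[\<alpha>] = f^(n - c), formed digit by digit so that
  \<open>Fun_neg\<close> takes from each digit of c at most that digit.\<close>

definition diffdig :: "(nat => nat) => (nat => nat) => nat => nat => int" where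
 "diffdig n c i j = (if i : {1..r} then int (digit (n i) j) - int (digit (c i) j) else 0)"

text \<open>The third claim holds for all large M so that its sum can be given the length of any
  other digit expansion it is compared with.\<close>

lemma diffdig_props: shows "diffdig n c : Fun_set p r" and "i : {1..r} ==> Fun_exp p (diffdig n c) i = int (n i) - int (c i)"
  and "i : {1..r} ==> \<exists>N. \<forall>M\<ge>N. Fun_neg p (diffdig n c) i = (\<Sum>j<M. (digit (c i) j - digit (n i) j) * p ^ j)"
proof -
 have small: "m < p ^ j" if "m <= j" for m j proof -
  have "m < p ^ m" using p_gt1 by (simp add: power_gt_expt)
  also have "... <= p ^ j" by (rule power_increasing[OF that]) (use p_pos in simp)
  finally show ?thesis .
 qed
 have z: "diffdig n c i j = 0" if "n i <= j" "c i <= j" for i j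
  using digit_zero[OF small[OF that(1)]] digit_zero[OF small[OF that(2)]] by (simp add: diffdig_def)
 have sub: "{j. diffdig n c i j ~= 0} <= {..<M}" if "n i <= M" "c i <= M" for i M proof
  fix j assume "j : {j. diffdig n c i j ~= 0}"
  hence "\<not> (n i <= j \<and> c i <= j)" using z by blast
  thus "j : {..<M}" using that by auto
 qed
 have "{(i, j). diffdig n c i j ~= 0} <= (SIGMA i:{1..r}. {..<max (n i) (c i)})" proof clarify
  fix i j assume nz: "diffdig n c i j ~= 0"
  have "i : {1..r}" by (rule ccontr) (use nz in \<open>simp only: diffdig_def if_False\<close>)
  moreover have "j : {..<max (n i) (c i)}"  proof (rule subsetD)
   show "{j. diffdig n c i j ~= 0} <= {..<max (n i) (c i)}" by (rule sub) simp_all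
  qed (use nz in blast)
  ultimately show "i : {1..r} \<and> j : {..<max (n i) (c i)}" ..
 qed
 hence "finite {(i, j). diffdig n c i j ~= 0}" by (rule finite_subset) auto
 moreover have "diffdig n c i j : {- int p + 1..int p - 1}" for i j proof -
  have "int x - int y : {- int p + 1..int p - 1}" if "x < p" "y < p" for x y using that unfolding atLeastAtMost_iff by linarith
  from this[OF digit_less digit_less, of "n i" j "c i" j] show ?thesis unfolding diffdig_def using p_pos by (cases "i : {1..r}") auto
 qed
 moreover have "diffdig n c i j = 0" if "i \<notin> {1..r}" for i j using that by (simp only: diffdig_def if_False)
 ultimately show "diffdig n c : Fun_set p r" unfolding Fun_set_def by blast
 assume i: "i : {1..r}"
 have ds: "(\<Sum>j<M. digit m j * p ^ j) = m" if "m <= M" for m M unfolding digit_def digit_sum using small[OF that] by simp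
 define M where "M = max (n i) (c i)"
 have "Fun_exp p (diffdig n c) i = (\<Sum>j<M. diffdig n c i j * int p ^ j)" unfolding Fun_exp_def proof (rule sum.mono_neutral_left)
  show "{j. diffdig n c i j ~= 0} <= {..<M}" by (rule sub) (simp_all add: M_def)
 qed auto
 also have "... = int (\<Sum>j<M. digit (n i) j * p ^ j) - int (\<Sum>j<M. digit (c i) j * p ^ j)"
  using i by (simp add: diffdig_def left_diff_distrib sum_subtractf)
 also have "... = int (n i) - int (c i)" by (simp add: ds M_def)
 finally show "Fun_exp p (diffdig n c) i = int (n i) - int (c i)" .
 show "\<exists>N. \<forall>M\<ge>N. Fun_neg p (diffdig n c) i = (\<Sum>j<M. (digit (c i) j - digit (n i) j) * p ^ j)"
 proof (intro exI[of _ M] allI impI)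
  fix K assume "M <= K"
  hence le: "n i <= K" "c i <= K" by (simp_all add: M_def)
  have "Fun_neg p (diffdig n c) i = (\<Sum>j | diffdig n c i j < 0. (digit (c i) j - digit (n i) j) * p ^ j)" proof -
   have aux: "nat (- (int x - int y)) = y - x" for x y :: nat by linarith
   show ?thesis unfolding Fun_neg_def diffdig_def if_P[OF i] aux ..
  qed
  also have "... = (\<Sum>j<K. (digit (c i) j - digit (n i) j) * p ^ j)" proof (rule sum.mono_neutral_left)
   show "{j. diffdig n c i j < 0} <= {..<K}" proof
    fix j assume "j : {j. diffdig n c i j < 0}"
    hence "j : {j. diffdig n c i j ~= 0}" by simp
    thus "j : {..<K}" by (rule subsetD[OF sub[OF le]])
   qed
   show "\<forall>j\<in>{..<K} - {j. diffdig n c i j < 0}. (digit (c i) j - digit (n i) j) * p ^ j = 0" unfolding diffdig_def if_P[OF i] by simp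
  qed simp
  finally show "Fun_neg p (diffdig n c) i = (\<Sum>j<K. (digit (c i) j - digit (n i) j) * p ^ j)" .
 qed
qed

text \<open>Digitwise, \<open>Fun_neg (diffdig n c) i <= c i\<close>, so the binomial coefficient is a unit modulo \<open>p\<close> by
 Lucas's theorem.\<close>

lemma Bco_diffdig: assumes x: "x : Ypts p r" and t: "!!i. i : {1..r} ==> tr e x i = c i"
  and c: "!!i. i : {1..r} ==> c i < p ^ e" shows "\<not> p dvd Bco (Fun_neg p (diffdig n c)) x" proof -
 define k where "k = Fun_neg p (diffdig n c)"
 define e0 where "e0 = Blev k"
 have kc: "\<not> p dvd (tr e0 x i choose k i)" if i: "i : {1..r}" for i proof -
  obtain N where N: "!!M. M \<ge> N ==> k i = (\<Sum>j<M. (digit (c i) j - digit (n i) j) * p ^ j)"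
   using diffdig_props(3)[OF i, of n c] unfolding k_def by blast
  define \<kappa> where "\<kappa> j = digit (c i) j - digit (n i) j" for j
  have ke: "k i < p ^ e0" unfolding e0_def by (rule Blev[OF i])
  \<comment> \<open>\<open>Bfun\<close> is evaluated at its own least level e0, which may be below
    e; beyond e0 the digits of k vanish, so c may be truncated at e0.\<close>
  have \<kappa>0: "\<kappa> j = 0" if "e0 <= j" for j proof (rule ccontr)
   assume "\<kappa> j ~= 0"
   hence "p ^ j <= \<kappa> j * p ^ j" by simp
   also have "... <= (\<Sum>j<max N (Suc j). \<kappa> j * p ^ j)" by (rule member_le_sum[of j "{..<max N (Suc j)}" "%j. \<kappa> j * p ^ j"]) auto
   also have "... = k i" using N[of "max N (Suc j)"] by (simp add: \<kappa>_def)
   finally have "p ^ j < p ^ e0" using ke by simp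
   thus False using that p_gt1 by simp
  qed
  have "k i = (\<Sum>j<max N e0. \<kappa> j * p ^ j)" using N[of "max N e0"] by (simp add: \<kappa>_def)
  also have "... = (\<Sum>j<e0. \<kappa> j * p ^ j)" by (rule sum.mono_neutral_right) (use \<kappa>0 in auto)
  finally have ki: "k i = (\<Sum>j<e0. \<kappa> j * p ^ j)" .
  have "e0 <= e" unfolding e0_def proof (rule Blev_le)
   fix l assume l: "l : {1..r}"
   obtain N where N: "!!M. M \<ge> N ==> k l = (\<Sum>j<M. (digit (c l) j - digit (n l) j) * p ^ j)"
    using diffdig_props(3)[OF l, of n c] unfolding k_def by blast
   have "k l = (\<Sum>j<max N e. (digit (c l) j - digit (n l) j) * p ^ j)" by (rule N) simp
   also have "... <= (\<Sum>j<max N e. digit (c l) j * p ^ j)" by (rule sum_mono) simp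
   also have "... = c l mod p ^ max N e" using digit_sum[where p = p] by (simp add: digit_def)
   also have "... <= c l" by simp
   finally show "k l < p ^ e" using c[OF l] by simp
  qed
  hence "tr e0 x i = c i mod p ^ e0" using trunc_mod[OF Ypts_D[OF x i]] t[OF i] by (metis tr_def)
  also have "... = (\<Sum>j<e0. digit (c i) j * p ^ j)" using digit_sum[where p = p] by (simp add: digit_def)
  finally show ?thesis unfolding ki by (simp only:) (rule not_dvd_choose_digits[OF p_prime], simp_all add: \<kappa>_def digit_less)
 qed
 hence "\<not> p dvd (\<Prod>i\<in>{1..r}. tr e0 x i choose k i)" using p_prime by (simp add: prime_dvd_prod_iff)
 thus ?thesis unfolding k_def[symmetric] Bco_def e0_def by (simp add: dvd_mod_iff)
qed

text \<open>m' is the inverse of m modulo p, and multiples of p annihilate R.\<close>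

lemma char_unit:
 assumes "0 < m" "m < p" and v: "v : car R" shows "\<exists>m'::nat. [m'] \<cdot>\<^bsub>R\<^esub> ([m] \<cdot>\<^bsub>R\<^esub> v) = v"
proof -
 have "\<not> p dvd m" using assms(1,2) by (auto dest: dvd_imp_le)
 hence "coprime m p" using prime_imp_coprime[OF p_prime] coprime_commute by blast
 then obtain m' where m': "[m * m' = 1] (mod p)" using cong_solve_coprime_nat[of m p] unfolding One_nat_def by blast
 have pz: "[(p * l)] \<cdot>\<^bsub>R\<^esub> v = \<zero>\<^bsub>R\<^esub>" for l proof -
  have "[p] \<cdot>\<^bsub>R\<^esub> v = ([p] \<cdot>\<^bsub>R\<^esub> \<one>\<^bsub>R\<^esub>) \<otimes>\<^bsub>R\<^esub> v" using v by (simp add: R.add_pow_ldistr)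
  hence "[p] \<cdot>\<^bsub>R\<^esub> v = \<zero>\<^bsub>R\<^esub>" using v by (simp add: char_R)
  thus ?thesis using R.add.nat_pow_pow[of v l p] v by simp
 qed
 have "m * m' = p * (m * m' div p) + 1" using m' p_gt1 mult_div_mod_eq[of p "m * m'"] by (simp add: cong_def)
 hence "[(m * m')] \<cdot>\<^bsub>R\<^esub> v = [(p * (m * m' div p))] \<cdot>\<^bsub>R\<^esub> v \<oplus>\<^bsub>R\<^esub> [(1::nat)] \<cdot>\<^bsub>R\<^esub> v"
  using R.add.nat_pow_mult[of v "p * (m * m' div p)" 1] v by simp
 hence "[(m * m')] \<cdot>\<^bsub>R\<^esub> v = v" using v by (simp add: pz) thus ?thesis using R.add.nat_pow_pow[of v m' m] v by auto
qed

text \<open>With \<alpha> = \<open>diffdig n c\<close>, the value of Bd^[\<alpha>] f^[\<alpha>]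
  times f^c on the residue class c is m f^n, where m is invertible modulo p. The scalar P is psi
  preceded by multiplication with the inverse of m on this class, and 0 off it.\<close>

lemma ind_gen_BdS:
 assumes psi: "psi : DL p R e" and wn: "F.wt n = F.wt c + k" and c: "!!i. i : {1..r} ==> c i < p ^ e"
 shows "ind e c (\<iota> (psi (F.mono n))) : BdS k" proof -
 interpret M: left_module "CD p r R" fsR by (rule left_module_fsR)
 define \<alpha> where "\<alpha> = diffdig n c"
 have ex: "Fun_exp p \<alpha> i = int (n i) - int (c i)" if "i : {1..r}" for i unfolding \<alpha>_def by (rule diffdig_props(2)[OF that])
 have "Fun_norm p r \<alpha> = (\<Sum>i\<in>{1..r}. int (n i) - int (c i))" unfolding Fun_norm_def by (rule sum.cong[OF refl ex])
 also have "... = int (F.wt n) - int (F.wt c)" by (simp add: sum_subtractf F.wt_def)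
 finally have norm: "Fun_norm p r \<alpha> = int k" using wn by simp
 have \<alpha>: "\<alpha> : {\<alpha> : Fun_set p r. Fun_norm p r \<alpha> = int k}" using norm diffdig_props(1)[of n c] by (simp add: \<alpha>_def)
 define m where "m = Bco (Fun_neg p \<alpha>) (ptn c)"
 have trp: "tr e (ptn c) i = c i" if "i : {1..r}" for i using c[OF that] that by (simp add: tr_ptn)
 have nd: "\<not> p dvd m" unfolding m_def \<alpha>_def by (rule Bco_diffdig[OF ptn_Ypts trp c])
 hence m0: "0 < m" by (cases m) auto
 have mp: "m < p" unfolding m_def Bco_def by (rule mod_less_divisor[OF p_pos])
 obtain m' :: nat where m': "[m'] \<cdot>\<^bsub>R\<^esub> ([m] \<cdot>\<^bsub>R\<^esub> F.mono n) = F.mono n"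
  using char_unit[OF m0 mp, of "F.mono n"] by auto
 have le: "Blev (Fun_neg p \<alpha>) <= e" proof (rule Blev_le)
  fix l assume l: "l : {1..r}"
  have "Fun_neg p \<alpha> l <= c l" proof -
   obtain N where N: "!!M. M \<ge> N ==> Fun_neg p \<alpha> l = (\<Sum>j<M. (digit (c l) j - digit (n l) j) * p ^ j)"
    using diffdig_props(3)[OF l, of n c] unfolding \<alpha>_def by blast
   have "Fun_neg p \<alpha> l = (\<Sum>j<N. (digit (c l) j - digit (n l) j) * p ^ j)" by (rule N) simp
   also have "... <= (\<Sum>j<N. digit (c l) j * p ^ j)" by (rule sum_mono) simp
   also have "... = c l mod p ^ N" using digit_sum[where p = p] by (simp add: digit_def)
   also have "... <= c l" by simp
   finally show ?thesis .
  qed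
  thus "Fun_neg p \<alpha> l < p ^ e" using c[OF l] by simp
 qed
 define op where "op = (\<lambda>x\<in>car R. psi (([m'] \<cdot>\<^bsub>R\<^esub> \<one>\<^bsub>R\<^esub>) \<otimes>\<^bsub>R\<^esub> x))"
 have op: "op : DL p R e" unfolding op_def by (rule F.DiffOp_premult[OF psi]) simp
 define zop where "zop = (\<lambda>x\<in>car R. \<zero>\<^bsub>R\<^esub>)"
 have zop: "zop : DL p R e" unfolding zop_def by (rule R.DiffOp_level_zero)
 define P where "P = (\<lambda>x\<in>Ypts p r. if \<forall>i\<in>{1..r}. tr e x i = c i then op else zop)"
 have PD: "P x : DL p R e" if "x : Ypts p r" for x using op zop that by (simp add: P_def)
 have P: "P : car (CD p r R)" proof (rule CF_I[OF p_pos, of _ _ _ e])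
  show "P : Ypts p r \<rightarrow>\<^sub>E car (DiffOp p R)" using op zop by (auto simp: P_def DiffOp_carrier)
  show "loc_const p r e P" by (rule loc_constI) (auto simp: P_def tr_cong)
 qed
 have "act (CD_map P) (BdF \<alpha>) = ind e c (\<iota> (psi (F.mono n)))" proof (rule Cfun_ext)
  show "act (CD_map P) (BdF \<alpha>) : car CB" by (rule act_closed[OF ring_hom_closed[OF CD_map_hom P] BdF_closed])
  have pc: "psi (F.mono n) : car R" by (rule DLD(2)[OF psi]) simp
  thus "ind e c (\<iota> (psi (F.mono n))) : car CB" by (intro ind_closed) simp
  fix x assume x: "x : Ypts p r"
  have act_x: "act (CD_map P) (BdF \<alpha>) x = \<sigma> (P x) (BdF \<alpha> x \<otimes> fpw (tr e x)) \<otimes> inv (fpw (tr e x))"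
   using x tw_eq[OF \<sigma>_level[OF PD[OF x]] x Cfun_val[OF BdF_closed x], of \<alpha>] by (simp add: act_def CD_map_def tr_def[abs_def])
  \<comment> \<open>Off the class the value is computed by \<open>\<sigma>_\<iota>\<close>, so even
    for the zero operator the argument has to be exhibited as some \<iota> d; \<open>BdF_Sk\<close>
    does so at a level E.\<close>
  obtain E d where E: "e <= E" and d: "d : car R" "BdF \<alpha> x \<otimes> fpw (tr E x) = \<iota> d" proof -
   obtain e' where "Sat k e' (BdF \<alpha>)" using BdF_Sk[of \<alpha> k] \<alpha> unfolding Sk_def by blast
   hence "Sat k (max e e') (BdF \<alpha>)" by (rule Sat_mono[OF BdF_closed]) simp
   then obtain d where d: "d : F.Dn p (max e e') (F.wt (tr (max e e') x) + k)"
     "BdF \<alpha> x \<otimes> fpw (tr (max e e') x) = \<iota> d" using x unfolding Sat_def by blast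
   show ?thesis by (rule that[OF _ F.Dn_closed[OF d(1)] d(2)]) simp
  qed
  show "act (CD_map P) (BdF \<alpha>) x = ind e c (\<iota> (psi (F.mono n))) x" proof (cases "\<forall>i\<in>{1..r}. tr e x i = c i")
   case True
   have fc: "fpw (tr e x) = fpw c" by (rule fpw_cong) (use True in blast)
   have "cong_pts r e x (ptn c)" by (rule tr_cong_pts[OF x ptn_Ypts]) (use True trp in simp)
   hence Bm: "Bco (Fun_neg p \<alpha>) x = m" unfolding m_def by (intro Bco_cong cong_pts_mono[OF x ptn_Ypts le])
   have "(\<Otimes>i\<in>{1..r}. u i [^] Fun_exp p \<alpha> i) \<otimes> fpw c = fpw (%i. nat (Fun_exp p \<alpha> i + int (c i)))"
    by (rule prod_int_pow) (simp add: ex)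
   also have "... = \<iota> (F.mono n)" unfolding \<iota>_mono by (rule fpw_cong) (simp add: ex)
   finally have "BdF \<alpha> x \<otimes> fpw c = [m] \<cdot> \<iota> (F.mono n)"
    unfolding BdF_val[OF x] Bm add_pow_mult_fpw[OF prod_int_pow_closed] by simp
   also have "... = \<iota> ([m] \<cdot>\<^bsub>R\<^esub> F.mono n)"
    by (rule additive_map(3)[OF R.abelian_group_axioms abelian_group_axioms, symmetric]) simp_all
   finally have "act (CD_map P) (BdF \<alpha>) x = \<sigma> op (\<iota> ([m] \<cdot>\<^bsub>R\<^esub> F.mono n)) \<otimes> inv (fpw c)"
    unfolding act_x fc by (simp only: P_def restrict_apply'[OF x] if_P[OF True])
   also have "\<sigma> op (\<iota> ([m] \<cdot>\<^bsub>R\<^esub> F.mono n)) = \<iota> (op ([m] \<cdot>\<^bsub>R\<^esub> F.mono n))" by (rule \<sigma>_\<iota>[OF op]) simp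
   also have "op ([m] \<cdot>\<^bsub>R\<^esub> F.mono n) = psi (F.mono n)" proof -
    have "([m'] \<cdot>\<^bsub>R\<^esub> \<one>\<^bsub>R\<^esub>) \<otimes>\<^bsub>R\<^esub> ([m] \<cdot>\<^bsub>R\<^esub> F.mono n) = [m'] \<cdot>\<^bsub>R\<^esub> ([m] \<cdot>\<^bsub>R\<^esub> F.mono n)"
     by (simp add: R.add_pow_ldistr)
    also note m'
    finally show ?thesis by (simp add: op_def)
   qed
   finally show ?thesis using True x by (simp add: ind_def)
  next
   case False
   have Pz: "P x = zop" using False x by (auto simp: P_def)
   have zE: "zop : DL p R E" unfolding zop_def by (rule R.DiffOp_level_zero)
   have "act (CD_map P) (BdF \<alpha>) x = \<sigma> zop (BdF \<alpha> x \<otimes> fpw (tr E x)) \<otimes> inv (fpw (tr E x))"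
    using x tw_eq[OF \<sigma>_level[OF zE] x Cfun_val[OF BdF_closed x], of \<alpha>] Pz by (simp add: act_def CD_map_def tr_def[abs_def])
   also have "\<sigma> zop (BdF \<alpha> x \<otimes> fpw (tr E x)) = \<iota> (zop d)" unfolding d(2) by (rule \<sigma>_\<iota>[OF zE d(1)])
   finally have "act (CD_map P) (BdF \<alpha>) x = \<zero>" using d(1) by (simp add: zop_def)
   thus ?thesis unfolding ind_def restrict_apply'[OF x] if_not_P[OF False] .
  qed
 qed
 moreover have "P \<odot>\<^bsub>fsR\<^esub> BdF \<alpha> : BdS k"
  unfolding BdS_def by (rule M.cyclic_sum_gen[OF \<alpha> _ P]) (simp add: fsR_sel BdF_closed)
 ultimately show ?thesis by (simp add: fsR_smult P BdF_closed)
qed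

theorem BdS_eq_Sk: "BdS k = Sk k" proof (rule antisym[OF BdS_sub_Sk])
 interpret M: left_module "CD p r R" fsR by (rule left_module_fsR)
 have v: "BdF : {\<alpha> : Fun_set p r. Fun_norm p r \<alpha> = int k} \<rightarrow> car fsR" by (simp add: fsR_sel BdF_closed)
 show "Sk k <= BdS k" proof (rule Sk_least)
  show "BdS k <= car CB" using BdS_sub_Sk unfolding Sk_def by blast
  show "\<zero>\<^bsub>CB\<^esub> : BdS k" using M.cyclic_sum_zero unfolding BdS_def fsR_sel by blast
  show "!!U V. U : BdS k ==> V : BdS k ==> U \<oplus>\<^bsub>CB\<^esub> V : BdS k"
   using M.cyclic_sum_add[OF v] unfolding BdS_def fsR_sel by blast
  fix e psi and n c :: "nat => nat"
  assume "psi : DL p R e" "F.wt n = F.wt c + k" "!!i. i : {1..r} ==> c i < p ^ e"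
  thus "ind e c (\<iota> (psi (F.mono n))) : BdS k" by (rule ind_gen_BdS)
 qed
qed

end

section \<open>Bernstein-Sato roots\<close>

lemma Zp_abelian_monoid: assumes p: "p > 0" shows "abelian_monoid (Zp p)" proof (rule abelian_monoidI)
 have ops: "x \<oplus>\<^bsub>Zp p\<^esub> y = (%e. (x e + y e) mod int p ^ e)" "\<zero>\<^bsub>Zp p\<^esub> = (%e. 0)" for x y
  by (simp_all add: Zp_def)
 show "\<zero>\<^bsub>Zp p\<^esub> : car (Zp p)" using p unfolding Zp_carrier ops by simp
 show "\<zero>\<^bsub>Zp p\<^esub> \<oplus>\<^bsub>Zp p\<^esub> x = x" if "x : car (Zp p)" for x
  using that unfolding ops Zp_carrier by (auto simp: fun_eq_iff)
 show "(x \<oplus>\<^bsub>Zp p\<^esub> y) \<oplus>\<^bsub>Zp p\<^esub> z = x \<oplus>\<^bsub>Zp p\<^esub> (y \<oplus>\<^bsub>Zp p\<^esub> z)" for x y z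
  unfolding ops by (simp add: mod_add_left_eq mod_add_right_eq add.assoc)
 show "x \<oplus>\<^bsub>Zp p\<^esub> y = y \<oplus>\<^bsub>Zp p\<^esub> x" for x y unfolding ops by (simp add: add.commute)
 fix x y assume x: "x : car (Zp p)" and y: "y : car (Zp p)"
 show "x \<oplus>\<^bsub>Zp p\<^esub> y : car (Zp p)" unfolding Zp_carrier ops proof (intro allI conjI)
  fix e
  show "(x (Suc e) + y (Suc e)) mod int p ^ Suc e mod int p ^ e = (x e + y e) mod int p ^ e"
   using Zp_mod[OF x, of e "Suc e"] Zp_mod[OF y, of e "Suc e"]
   by (simp add: mod_mod_cancel mod_add_eq[of "x (Suc e)" "int p ^ e" "y (Suc e)", symmetric])
 qed (use p in simp_all)
qed

lemma Zp_finsum: assumes p: "p > 0" and v: "v : J \<rightarrow> car (Zp p)" and J: "finite J"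
 shows "(\<Oplus>\<^bsub>Zp p\<^esub>i\<in>J. v i) : car (Zp p)" "(\<Oplus>\<^bsub>Zp p\<^esub>i\<in>J. v i) k = int ((\<Sum>i\<in>J. trunc (v i) k) mod p ^ k)"
proof -
 interpret Z: abelian_monoid "Zp p" by (rule Zp_abelian_monoid[OF p])
 show "(\<Oplus>\<^bsub>Zp p\<^esub>i\<in>J. v i) : car (Zp p)" using v by (rule Z.finsum_closed)
 show "(\<Oplus>\<^bsub>Zp p\<^esub>i\<in>J. v i) k = int ((\<Sum>i\<in>J. trunc (v i) k) mod p ^ k)" using J v proof (induction J)
  case empty show ?case unfolding Z.finsum_empty by (simp add: Zp_def)
 next
  case (insert i J)
  hence c: "v : J \<rightarrow> car (Zp p)" "v i : car (Zp p)" by auto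
  have "(\<Oplus>\<^bsub>Zp p\<^esub>i\<in>insert i J. v i) = v i \<oplus>\<^bsub>Zp p\<^esub> (\<Oplus>\<^bsub>Zp p\<^esub>i\<in>J. v i)"
   using insert.hyps c by (intro Z.finsum_insert) auto
  hence "(\<Oplus>\<^bsub>Zp p\<^esub>i\<in>insert i J. v i) k = (v i k + (\<Oplus>\<^bsub>Zp p\<^esub>i\<in>J. v i) k) mod int p ^ k"
   by (simp add: Zp_def)
  also have "... = int ((trunc (v i) k + (\<Sum>i\<in>J. trunc (v i) k) mod p ^ k) mod p ^ k)"
   unfolding insert.IH[OF c(1)] by (simp add: int_trunc[OF c(2)] zmod_int)
  also have "(trunc (v i) k + (\<Sum>i\<in>J. trunc (v i) k) mod p ^ k) mod p ^ k = (\<Sum>i\<in>insert i J. trunc (v i) k) mod p ^ k"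
   using insert.hyps by (simp add: mod_add_right_eq)
  finally show ?case .
 qed
qed

lemma limitin_discrete: "limitin (discrete_topology Q) h l G \<longleftrightarrow> l : Q \<and> eventually (%e. h e = l) G" proof
 assume L: "limitin (discrete_topology Q) h l G"
 hence l: "l : Q" unfolding limitin_def by simp
 have "eventually (%e. h e : {l}) G" using L l unfolding limitin_def by (auto simp del: singleton_iff)
 thus "l : Q \<and> eventually (%e. h e = l) G" using l by simp
next
 assume "l : Q \<and> eventually (%e. h e = l) G"
 thus "limitin (discrete_topology Q) h l G" unfolding limitin_def by (auto elim: eventually_mono)
qed

text \<open>In a product of discrete spaces a sequence converges when each of its components is
  eventually constant.\<close>

lemma limitin_Zp: assumes p: "p > 0" and x: "x : car (Zp p)" and h: "!!e. h e : car (Zp p)"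
 shows "limitin (Zp_topology p) h x sequentially \<longleftrightarrow> (\<forall>k. eventually (%e. h e k = x k) sequentially)" proof -
 have t: "y : car (Zp p) ==> y : topspace (product_topology (%e. discrete_topology {0..<int p ^ e}) UNIV)" for y
  by (auto simp: Zp_carrier)
 show ?thesis unfolding Zp_topology_def limitin_subtopology limitin_componentwise limitin_discrete using x h t[OF h] by (auto simp: Zp_carrier)
qed

section \<open>Roots and the jumps of D^e I^n in residue classes\<close>

context bs_setup begin

lemma BS_set_eq: "BS_set p R F.I e = {n. \<not> F.Dn p e n <= F.Dn p e (Suc n)}"
 unfolding BS_set_def F.Dn_def[symmetric] using F.Dn_Suc_sub by blast

text \<open>The level of the jump and the modulus of the congruence are tied to the same k, which
  leaves one condition for each k.\<close>

definition Good :: "(nat => int) => nat => bool" where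
 "Good x k \<longleftrightarrow> (\<exists>n. int (n mod p ^ k) = x k \<and> \<not> F.Dn p k n <= F.Dn p k (Suc n))"

lemma Zp_of_nat: "Zp_of_int p (int n) k = int (n mod p ^ k)" by (simp add: Zp_of_int_def zmod_int)

text \<open>A jump at level e is a jump at every lower level k, by \<open>Dn_stable_level\<close>
  read backwards; so a sequence of jumps with limit x yields a jump in the class of x for each k.
  Conversely, one jump for each k makes up such a sequence.\<close>

lemma BS_root_iff: assumes x: "x : car (Zp p)" shows "BS_root p R F.I x \<longleftrightarrow> (\<forall>k. Good x k)" proof
 assume "BS_root p R F.I x"
 then obtain \<nu> where \<nu>: "!!e. \<nu> e : BS_set p R F.I e"
  and lim: "limitin (Zp_topology p) (%e. Zp_of_int p (int (\<nu> e))) x sequentially" unfolding BS_root_def by blast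
 show "\<forall>k. Good x k" proof
  fix k
  have "eventually (%e. Zp_of_int p (int (\<nu> e)) k = x k) sequentially"
   using lim unfolding limitin_Zp[OF p_pos x Zp_of_int_carrier[OF p_pos]] by blast
  then obtain E where E: "!!e. e \<ge> E ==> Zp_of_int p (int (\<nu> e)) k = x k" unfolding eventually_sequentially by blast
  define e where "e = max E k"
  have "\<not> F.Dn p e (\<nu> e) <= F.Dn p e (Suc (\<nu> e))" using \<nu>[of e] unfolding BS_set_eq by blast
  hence "\<not> F.Dn p k (\<nu> e) <= F.Dn p k (Suc (\<nu> e))"
   using F.Dn_stable_level[of k e p "\<nu> e" "Suc (\<nu> e)"] by (auto simp: e_def)
  moreover have "int (\<nu> e mod p ^ k) = x k" using E[of e] by (simp add: e_def Zp_of_nat)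
  ultimately show "Good x k" unfolding Good_def by blast
 qed
next
 assume "\<forall>k. Good x k"
 hence "\<forall>k. \<exists>n. int (n mod p ^ k) = x k \<and> \<not> F.Dn p k n <= F.Dn p k (Suc n)" unfolding Good_def .
 then obtain \<nu> where \<nu>: "!!k. int (\<nu> k mod p ^ k) = x k" "!!k. \<not> F.Dn p k (\<nu> k) <= F.Dn p k (Suc (\<nu> k))"
  by metis
 have "eventually (%e. Zp_of_int p (int (\<nu> e)) k = x k) sequentially" for k unfolding eventually_sequentially proof (intro exI allI impI)
  fix e assume ke: "k <= e"
  have "x k = x e mod int p ^ k" by (rule Zp_mod[OF x ke, symmetric])
  also have "... = int (\<nu> e) mod int p ^ e mod int p ^ k" unfolding \<nu>(1)[of e, symmetric] by (simp add: zmod_int)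
  also have "... = int (\<nu> e) mod int p ^ k" by (rule mod_mod_cancel) (rule le_imp_power_dvd[OF ke])
  finally show "Zp_of_int p (int (\<nu> e)) k = x k" by (simp add: Zp_of_int_def)
 qed
 hence "limitin (Zp_topology p) (%e. Zp_of_int p (int (\<nu> e))) x sequentially"
  unfolding limitin_Zp[OF p_pos x Zp_of_int_carrier[OF p_pos]] by blast
 moreover have "\<nu> e : BS_set p R F.I e" for e unfolding BS_set_eq using \<nu>(2) by blast
 ultimately show "BS_root p R F.I x" unfolding BS_root_def using x by blast
qed

definition SigF :: "((nat => int) => int) => ((nat => nat => int) => 'b)" where
 "SigF H = Fp_scale (Zp_space p r) B (Sigma_fun p r H) \<one>\<^bsub>CB\<^esub>"

lemma Sig_sum: assumes z: "z : Ypts p r" shows "(\<Oplus>\<^bsub>Zp p\<^esub>i\<in>{1..r}. z i) : car (Zp p)"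
  and "(\<Oplus>\<^bsub>Zp p\<^esub>i\<in>{1..r}. z i) k = int (F.wt (tr k z) mod p ^ k)"
 using Zp_finsum[OF p_pos, of z "{1..r}"] Ypts_D[OF z] by (auto simp: F.wt_def tr_def)

lemma SigF_val: "z : Ypts p r ==> H (\<Oplus>\<^bsub>Zp p\<^esub>i\<in>{1..r}. z i) = int m ==> SigF H z = [m] \<cdot> \<one>"
 by (simp add: SigF_def Fp_scale_def Sigma_fun_def Cfun_ops add_pow_def int_pow_int)

lemma Sigma_closed: assumes H: "H : car (Cfun (Zp_topology p) (Fp p))" shows "SigF H : car CB" proof -
 interpret CB: ring CB by (rule ring_CB)
 obtain k where Hk: "H : car (Zp p) \<rightarrow>\<^sub>E car (Fp p)"
   "!!x y. x : car (Zp p) ==> y : car (Zp p) ==> x k = y k ==> H x = H y"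
  using H unfolding Cfun_Zp_iff[OF p_pos] by blast
 have "Sigma_fun p r H : car (CF p r (Fp p))" proof (rule CF_I[OF p_pos])
  show "Sigma_fun p r H : Ypts p r \<rightarrow>\<^sub>E car (Fp p)" using Hk(1) Sig_sum(1) unfolding Sigma_fun_def by (intro PiE_I) auto
  show "loc_const p r k (Sigma_fun p r H)" proof (rule loc_constI)
   fix x y assume x: "x : Ypts p r" and y: "y : Ypts p r" and c: "cong_pts r k x y"
   have "F.wt (tr k x) = F.wt (tr k y)" by (rule F.wt_cong) (rule tr_cong[OF c])
   hence "(\<Oplus>\<^bsub>Zp p\<^esub>i\<in>{1..r}. x i) k = (\<Oplus>\<^bsub>Zp p\<^esub>i\<in>{1..r}. y i) k"
    unfolding Sig_sum(2)[OF x] Sig_sum(2)[OF y] by (simp only:)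
   from Hk(2)[OF Sig_sum(1)[OF x] Sig_sum(1)[OF y] this]
   show "Sigma_fun p r H x = Sigma_fun p r H y" unfolding Sigma_fun_def restrict_apply'[OF x] restrict_apply'[OF y] .
  qed
 qed
 thus ?thesis unfolding SigF_def by (rule Fp_scale_CF[OF ring_axioms p_pos _ CB.one_closed])
qed

lemma Fp_nat: "m : car (Fp p) ==> \<exists>n. m = int n \<and> n < p"
 unfolding Fp_carrier[OF p_gt1] by (intro exI[of _ "nat m"]) auto

text \<open>With q = p^k, f^c is f^(c mod q) times the q-th power f^(q (c div q)), and
  \<open>Dn_mult_mono\<close> adds the weight of the latter.\<close>

lemma Dn_mod: assumes n: "F.wt c = n" and t: "F.mono (%i. c i mod p ^ k) : F.Dn p k (Suc (F.wt (%i. c i mod p ^ k)))"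
 shows "F.mono c : F.Dn p k (Suc n)" proof -
 define d where "d i = c i div p ^ k" for i
 have sp: "c i = c i mod p ^ k + d i * p ^ k" for i unfolding d_def by (rule mod_div_mult_eq[symmetric])
 have m: "F.mono c = F.mono (%i. c i mod p ^ k) \<otimes>\<^bsub>R\<^esub> F.mono (%i. d i * p ^ k)"
  unfolding F.mono_add[symmetric] by (rule F.mono_cong) (rule sp)
 have "n = F.wt (%i. c i mod p ^ k + d i * p ^ k)" unfolding n[symmetric] by (rule F.wt_cong) (rule sp)
 also have "... = F.wt (%i. c i mod p ^ k) + F.wt d * p ^ k" unfolding F.wt_add by (simp add: F.wt_def sum_distrib_right)
 finally have "n = F.wt (%i. c i mod p ^ k) + F.wt d * p ^ k" . thus ?thesis using F.Dn_mult_mono[OF t, of d] unfolding m by simp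
qed

text \<open>Operators of level k map D^k I^m into itself, so the inclusion is decided on
  monomials.\<close>

lemma Dn_sub_mono: assumes "!!c. F.wt c = n ==> F.mono c : F.Dn p k m" shows "F.Dn p k n <= F.Dn p k m" proof
 fix y assume "y : F.Dn p k n"
 thus "y : F.Dn p k m" proof (induction rule: F.Dn_induct)
  case zero show ?case by (rule additive_subgroup.zero_closed[OF ideal.axioms(1)[OF F.Dn_ideal]])
 next
  case (gen phi c) show ?case by (rule F.Dn_DiffOp[OF gen(1) assms[OF gen(2)]])
 next
  case (add x y)
  thus ?case using additive_subgroup.a_closed[OF ideal.axioms(1)[OF F.Dn_ideal] add(3,4)] by (simp only:)
 qed
qed

text \<open>If H x were nonzero, membership in S^1 would put m f^a, with m invertible modulo p, into
  D^k I^(|a|+1) for all a whose weight lies in the class of x, and that class would contain no jump.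
  If conversely some class x + p^k Z_p contains no jump, its indicator function gives an element of
  S^1 without vanishing at x.\<close>

theorem BS_root_SigF: assumes x: "x : car (Zp p)" shows "BS_root p R F.I x \<longleftrightarrow>
  (\<forall>H\<in>car (Cfun (Zp_topology p) (Fp p)). SigF H : Sk 1 \<longrightarrow> H x = 0)" unfolding BS_root_iff[OF x]
proof (intro iffI ballI impI allI)
 fix H assume good: "\<forall>k. Good x k" and H: "H : car (Cfun (Zp_topology p) (Fp p))" and S: "SigF H : Sk 1"
 obtain k0 where Hk: "H : car (Zp p) \<rightarrow>\<^sub>E car (Fp p)"
   "!!x y. x : car (Zp p) ==> y : car (Zp p) ==> x k0 = y k0 ==> H x = H y"
  using H unfolding Cfun_Zp_iff[OF p_pos] by blast
 obtain e where e: "Sat 1 e (SigF H)" using S unfolding Sk_def by blast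
 define k where "k = max k0 e"
 have sat: "Sat 1 k (SigF H)" by (rule Sat_mono[OF Sigma_closed[OF H] e]) (simp add: k_def)
 obtain n where n: "int (n mod p ^ k) = x k" "\<not> F.Dn p k n <= F.Dn p k (Suc n)" using good unfolding Good_def by blast
 have "H x : car (Fp p)" using Hk(1) x by blast
 then obtain m where m: "H x = int m" "m < p" using Fp_nat by blast
 show "H x = 0" proof (rule ccontr)
  assume "H x ~= 0"
  hence m0: "0 < m" using m(1) by simp
  \<comment> \<open>By \<open>Dn_mod\<close> the residue a of c modulo p^k decides. The point
    \<open>ptn c\<close> has truncation a, and the sum of its coordinates agrees with n, hence with
    x, modulo p^k.\<close>
  have "F.mono c : F.Dn p k (Suc n)" if c: "F.wt c = n" for c proof (rule Dn_mod[OF c])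
   define a where "a i = c i mod p ^ k" for i
   have ta: "tr k (ptn c) i = a i" if "i : {1..r}" for i using that by (simp add: tr_ptn a_def)
   have wa: "F.wt (tr k (ptn c)) = F.wt a" and fa: "fpw (tr k (ptn c)) = fpw a" using F.wt_cong[OF ta] fpw_cong[OF ta] by auto
   have "F.wt a mod p ^ k = n mod p ^ k" unfolding c[symmetric] F.wt_def a_def by (rule mod_sum_eq)
   hence "(\<Oplus>\<^bsub>Zp p\<^esub>i\<in>{1..r}. ptn c i) k = x k" unfolding Sig_sum(2)[OF ptn_Ypts] wa n(1)[symmetric] by (simp only:)
   hence "(\<Oplus>\<^bsub>Zp p\<^esub>i\<in>{1..r}. ptn c i) k0 = x k0"
    by (rule Zp_eq_mono[OF Sig_sum(1)[OF ptn_Ypts] x, rotated]) (simp add: k_def)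
   hence "H (\<Oplus>\<^bsub>Zp p\<^esub>i\<in>{1..r}. ptn c i) = int m" using Hk(2)[OF Sig_sum(1)[OF ptn_Ypts] x] m(1) by (simp only:)
   hence Sv: "SigF H (ptn c) = [m] \<cdot> \<one>" by (rule SigF_val[OF ptn_Ypts])
   obtain d where d: "d : F.Dn p k (F.wt a + 1)" "SigF H (ptn c) \<otimes> fpw a = \<iota> d"
    using sat ptn_Ypts[of c] unfolding Sat_def using wa fa by fastforce
   have "\<iota> d = [m] \<cdot> \<iota> (F.mono a)" using d(2) unfolding Sv add_pow_mult_fpw[OF one_closed] by (simp add: \<iota>_mono)
   also have "... = \<iota> ([m] \<cdot>\<^bsub>R\<^esub> F.mono a)"
    by (rule additive_map(3)[OF R.abelian_group_axioms abelian_group_axioms, symmetric]) simp_all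
   finally have dm: "d = [m] \<cdot>\<^bsub>R\<^esub> F.mono a" using F.Dn_closed[OF d(1)] by (intro inj_onD[OF \<iota>_inj]) auto
   obtain m' :: nat where "[m'] \<cdot>\<^bsub>R\<^esub> d = F.mono a" using char_unit[OF m0 m(2), of "F.mono a"] unfolding dm by auto
   moreover have "[m'] \<cdot>\<^bsub>R\<^esub> d = ([m'] \<cdot>\<^bsub>R\<^esub> \<one>\<^bsub>R\<^esub>) \<otimes>\<^bsub>R\<^esub> d"
    using F.Dn_closed[OF d(1)] by (simp add: R.add_pow_ldistr)
   moreover have "([m'] \<cdot>\<^bsub>R\<^esub> \<one>\<^bsub>R\<^esub>) \<otimes>\<^bsub>R\<^esub> d : F.Dn p k (F.wt a + 1)"
    by (rule ideal.I_l_closed[OF F.Dn_ideal d(1)]) simp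
   ultimately have "F.mono a : F.Dn p k (Suc (F.wt a))" by (simp only: Suc_eq_plus1)
   thus "F.mono (%i. c i mod p ^ k) : F.Dn p k (Suc (F.wt (%i. c i mod p ^ k)))" unfolding a_def[abs_def] .
  qed
  thus False using n(2) Dn_sub_mono by blast
 qed
next
 fix k assume all: "\<forall>H\<in>car (Cfun (Zp_topology p) (Fp p)). SigF H : Sk 1 \<longrightarrow> H x = 0"
 show "Good x k" proof (rule ccontr)
  assume "\<not> Good x k"
  hence st: "F.Dn p k n <= F.Dn p k (Suc n)" if "int (n mod p ^ k) = x k" for n using that unfolding Good_def by blast
  define H where "H = (\<lambda>y\<in>car (Zp p). if y k = x k then 1 else (0::int))"
  have H: "H : car (Cfun (Zp_topology p) (Fp p))" unfolding Cfun_Zp_iff[OF p_pos] Fp_carrier[OF p_gt1]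
   using p_gt1 by (auto simp: H_def intro!: exI[of _ k])
  have val: "SigF H z = (if int (F.wt (tr k z) mod p ^ k) = x k then \<one> else \<zero>)" if z: "z : Ypts p r" for z
  proof (cases "int (F.wt (tr k z) mod p ^ k) = x k")
   case True
   hence "H (\<Oplus>\<^bsub>Zp p\<^esub>i\<in>{1..r}. z i) = int 1"
    unfolding H_def restrict_apply'[OF Sig_sum(1)[OF z]] Sig_sum(2)[OF z] by simp
   from SigF_val[of z H 1, OF z this] show ?thesis using True by simp
  next
   case False
   hence "H (\<Oplus>\<^bsub>Zp p\<^esub>i\<in>{1..r}. z i) = int 0"
    unfolding H_def restrict_apply'[OF Sig_sum(1)[OF z]] Sig_sum(2)[OF z] by simp
   from SigF_val[of z H 0, OF z this] show ?thesis using False by simp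
  qed
  have "Sat 1 k (SigF H)" unfolding Sat_def proof (intro conjI ballI)
   show "loc_const p r k (SigF H)" proof (rule loc_constI)
    fix z y assume z: "z : Ypts p r" and y: "y : Ypts p r" and c: "cong_pts r k z y"
    have w: "F.wt (tr k z) = F.wt (tr k y)" by (rule F.wt_cong) (rule tr_cong[OF c])
    show "SigF H z = SigF H y" unfolding val[OF z] val[OF y] w ..
   qed
   fix z assume z: "z : Ypts p r"
   show "\<exists>d\<in>F.Dn p k (F.wt (tr k z) + 1). SigF H z \<otimes> fpw (tr k z) = \<iota> d"
   proof (cases "int (F.wt (tr k z) mod p ^ k) = x k")
    case True
    have "(\<lambda>a\<in>car R. a) (F.mono (tr k z)) : F.Dn p k (F.wt (tr k z))" by (rule F.Dn_gen[OF R.DiffOp_level_one refl])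
    hence "F.mono (tr k z) : F.Dn p k (F.wt (tr k z))" by simp
    hence "F.mono (tr k z) : F.Dn p k (F.wt (tr k z) + 1)" using st[OF True] unfolding Suc_eq_plus1 by blast
    moreover have "SigF H z \<otimes> fpw (tr k z) = \<iota> (F.mono (tr k z))" unfolding val[OF z] if_P[OF True] \<iota>_mono by simp
    ultimately show ?thesis by blast
   next
    case False
    show ?thesis unfolding val[OF z] if_not_P[OF False] by (rule bexI[OF _ additive_subgroup.zero_closed[OF ideal.axioms(1)[OF F.Dn_ideal]]]) simp
   qed
  qed
  hence "SigF H : Sk 1" unfolding Sk_def using Sigma_closed[OF H] by blast
  hence "H x = 0" using all H by blast
  thus False using x by (simp add: H_def)
 qed
qed

end

section \<open>Comparison of the local cohomology modules\<close>

lemma restrict_CF: assumes "U : car (CF p r T)" shows "(\<lambda>x\<in>Ypts p r. U x) = U" proof -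
 have "U : extensional (Ypts p r)" using assms unfolding Cfun_def by simp thus ?thesis by (rule extensional_restrict)
qed

context bs_setup begin

lemma V_delta_image: "LamH ` VR 0 = Sk 0" "LamH ` VR 1 = Sk 1" using LamH_V_delta[of 0] LamH_V_delta[of 1] by simp_all

lemma V_delta_sub: "VR 0 <= car (HR)" "VR 1 <= car (HR)"
 using V_delta_H[of 0] V_delta_H[of 1] by simp_all

text \<open>Injectivity of \<open>LamH\<close> allows membership to be tested on values.\<close>

lemma V_delta_mem: assumes z: "z : car (HR)"
 shows "z : VR 0 \<longleftrightarrow> LamH z : Sk 0" "z : VR 1 \<longleftrightarrow> LamH z : Sk 1"
 unfolding V_delta_image[symmetric] using inj_on_image_mem_iff[OF LamH_inj z V_delta_sub(1)] inj_on_image_mem_iff[OF LamH_inj z V_delta_sub(2)]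
 by simp_all

lemma LamH_ops: assumes "x : car (HR)"
 shows "y : car (HR) ==> LamH (x \<oplus>\<^bsub>HR\<^esub> y) = LamH x \<oplus>\<^bsub>fsR\<^esub> LamH y"
  and "a : car (CD p r R) ==> LamH (a \<odot>\<^bsub>HR\<^esub> x) = a \<odot>\<^bsub>fsR\<^esub> LamH x"
 using LamH_hom assms unfolding left_module_hom_def by blast+

lemma V_delta_submodule: "submodule (VR 0) (CD p r R) (HR)" proof -
 interpret H: left_module "CD p r R" "HR" by (rule left_module_H)
 interpret M: left_module "CD p r R" fsR by (rule left_module_fsR)
 note sub = subsetD[OF V_delta_sub(1)]
 have Sk0: "U : Sk 0 ==> U : car CB" for U unfolding Sk_def by blast
 show ?thesis proof (rule H.submoduleI_left[OF V_delta_sub(1)])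
  have "LamH \<zero>\<^bsub>HR\<^esub> = \<zero>\<^bsub>fsR\<^esub>"
   by (rule additive_map(1)[OF left_module.axioms(2)[OF left_module_H] left_module.axioms(2)[OF left_module_fsR]])
    (simp_all add: LamH_closed fsR_sel(1) LamH_ops(1))
  thus "\<zero>\<^bsub>HR\<^esub> : VR 0"
   unfolding V_delta_mem(1)[OF H.M.zero_closed] using Sk_zero by (simp add: fsR_sel)
  fix x y assume x: "x : VR 0" and y: "y : VR 0"
  have "LamH x : Sk 0" "LamH y : Sk 0" using x y V_delta_mem(1) sub by blast+
  thus "x \<oplus>\<^bsub>HR\<^esub> y : VR 0"
   unfolding V_delta_mem(1)[OF H.M.a_closed[OF sub[OF x] sub[OF y]]] LamH_ops(1)[OF sub[OF x] sub[OF y]] fsR_sel by (rule Sk_add)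
 next
  fix a x assume a: "a : car (CD p r R)" and x: "x : VR 0"
  have Lx: "LamH x : Sk 0" using x V_delta_mem(1) sub by blast
  show "a \<odot>\<^bsub>HR\<^esub> x : VR 0"
   unfolding V_delta_mem(1)[OF H.smult_closed[OF a sub[OF x]]] LamH_ops(2)[OF sub[OF x] a] fsR_smult[OF a Sk0[OF Lx]] by (rule Sk_smult[OF a Lx])
 qed
qed

text \<open>V^1 delta is the kernel of \<open>LamH\<close> followed by the projection onto S^0 /
  S^1, so \<open>kernel_quotient\<close> yields the isomorphism. Its formula on cosets is recorded
  because it has to be the identification given by Theta and not just some isomorphism.\<close>

lemma Psi_exists:
 defines "M0 \<equiv> fsR\<lparr>carrier := Sk 0\<rparr>"
 shows "\<exists>\<Psi>. left_module_iso (CD p r R) (N_mod p r R f) (quot_module M0 (Sk 1)) \<Psi> \<and>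
  (\<forall>z\<in>VR 0. \<Psi> (VR 1 +>\<^bsub>V0_mod p r R f\<^esub> z) = Sk 1 +>\<^bsub>M0\<^esub> LamH z)" proof -
 have lmV: "left_module (CD p r R) (V0_mod p r R f)" unfolding V0_mod_def by (rule left_module_submodule[OF left_module_H V_delta_submodule])
 have lmM: "left_module (CD p r R) M0" unfolding M0_def by (rule left_module_submodule[OF left_module_fsR Sk_submodule])
 interpret V: left_module "CD p r R" "V0_mod p r R f" by (rule lmV)
 interpret M: left_module "CD p r R" M0 by (rule lmM)
 have S1: "submodule (Sk 1) (CD p r R) M0" proof (rule M.submoduleI_left)
  show "Sk 1 <= car M0" using Sk_antimono[of 0 1] by (simp add: M0_def)
  show "\<zero>\<^bsub>M0\<^esub> : Sk 1" using Sk_zero by (simp add: M0_def fsR_sel)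
  show "x \<oplus>\<^bsub>M0\<^esub> y : Sk 1" if "x : Sk 1" "y : Sk 1" for x y using Sk_add[OF that] by (simp add: M0_def fsR_sel)
  show "a \<odot>\<^bsub>M0\<^esub> x : Sk 1" if "a : car (CD p r R)" "x : Sk 1" for a x proof -
   have "x : car CB" using that(2) unfolding Sk_def by blast thus ?thesis using Sk_smult[OF that] by (simp add: M0_def fsR_smult that)
  qed
 qed
 define Q where "Q = quot_module M0 (Sk 1)"
 define pr where "pr U = Sk 1 +>\<^bsub>M0\<^esub> U" for U
 have prh: "left_module_hom (CD p r R) M0 Q pr" unfolding Q_def pr_def by (rule quot_module_left_module(1)[OF lmM S1])
 have pr0: "U : Sk 0 ==> pr U = \<zero>\<^bsub>Q\<^esub> \<longleftrightarrow> U : Sk 1" for U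
  unfolding Q_def pr_def by (rule quot_module_left_module(2)[OF lmM S1]) (simp add: M0_def)
 have Qm: "left_module (CD p r R) Q" and prc: "U : Sk 0 ==> pr U : car Q"
  and pra: "U : Sk 0 ==> V : Sk 0 ==> pr (U \<oplus>\<^bsub>fsR\<^esub> V) = pr U \<oplus>\<^bsub>Q\<^esub> pr V"
  and prs: "a : car (CD p r R) ==> U : Sk 0 ==> pr (a \<odot>\<^bsub>fsR\<^esub> U) = a \<odot>\<^bsub>Q\<^esub> pr U" for U V a
  using prh unfolding left_module_hom_def by (auto simp: M0_def)
 have Vsel: "car (V0_mod p r R f) = VR 0"
  "x \<oplus>\<^bsub>V0_mod p r R f\<^esub> y = x \<oplus>\<^bsub>HR\<^esub> y" "a \<odot>\<^bsub>V0_mod p r R f\<^esub> x = a \<odot>\<^bsub>HR\<^esub> x" for x y a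
  by (simp_all add: V0_mod_def)
 have LV: "z : VR 0 ==> LamH z : Sk 0" and VH: "z : VR 0 ==> z : car (HR)" for z
  using V_delta_image(1) V_delta_sub(1) by blast+
 interpret K: kernel_quotient "V0_mod p r R f" Q "%z. pr (LamH z)" "VR 1"
 proof (intro kernel_quotient.intro kernel_quotient_axioms.intro)
  show "abelian_group (V0_mod p r R f)" by (rule left_module.axioms(2)[OF lmV])
  show "abelian_group Q" by (rule left_module.axioms(2)[OF Qm])
  fix x assume x: "x : car (V0_mod p r R f)"
  thus "pr (LamH x) : car Q" unfolding Vsel by (intro prc LV)
  fix y assume y: "y : car (V0_mod p r R f)"
  show "pr (LamH (x \<oplus>\<^bsub>V0_mod p r R f\<^esub> y)) = pr (LamH x) \<oplus>\<^bsub>Q\<^esub> pr (LamH y)"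
   using x y unfolding Vsel by (simp only: LamH_ops(1)[OF VH VH] pra[OF LV LV])
 next
  have "VR 1 <= VR 0" using V_delta_mem V_delta_sub(2) Sk_antimono[of 0 1] by auto
  thus "VR 1 = {x : car (V0_mod p r R f). pr (LamH x) = \<zero>\<^bsub>Q\<^esub>}"
   unfolding Vsel using pr0[OF LV] V_delta_mem(2)[OF VH] by blast
 qed
 have hom: "left_module_hom (CD p r R) (quot_module (V0_mod p r R f) (VR 1)) Q K.quot_map" proof (rule K.quot_map_hom[OF Qm])
  fix a x assume a: "a : car (CD p r R)" and x: "x : car (V0_mod p r R f)"
  show "a \<odot>\<^bsub>V0_mod p r R f\<^esub> x : car (V0_mod p r R f)" by (rule V.smult_closed[OF a x])
  show "pr (LamH (a \<odot>\<^bsub>V0_mod p r R f\<^esub> x)) = a \<odot>\<^bsub>Q\<^esub> pr (LamH x)"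
   using x unfolding Vsel by (simp only: LamH_ops(2)[OF VH a] prs[OF a LV])
 qed
 have "K.quot_map ` car (quot_module (V0_mod p r R f) (VR 1)) = pr ` (LamH ` VR 0)"
  unfolding K.image_quot_map Vsel image_image ..
 also have "... = car Q" unfolding V_delta_image by (auto simp: Q_def quot_module_def A_RCOSETS_def' pr_def M0_def a_r_coset_def')
 finally have "bij_betw K.quot_map (car (quot_module (V0_mod p r R f) (VR 1))) (car Q)"
  unfolding bij_betw_def using K.inj_quot_map by blast
 hence "left_module_iso (CD p r R) (N_mod p r R f) Q K.quot_map" unfolding left_module_iso_def N_mod_def using hom by blast
 moreover have "K.quot_map (VR 1 +>\<^bsub>V0_mod p r R f\<^esub> z) = Sk 1 +>\<^bsub>M0\<^esub> LamH z" if "z : VR 0" for z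
  using K.quot_map_coset[of z] that unfolding Vsel pr_def by blast
 ultimately show ?thesis unfolding Q_def by blast
qed

end

section \<open>The isomorphism Theta and the map from H to H'\<close>

lemma (in unit_family) bs_setup_self: "bs_setup B p r B (%x. x) f (%phi. phi)" proof -
 have "(%x. x) : ring_hom B B" "(%phi. phi) : ring_hom (DiffOp p B) (DiffOp p B)" by (rule ring_hom_memI; simp)+
 thus ?thesis by (intro bs_setup.intro bs_setup_axioms.intro unit_family_axioms cring_axioms char_p)
   (use f_unit in \<open>auto intro: inj_onI\<close>)
qed

text \<open>For the identity of B, \<open>LamH_Theta\<close> says that Theta followed by
  \<open>LamH\<close> is the identity. So \<open>LamH\<close> is onto, and being injective it is the
  inverse of Theta.\<close>

lemma (in unit_family) Theta_iso:
 "left_module_iso (CD p r B) (fs_mod p r B f) (H_mod p r B f) (Theta p r B f)" proof -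
 interpret T: bs_setup B p r B "%x. x" f "%phi. phi" by (rule bs_setup_self)
 have CDm: "T.CD_map P = P" if "P : car (CD p r B)" for P unfolding T.CD_map_def by (rule restrict_CF[OF that])
 have fs: "car T.fsR = car (fs_mod p r B f)" "U \<oplus>\<^bsub>T.fsR\<^esub> V = U \<oplus>\<^bsub>fs_mod p r B f\<^esub> V"
  "P : car (CD p r B) ==> P \<odot>\<^bsub>T.fsR\<^esub> U = P \<odot>\<^bsub>fs_mod p r B f\<^esub> U" for U V P
  by (simp_all add: T.fsR_def restrict_scalars_def CDm)
 have hom: "left_module_hom (CD p r B) (H_mod p r B f) (fs_mod p r B f) T.LamH" unfolding left_module_hom_def
 proof (intro conjI ballI T.left_module_H left_module_fs)
  show "T.LamH : car (H_mod p r B f) \<rightarrow> car (fs_mod p r B f)" unfolding fs_mod_sel using T.LamH_closed by blast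
  show "T.LamH (x \<oplus>\<^bsub>H_mod p r B f\<^esub> y) = T.LamH x \<oplus>\<^bsub>fs_mod p r B f\<^esub> T.LamH y"
   if "x : car (H_mod p r B f)" "y : car (H_mod p r B f)" for x y unfolding T.LamH_ops(1)[OF that] by (rule fs(2))
  show "T.LamH (a \<odot>\<^bsub>H_mod p r B f\<^esub> x) = a \<odot>\<^bsub>fs_mod p r B f\<^esub> T.LamH x"
   if "a : car (CD p r B)" "x : car (H_mod p r B f)" for a x unfolding T.LamH_ops(2)[OF that(2,1)] by (rule fs(3)[OF that(1)])
 qed
 have U: "T.LamH (Theta p r B f U) = U" if "U : car (CF p r B)" for U unfolding T.LamH_Theta(2)[OF that] by (rule restrict_CF[OF that])
 have "T.LamH ` car (H_mod p r B f) = car (fs_mod p r B f)" proof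
  show "T.LamH ` car (H_mod p r B f) <= car (fs_mod p r B f)" using T.LamH_closed unfolding fs_mod_sel by blast
  show "car (fs_mod p r B f) <= T.LamH ` car (H_mod p r B f)" proof
   fix U assume "U : car (fs_mod p r B f)"
   hence c: "U : car (CF p r B)" by (simp only: fs_mod_sel)
   show "U : T.LamH ` car (H_mod p r B f)" using imageI[OF T.LamH_Theta(1)[OF c], of T.LamH] unfolding U[OF c] .
  qed
 qed
 hence "left_module_iso (CD p r B) (H_mod p r B f) (fs_mod p r B f) T.LamH"
  unfolding left_module_iso_def bij_betw_def using hom T.LamH_inj by blast
 thus "left_module_iso (CD p r B) (fs_mod p r B f) (H_mod p r B f) (Theta p r B f)"
  by (rule left_module_iso_inverse) (use T.LamH_Theta(1) U in \<open>simp_all add: fs_mod_sel\<close>)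
qed

context bs_setup begin

definition Hin :: "((nat multiset => 'a) \<times> (nat multiset => 'a)) set set =>
  ((nat multiset => 'b) \<times> (nat multiset => 'b)) set set" where
 "Hin Z = (\<Union>C\<in>Z. cech_bound B r u +>\<^bsub>cech_top p r B u\<^esub> loc_map (MPoly B r) (cech_set B r u) (mpoly_map \<iota>) C)"

text \<open>A fraction and its image over B have the same expansion, so \<open>Hin\<close> followed
  by the \<open>LamH\<close> of H' is the \<open>LamH\<close> of H. Both are injective, and each
  claim follows by comparing values under the \<open>LamH\<close> of H'.\<close>

lemma Hin_props: shows "left_module_hom (CD p r R) (HR) (restrict_scalars CD_map (H_mod p r B u)) Hin"
  and "inj_on Hin (car (HR))" and "!!z. z : car (HR) ==> Theta p r B u (LamH z) = Hin z" proof -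
 interpret T: bs_setup B p r B "%x. x" u "%phi. phi" by (rule bs_setup_self)
 let ?h = "mpoly_map \<iota>"
 have hh: "?h : ring_hom A T.A" by (rule R.mpoly_map_hom[OF cring_axioms \<iota>_hom])
 interpret h: ring_hom_cring A T.A ?h by (intro ring_hom_cring.intro ring_hom_cring_axioms.intro A.cring_axioms T.A.cring_axioms hh)
 have hgi: "?h (gi i) = T.gi i" if i: "i : {1..r}" for i proof -
  have c: "mon R (f i) {#} : car A" "mon R \<one>\<^bsub>R\<^esub> {#i#} : car A" using i f_car by auto
  have "?h (gi i) = ?h (mon R (f i) {#}) \<ominus>\<^bsub>T.A\<^esub> ?h (mon R \<one>\<^bsub>R\<^esub> {#i#})"
   unfolding gi_eq[OF i] A.minus_eq T.A.minus_eq by (simp only: h.hom_add[OF c(1) A.a_inv_closed[OF c(2)]] h.hom_a_inv[OF c(2)])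
  also have "... = T.gi i" unfolding T.gi_eq[OF i] by (simp only: R.mpoly_map_mon[where h = \<iota> and B = B, OF \<iota>.hom_zero] \<iota>.hom_one)
  finally show ?thesis .
 qed
 have hg: "?h g = T.g" proof -
  have "?h g = (\<Otimes>\<^bsub>T.A\<^esub>i\<in>{1..r}. ?h (gi i))" unfolding g_eq by (subst h.hom_finprod) (auto simp: comp_def)
  also have "... = T.g" unfolding T.g_eq by (rule T.A.finprod_cong') (use hgi in auto)
  finally show ?thesis .
 qed
 have hS: "?h s : T.S" if s: "s : S" for s proof -
  obtain n :: nat where "s = g [^]\<^bsub>A\<^esub> n" using s unfolding S_eq by blast
  hence "?h s = T.g [^]\<^bsub>T.A\<^esub> n" using g_closed by (simp add: hg) thus ?thesis using T.g_pow_S by simp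
 qed
 let ?m = "loc_map (MPoly B r) (cech_set B r u) ?h"
 have lm: "?m (L.frac a s) = T.L.frac (?h a) (?h s)" if "a : car A" "s : S" for a s
  by (rule L.loc_map_frac[OF T.L.mult_set_axioms hh hS that])
 have key: "?m w : car T.AS \<and> T.Lam (?m w) = Lam w" if w: "w : car AS" for w proof -
  obtain a s where as: "a : car A" "s : S" "w = L.frac a s" using w unfolding L.carrier_Loc by blast
  have ha: "?h a : car T.A" using as(1) by simp
  have c: "?m w : car T.AS" unfolding as(3) lm[OF as(1,2)] by (rule T.L.frac_closed[OF ha hS[OF as(2)]])
  \<comment> \<open>Over B itself coefficients are not changed by the expansion, so expanding the
    image over B repeats what \<open>ex\<close> has already done.\<close>
  have exT: "T.ex b = b" for b by (simp add: T.ex_def mpoly_map_def)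
  have "T.exL (?m w) = exL w" unfolding as(3) lm[OF as(1,2)] T.exL_frac[OF ha hS[OF as(2)]] exL_frac[OF as(1,2)] exT ex_def ..
  hence "T.Lam (?m w) = Lam w" unfolding T.Lam_def Lam_def T.isLam_def isLam_def by simp thus ?thesis using c by blast
 qed
 have HZ: "Hin (coset w) = T.coset (?m w)" if w: "w : car AS" for w proof -
  have "T.coset (?m C) = T.coset (?m w)" if "C : coset w" for C proof -
   have C: "C : car AS" "Lam C = Lam w" using that coset_eq[OF w] by auto
   have e: "T.Lam (?m C) = T.Lam (?m w)" using key[OF C(1)] key[OF w] C(2) by simp
   show ?thesis unfolding T.coset_eq[OF conjunct1[OF key[OF C(1)]]] T.coset_eq[OF conjunct1[OF key[OF w]]] e ..
  qed
  hence "Hin (coset w) = (\<Union>C\<in>coset w. T.coset (?m w))" unfolding Hin_def by (rule SUP_cong[OF refl])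
  moreover have "coset w ~= {}" using w by (auto simp: coset_eq)
  ultimately show ?thesis by simp
 qed
 have Hc: "Hin z : car (H_mod p r B u) \<and> T.LamH (Hin z) = LamH z" if z: "z : car (HR)" for z proof -
  obtain w where w: "w : car AS" "z = coset w" using z unfolding H_carrier loc_coh_carrier by blast
  have "Hin z : car (H_mod p r B u)" unfolding w(2) HZ[OF w(1)] T.H_carrier T.loc_coh_carrier using key[OF w(1)] by blast
  moreover have "T.LamH (Hin z) = LamH z"
   unfolding w(2) HZ[OF w(1)] LamH_coset[OF w(1)] T.LamH_coset[OF conjunct1[OF key[OF w(1)]]] using key[OF w(1)] by blast
  ultimately show ?thesis by blast
 qed
 show inj: "inj_on Hin (car (HR))" proof (rule inj_onI)
  fix x y assume x: "x : car (HR)" and y: "y : car (HR)" and e: "Hin x = Hin y"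
  have "LamH x = LamH y" using Hc[OF x] Hc[OF y] e by simp
  thus "x = y" by (rule inj_onD[OF LamH_inj _ x y])
 qed
 have eqI: "x = y" if "T.LamH x = T.LamH y" "x : car (H_mod p r B u)" "y : car (H_mod p r B u)" for x y
  by (rule inj_onD[OF T.LamH_inj that])
 show "Theta p r B u (LamH z) = Hin z" if z: "z : car (HR)" for z proof (rule eqI)
  have c: "LamH z : car CB" by (rule LamH_closed[OF z])
  show "Theta p r B u (LamH z) : car (H_mod p r B u)" by (rule T.LamH_Theta(1)[OF c])
  show "T.LamH (Theta p r B u (LamH z)) = T.LamH (Hin z)" unfolding T.LamH_Theta(2)[OF c] conjunct2[OF Hc[OF z]] by (rule restrict_CF[OF c])
 qed (use Hc[OF z] in blast)
 interpret H: left_module "CD p r R" "HR" by (rule left_module_H)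
 interpret TH: left_module "CD p r B" "H_mod p r B u" by (rule T.left_module_H)
 have rs: "left_module (CD p r R) (restrict_scalars CD_map (H_mod p r B u))"
  by (rule left_module_restrict_scalars[OF T.left_module_H CD_map_hom ring_CDR])
 have CDm: "T.CD_map P = P" if "P : car (CD p r B)" for P unfolding T.CD_map_def by (rule restrict_CF[OF that])
 show "left_module_hom (CD p r R) (HR) (restrict_scalars CD_map (H_mod p r B u)) Hin" unfolding left_module_hom_def
 proof (intro conjI ballI left_module_H rs)
  show "Hin : car (HR) \<rightarrow> car (restrict_scalars CD_map (H_mod p r B u))"
   using Hc by (auto simp: restrict_scalars_def)
  fix x y assume x: "x : car (HR)" and y: "y : car (HR)"
  have "Hin (x \<oplus>\<^bsub>HR\<^esub> y) = Hin x \<oplus>\<^bsub>H_mod p r B u\<^esub> Hin y" proof (rule eqI)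
   note xy = H.M.a_closed[OF x y]
   show "T.LamH (Hin (x \<oplus>\<^bsub>HR\<^esub> y)) = T.LamH (Hin x \<oplus>\<^bsub>H_mod p r B u\<^esub> Hin y)"
    unfolding conjunct2[OF Hc[OF xy]] LamH_ops(1)[OF x y]
     T.LamH_ops(1)[OF conjunct1[OF Hc[OF x]] conjunct1[OF Hc[OF y]]] conjunct2[OF Hc[OF x]] conjunct2[OF Hc[OF y]]
     fsR_sel T.fsR_sel ..
  qed (use Hc[OF H.M.a_closed[OF x y]] Hc[OF x] Hc[OF y] in auto)
  thus "Hin (x \<oplus>\<^bsub>HR\<^esub> y) = Hin x \<oplus>\<^bsub>restrict_scalars CD_map (H_mod p r B u)\<^esub> Hin y"
   by (simp add: restrict_scalars_def)
 next
  fix a x assume a: "a : car (CD p r R)" and x: "x : car (HR)"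
  have ca: "CD_map a : car (CD p r B)" by (rule ring_hom_closed[OF CD_map_hom a])
  have hx: "Hin x : car (H_mod p r B u)" "T.LamH (Hin x) = LamH x" using Hc[OF x] by blast+
  have "Hin (a \<odot>\<^bsub>HR\<^esub> x) = CD_map a \<odot>\<^bsub>H_mod p r B u\<^esub> Hin x" proof (rule eqI)
   note ax = H.smult_closed[OF a x]
   show "T.LamH (Hin (a \<odot>\<^bsub>HR\<^esub> x)) = T.LamH (CD_map a \<odot>\<^bsub>H_mod p r B u\<^esub> Hin x)"
    unfolding conjunct2[OF Hc[OF ax]] LamH_ops(2)[OF x a] T.LamH_ops(2)[OF hx(1) ca] hx(2)
     fsR_smult[OF a LamH_closed[OF x]] T.fsR_smult[OF ca LamH_closed[OF x]] CDm[OF ca] ..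
   show "Hin (a \<odot>\<^bsub>HR\<^esub> x) : car (H_mod p r B u)" using Hc[OF ax] by blast
   show "CD_map a \<odot>\<^bsub>H_mod p r B u\<^esub> Hin x : car (H_mod p r B u)" by (rule TH.smult_closed[OF ca hx(1)])
  qed
  thus "Hin (a \<odot>\<^bsub>HR\<^esub> x) = a \<odot>\<^bsub>restrict_scalars CD_map (H_mod p r B u)\<^esub> Hin x"
   by (simp add: restrict_scalars_def)
 qed
qed

end

section \<open>Specialization to R and R_f\<close>

lemma Rf_mult_set: assumes "cring R" "f : {1..r} \<rightarrow> car R" shows "mult_set R (f_powers R r f)" proof -
 interpret cring R by fact
 have c: "(\<Otimes>\<^bsub>R\<^esub>i\<in>{1..r}. f i) : car R" using assms(2) by (rule finprod_closed)
 show ?thesis proof (unfold_locales)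
  show "f_powers R r f <= car R" unfolding f_powers_def powers_def using c by auto
  show "\<one>\<^bsub>R\<^esub> : f_powers R r f" unfolding f_powers_def powers_def by (rule range_eqI[of _ _ 0]) simp
  fix s t assume "s : f_powers R r f" "t : f_powers R r f"
  then obtain n m :: nat where "s = (\<Otimes>\<^bsub>R\<^esub>i\<in>{1..r}. f i) [^]\<^bsub>R\<^esub> n" "t = (\<Otimes>\<^bsub>R\<^esub>i\<in>{1..r}. f i) [^]\<^bsub>R\<^esub> m"
   unfolding f_powers_def powers_def by blast
  thus "s \<otimes>\<^bsub>R\<^esub> t : f_powers R r f"
   unfolding f_powers_def powers_def by (intro range_eqI[of _ _ "n + m"]) (simp add: nat_pow_mult[OF c])
 qed
qed

text \<open>Each f_i divides the product of all f_j, which becomes a unit, and so is a unit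
  itself.\<close>

lemma Rf_unit_family: assumes R: "cring R" and p: "Factorial_Ring.prime p" and ch: "char_ring R p" and f: "f : {1..r} \<rightarrow> car R"
 shows "unit_family (Rf R r f) p r (%i. Rf_incl R r f (f i))" proof -
 interpret M: mult_set R "f_powers R r f" by (rule Rf_mult_set[OF R f])
 interpret B: cring "Rf R r f" by (rule M.cring_Loc)
 have h: "Rf_incl R r f : ring_hom R (Rf R r f)" by (rule M.loc_incl_hom)
 interpret h: ring_hom_cring R "Rf R r f" "Rf_incl R r f" by (intro ring_hom_cring.intro ring_hom_cring_axioms.intro R B.cring_axioms h)
 have charR: "[p] \<cdot>\<^bsub>R\<^esub> \<one>\<^bsub>R\<^esub> = \<zero>\<^bsub>R\<^esub>" using ch unfolding char_ring_def by simp
 have "[p] \<cdot>\<^bsub>Rf R r f\<^esub> Rf_incl R r f \<one>\<^bsub>R\<^esub> = Rf_incl R r f ([p] \<cdot>\<^bsub>R\<^esub> \<one>\<^bsub>R\<^esub>)"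
  by (rule additive_map(3)[OF M.abelian_group_axioms B.abelian_group_axioms, symmetric]) simp_all
 hence charB: "[p] \<cdot>\<^bsub>Rf R r f\<^esub> \<one>\<^bsub>Rf R r f\<^esub> = \<zero>\<^bsub>Rf R r f\<^esub>" by (simp add: charR)
 have U: "Rf_incl R r f (f i) : Units (Rf R r f)" if i: "i : {1..r}" for i proof -
  let ?b = "\<Otimes>\<^bsub>R\<^esub>j\<in>{1..r} - {i}. f j"
  have fc: "f i : car R" "?b : car R" using f i by (auto intro!: M.finprod_closed)
  have "(\<Otimes>\<^bsub>R\<^esub>j\<in>insert i ({1..r} - {i}). f j) = f i \<otimes>\<^bsub>R\<^esub> ?b"
   by (rule M.finprod_insert) (use f i in auto)
  hence e: "(\<Otimes>\<^bsub>R\<^esub>j\<in>{1..r}. f j) = f i \<otimes>\<^bsub>R\<^esub> ?b" using i by (simp add: insert_absorb)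
  have "f i \<otimes>\<^bsub>R\<^esub> ?b : f_powers R r f"
   unfolding f_powers_def powers_def e by (rule range_eqI[of _ _ "1::nat"]) (use fc in simp)
  hence "Rf_incl R r f (f i \<otimes>\<^bsub>R\<^esub> ?b) : Units (Rf R r f)" by (rule M.loc_incl_inverse(1))
  hence "Rf_incl R r f (f i) \<otimes>\<^bsub>Rf R r f\<^esub> Rf_incl R r f ?b : Units (Rf R r f)" using fc by simp
  thus ?thesis by (rule B.unit_factor) (use fc in simp_all)
 qed
 show ?thesis by (intro unit_family.intro unit_family_axioms.intro B.cring_axioms p charB U)
qed

lemma (in cring) nonzero_divisor_mult: assumes x: "nonzero_divisor R x" and y: "nonzero_divisor R y" shows "nonzero_divisor R (x \<otimes> y)" proof -
 have c: "x : car R" "y : car R" using x y unfolding nonzero_divisor_def by blast+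
 have "b = \<zero>" if b: "b : car R" and z: "x \<otimes> y \<otimes> b = \<zero>" for b proof -
  have "x \<otimes> (y \<otimes> b) = \<zero>" using z m_assoc[OF c b] by (rule trans[OF sym, rotated])
  moreover have "y \<otimes> b : car R" by (rule m_closed[OF c(2) b])
  ultimately have "y \<otimes> b = \<zero>" using x unfolding nonzero_divisor_def by blast
  thus ?thesis using y b unfolding nonzero_divisor_def by blast
 qed
 thus ?thesis unfolding nonzero_divisor_def using m_closed[OF c] by blast
qed

lemma (in cring) nonzero_divisor_one: "nonzero_divisor R \<one>" unfolding nonzero_divisor_def by simp

lemma (in cring) nonzero_divisor_finprod: assumes "finite J" "!!i. i : J ==> nonzero_divisor R (f i)"
 shows "nonzero_divisor R (\<Otimes>i\<in>J. f i)" using assms proof (induction J)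
 case (insert i J)
 have f: "f : J \<rightarrow> car R" "f i : car R" using insert.prems unfolding nonzero_divisor_def by blast+
 have "(\<Otimes>i\<in>insert i J. f i) = f i \<otimes> (\<Otimes>i\<in>J. f i)" by (rule finprod_insert[OF insert.hyps f])
 thus ?case using nonzero_divisor_mult[of "f i" "\<Otimes>i\<in>J. f i"] insert.IH insert.prems by simp
qed (simp add: nonzero_divisor_one)

lemma (in cring) nonzero_divisor_pow:
 "nonzero_divisor R x ==> nonzero_divisor R (x [^] (n::nat))" by (induction n) (simp_all add: nonzero_divisor_one nonzero_divisor_mult)

text \<open>Powers of a product of nonzero divisors are nonzero divisors; this gives the injectivity
  of the map from R to R_f.\<close>

lemma Rf_bs_setup: assumes R: "cring R" and p: "Factorial_Ring.prime p" and ch: "char_ring R p" and f: "f : {1..r} \<rightarrow> car R"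
  and nz: "!!i. i : {1..r} ==> nonzero_divisor R (f i)"
 shows "bs_setup (Rf R r f) p r R (Rf_incl R r f) f (DiffOp_loc p R (f_powers R r f))" proof -
 interpret M: mult_set R "f_powers R r f" by (rule Rf_mult_set[OF R f])
 interpret U: unit_family "Rf R r f" p r "%i. Rf_incl R r f (f i)" by (rule Rf_unit_family[OF R p ch f])
 have inj: "inj_on (Rf_incl R r f) (car R)" proof (rule inj_onI)
  fix a b assume a: "a : car R" and b: "b : car R" and e: "Rf_incl R r f a = Rf_incl R r f b"
  then obtain s where s: "s : f_powers R r f" "s \<otimes>\<^bsub>R\<^esub> a = s \<otimes>\<^bsub>R\<^esub> b" using M.loc_incl_eq_iff by blast
  have "nonzero_divisor R s" using s(1) M.nonzero_divisor_pow[OF M.nonzero_divisor_finprod[of "{1..r}" f]] nz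
   unfolding f_powers_def powers_def by blast
  moreover have "s \<otimes>\<^bsub>R\<^esub> (a \<ominus>\<^bsub>R\<^esub> b) = \<zero>\<^bsub>R\<^esub>" proof -
   have sc: "s : car R" by (rule M.S_car[OF s(1)])
   have "s \<otimes>\<^bsub>R\<^esub> (a \<ominus>\<^bsub>R\<^esub> b) = s \<otimes>\<^bsub>R\<^esub> a \<ominus>\<^bsub>R\<^esub> s \<otimes>\<^bsub>R\<^esub> b"
    unfolding M.minus_eq using sc a b by (simp add: M.r_distr M.r_minus)
   also have "... = \<zero>\<^bsub>R\<^esub>" unfolding s(2) M.minus_eq by (rule M.r_neg[OF M.m_closed[OF sc b]])
   finally show ?thesis .
  qed
  ultimately have "a \<ominus>\<^bsub>R\<^esub> b = \<zero>\<^bsub>R\<^esub>" using M.minus_closed[OF a b] unfolding nonzero_divisor_def by blast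
  thus "a = b" using a b by (simp only: M.r_right_minus_eq)
 qed
 show ?thesis proof (intro bs_setup.intro bs_setup_axioms.intro)
  show "[p] \<cdot>\<^bsub>R\<^esub> \<one>\<^bsub>R\<^esub> = \<zero>\<^bsub>R\<^esub>" using ch unfolding char_ring_def by simp
  show "f i : car R" if "i : {1..r}" for i using f that by blast
  show "DiffOp_loc p R (f_powers R r f) phi : DL p (Rf R r f) e" if "phi : DL p R e" for phi e
   by (rule M.DiffOp_loc_level[OF that U.p_pos])
  show "DiffOp_loc p R (f_powers R r f) phi (Rf_incl R r f a) = Rf_incl R r f (phi a)"
   if "phi : DL p R e" "a : car R" for phi e a by (rule M.DiffOp_loc_incl[OF that(1) U.p_pos that(2)])
  show "unit_family (Rf R r f) p r (%i. Rf_incl R r f (f i))" by (rule U.unit_family_axioms)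
 qed (rule R inj M.loc_incl_hom M.DiffOp_loc_hom[OF U.p_pos])+
qed

theorem theorem1:
  fixes R :: "('a, 'm) ring_scheme" and p r :: nat and I :: "'a set" and f :: "nat \<Rightarrow> 'a"
  assumes "Factorial_Ring.prime p" and "regular_ring R" and "char_ring R p" and "F_finite p R"
    and "ideal I R" and "I \<noteq> {\<zero>\<^bsub>R\<^esub>}"
    and "f \<in> {1..r} \<rightarrow> carrier R" and "I = Idl\<^bsub>R\<^esub> (f ` {1..r})"
  shows
    "left_module_iso (CD p r (Rf R r f)) (fs_Rf p r R f) (H_Rf p r R f) (Theta_Rf p r R f) \<and>
     ((\<forall>i\<in>{1..r}. nonzero_divisor R (f i)) \<longrightarrow>
        left_module_hom (CD p r R)
          (H_mod p r R f) (restrict_scalars (CD_incl p r R f) (H_Rf p r R f)) (H_incl p r R f) \<and>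
        inj_on (H_incl p r R f) (carrier (H_mod p r R f)) \<and>
        submodule (Bd_sum p r R f 0) (CD p r R) (fs_over_R p r R f) \<and>
        submodule (Bd_sum p r R f 1) (CD p r R) (fs_over_R p r R f) \<and>
        Bd_sum p r R f 1 \<subseteq> Bd_sum p r R f 0 \<and>
        (\<exists>\<Psi>. left_module_iso (CD p r R)
                (N_mod p r R f) (quot_module (Bd_mod p r R f) (Bd_sum p r R f 1)) \<Psi> \<and>
              (\<forall>z\<in>V_delta p r R f 0. \<exists>U\<in>Bd_sum p r R f 0.
                 Theta_Rf p r R f U = H_incl p r R f z \<and>
                 \<Psi> (V_delta p r R f 1 +>\<^bsub>V0_mod p r R f\<^esub> z) =
                   Bd_sum p r R f 1 +>\<^bsub>Bd_mod p r R f\<^esub> U))) \<and>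
     ((\<forall>i\<in>{1..r}. nonzero_divisor R (f i)) \<longrightarrow>
        (\<forall>x\<in>carrier (Zp p).
           BS_root p R I x \<longleftrightarrow>
           (\<forall>F\<in>carrier (Cfun (Zp_topology p) (Fp p)). BS_functional_eq p r R f F \<longrightarrow> F x = 0)))"
proof -
 have R: "cring R" using assms(2) by (simp add: regular_ring_def)
 interpret U: unit_family "Rf R r f" p r "%i. Rf_incl R r f (f i)" by (rule Rf_unit_family[OF R assms(1,3,7)])
 have part1: "left_module_iso (CD p r (Rf R r f)) (fs_Rf p r R f) (H_Rf p r R f) (Theta_Rf p r R f)" by (rule U.Theta_iso)
 {
  assume nz: "\<forall>i\<in>{1..r}. nonzero_divisor R (f i)"
  interpret T: bs_setup "Rf R r f" p r R "Rf_incl R r f" f "DiffOp_loc p R (f_powers R r f)"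
   by (rule Rf_bs_setup[OF R assms(1,3,7)]) (use nz in blast)
  have CD: "T.CD_map = CD_incl p r R f" by (simp add: fun_eq_iff T.CD_map_def CD_incl_def)
  have fs: "T.fsR = fs_over_R p r R f" unfolding T.fsR_def CD ..
  have Bd: "T.BdF = Bd_fs p r R f" by (simp add: fun_eq_iff T.BdF_def Bd_fs_def Let_def)
  have Bdk: "Bd_sum p r R f (int k) = T.Sk k" for k unfolding T.BdS_eq_Sk[symmetric] T.BdS_def Bd_sum_def fs Bd ..
  note B0 = Bdk[of 0, unfolded of_nat_0] and B1 = Bdk[of 1, unfolded of_nat_1]
  have Hi: "T.Hin = H_incl p r R f" by (simp add: fun_eq_iff T.Hin_def H_incl_def Let_def)
  have M0: "fs_over_R p r R f\<lparr>carrier := T.Sk 0\<rparr> = Bd_mod p r R f" unfolding Bd_mod_def B0 ..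
  obtain \<Psi> where \<Psi>: "left_module_iso (CD p r R) (N_mod p r R f) (quot_module (Bd_mod p r R f) (Bd_sum p r R f 1)) \<Psi>"
   and \<Psi>v: "!!z. z : V_delta p r R f 0 ==>
    \<Psi> (V_delta p r R f 1 +>\<^bsub>V0_mod p r R f\<^esub> z) = Bd_sum p r R f 1 +>\<^bsub>Bd_mod p r R f\<^esub> T.LamH z"
   using T.Psi_exists unfolding fs M0 B1[symmetric] by (elim exE conjE) (rule that, assumption, drule bspec, assumption, assumption)
  \<comment> \<open>The U attached to z is \<open>LamH z\<close>: Theta sends it to the image of z
    in H', and its class is the value of \<Psi> at the class of z.\<close>
  have wit: "\<exists>U\<in>Bd_sum p r R f 0. Theta_Rf p r R f U = H_incl p r R f z \<and>
    \<Psi> (V_delta p r R f 1 +>\<^bsub>V0_mod p r R f\<^esub> z) = Bd_sum p r R f 1 +>\<^bsub>Bd_mod p r R f\<^esub> U"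
   if z: "z : V_delta p r R f 0" for z proof (intro bexI[of _ "T.LamH z"] conjI \<Psi>v[OF z])
   show "Theta_Rf p r R f (T.LamH z) = H_incl p r R f z" using T.Hin_props(3) T.V_delta_sub(1) z unfolding Hi by blast
   show "T.LamH z : Bd_sum p r R f 0" unfolding B0 T.V_delta_image(1)[symmetric] using z by (rule imageI)
  qed
  have part2: "left_module_hom (CD p r R) (H_mod p r R f) (restrict_scalars (CD_incl p r R f) (H_Rf p r R f)) (H_incl p r R f) \<and>
    inj_on (H_incl p r R f) (car (H_mod p r R f)) \<and> submodule (Bd_sum p r R f 0) (CD p r R) (fs_over_R p r R f) \<and>
    submodule (Bd_sum p r R f 1) (CD p r R) (fs_over_R p r R f) \<and> Bd_sum p r R f 1 <= Bd_sum p r R f 0 \<and>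
    (\<exists>\<Psi>. left_module_iso (CD p r R) (N_mod p r R f) (quot_module (Bd_mod p r R f) (Bd_sum p r R f 1)) \<Psi> \<and>
       (\<forall>z\<in>V_delta p r R f 0. \<exists>U\<in>Bd_sum p r R f 0. Theta_Rf p r R f U = H_incl p r R f z \<and>
        \<Psi> (V_delta p r R f 1 +>\<^bsub>V0_mod p r R f\<^esub> z) = Bd_sum p r R f 1 +>\<^bsub>Bd_mod p r R f\<^esub> U))"
  proof (intro conjI exI[of _ \<Psi>] ballI wit \<Psi>)
   show "left_module_hom (CD p r R) (H_mod p r R f) (restrict_scalars (CD_incl p r R f) (H_Rf p r R f)) (H_incl p r R f)"
    using T.Hin_props(1) unfolding CD Hi .
   show "inj_on (H_incl p r R f) (car (H_mod p r R f))" using T.Hin_props(2) unfolding Hi .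
   show "submodule (Bd_sum p r R f 0) (CD p r R) (fs_over_R p r R f)" using T.Sk_submodule[of 0] unfolding fs B0 .
   show "submodule (Bd_sum p r R f 1) (CD p r R) (fs_over_R p r R f)" using T.Sk_submodule[of 1] unfolding fs B1 .
   show "Bd_sum p r R f 1 <= Bd_sum p r R f 0" unfolding B0 B1 by (rule T.Sk_antimono) simp
  qed
  have I: "I = T.F.I" unfolding T.F.I_def by (rule assms(8))
  interpret M: left_module "CD p r R" "fs_over_R p r R f" using T.left_module_fsR unfolding fs .
  have BS: "BS_functional_eq p r R f F \<longleftrightarrow> T.SigF F : T.Sk 1" for F proof -
   let ?J = "{\<alpha> : Fun_set p r. Fun_norm p r \<alpha> = 1}"
   have v: "Bd_fs p r R f : ?J \<rightarrow> car (fs_over_R p r R f)" using T.BdF_closed unfolding Bd fs[symmetric] T.fsR_sel by blast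
   show ?thesis unfolding B1[symmetric] Bd_sum_def M.cyclic_sum_iff[OF v] BS_functional_eq_def Let_def T.SigF_def ..
  qed
  have part3: "\<forall>x\<in>car (Zp p). BS_root p R I x \<longleftrightarrow>
    (\<forall>F\<in>car (Cfun (Zp_topology p) (Fp p)). BS_functional_eq p r R f F \<longrightarrow> F x = 0)"
   unfolding BS I using T.BS_root_SigF by blast
  note part2 part3
 } thus ?thesis using part1 by blast
qed

end
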